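(* Let $\Gamma_{0,3}=\langle\alpha,\beta\rangle$ be the fundamental group of the pair of pants, $W_3=\langle s_1,s_2,s_3\mid s_1^2=s_2^2=s_3^2=1\rangle$, and $\phi:\Gamma_{0,3}\to W_3$ the homomorphism $\alpha\mapsto s_1s_2$, $\beta\mapsto s_2s_3$. The map $$f:\chi^{\max}(W_3,\mathrm{PSp}^\pm(4,\mathbb R))\to\chi^{\max,\mathrm{Shilov}}(\Gamma_{0,3},\mathrm{PSp}(4,\mathbb R)),\qquad[\widetilde\rho]\mapsto[\widetilde\rho|_{\mathrm{Im}(\phi)}]=[\widetilde\rho\circ\phi]$$ is neither injective nor surjective.
   Context: $\mathrm{Sp}(4,\mathbb R)$ preserves the symplectic form with matrix $J=\begin{pmatrix}0&\mathrm{Id}\\-\mathrm{Id}&0\end{pmatrix}$; $\mathrm{Sp}^-(4,\mathbb R)=\{M:M^TJM=-J\}$ (antisymplectic), $\mathrm{Sp}^\pm=\mathrm{Sp}\cup\mathrm{Sp}^-$, $\mathrm{PSp}=\mathrm{Sp}/\{\pm\mathrm{Id}\}$, $\mathrm{PSp}^\pm=\mathrm{Sp}^\pm/\{\pm\mathrm{Id}\}$. $\mathcal X=\{X+iY: X\in\mathrm{Sym}(2,\mathbb R),\,Y\in\mathrm{Sym}^+(2,\mathbb R)\}$ is the Siegel space. A reflection of $\mathcal X$ is an antisymplectic $R$ with $R^2=\mathrm{Id}$. $\mathcal L(\mathbb R^4)$ is the set of Lagrangians; a real symmetric matrix $X$ denotes the Lagrangian spanned by the columns of $\binom{X}{\mathrm{Id}}$,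 $\infty=\langle e_1,e_2\rangle$. A triple of pairwise transverse Lagrangians is maximal if it is in the $\mathrm{Sp}(4,\mathbb R)$-orbit of $(\infty,0,\mathrm{Id})$; an $m$-tuple is maximal if all subtriples with increasing indices are. Cross-ratio: $R(l_1,l_2,l_3,l_4)=p_{l_1}^{\|l_2}\circ p_{l_4}^{\|l_3}|_{l_1}$ ($p_l^{\|l'}$ = projection to $l$ parallel to $l'$). The $\mathbb R$-tube of transverse Lagrangians $a,b$ is $\mathcal Y_{a,b}=\{l\in\mathcal X:R(a,l,\overline l,b)=-\mathrm{Id}\}$ (points $Z\in\mathcal X$ seen as complex Lagrangians via $\binom Z{\mathrm{Id}}$); if $(a,c,b,d)$ is maximal, $\mathcal Y_{a,b}\perp\mathcal Y_{c,d}$ (orthogonal submanifolds) iff $R(a,c,b,d)=2\mathrm{Id}$. A representation $\rho:W_3\to\mathrm{PSp}^\pm(4,\mathbb R)$ is maximal if there is a maximal 6-tuple of Lagrangians $(P_1,P_2,Q_1,Q_2,R_1,R_2)$ such that $\rho(s_1),\rho(s_2),\rho(s_3)$ are reflections fixing $(P_1,P_2)$, $(Q_1,Q_2)$, $(R_1,R_2)$ respectively, and $\rho(s_1)X_1=X_2$, $\rho(s_1)Z_1=Z_2$, $\rho(s_2)X_1=X_2$, $\rho(s_2)Y_1=Y_2$, $\rho(s_3)Y_1=Y_2$, $\rho(s_3)Z_1=Z_2$, where $X_i,Y_i,Z_i$ are determined by $\mathcal Y_{P_1,P_2}\perp\mathcal Y_{X_1,X_2}\perp\mathcal Y_{Q_1,Q_2}\perp\mathcal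 Y_{Y_1,Y_2}\perp\mathcal Y_{R_1,R_2}\perp\mathcal Y_{Z_1,Z_2}\perp\mathcal Y_{P_1,P_2}$ (with $(X_1,X_2,Y_1,Y_2,Z_1,Z_2)$ maximal). $\chi^{\max}(W_3,\mathrm{PSp}^\pm(4,\mathbb R))$ is the set of these modulo conjugation by $\mathrm{PSp}(4,\mathbb R)$. $\alpha,\beta,(\alpha\beta)^{-1}$ represent the boundary components of the oriented pair of pants $\Sigma_{0,3}$ (surface to the right of the boundary); $\Gamma_{0,3}$ acts on $S^1=\partial\mathbb H^2$ via a fixed hyperbolization. $\rho:\Gamma_{0,3}\to\mathrm{PSp}(4,\mathbb R)$ is maximal if there is a $\rho$-equivariant right-continuous map $S^1\to\mathcal L(\mathbb R^4)$ sending positively oriented triples to maximal triples; it is Shilov hyperbolic if each $\rho(\gamma)$, $\gamma\ne1$, is conjugate to $\begin{pmatrix}A&0\\0&A^{-T}\end{pmatrix}$ with all eigenvalues of $A\in\mathrm{GL}(2,\mathbb R)$ of modulus $>1$. $\chi^{\max,\mathrm{Shilov}}(\Gamma_{0,3},\mathrm{PSp}(4,\mathbb R))$ is the set of maximal Shilov hyperbolic representations modulo conjugation by $\mathrm{PSp}(4,\mathbb R)$. The map $f$ is well defined (the restriction of a maximal representation of $W_3$ is maximal and Shilov hyperbolic). *)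

theory Defs
  imports "HOL-Analysis.Analysis" "HOL-Algebra.Coset"
begin

section \<open>The groups \<open>\<Gamma>\<^sub>0\<^sub>,\<^sub>3\<close> and \<open>W\<^sub>3\<close>\<close>

text \<open>
  \<open>word_group bar\<close> is the group generated by the letters subject to the relations
  \<open>x \<cdot> bar x = 1\<close>, for an involution \<open>bar\<close> of the alphabet, realised on its normal forms: words
  without two adjacent letters \<open>x, bar x\<close>.  With a fixed-point-free \<open>bar\<close> this is a free group, with
  \<open>bar = id\<close> it is a free product of copies of \<open>\<int>/2\<close>.  The lemmas \<open>group_word_group\<close> and
  \<open>word_group_hom\<close> confirm that it is the group with that presentation.
\<close>

definition reduced :: "('l \<Rightarrow> 'l) \<Rightarrow> 'l list \<Rightarrow> bool" where
  "reduced bar = successively (\<lambda>x y. y \<noteq> bar x)"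

fun push :: "('l \<Rightarrow> 'l) \<Rightarrow> 'l \<Rightarrow> 'l list \<Rightarrow> 'l list" where
  "push bar x [] = [x]"
| "push bar x (y # w) = (if y = bar x then w else x # y # w)"

definition word_group :: "('l \<Rightarrow> 'l) \<Rightarrow> 'l list monoid" where
  "word_group bar =
     \<lparr>carrier = {w. reduced bar w}, mult = (\<lambda>u v. foldr (push bar) u v), one = []\<rparr>"

lemma reduced_Nil: "reduced bar []"
  by (simp add: reduced_def)

lemma reduced_push: "reduced bar w \<Longrightarrow> reduced bar (push bar x w)"
  by (cases w; cases "tl w") (auto simp: reduced_def)

lemma reduced_foldr_push: "reduced bar w \<Longrightarrow> reduced bar (foldr (push bar) u w)"
  by (induction u) (auto intro: reduced_push)

lemma push_push_bar:
  assumes "\<And>x. bar (bar x) = x" "reduced bar w"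
  shows "push bar x (push bar (bar x) w) = w"
proof (cases w)
  case (Cons y w')
  show ?thesis
    using assms by (cases w') (auto simp: Cons reduced_def)
qed simp

lemma reduced_ConsD: "reduced bar (x # w) \<Longrightarrow> reduced bar w"
  by (cases w) (auto simp: reduced_def)

lemma push_reduced_Cons: "reduced bar (x # w) \<Longrightarrow> push bar x w = x # w"
  by (cases w) (auto simp: reduced_def)

lemma foldr_push_push:
  assumes "\<And>x. bar (bar x) = x" "reduced bar w"
  shows "foldr (push bar) (push bar x u) w = push bar x (foldr (push bar) u w)"
proof (cases u)
  case (Cons y u')
  have "reduced bar (foldr (push bar) u' w)"
    by (rule reduced_foldr_push) fact
  then show ?thesis
    using push_push_bar[OF assms(1), of "foldr (push bar) u' w" x] by (simp add: Cons)
qed simp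

lemma foldr_push_assoc:
  assumes "\<And>x. bar (bar x) = x" "reduced bar w"
  shows "foldr (push bar) (foldr (push bar) u v) w = foldr (push bar) u (foldr (push bar) v w)"
  by (induction u) (simp_all add: foldr_push_push[OF assms])

lemma foldr_push_Nil: "reduced bar w \<Longrightarrow> foldr (push bar) w [] = w"
proof (induction w)
  case (Cons x w)
  then show ?case
    using reduced_ConsD[OF Cons.prems] push_reduced_Cons[OF Cons.prems] by simp
qed simp

lemma word_left_inverse:
  assumes bar: "\<And>x. bar (bar x) = x" and "reduced bar w"
  shows "\<exists>v. reduced bar v \<and> foldr (push bar) v w = []"
  using assms(2)
proof (induction w)
  case Nil
  show ?case by (rule exI[of _ "[]"]) (simp add: reduced_def)
next
  case (Cons x w)
  have red: "reduced bar w" using reduced_ConsD[OF Cons.prems] .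
  then obtain v where v: "reduced bar v" "foldr (push bar) v w = []"
    using Cons.IH by blast
  let ?v = "foldr (push bar) v [bar x]"
  have "reduced bar [bar x]" by (simp add: reduced_def)
  then have "reduced bar ?v" by (rule reduced_foldr_push)
  moreover have "foldr (push bar) ?v (x # w) = []"
    using v(2) by (simp add: foldr_push_assoc[OF bar Cons.prems] bar)
  ultimately show ?case by blast
qed

theorem group_word_group:
  assumes "\<And>x. bar (bar x) = x"
  shows "group (word_group bar)"
proof (rule groupI, goal_cases)
  case (5 x)
  then show ?case using word_left_inverse[OF assms] by (force simp: word_group_def)
qed (auto simp: word_group_def reduced_foldr_push foldr_push_assoc[OF assms] reduced_Nil)

theorem word_group_hom:
  fixes G (structure)
  assumes "group G" "\<And>x. f x \<in> carrier G" "\<And>x. f x \<otimes> f (bar x) = \<one>"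
  shows "\<exists>h \<in> hom (word_group bar) G. (\<forall>x. h [x] = f x) \<and>
           (\<forall>h' \<in> hom (word_group bar) G. (\<forall>x. h' [x] = f x) \<longrightarrow>
              (\<forall>w \<in> carrier (word_group bar). h' w = h w))"
proof -
  interpret group G by fact
  define h where "h w = foldr (\<lambda>x g. f x \<otimes> g) w \<one>" for w
  have h_closed: "h w \<in> carrier G" for w
    by (induction w) (simp_all add: h_def assms(2))
  have h_Cons: "h (x # w) = f x \<otimes> h w" for x w
    by (simp add: h_def)
  have h_push: "h (push bar x w) = f x \<otimes> h w" for x w
  proof (cases w)
    case Nil
    then show ?thesis by (simp add: h_def)
  next
    case (Cons y w')
    show ?thesis
      using assms(3)[of x] h_closed[of w'] assms(2)
      by (auto simp: Cons h_Cons simp flip: m_assoc)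
  qed
  have h_foldr: "h (foldr (push bar) u v) = h u \<otimes> h v" for u v
  proof (induction u)
    case Nil
    then show ?case using h_closed[of v] by (simp add: h_def[of "[]"])
  next
    case (Cons x u)
    then show ?case using h_closed assms(2) by (simp add: h_push h_Cons m_assoc)
  qed
  have "h \<in> hom (word_group bar) G"
    by (auto simp: hom_def word_group_def h_closed h_foldr)
  moreover have "h [x] = f x" for x
    using assms(2) by (simp add: h_def)
  moreover have "h' w = h w"
    if h': "h' \<in> hom (word_group bar) G" "\<forall>x. h' [x] = f x" and w: "reduced bar w" for h' w
    using w
  proof (induction w)
    case Nil
    have red: "reduced bar []" by (simp add: reduced_def)
    have "h' [] \<in> carrier G" "h' [] \<otimes> h' [] = h' []"
      using h'(1) red by (force simp: hom_def word_group_def)+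
    then show ?case by (simp add: h_def)
  next
    case (Cons x w)
    have red: "reduced bar [x]" "reduced bar w"
      using reduced_ConsD[OF Cons.prems] by (simp_all add: reduced_def)
    have "x # w = foldr (push bar) [x] w"
      using push_reduced_Cons[OF Cons.prems] by simp
    also have "h' \<dots> = h' [x] \<otimes> h' w"
      using h'(1) red by (auto simp: hom_def word_group_def)
    finally show ?case
      using Cons.IH[OF red(2)] h'(2) by (simp add: h_Cons)
  qed
  ultimately show ?thesis by (auto simp: word_group_def intro!: bexI[of _ h])
qed

datatype pants_gen = Gen_\<alpha> | Gen_\<beta>

text \<open>The letter \<open>(x, True)\<close> stands for \<open>x\<close> and \<open>(x, False)\<close> for its inverse.\<close>

definition \<Gamma>03 :: "(pants_gen \<times> bool) list monoid" where
  "\<Gamma>03 = word_group (\<lambda>(x, e). (x, \<not> e))"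

definition \<alpha> :: "(pants_gen \<times> bool) list" where "\<alpha> = [(Gen_\<alpha>, True)]"
definition \<beta> :: "(pants_gen \<times> bool) list" where "\<beta> = [(Gen_\<beta>, True)]"

datatype W3_gen = S1 | S2 | S3

definition W3 :: "W3_gen list monoid" where
  "W3 = word_group id"

definition s1 :: "W3_gen list" where "s1 = [S1]"
definition s2 :: "W3_gen list" where "s2 = [S2]"
definition s3 :: "W3_gen list" where "s3 = [S3]"


section \<open>Symplectic groups\<close>

definition block :: "'a::zero^2^2 \<Rightarrow> 'a^2^2 \<Rightarrow> 'a^2^2 \<Rightarrow> 'a^2^2 \<Rightarrow> 'a^4^4" where
  "block A B C D = vector
     [vector [A$1$1, A$1$2, B$1$1, B$1$2],
      vector [A$2$1, A$2$2, B$2$1, B$2$2],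
      vector [C$1$1, C$1$2, D$1$1, D$1$2],
      vector [C$2$1, C$2$2, D$2$1, D$2$2]]"

definition block_col :: "'a::zero^2^2 \<Rightarrow> 'a^2^2 \<Rightarrow> 'a^2^4" where
  "block_col A C = vector
     [vector [A$1$1, A$1$2],
      vector [A$2$1, A$2$2],
      vector [C$1$1, C$1$2],
      vector [C$2$1, C$2$2]]"

definition J :: "real^4^4" where
  "J = block 0 (mat 1) (- mat 1) 0"

definition Sp :: "(real^4^4) set" where
  "Sp = {M. transpose M ** J ** M = J}"

definition Sp_minus :: "(real^4^4) set" where
  "Sp_minus = {M. transpose M ** J ** M = - J}"

definition matrix_monoid :: "(real^4^4) set \<Rightarrow> (real^4^4) monoid" where
  "matrix_monoid S = \<lparr>carrier = S, mult = (**), one = mat 1\<rparr>"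

text \<open>The elements of both quotients are the cosets \<open>{M, -M}\<close>, so that the carrier of
  \<open>PSp\<close> is contained in that of \<open>PSp_pm\<close>, with the same multiplication.\<close>

definition PSp :: "(real^4^4) set monoid" where
  "PSp = matrix_monoid Sp Mod {mat 1, - mat 1}"

definition PSp_pm :: "(real^4^4) set monoid" where
  "PSp_pm = matrix_monoid (Sp \<union> Sp_minus) Mod {mat 1, - mat 1}"

definition is_reflection :: "(real^4^4) set \<Rightarrow> bool" where
  "is_reflection g \<longleftrightarrow> (\<exists>R\<in>g. R \<in> Sp_minus \<and> R ** R = mat 1)"


section \<open>Lagrangians, maximal tuples and the cross-ratio\<close>

definition lagrangians :: "(real^4) set set" where
  "lagrangians = {l. subspace l \<and> dim l = 2 \<and> (\<forall>v\<in>l. \<forall>w\<in>l. v \<bullet> (J *v w) = 0)}"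

definition act :: "(real^4^4) set \<Rightarrow> (real^4) set \<Rightarrow> (real^4) set" where
  "act g l = {M *v v | M v. M \<in> g \<and> v \<in> l}"

definition lag :: "'a::field^2^2 \<Rightarrow> ('a^4) set" where
  "lag X = vec.span (columns (block_col X (mat 1)))"

definition lag_inf :: "(real^4) set" where
  "lag_inf = span {axis 1 1, axis 2 1}"

text \<open>Members of the orbit of \<open>(\<infinity>, 0, Id)\<close> are automatically pairwise transverse Lagrangians.\<close>

definition maximal_triple :: "(real^4) set \<Rightarrow> (real^4) set \<Rightarrow> (real^4) set \<Rightarrow> bool" where
  "maximal_triple l1 l2 l3 \<longleftrightarrow>
     (\<exists>M\<in>Sp. l1 = (*v) M ` lag_inf \<and> l2 = (*v) M ` lag 0 \<and> l3 = (*v) M ` lag (mat 1))"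

definition maximal_tuple :: "(real^4) set list \<Rightarrow> bool" where
  "maximal_tuple ls \<longleftrightarrow>
     (\<forall>i j k. i < j \<and> j < k \<and> k < length ls \<longrightarrow> maximal_triple (ls!i) (ls!j) (ls!k))"

text \<open>\<open>proj_par l l'\<close> is the projection to \<open>l\<close> parallel to \<open>l'\<close>; it is only meaningful for
  complementary subspaces.\<close>

definition proj_par :: "'a::ab_group_add set \<Rightarrow> 'a set \<Rightarrow> 'a \<Rightarrow> 'a" where
  "proj_par l l' v = (THE w. w \<in> l \<and> v - w \<in> l')"

definition cross_ratio ::
    "'a::ab_group_add set \<Rightarrow> 'a set \<Rightarrow> 'a set \<Rightarrow> 'a set \<Rightarrow> 'a \<Rightarrow> 'a" where
  "cross_ratio l1 l2 l3 l4 = restrict (proj_par l1 l2 \<circ> proj_par l4 l3) l1"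


section \<open>The Siegel space and orthogonal \<open>\<real>\<close>-tubes\<close>

definition siegel :: "(complex^2^2) set" where
  "siegel = {\<chi> i j. Complex (X$i$j) (Y$i$j) | X Y.
     transpose X = X \<and> transpose Y = Y \<and> (\<forall>v. v \<noteq> 0 \<longrightarrow> v \<bullet> (Y *v v) > 0)}"

definition complexify :: "(real^4) set \<Rightarrow> (complex^4) set" where
  "complexify l = {\<chi> i. Complex (v$i) (w$i) | v w. v \<in> l \<and> w \<in> l}"

definition conj_space :: "(complex^4) set \<Rightarrow> (complex^4) set" where
  "conj_space l = (\<lambda>v. \<chi> i. cnj (v$i)) ` l"

definition tube :: "(real^4) set \<Rightarrow> (real^4) set \<Rightarrow> (complex^2^2) set" where
  "tube a b = {Z \<in> siegel.
     \<forall>v \<in> complexify a.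
       cross_ratio (complexify a) (lag Z) (conj_space (lag Z)) (complexify b) v = - v}"

text \<open>The \<open>Sp(4,\<real>)\<close>-invariant Riemannian metric of the Siegel space at \<open>Z = X + iY\<close>, in the form
  \<open>Re tr (Y\<^sup>-\<^sup>1 V Y\<^sup>-\<^sup>1 W\<^sup>*)\<close> for tangent vectors \<open>V, W\<close>, which are complex symmetric matrices
  (so that \<open>W\<^sup>*\<close> is the entrywise conjugate).\<close>

definition siegel_metric :: "complex^2^2 \<Rightarrow> complex^2^2 \<Rightarrow> complex^2^2 \<Rightarrow> real" where
  "siegel_metric Z V W =
     (let Yinv = map_matrix of_real (matrix_inv (map_matrix Im Z))
      in Re (trace (Yinv ** V ** Yinv ** map_matrix cnj W)))"

text \<open>For a submanifold \<open>S\<close> this is the tangent space at \<open>Z\<close>, as the set of velocities of curves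
  in \<open>S\<close> through \<open>Z\<close>.\<close>

definition tangent_vectors :: "(complex^2^2) set \<Rightarrow> complex^2^2 \<Rightarrow> (complex^2^2) set" where
  "tangent_vectors S Z =
     {V. \<exists>c::real \<Rightarrow> complex^2^2.
        (\<forall>t. c t \<in> S) \<and> c 0 = Z \<and> (c has_vector_derivative V) (at 0)}"

definition orthogonal_submanifolds :: "(complex^2^2) set \<Rightarrow> (complex^2^2) set \<Rightarrow> bool"
    (infix \<open>\<bottom>\<^sub>X\<close> 50) where
  "S \<bottom>\<^sub>X T \<longleftrightarrow> S \<inter> T \<noteq> {} \<and>
     (\<forall>Z \<in> S \<inter> T. \<forall>V \<in> tangent_vectors S Z. \<forall>W \<in> tangent_vectors T Z.
        siegel_metric Z V W = 0)"


section \<open>Character sets\<close>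

definition conj_rel ::
    "('a, 'c) monoid_scheme \<Rightarrow> ('b, 'd) monoid_scheme \<Rightarrow> 'b set \<Rightarrow> (('a \<Rightarrow> 'b) \<times> ('a \<Rightarrow> 'b)) set" where
  "conj_rel D G K = {(\<rho>, \<sigma>). \<rho> \<in> hom D G \<and> \<sigma> \<in> hom D G \<and>
     (\<exists>g\<in>K. \<forall>x\<in>carrier D. \<sigma> x = g \<otimes>\<^bsub>G\<^esub> \<rho> x \<otimes>\<^bsub>G\<^esub> inv\<^bsub>G\<^esub> g)}"

definition maximal_W3 :: "(W3_gen list \<Rightarrow> (real^4^4) set) \<Rightarrow> bool" where
  "maximal_W3 \<rho> \<longleftrightarrow> \<rho> \<in> hom W3 PSp_pm \<and>
     (\<exists>P1 P2 Q1 Q2 R1 R2 X1 X2 Y1 Y2 Z1 Z2.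
        maximal_tuple [P1, P2, Q1, Q2, R1, R2] \<and>
        maximal_tuple [X1, X2, Y1, Y2, Z1, Z2] \<and>
        tube P1 P2 \<bottom>\<^sub>X tube X1 X2 \<and> tube X1 X2 \<bottom>\<^sub>X tube Q1 Q2 \<and>
        tube Q1 Q2 \<bottom>\<^sub>X tube Y1 Y2 \<and> tube Y1 Y2 \<bottom>\<^sub>X tube R1 R2 \<and>
        tube R1 R2 \<bottom>\<^sub>X tube Z1 Z2 \<and> tube Z1 Z2 \<bottom>\<^sub>X tube P1 P2 \<and>
        is_reflection (\<rho> s1) \<and> act (\<rho> s1) P1 = P1 \<and> act (\<rho> s1) P2 = P2 \<and>
        is_reflection (\<rho> s2) \<and> act (\<rho> s2) Q1 = Q1 \<and> act (\<rho> s2) Q2 = Q2 \<and>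
        is_reflection (\<rho> s3) \<and> act (\<rho> s3) R1 = R1 \<and> act (\<rho> s3) R2 = R2 \<and>
        act (\<rho> s1) X1 = X2 \<and> act (\<rho> s1) Z1 = Z2 \<and>
        act (\<rho> s2) X1 = X2 \<and> act (\<rho> s2) Y1 = Y2 \<and>
        act (\<rho> s3) Y1 = Y2 \<and> act (\<rho> s3) Z1 = Z2)"

definition chi_max_W3 :: "(W3_gen list \<Rightarrow> (real^4^4) set) set set" where
  "chi_max_W3 = Collect maximal_W3 // conj_rel W3 PSp_pm (carrier PSp)"

text \<open>Counterclockwise order of three points of the unit circle of \<open>\<complex>\<close>, the boundary at infinity
  of the Poincare disc.\<close>

definition positively_oriented :: "complex \<Rightarrow> complex \<Rightarrow> complex \<Rightarrow> bool" where
  "positively_oriented x y z \<longleftrightarrow>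
     {x, y, z} \<subseteq> sphere 0 1 \<and> Im (cnj (y - x) * (z - x)) > 0"

definition limit_set :: "((pants_gen \<times> bool) list \<Rightarrow> complex \<Rightarrow> complex) \<Rightarrow> complex set" where
  "limit_set H = closure ((\<lambda>\<gamma>. H \<gamma> 0) ` carrier \<Gamma>03) \<inter> sphere 0 1"

text \<open>
  If \<open>H \<gamma>\<close> is hyperbolic, the condition says that all limit points lie on the closed arc to the right
  of the axis of \<open>H \<gamma>\<close> (the one running counterclockwise from the repelling to the attracting fixed
  point), i.e. \<open>\<gamma>\<close> is a boundary geodesic of the convex core, which lies to its right.  If \<open>H \<gamma>\<close> is
  parabolic, it says that \<open>H \<gamma>\<close> is conjugate to \<open>z \<mapsto> z + 1\<close> in the upper half-plane, i.e. \<open>\<gamma>\<close> goes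
  round a cusp with the surface on the right.
\<close>

definition surface_on_right ::
    "((pants_gen \<times> bool) list \<Rightarrow> complex \<Rightarrow> complex) \<Rightarrow> (pants_gen \<times> bool) list \<Rightarrow> bool" where
  "surface_on_right H \<gamma> \<longleftrightarrow>
     (\<exists>y\<in>sphere 0 1. H \<gamma> y = y \<and>
        (\<forall>x\<in>limit_set H. H \<gamma> x \<noteq> x \<longrightarrow> positively_oriented y x (H \<gamma> x)))"

text \<open>
  A hyperbolization, given by the action of \<open>\<Gamma>\<^sub>0\<^sub>,\<^sub>3\<close> on the closed Poincare disc: a faithful discrete
  action by orientation-preserving isometries for which \<open>\<alpha>, \<beta>, (\<alpha>\<beta>)\<^sup>-\<^sup>1\<close> represent boundary components
  (boundary geodesics or cusps) with the surface to their right.  Three boundary components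
  distinguish the pair of pants from the one-holed torus, the other orientable surface with free
  fundamental group of rank 2: there the peripheral elements are conjugate to powers of one commutator.
\<close>

definition hyperbolization ::
    "((pants_gen \<times> bool) list \<Rightarrow> complex \<Rightarrow> complex) \<Rightarrow> bool" where
  "hyperbolization H \<longleftrightarrow>
     (\<forall>\<gamma>\<in>carrier \<Gamma>03. \<exists>a b. (cmod a)\<^sup>2 - (cmod b)\<^sup>2 = 1 \<and>
        (\<forall>z\<in>cball 0 1. H \<gamma> z = (a * z + b) / (cnj b * z + cnj a))) \<and>
     (\<forall>\<gamma>\<in>carrier \<Gamma>03. \<forall>\<delta>\<in>carrier \<Gamma>03. \<forall>z\<in>cball 0 1.
        H (\<gamma> \<otimes>\<^bsub>\<Gamma>03\<^esub> \<delta>) z = H \<gamma> (H \<delta> z)) \<and>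
     inj_on (\<lambda>\<gamma>. restrict (H \<gamma>) (cball 0 1)) (carrier \<Gamma>03) \<and>
     (\<forall>r<1. finite {\<gamma>\<in>carrier \<Gamma>03. cmod (H \<gamma> 0) \<le> r}) \<and>
     surface_on_right H \<alpha> \<and> surface_on_right H \<beta> \<and>
     surface_on_right H (inv\<^bsub>\<Gamma>03\<^esub> (\<alpha> \<otimes>\<^bsub>\<Gamma>03\<^esub> \<beta>))"

text \<open>A family of subspaces converges in the Grassmannian iff the orthogonal projections onto them
  converge.\<close>

definition right_continuous :: "(complex \<Rightarrow> (real^4) set) \<Rightarrow> bool" where
  "right_continuous \<xi> \<longleftrightarrow>
     (\<forall>x\<in>sphere 0 1. \<forall>v.
        ((\<lambda>t. closest_point (\<xi> (cis t * x)) v) \<longlongrightarrow> closest_point (\<xi> x) v) (at_right 0))"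

definition maximal_\<Gamma>03 ::
    "((pants_gen \<times> bool) list \<Rightarrow> complex \<Rightarrow> complex) \<Rightarrow>
     ((pants_gen \<times> bool) list \<Rightarrow> (real^4^4) set) \<Rightarrow> bool" where
  "maximal_\<Gamma>03 H \<rho> \<longleftrightarrow> \<rho> \<in> hom \<Gamma>03 PSp \<and>
     (\<exists>\<xi>. \<xi> \<in> sphere 0 1 \<rightarrow> lagrangians \<and> right_continuous \<xi> \<and>
        (\<forall>\<gamma>\<in>carrier \<Gamma>03. \<forall>x\<in>sphere 0 1. \<xi> (H \<gamma> x) = act (\<rho> \<gamma>) (\<xi> x)) \<and>
        (\<forall>x y z. positively_oriented x y z \<longrightarrow> maximal_triple (\<xi> x) (\<xi> y) (\<xi> z)))"

definition shilov_hyperbolic :: "((pants_gen \<times> bool) list \<Rightarrow> (real^4^4) set) \<Rightarrow> bool" where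
  "shilov_hyperbolic \<rho> \<longleftrightarrow>
     (\<forall>\<gamma>\<in>carrier \<Gamma>03. \<gamma> \<noteq> \<one>\<^bsub>\<Gamma>03\<^esub> \<longrightarrow>
        (\<exists>M\<in>\<rho> \<gamma>. \<exists>S\<in>Sp. \<exists>A::real^2^2.
           invertible A \<and>
           S ** M ** matrix_inv S = block A 0 0 (transpose (matrix_inv A)) \<and>
           (\<forall>(c::complex) v. v \<noteq> 0 \<and> map_matrix of_real A *v v = c *s v \<longrightarrow> cmod c > 1)))"

definition chi_max_shilov ::
    "((pants_gen \<times> bool) list \<Rightarrow> complex \<Rightarrow> complex) \<Rightarrow>
     ((pants_gen \<times> bool) list \<Rightarrow> (real^4^4) set) set set" where
  "chi_max_shilov H =
     {\<rho>. maximal_\<Gamma>03 H \<rho> \<and> shilov_hyperbolic \<rho>} // conj_rel \<Gamma>03 PSp (carrier PSp)"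

text \<open>The class of \<open>\<rho> \<circ> \<phi>\<close> for any representative \<open>\<rho>\<close> of the class \<open>C\<close>.\<close>

definition restriction_map ::
    "((pants_gen \<times> bool) list \<Rightarrow> W3_gen list) \<Rightarrow>
     (W3_gen list \<Rightarrow> (real^4^4) set) set \<Rightarrow> ((pants_gen \<times> bool) list \<Rightarrow> (real^4^4) set) set" where
  "restriction_map \<phi> C = conj_rel \<Gamma>03 PSp (carrier PSp) `` ((\<lambda>\<rho>. \<rho> \<circ> \<phi>) ` C)"

end

theory Submission
  imports Defs
begin

text \<open>
  Non-injectivity: let a reflection group of a right-angled hyperbolic hexagon act on the Siegel space
  through the diagonal embedding, and twist all three reflections by the same \<open>r = diag(1, -1)\<close>
  commuting with that embedding. Products of two reflections do not change, so both representations
  have the same restriction, but the traces of \<open>s\<^sub>1 s\<^sub>2 s\<^sub>3\<close> differ.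

  Non-surjectivity: in \<open>W\<^sub>3\<close> the image of \<open>s\<^sub>2\<close> conjugates \<open>\<alpha>, \<beta>\<close> to their inverses, so a word and its
  reversal have, in a restricted representation, the same trace up to sign. This fails for
  \<open>\<alpha>\<alpha>\<beta>\<alpha>\<beta>\<beta>\<close> in a suitable Schottky group. Its four generators and inverses
  map \<open>X\<close> to \<open>C\<^sub>l - (X - C\<^sub>l\<^sub>')\<^sup>-\<^sup>1\<close> for symmetric \<open>C\<^sub>l\<close> that increase with gaps larger than 2 in the Loewner
  order, and contract the complement of one ball to another. The circle decomposes in the
  same way into four arcs, one for each letter, and gaps: the \<open>\<alpha>\<close>-, \<open>\<beta>\<close>- and \<open>\<alpha>\<beta>\<close>-boundary conditions produce end
  points of such arcs. Points are separated by their itineraries, and the limit map sends an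
  itinerary to the limit of the corresponding contractions. It is strictly increasing because matrix
  inversion reverses the Loewner order. Shilov hyperbolicity holds because a cyclically reduced word
  that starts with \<open>l\<close> strictly increases the quadratic form of the ball around \<open>C\<^sub>l\<close>.
\<close>

section \<open>Block matrices and the projective symplectic groups\<close>

text \<open>Elements of the quotient have a trace only up to sign, so both halves compare absolute
  values of traces. In the first half the twist survives in words of odd length and makes their
  trace a multiple of tr r = 0. In the second half conjugation by an antisymplectic matrix keeps the
  trace, and a symplectic inverse has the trace of the original; the test is void for a word that is
  a cyclic rotation of its reversal, and among positive words six letters are the least that avoid
  this. In SL(2, R) a word in two generators always has the trace of its reversal, so the Schottky
  group must not split into two copies of SL(2, R). The main obstacle is that the hyperbolization is
  arbitrary, possibly with cusps, while the limit map is required on the whole circle. At a cusp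
  neighbouring arcs share an end point; half-open arcs decide which of them owns it, and yield
  continuity from one side. Distinctness of itineraries then needs proof: discreteness drives a
  common itinerary towards shared end points, where it becomes periodic along a parabolic
  element.\<close>

lemma vector_4:
  "(vector [a, b, c, d] :: ('a::zero)^4) $ 1 = a" "(vector [a, b, c, d] :: 'a^4) $ 2 = b"
  "(vector [a, b, c, d] :: 'a^4) $ 3 = c" "(vector [a, b, c, d] :: 'a^4) $ 4 = d"
  unfolding vector_def by simp_all

section \<open>Vectors and matrices of size 4 in blocks of size 2\<close>

definition vpair :: "'a::zero^2 \<Rightarrow> 'a^2 \<Rightarrow> 'a^4" where
  "vpair x y = vector [x$1, x$2, y$1, y$2]"

lemma vpair_nth [simp]:
  "vpair x y $ 1 = x $ 1" "vpair x y $ 2 = x $ 2" "vpair x y $ 3 = y $ 1" "vpair x y $ 4 = y $ 2"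
  by (simp_all add: vpair_def vector_4)

lemma vec4_eq_iff: "v = w \<longleftrightarrow> v$1 = w$1 \<and> v$2 = w$2 \<and> v$3 = w$3 \<and> v$4 = w$4"
  for v w :: "'a^4"
  by (simp add: vec_eq_iff forall_4)

lemma vec2_eq_iff: "v = w \<longleftrightarrow> v$1 = w$1 \<and> v$2 = w$2" for v w :: "'a^2"
  by (simp add: vec_eq_iff forall_2)

lemma vpair_eq_iff [simp]: "vpair x y = vpair x' y' \<longleftrightarrow> x = x' \<and> y = y'"
  by (auto simp: vec4_eq_iff vec2_eq_iff)

lemma vpair_exhaust: obtains x y where "v = vpair x y"
proof
  show "v = vpair (vector [v$1, v$2]) (vector [v$3, v$4])"
    by (simp add: vec4_eq_iff vector_2)
qed

lemma vpair_add: "vpair x y + vpair x' y' = vpair (x + x') (y + y')" for x :: "'a::monoid_add^2"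
  by (simp add: vec4_eq_iff)
lemma vpair_diff: "vpair x y - vpair x' y' = vpair (x - x') (y - y')" for x :: "'a::group_add^2"
  by (simp add: vec4_eq_iff)
lemma vpair_uminus: "- vpair x y = vpair (- x) (- y)" for x :: "'a::group_add^2"
  by (simp add: vec4_eq_iff)
lemma vpair_smult: "c *s vpair x y = vpair (c *s x) (c *s y)" for x :: "'a::semiring_0^2"
  by (simp add: vec4_eq_iff)
lemma vpair_scaleR: "c *\<^sub>R vpair x y = vpair (c *\<^sub>R x) (c *\<^sub>R y)" for x :: "'a::real_vector^2"
  by (simp add: vec4_eq_iff)
lemma vpair_zero [simp]: "vpair 0 0 = 0"
  by (simp add: vec4_eq_iff)
lemma vpair_eq_0_iff [simp]: "vpair x y = 0 \<longleftrightarrow> x = 0 \<and> y = 0"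
  using vpair_eq_iff[of x y 0 0] by simp

lemma inner_vpair: "vpair x y \<bullet> vpair x' y' = x \<bullet> x' + y \<bullet> y'" for x :: "real^2"
  by (simp add: inner_vec_def sum_2 sum_4)

lemma block_nth [simp]:
  "block A B C D $ 1 = vpair (A$1) (B$1)" "block A B C D $ 2 = vpair (A$2) (B$2)"
  "block A B C D $ 3 = vpair (C$1) (D$1)" "block A B C D $ 4 = vpair (C$2) (D$2)"
  by (simp_all add: block_def vpair_def vector_4)

lemma block_eq_iff [simp]:
  "block A B C D = block A' B' C' D' \<longleftrightarrow> A = A' \<and> B = B' \<and> C = C' \<and> D = D'"
  by (auto simp: vec4_eq_iff vec2_eq_iff)

lemma block_exhaust: obtains A B C D where "M = block A B C D"
proof
  show "M = block (\<chi> i j. M $ (if i = 1 then 1 else 2) $ (if j = 1 then 1 else 2))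
     (\<chi> i j. M $ (if i = 1 then 1 else 2) $ (if j = 1 then 3 else 4))
     (\<chi> i j. M $ (if i = 1 then 3 else 4) $ (if j = 1 then 1 else 2))
     (\<chi> i j. M $ (if i = 1 then 3 else 4) $ (if j = 1 then 3 else 4))"
    by (simp add: vec4_eq_iff)
qed

lemma block_mult_vec: "block A B C D *v vpair x y = vpair (A *v x + B *v y) (C *v x + D *v y)"
  for A :: "'a::comm_semiring_1^2^2"
  by (simp add: vec4_eq_iff matrix_vector_mult_def sum_2 sum_4 add.assoc)

lemma block_mult:
  "block A B C D ** block A' B' C' D' =
     block (A ** A' + B ** C') (A ** B' + B ** D') (C ** A' + D ** C') (C ** B' + D ** D')"
  for A :: "'a::comm_semiring_1^2^2"
  by (simp add: vec4_eq_iff matrix_matrix_mult_def sum_2 sum_4 add.assoc)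

lemma transpose_block:
  "transpose (block A B C D) = block (transpose A) (transpose C) (transpose B) (transpose D)"
  by (simp add: vec4_eq_iff transpose_def)

lemma mat1_block: "mat 1 = block (mat 1) 0 0 (mat 1)"
  by (simp add: vec4_eq_iff mat_def)

lemma uminus_block: "- block A B C D = block (- A) (- B) (- C) (- D)" for A :: "'a::group_add^2^2"
  by (simp add: vec4_eq_iff)

lemma trace_block: "trace (block A B C D) = trace A + trace D" for A :: "'a::comm_semiring_1^2^2"
  by (simp add: trace_def sum_2 sum_4 add.assoc)

lemma block_col_mult_vec: "block_col A C *v u = vpair (A *v u) (C *v u)"
  for A :: "'a::comm_semiring_1^2^2"
  by (simp add: vec4_eq_iff matrix_vector_mult_def sum_2 block_col_def vector_4 vector_2)

lemma span_columns_eq_range: "vec.span (columns M) = range ((*v) M)" for M :: "'a::field^'n^'m"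
proof
  have "column i M = M *v axis i 1" for i
    by (simp add: vec_eq_iff column_def matrix_vector_mult_def axis_def if_distrib cong: if_cong)
  then have "columns M \<subseteq> range ((*v) M)"
    by (force simp: columns_def)
  moreover have "vec.subspace (range ((*v) M))"
    unfolding vec.subspace_def
  proof (safe)
    show "0 \<in> range ((*v) M)" by (rule range_eqI[of _ _ 0]) simp
  next
    fix x y show "M *v x + M *v y \<in> range ((*v) M)"
      by (rule range_eqI[of _ _ "x + y"]) (simp add: matrix_vector_right_distrib)
  next
    fix c x show "c *s (M *v x) \<in> range ((*v) M)"
      by (rule range_eqI[of _ _ "c *s x"]) (simp add: vec.scale)
  qed
  ultimately show "vec.span (columns M) \<subseteq> range ((*v) M)"
    by (rule vec.span_minimal)
qed (auto intro: matrix_vector_mult_in_columnspace_gen)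

lemma lag_eq: "lag X = range (\<lambda>u. vpair (X *v u) u)"
  by (simp add: lag_def span_columns_eq_range block_col_mult_vec image_def)

lemma lag_inf_eq: "lag_inf = range (\<lambda>u. vpair u 0)"
proof -
  have "vec.subspace (range (\<lambda>u. vpair u (0::real^2)))"
    unfolding vec.subspace_def
  proof (safe)
    show "0 \<in> range (\<lambda>u. vpair u (0::real^2))" by (rule range_eqI[of _ _ 0]) simp
  next
    fix x y show "vpair x 0 + vpair y 0 \<in> range (\<lambda>u. vpair u (0::real^2))"
      by (rule range_eqI[of _ _ "x + y"]) (simp add: vpair_add)
  next
    fix c x show "c *s vpair x 0 \<in> range (\<lambda>u. vpair u (0::real^2))"
      by (rule range_eqI[of _ _ "c *s x"]) (simp add: vpair_smult)
  qed
  moreover have "axis 1 1 = vpair (axis 1 1) (0::real^2)" "axis 2 1 = vpair (axis 2 1) (0::real^2)"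
    by (auto simp: vec4_eq_iff axis_def)
  ultimately have "lag_inf \<subseteq> range (\<lambda>u. vpair u 0)"
    unfolding lag_inf_def span_vec_eq[symmetric] by (intro vec.span_minimal) auto
  moreover have "vpair u 0 \<in> lag_inf" for u :: "real^2"
  proof -
    have "vpair u 0 = u$1 *\<^sub>R axis 1 1 + u$2 *\<^sub>R axis 2 1"
      by (simp add: vec4_eq_iff axis_def)
    then show ?thesis
      by (auto simp: lag_inf_def intro!: span_add span_scale intro: span_base)
  qed
  ultimately show ?thesis by auto
qed

section \<open>Inverses and ring identities of matrices\<close>

lemma matrix_inv_unique:
  fixes A :: "'a::field^'n^'n"
  assumes "A ** B = mat 1"
  shows "matrix_inv A = B"
proof -
  have "B ** A = mat 1" using assms matrix_left_right_inverse by blast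
  then have "A ** matrix_inv A = mat 1 \<and> matrix_inv A ** A = mat 1"
    unfolding matrix_inv_def
    using someI[of "\<lambda>A'. A ** A' = mat 1 \<and> A' ** A = mat 1" B] assms by simp
  then show ?thesis
    by (metis \<open>B ** A = mat 1\<close> matrix_mul_assoc matrix_mul_lid matrix_mul_rid)
qed

lemma matrix_inv_mult:
  fixes A :: "'a::field^'n^'n"
  assumes "invertible A"
  shows "A ** matrix_inv A = mat 1" "matrix_inv A ** A = mat 1"
  using assms matrix_inv_unique unfolding invertible_def by metis+

lemma matrix_uminus_mult: "(- A) ** B = - (A ** B)" for A :: "'a::ring_1^'n^'m"
  by (simp add: vec_eq_iff matrix_matrix_mult_def sum_negf)
lemma matrix_mult_uminus: "A ** (- B) = - (A ** B)" for A :: "'a::ring_1^'n^'m"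
  by (simp add: vec_eq_iff matrix_matrix_mult_def sum_negf)
lemma matrix_zero_mult: "0 ** B = 0" for B :: "'a::semiring_1^'n^'m"
  by (simp add: vec_eq_iff matrix_matrix_mult_def)
lemma matrix_mult_zero: "A ** 0 = 0" for A :: "'a::semiring_1^'n^'m"
  by (simp add: vec_eq_iff matrix_matrix_mult_def)
lemma matrix_uminus_vec: "(- A) *v x = - (A *v x)" for A :: "'a::ring_1^'n^'m"
  by (simp add: vec_eq_iff matrix_vector_mult_def sum_negf)
lemma matrix_vec_uminus: "A *v (- x) = - (A *v x)" for A :: "'a::ring_1^'n^'m"
  by (simp add: vec_eq_iff matrix_vector_mult_def sum_negf)
lemma transpose_uminus: "transpose (- A) = - transpose A" for A :: "'a::ring_1^'n^'m"
  by (simp add: vec_eq_iff transpose_def)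
lemma transpose_add: "transpose (A + B) = transpose A + transpose B" for A :: "'a::ring_1^'n^'m"
  by (simp add: vec_eq_iff transpose_def)
lemma transpose_diff: "transpose (A - B) = transpose A - transpose B" for A :: "'a::ring_1^'n^'m"
  by (simp add: vec_eq_iff transpose_def)
lemma transpose_zero: "transpose 0 = (0::'a::zero^'n^'m)"
  by (simp add: vec_eq_iff transpose_def)
lemma matrix_mult_add: "A ** (B + C) = A ** B + A ** C" for A :: "'a::ring_1^'n^'m"
  by (simp add: vec_eq_iff matrix_matrix_mult_def distrib_left sum.distrib)
lemma matrix_add_mult: "(A + B) ** C = A ** C + B ** C" for A :: "'a::ring_1^'n^'m"
  by (simp add: vec_eq_iff matrix_matrix_mult_def distrib_right sum.distrib)
lemma matrix_mult_diff: "A ** (B - C) = A ** B - A ** C" for A :: "'a::ring_1^'n^'m"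
  by (simp add: vec_eq_iff matrix_matrix_mult_def right_diff_distrib sum_subtractf)
lemma matrix_diff_mult: "(A - B) ** C = A ** C - B ** C" for A :: "'a::ring_1^'n^'m"
  by (simp add: vec_eq_iff matrix_matrix_mult_def left_diff_distrib sum_subtractf)

lemmas matrix_ring_simps = matrix_uminus_mult matrix_mult_uminus matrix_zero_mult matrix_mult_zero
  matrix_uminus_vec matrix_vec_uminus transpose_uminus transpose_add transpose_diff transpose_zero
  matrix_mult_add matrix_add_mult matrix_mult_diff matrix_diff_mult

section \<open>Symplectic and antisymplectic matrices\<close>

lemma Sp_block_iff:
  "block A B C D \<in> Sp \<longleftrightarrow> transpose A ** C = transpose C ** A \<and> transpose B ** D = transpose D ** B \<and>
     transpose A ** D - transpose C ** B = mat 1"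
proof -
  have "transpose (block A B C D) ** J ** block A B C D =
    block (transpose A ** C - transpose C ** A) (transpose A ** D - transpose C ** B)
      (transpose B ** C - transpose D ** A) (transpose B ** D - transpose D ** B)"
    by (simp add: J_def transpose_block block_mult matrix_ring_simps)
  \<comment> \<open>J is antisymmetric, so the lower left block is determined by the upper right one
    and three block equations remain.\<close>
  moreover have "transpose B ** C - transpose D ** A = - transpose (transpose A ** D - transpose C ** B)"
    by (simp add: matrix_ring_simps matrix_transpose_mul)
  ultimately show ?thesis
    by (auto simp: Sp_def J_def)
qed

lemma Sp_minus_block_iff:
  "block A B C D \<in> Sp_minus \<longleftrightarrow> transpose A ** C = transpose C ** A \<and> transpose B ** D = transpose D ** B \<and>
     transpose A ** D - transpose C ** B = - mat 1"
proof -
  have "transpose (block A B C D) ** J ** block A B C D =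
    block (transpose A ** C - transpose C ** A) (transpose A ** D - transpose C ** B)
      (transpose B ** C - transpose D ** A) (transpose B ** D - transpose D ** B)"
    by (simp add: J_def transpose_block block_mult matrix_ring_simps)
  moreover have off: "transpose B ** C - transpose D ** A = - transpose (transpose A ** D - transpose C ** B)"
    by (simp add: matrix_ring_simps matrix_transpose_mul)
  have "transpose B ** C - transpose D ** A = mat 1" if "transpose A ** D - transpose C ** B = - mat 1"
    unfolding off that by (simp add: matrix_ring_simps)
  ultimately show ?thesis
    by (auto simp: Sp_minus_def J_def uminus_block)
qed

lemma J_square: "J ** J = - mat 1"
  by (simp add: J_def block_mult matrix_ring_simps mat1_block uminus_block)

lemma mat1_Sp: "mat 1 \<in> Sp" by (simp add: Sp_def)

lemma Sp_uminus_iff [simp]: "- M \<in> Sp \<longleftrightarrow> M \<in> Sp" "- M \<in> Sp_minus \<longleftrightarrow> M \<in> Sp_minus"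
  by (simp_all add: Sp_def Sp_minus_def matrix_ring_simps)

lemma form_mult:
  fixes M N K :: "real^4^4"
  shows "transpose (M ** N) ** K ** (M ** N) = transpose N ** (transpose M ** K ** M) ** N"
  by (simp add: matrix_transpose_mul matrix_mul_assoc)

lemma Sp_mult:
  "M \<in> Sp \<Longrightarrow> N \<in> Sp \<Longrightarrow> M ** N \<in> Sp"
  "M \<in> Sp \<Longrightarrow> N \<in> Sp_minus \<Longrightarrow> M ** N \<in> Sp_minus"
  "M \<in> Sp_minus \<Longrightarrow> N \<in> Sp \<Longrightarrow> M ** N \<in> Sp_minus"
  "M \<in> Sp_minus \<Longrightarrow> N \<in> Sp_minus \<Longrightarrow> M ** N \<in> Sp"
  unfolding Sp_def Sp_minus_def mem_Collect_eq form_mult by (simp_all add: matrix_ring_simps)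

lemma form_inverse:
  fixes M N K L :: "real^4^4"
  assumes "N ** M = mat 1" "transpose M ** K ** M = L"
  shows "transpose N ** L ** N = K"
proof -
  have "M ** N = mat 1" using assms matrix_left_right_inverse by blast
  then show ?thesis using form_mult[of M N K] assms by simp
qed

lemma Sp_inverse:
  assumes "N ** M = mat 1"
  shows "M \<in> Sp \<Longrightarrow> N \<in> Sp" "M \<in> Sp_minus \<Longrightarrow> N \<in> Sp_minus"
proof -
  show "N \<in> Sp" if "M \<in> Sp"
    using form_inverse[OF assms, of J J] that by (simp add: Sp_def)
  show "N \<in> Sp_minus" if "M \<in> Sp_minus"
    using form_inverse[OF assms, of "- J" J] that
    by (simp add: Sp_minus_def matrix_ring_simps)
qed

lemma Sp_left_inverse: "M \<in> Sp \<Longrightarrow> (- (J ** transpose M ** J)) ** M = mat 1"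
  by (simp add: Sp_def matrix_ring_simps matrix_mul_assoc[symmetric] J_square)

lemma Sp_minus_left_inverse: "M \<in> Sp_minus \<Longrightarrow> (J ** transpose M ** J) ** M = mat 1"
  by (simp add: Sp_minus_def matrix_ring_simps matrix_mul_assoc[symmetric] J_square)

lemma Sp_inverse_ex: "M \<in> Sp \<Longrightarrow> \<exists>N\<in>Sp. N ** M = mat 1 \<and> M ** N = mat 1"
  using Sp_left_inverse Sp_inverse(1) matrix_left_right_inverse by blast

lemma Sp_minus_inverse_ex: "M \<in> Sp_minus \<Longrightarrow> \<exists>N\<in>Sp_minus. N ** M = mat 1 \<and> M ** N = mat 1"
  using Sp_minus_left_inverse Sp_inverse(2) matrix_left_right_inverse by blast

lemma trace_transpose: "trace (transpose A) = trace (A::'a::comm_semiring_1^'n^'n)"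
  by (simp add: trace_def transpose_def)

lemma trace_uminus: "trace (- A) = - trace (A::'a::ring_1^'n^'n)"
  by (simp add: trace_def sum_negf)

text \<open>The inverse is the transpose conjugated by J, hence the equal traces. This disposes of
  the inversion in the reversal argument.\<close>

lemma Sp_trace_inverse:
  assumes "M \<in> Sp" "N ** M = mat 1"
  shows "trace N = trace M"
proof -
  have "M ** N = mat 1" using assms matrix_left_right_inverse by blast
  then have "N = - (J ** transpose M ** J)"
    using Sp_left_inverse[OF assms(1)] by (metis matrix_mul_assoc matrix_mul_lid matrix_mul_rid)
  also have "trace \<dots> = - trace (J ** (J ** transpose M))"
    by (simp add: trace_uminus trace_mul_sym[of "J ** transpose M"])
  also have "\<dots> = trace M"
    by (simp add: matrix_mul_assoc J_square matrix_ring_simps trace_uminus trace_transpose)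
  finally show ?thesis .
qed

section \<open>The quotients by the sign\<close>

definition pm :: "real^4^4 \<Rightarrow> (real^4^4) set" where
  "pm M = {M, - M}"

lemma pm_eq_iff: "pm M = pm N \<longleftrightarrow> M = N \<or> M = - N"
  by (auto simp: pm_def doubleton_eq_iff)

lemma mem_pm: "N \<in> pm M \<longleftrightarrow> N = M \<or> N = - M"
  by (simp add: pm_def)

lemma pm_uminus [simp]: "pm (- M) = pm M"
  by (auto simp: pm_def)

lemma
  shows carrier_PSp: "carrier PSp = pm ` Sp"
    and carrier_PSp_pm: "carrier PSp_pm = pm ` (Sp \<union> Sp_minus)"
    and one_PSp: "\<one>\<^bsub>PSp\<^esub> = pm (mat 1)"
    and one_PSp_pm: "\<one>\<^bsub>PSp_pm\<^esub> = pm (mat 1)"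
    and mult_PSp: "pm M \<otimes>\<^bsub>PSp\<^esub> pm N = pm (M ** N)"
    and mult_PSp_pm: "pm M \<otimes>\<^bsub>PSp_pm\<^esub> pm N = pm (M ** N)"
  by (auto simp: PSp_def PSp_pm_def matrix_monoid_def FactGroup_def RCOSETS_def r_coset_def
      set_mult_def pm_def matrix_ring_simps)

lemma group_PSp: "group PSp"
proof (rule groupI, goal_cases)
  case (5 x)
  then obtain M where "M \<in> Sp" "x = pm M" by (auto simp: carrier_PSp)
  then obtain N where "N \<in> Sp" "N ** M = mat 1" using Sp_inverse_ex by blast
  then show ?case using \<open>x = pm M\<close>
    by (intro bexI[of _ "pm N"]) (auto simp: carrier_PSp mult_PSp one_PSp)
qed (auto simp: carrier_PSp one_PSp mult_PSp mat1_Sp Sp_mult matrix_mul_assoc)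

lemma group_PSp_pm: "group PSp_pm"
proof (rule groupI, goal_cases)
  case (5 x)
  then obtain M where "M \<in> Sp \<union> Sp_minus" "x = pm M" by (auto simp: carrier_PSp_pm)
  then obtain N where "N \<in> Sp \<union> Sp_minus" "N ** M = mat 1"
    using Sp_inverse_ex Sp_minus_inverse_ex by blast
  then show ?case using \<open>x = pm M\<close>
    by (intro bexI[of _ "pm N"]) (auto simp: carrier_PSp_pm mult_PSp_pm one_PSp_pm)
qed (auto simp: carrier_PSp_pm one_PSp_pm mult_PSp_pm mat1_Sp Sp_mult matrix_mul_assoc)

lemma inv_PSp:
  assumes "M \<in> Sp" "N ** M = mat 1"
  shows "inv\<^bsub>PSp\<^esub> (pm M) = pm N"
  using assms Sp_inverse(1)
  by (intro group.inv_equality[OF group_PSp]) (auto simp: mult_PSp one_PSp carrier_PSp)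

lemma inv_PSp_pm:
  assumes "M \<in> Sp \<union> Sp_minus" "N ** M = mat 1"
  shows "inv\<^bsub>PSp_pm\<^esub> (pm M) = pm N"
proof -
  have "N \<in> Sp \<union> Sp_minus" using assms Sp_inverse[OF assms(2)] by auto
  then show ?thesis using assms
    by (intro group.inv_equality[OF group_PSp_pm]) (auto simp: mult_PSp_pm one_PSp_pm carrier_PSp_pm)
qed

text \<open>A subspace is closed under negation, so either representative of the coset computes the
  action.\<close>

lemma act_pm: assumes "subspace l" shows "act (pm M) l = (*v) M ` l"
proof -
  have "- v \<in> l" if "v \<in> l" for v using assms that by (simp add: subspace_neg)
  then have "- (M *v v) \<in> (*v) M ` l" if "v \<in> l" for v
    using that by (metis imageI matrix_vec_uminus)
  then show ?thesis by (auto simp: act_def pm_def matrix_ring_simps)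
qed

section \<open>Lagrangians and the Loewner order\<close>

definition mat2 :: "'a::zero \<Rightarrow> 'a \<Rightarrow> 'a \<Rightarrow> 'a \<Rightarrow> 'a^2^2" where
  "mat2 a b c d = vector [vector [a, b], vector [c, d]]"

lemma mat2_nth [simp]:
  "mat2 a b c d $ 1 $ 1 = a" "mat2 a b c d $ 1 $ 2 = b"
  "mat2 a b c d $ 2 $ 1 = c" "mat2 a b c d $ 2 $ 2 = d"
  by (simp_all add: mat2_def)

text \<open>Homogeneous coordinates \<open>[R : S]\<close>: a common invertible factor on the right
  does not change the subspace (\<open>frame_mult\<close>). In them matrices act linearly, and on
  \<open>lag X\<close> by fractional linear maps.\<close>

definition frame :: "'a::field^2^2 \<Rightarrow> 'a^2^2 \<Rightarrow> ('a^4) set" where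
  "frame R S = range (\<lambda>u. vpair (R *v u) (S *v u))"

lemma lag_frame: "lag X = frame X (mat 1)"
  by (simp add: lag_eq frame_def)

lemma lag_inf_frame: "lag_inf = frame (mat 1) 0"
  by (simp add: lag_inf_eq frame_def)

lemma image_frame:
  "(*v) (block A B C D) ` frame R S = frame (A ** R + B ** S) (C ** R + D ** S)"
  by (simp add: frame_def image_image block_mult_vec matrix_vector_mul_assoc matrix_vector_mult_add_rdistrib)

lemma frame_mult:
  fixes T :: "'a::field^2^2"
  assumes "invertible T"
  shows "frame (R ** T) (S ** T) = frame R S"
proof -
  have "surj ((*v) T)"
    using assms matrix_right_invertible_surjective[of T] by (auto simp: invertible_def)
  then have "frame R S = (\<lambda>u. vpair (R *v u) (S *v u)) ` ((*v) T ` UNIV)"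
    by (simp add: frame_def)
  then show ?thesis
    by (simp add: frame_def image_image matrix_vector_mul_assoc)
qed

lemma frame_eq_lag:
  assumes "invertible S" "R = X ** S"
  shows "frame R S = lag X"
  using frame_mult[OF assms(1), of X "mat 1"] assms by (simp add: lag_frame)

lemma invertible_uminus: "invertible A \<Longrightarrow> invertible (- A)" for A :: "'a::field^'n^'n"
  unfolding invertible_def
proof (elim exE)
  fix B assume "A ** B = mat 1 \<and> B ** A = mat 1"
  then show "\<exists>B. - A ** B = mat 1 \<and> B ** - A = mat 1"
    by (intro exI[of _ "- B"]) (simp add: matrix_ring_simps)
qed

lemma invertible_ker:
  fixes A :: "'a::field^'n^'n"
  assumes "\<And>x. A *v x = 0 \<Longrightarrow> x = 0"
  shows "invertible A"
proof -
  have "\<exists>B. B ** A = mat 1"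
    using assms by (subst matrix_left_invertible_ker) auto
  then show ?thesis
    using matrix_left_right_inverse[of _ A] by (auto simp: invertible_def)
qed

section \<open>The Loewner order\<close>

definition sym_mat :: "real^'n^'n \<Rightarrow> bool" where "sym_mat X \<longleftrightarrow> transpose X = X"

lemma sym_mat_simps [simp]: "sym_mat 0" "sym_mat (mat c)"
  "sym_mat X \<Longrightarrow> sym_mat (- X)" "sym_mat X \<Longrightarrow> sym_mat Y \<Longrightarrow> sym_mat (X + Y)"
  "sym_mat X \<Longrightarrow> sym_mat Y \<Longrightarrow> sym_mat (X - Y)" "sym_mat X \<Longrightarrow> sym_mat (c *\<^sub>R X)"
  by (auto simp: sym_mat_def matrix_ring_simps transpose_scalar)

lemma sym_mat_inner: "sym_mat X \<Longrightarrow> (X *v u) \<bullet> v = u \<bullet> (X *v v)"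
  by (metis dot_lmul_matrix sym_mat_def transpose_matrix_vector)

lemma sym_mat_inv:
  assumes "invertible X" "sym_mat X" shows "sym_mat (matrix_inv X)"
proof -
  have "transpose (matrix_inv X ** X) = mat 1"
    using assms by (simp add: matrix_inv_mult)
  then have "X ** transpose (matrix_inv X) = mat 1"
    using assms by (simp add: matrix_transpose_mul sym_mat_def)
  then show ?thesis using matrix_inv_unique by (metis sym_mat_def)
qed

text \<open>Only quadratic forms are compared; symmetry is carried separately by
  \<open>sym_mat\<close>.\<close>

definition loewner :: "real^'n^'n \<Rightarrow> real^'n^'n \<Rightarrow> bool" (infix \<open>\<prec>\<^sub>L\<close> 50) where
  "X \<prec>\<^sub>L Y \<longleftrightarrow> (\<forall>v. v \<noteq> 0 \<longrightarrow> v \<bullet> (X *v v) < v \<bullet> (Y *v v))"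

lemma loewner_trans: "X \<prec>\<^sub>L Y \<Longrightarrow> Y \<prec>\<^sub>L Z \<Longrightarrow> X \<prec>\<^sub>L Z"
  unfolding loewner_def by (meson less_trans)

lemma loewner_diff: "X \<prec>\<^sub>L Y \<longleftrightarrow> 0 \<prec>\<^sub>L Y - X"
  by (simp add: loewner_def matrix_vector_mult_diff_rdistrib inner_diff_right)

lemma loewner_uminus: "- X \<prec>\<^sub>L - Y \<longleftrightarrow> Y \<prec>\<^sub>L X"
  by (simp add: loewner_def matrix_ring_simps)

lemma pos_invertible: "0 \<prec>\<^sub>L X \<Longrightarrow> invertible X"
  by (rule invertible_ker) (force simp: loewner_def)

text \<open>With p and q the preimages of u under P and Q, expanding the nonnegative number (p - q)
  . P (p - q) gives 2 q.u <= p.u + q.Pq, and q.Pq < q.u because P lies below Q.\<close>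

lemma loewner_inverse:
  assumes P: "0 \<prec>\<^sub>L P" "P \<prec>\<^sub>L Q" and sym: "sym_mat P" "sym_mat Q"
  shows "0 \<prec>\<^sub>L matrix_inv Q" "matrix_inv Q \<prec>\<^sub>L matrix_inv P"
proof -
  have Q: "0 \<prec>\<^sub>L Q" using P loewner_trans by blast
  have inv: "P ** matrix_inv P = mat 1" "Q ** matrix_inv Q = mat 1"
    using P Q pos_invertible matrix_inv_mult by blast+
  have *: "0 < u \<bullet> (matrix_inv Q *v u) \<and> u \<bullet> (matrix_inv Q *v u) < u \<bullet> (matrix_inv P *v u)"
    if "u \<noteq> 0" for u
  proof -
    define p where "p = matrix_inv P *v u"
    define q where "q = matrix_inv Q *v u"
    have pq: "P *v p = u" "Q *v q = u"
      by (simp_all add: p_def q_def matrix_vector_mul_assoc inv)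
    then have "q \<noteq> 0" using that by auto
    have "0 < q \<bullet> u" using Q \<open>q \<noteq> 0\<close> pq by (auto simp: loewner_def)
    have less: "q \<bullet> (P *v q) < q \<bullet> u" using P(2) \<open>q \<noteq> 0\<close> pq by (auto simp: loewner_def)
    have "0 \<le> (p - q) \<bullet> (P *v (p - q))"
      using P(1) by (cases "p = q") (auto simp: loewner_def less_imp_le)
    also have "\<dots> = p \<bullet> u - p \<bullet> (P *v q) - q \<bullet> u + q \<bullet> (P *v q)"
      by (simp add: matrix_vector_mult_diff_distrib inner_diff_left inner_diff_right pq)
    also have "p \<bullet> (P *v q) = q \<bullet> u"
      using sym_mat_inner[OF sym(1), of p q] pq by (simp add: inner_commute)
    finally show ?thesis
      using less \<open>0 < q \<bullet> u\<close> by (simp add: p_def[symmetric] q_def[symmetric] inner_commute)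
  qed
  then show "0 \<prec>\<^sub>L matrix_inv Q" "matrix_inv Q \<prec>\<^sub>L matrix_inv P"
    by (auto simp: loewner_def)
qed

lemma cholesky:
  fixes W :: "real^2^2"
  assumes "0 \<prec>\<^sub>L W" "sym_mat W"
  shows "\<exists>V :: real^2^2. invertible V \<and> transpose V ** W ** V = mat 1"
proof -
  define a b d where "a = W$1$1" and "b = W$1$2" and "d = W$2$2"
  have sym: "W$2$1 = b" using assms(2) by (simp add: sym_mat_def b_def vec_eq_iff transpose_def)
  have quad: "x * x * a + 2 * x * y * b + y * y * d > 0" if "(x, y) \<noteq> (0, 0)" for x y
  proof -
    have "vector [x, y] \<noteq> (0::real^2)" using that by (simp add: vec2_eq_iff)
    then have "0 < vector [x, y] \<bullet> (W *v vector [x, y])"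
      using assms(1) by (simp add: loewner_def)
    then show ?thesis
      by (simp add: inner_vec_def sum_2 matrix_vector_mult_def sym a_def[symmetric] b_def[symmetric]
        d_def[symmetric] algebra_simps)
  qed
  have "a > 0" using quad[of 1 0] by simp
  have "a * (a * d - b * b) > 0" using quad[of "- b" a] \<open>a > 0\<close> by (simp add: algebra_simps)
  then have e: "a * d - b * b > 0" using \<open>a > 0\<close> by (simp add: zero_less_mult_iff)
  define r s where "r = sqrt a" and "s = sqrt (a * (a * d - b * b))"
  have rs: "r > 0" "s > 0" "r * r = a" "s * s = a * (a * d - b * b)"
    using \<open>a > 0\<close> e by (simp_all add: r_def s_def)
  \<comment> \<open>Gram-Schmidt for the form W applied to the standard basis: the second column is
    a multiple of (-b, a), whose W-norm squared is a * (a * d - b * b).\<close>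
  define V where "V = mat2 (1 / r) (- b / s) 0 (a / s)"
  have "invertible V"
    unfolding invertible_det_nz using rs \<open>a > 0\<close> by (simp add: V_def det_2)
  moreover have "transpose V ** W ** V = mat 1"
  proof -
    have 1: "a / (r * r) = 1" using rs \<open>a > 0\<close> by simp
    have 2: "(a * a * d - a * b * b) / (s * s) = 1" using rs \<open>a > 0\<close> e by (simp add: right_diff_distrib mult.assoc)
    show ?thesis
      using rs(1,2) 1 2 \<open>a > 0\<close>
      by (simp add: V_def vec2_eq_iff matrix_matrix_mult_def transpose_def sum_2 mat_def sym
        a_def[symmetric] b_def[symmetric] d_def[symmetric] field_simps)
        (use arg_cong[OF rs(4), of "\<lambda>t. s * t"] in \<open>simp add: algebra_simps\<close>)
  qed
  ultimately show ?thesis by blast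
qed

text \<open>The map taking T to minus the inverse of T - X sends X to infinity and Y, Z to
  \<open>- Pi\<close>, \<open>- Qi\<close>. Their difference W is positive because inversion
  reverses the order, and V rescales it to the identity; M is the inverse of this normalization,
  applied to the standard triple.\<close>

lemma maximal_triple_lag:
  fixes X Y Z :: "real^2^2"
  assumes sym: "sym_mat X" "sym_mat Y" "sym_mat Z" and "X \<prec>\<^sub>L Y" "Y \<prec>\<^sub>L Z"
  shows "maximal_triple (lag X) (lag Y) (lag Z)"
proof -
  define P Q where "P = Y - X" and "Q = Z - X"
  have P: "0 \<prec>\<^sub>L P" "sym_mat P" and Q: "P \<prec>\<^sub>L Q" "sym_mat Q" "0 \<prec>\<^sub>L Q"
    using assms loewner_trans[of X Y Z]
    by (auto simp: P_def Q_def loewner_diff[of X Y] loewner_diff[of Y Z] loewner_diff[of X Z]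
      loewner_diff[of "Y - X" "Z - X"])
  define Pi Qi where "Pi = matrix_inv P" and "Qi = matrix_inv Q"
  have inv: "invertible P" "invertible Q" using P Q pos_invertible by blast+
  have Pi: "P ** Pi = mat 1" "Pi ** P = mat 1" and Qi: "Q ** Qi = mat 1" "Qi ** Q = mat 1"
    using inv matrix_inv_mult by (auto simp: Pi_def Qi_def)
  have symi: "transpose Pi = Pi" "transpose Qi = Qi" "transpose X = X"
    using sym_mat_inv inv P Q sym by (auto simp: Pi_def Qi_def sym_mat_def)
  define W where "W = Pi - Qi"
  have "0 \<prec>\<^sub>L W" "sym_mat W"
    using loewner_inverse(2)[OF P(1) Q(1) P(2) Q(2)] symi
    by (simp_all add: W_def Pi_def[symmetric] Qi_def[symmetric] loewner_diff[of Qi] sym_mat_def matrix_ring_simps)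
  then obtain V :: "real^2^2" where V: "invertible V" "transpose V ** W ** V = mat 1"
    using cholesky by blast
  define M where "M = block (- (X ** W ** V)) (V + X ** Pi ** V) (- (W ** V)) (Pi ** V)"
  have symW: "transpose W = W" using \<open>sym_mat W\<close> by (simp add: sym_mat_def)
  have "M \<in> Sp"
    unfolding M_def Sp_block_iff using V(2) symi symW
    by (simp add: matrix_transpose_mul matrix_ring_simps matrix_mul_assoc)
  moreover have "invertible Pi" "invertible Qi" using Pi Qi by (auto simp: invertible_def)
  then have "invertible (- (W ** V))" "invertible (Pi ** V)" "invertible (Qi ** V)"
    using V(1) pos_invertible[OF \<open>0 \<prec>\<^sub>L W\<close>]
    by (simp_all add: invertible_mult invertible_uminus)
  moreover have "(*v) M ` lag_inf = frame (- (X ** W ** V)) (- (W ** V))"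
    by (simp add: M_def lag_inf_frame image_frame matrix_ring_simps)
  moreover have "(*v) M ` lag 0 = frame (V + X ** Pi ** V) (Pi ** V)"
    by (simp add: M_def lag_frame image_frame matrix_ring_simps)
  moreover have "(*v) M ` lag (mat 1) = frame (V + X ** Qi ** V) (Qi ** V)"
    by (simp add: M_def lag_frame image_frame matrix_ring_simps W_def add.commute)
  moreover have "V + X ** Pi ** V = Y ** (Pi ** V)" "V + X ** Qi ** V = Z ** (Qi ** V)"
  proof -
    have "Y = P + X" "Z = Q + X" by (simp_all add: P_def Q_def)
    then show "V + X ** Pi ** V = Y ** (Pi ** V)" "V + X ** Qi ** V = Z ** (Qi ** V)"
      by (simp_all add: matrix_ring_simps matrix_mul_assoc Pi Qi)
  qed
  ultimately show ?thesis
    unfolding maximal_triple_def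
    by (intro bexI[of _ M]) (simp_all add: frame_eq_lag matrix_ring_simps matrix_mul_assoc)
qed

lemma maximal_triple_rotate:
  assumes "maximal_triple a b c" shows "maximal_triple b c a"
proof -
  \<comment> \<open>The matrix version of z to 1 / (1 - z), which permutes infinity, 0 and 1
    cyclically.\<close>
  define K :: "real^4^4" where "K = block 0 (mat 1) (- mat 1) (mat 1)"
  have "K \<in> Sp" by (simp add: K_def Sp_block_iff matrix_ring_simps)
  have i: "invertible (mat 1 :: real^2^2)" "invertible (- mat 1 :: real^2^2)"
    by (auto simp: invertible_def intro: exI[of _ "mat 1"] exI[of _ "- mat 1"] simp: matrix_ring_simps)
  have "(*v) K ` lag_inf = frame 0 (- mat 1)" "(*v) K ` lag 0 = frame (mat 1) (mat 1)"
    "(*v) K ` lag (mat 1) = frame (mat 1) 0"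
    by (simp_all add: K_def lag_inf_frame lag_frame image_frame matrix_ring_simps)
  then have K: "(*v) K ` lag_inf = lag 0" "(*v) K ` lag 0 = lag (mat 1)" "(*v) K ` lag (mat 1) = lag_inf"
    using i by (simp_all add: frame_eq_lag matrix_ring_simps lag_inf_frame)
  obtain M where M: "M \<in> Sp" "a = (*v) M ` lag_inf" "b = (*v) M ` lag 0" "c = (*v) M ` lag (mat 1)"
    using assms by (auto simp: maximal_triple_def)
  have "(*v) (M ** K) ` l = (*v) M ` ((*v) K ` l)" for l
    by (simp add: image_image matrix_vector_mul_assoc)
  then show ?thesis
    unfolding maximal_triple_def
    by (intro bexI[of _ "M ** K"]) (simp_all add: M K Sp_mult \<open>K \<in> Sp\<close>)
qed

lemma subspace_lag: "subspace (lag (X::real^2^2))"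
  unfolding lag_def span_vec_eq by (rule subspace_span)

lemma lag_lagrangian:
  assumes "sym_mat X" shows "lag X \<in> lagrangians"
proof -
  have "linear (\<lambda>u::real^2. vpair (X *v u) u)"
    by (rule linearI) (simp_all add: vpair_add vpair_scaleR matrix_vector_right_distrib matrix_vector_mult_scaleR)
  moreover have "inj (\<lambda>u::real^2. vpair (X *v u) u)" by (auto simp: inj_on_def)
  ultimately have "dim (lag X) = 2"
    unfolding lag_eq by (subst dim_image_eq) (auto simp: inj_on_def)
  moreover have "v \<bullet> (J *v w) = 0" if "v \<in> lag X" "w \<in> lag X" for v w
    using that assms
    by (auto simp: lag_eq J_def block_mult_vec inner_vpair matrix_ring_simps sym_mat_inner)
  ultimately show ?thesis
    by (auto simp: lagrangians_def subspace_lag)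
qed

section \<open>Orthogonal tubes\<close>

text \<open>The projection onto \<open>lag X\<close> amounts to one linear equation for its
  parameter u. It is kept as a hypothesis so that no inverse matrix has to be written down.\<close>

lemma proj_par_lag:
  fixes X Y :: "'a::field^2^2"
  assumes "invertible (X - Y)" "(X - Y) *v u = a - Y *v b"
  shows "proj_par (lag X) (lag Y) (vpair a b) = vpair (X *v u) u"
  unfolding proj_par_def
proof (rule the_equality)
  have "a - X *v u = Y *v (b - u)"
    using assms(2) by (simp add: matrix_vector_mult_diff_rdistrib matrix_vector_mult_diff_distrib algebra_simps)
  then show "vpair (X *v u) u \<in> lag X \<and> vpair a b - vpair (X *v u) u \<in> lag Y"
    by (auto simp: lag_eq vpair_diff)
next
  fix w assume w: "w \<in> lag X \<and> vpair a b - w \<in> lag Y"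
  then obtain u' where u': "w = vpair (X *v u') u'" by (auto simp: lag_eq)
  with w have "a - X *v u' = Y *v (b - u')" by (auto simp: lag_eq vpair_diff)
  then have "X *v u' - Y *v u' = a - Y *v b"
    by (simp add: matrix_vector_mult_diff_distrib algebra_simps)
  then have "(X - Y) *v u' = (X - Y) *v u"
    unfolding assms(2) by (simp add: matrix_vector_mult_diff_rdistrib)
  then have "u' = u" using assms(1) by (metis inj_matrix_vector_mult injD)
  then show "w = vpair (X *v u) u" using u' by simp
qed

section \<open>Complex matrices by real and imaginary part, and tubes with scalar end points\<close>

definition cmat :: "real^'n^'m \<Rightarrow> real^'n^'m \<Rightarrow> complex^'n^'m" where
  "cmat X Y = (\<chi> i j. Complex (X$i$j) (Y$i$j))"

lemma cmat_eq_iff: "cmat X Y = cmat X' Y' \<longleftrightarrow> X = X' \<and> Y = Y'"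
  by (auto simp: cmat_def vec_eq_iff)
lemma cmat_add: "cmat X Y + cmat X' Y' = cmat (X + X') (Y + Y')"
  by (simp add: cmat_def vec_eq_iff complex_eq_iff)
lemma cmat_diff: "cmat X Y - cmat X' Y' = cmat (X - X') (Y - Y')"
  by (simp add: cmat_def vec_eq_iff complex_eq_iff)
lemma cmat_mult: "cmat X Y ** cmat X' Y' = cmat (X ** X' - Y ** Y') (X ** Y' + Y ** X')"
  by (simp add: cmat_def vec_eq_iff complex_eq_iff matrix_matrix_mult_def sum_subtractf sum.distrib)
lemma cmat_mat: "mat (Complex a b) = cmat (mat a) (mat b)"
  by (auto simp: cmat_def vec_eq_iff mat_def complex_eq_iff)
lemma cmat_mat_real: "mat (complex_of_real a) = cmat (mat a) 0"
  by (auto simp: cmat_def vec_eq_iff mat_def complex_eq_iff)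
lemma cmat_zero: "0 = cmat 0 0"
  by (simp add: cmat_def vec_eq_iff complex_eq_iff)
lemma cnj_cmat: "map_matrix cnj (cmat X Y) = cmat X (- Y)"
  by (simp add: cmat_def vec_eq_iff complex_eq_iff map_matrix_def)

lemma siegel_eq: "siegel = {cmat X Y | X Y. sym_mat X \<and> sym_mat Y \<and> 0 \<prec>\<^sub>L Y}"
  by (simp add: siegel_def cmat_def sym_mat_def loewner_def)

text \<open>For a kernel vector a + ib, symmetry of X forces a.Ya + b.Yb = 0, which definiteness of
  Y excludes. Both signs occur because the cross-ratio involves Z as well as its conjugate.\<close>

lemma siegel_invertible:
  assumes X: "sym_mat X" and Y: "0 \<prec>\<^sub>L Y \<or> 0 \<prec>\<^sub>L - Y"
  shows "invertible (cmat X Y)"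
proof (rule invertible_ker)
  fix v assume v: "cmat X Y *v v = 0"
  define a b where "a = (\<chi> i. Re (v$i))" and "b = (\<chi> i. Im (v$i))"
  have ab: "X *v a = Y *v b" "X *v b = - (Y *v a)"
    using v by (simp_all add: vec_eq_iff matrix_vector_mult_def cmat_def a_def b_def
        sum_subtractf complex_eq_iff sum.distrib add_eq_0_iff)
  have "a \<bullet> (X *v b) = b \<bullet> (X *v a)" using sym_mat_inner[OF X, of a b] by (simp add: inner_commute)
  then have sum: "a \<bullet> (Y *v a) + b \<bullet> (Y *v b) = 0" using ab by simp
  have "a = 0 \<and> b = 0"
    using Y
  proof
    assume pos: "0 \<prec>\<^sub>L Y"
    have "0 \<le> u \<bullet> (Y *v u)" "u \<bullet> (Y *v u) = 0 \<Longrightarrow> u = 0" for u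
      using pos by (cases "u = 0"; force simp: loewner_def)+
    then show ?thesis using sum by (metis add_nonneg_eq_0_iff)
  next
    assume neg: "0 \<prec>\<^sub>L - Y"
    have "u \<bullet> (Y *v u) \<le> 0" "u \<bullet> (Y *v u) = 0 \<Longrightarrow> u = 0" for u
      using neg by (cases "u = 0"; force simp: loewner_def matrix_ring_simps)+
    then show ?thesis using sum by (metis add_nonpos_eq_0_iff)
  qed
  then show "v = 0" by (simp add: vec_eq_iff a_def b_def complex_eq_iff)
qed

lemma complexify_lag: "complexify (lag (mat p)) = lag (mat (complex_of_real p))"
proof (intro equalityI subsetI)
  fix v assume "v \<in> complexify (lag (mat p))"
  then obtain x y :: "real^2" where "v = (\<chi> i. Complex (vpair (mat p *v x) x $ i) (vpair (mat p *v y) y $ i))"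
    by (auto simp: complexify_def lag_eq)
  then have "v = vpair (mat (complex_of_real p) *v (\<chi> i. Complex (x$i) (y$i))) (\<chi> i. Complex (x$i) (y$i))"
    by (simp add: vec4_eq_iff matrix_vector_mult_def mat_def sum_2 complex_eq_iff)
  then show "v \<in> lag (mat (complex_of_real p))" by (auto simp: lag_eq)
next
  fix v assume "v \<in> lag (mat (complex_of_real p))"
  then obtain u :: "complex^2" where u: "v = vpair (mat (complex_of_real p) *v u) u" by (auto simp: lag_eq)
  define x y where "x = (\<chi> i. Re (u$i))" and "y = (\<chi> i. Im (u$i))"
  have "v = (\<chi> i. Complex (vpair (mat p *v x) x $ i) (vpair (mat p *v y) y $ i))"
    using u by (simp add: vec4_eq_iff matrix_vector_mult_def mat_def sum_2 complex_eq_iff x_def y_def)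
  then show "v \<in> complexify (lag (mat p))" by (auto simp: complexify_def lag_eq)
qed

lemma conj_space_lag: "conj_space (lag Z) = lag (map_matrix cnj Z)"
proof (intro equalityI subsetI)
  fix v assume "v \<in> conj_space (lag Z)"
  then obtain u where "v = (\<chi> i. cnj (vpair (Z *v u) u $ i))"
    by (auto simp: conj_space_def lag_eq)
  then have "v = vpair (map_matrix cnj Z *v (\<chi> i. cnj (u$i))) (\<chi> i. cnj (u$i))"
    by (simp add: vec4_eq_iff matrix_vector_mult_def map_matrix_def sum_2)
  then show "v \<in> lag (map_matrix cnj Z)" by (auto simp: lag_eq)
next
  fix v assume "v \<in> lag (map_matrix cnj Z)"
  then obtain u where u: "v = vpair (map_matrix cnj Z *v u) u" by (auto simp: lag_eq)
  have "v = (\<chi> i. cnj (vpair (Z *v (\<chi> i. cnj (u$i))) (\<chi> i. cnj (u$i)) $ i))"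
    using u by (simp add: vec4_eq_iff matrix_vector_mult_def map_matrix_def sum_2)
  then show "v \<in> conj_space (lag Z)" by (auto simp: conj_space_def lag_eq)
qed

text \<open>Scalar end points commute with every matrix. Hence, if a vector of \<open>lag a\<close>
  is parametrized by \<open>(b - W) *v t\<close>, its projection to \<open>lag b\<close> has the
  parameter \<open>(a - W) *v t\<close>, and the cross-ratio condition becomes a polynomial
  identity.\<close>

lemma tube_complex_eq:
  assumes "Z \<in> siegel"
  shows "Z \<in> tube (lag (mat p)) (lag (mat q)) \<longleftrightarrow>
    (Z - mat (of_real q)) ** (map_matrix cnj Z - mat (of_real p)) +
    (Z - mat (of_real p)) ** (map_matrix cnj Z - mat (of_real q)) = 0"
proof -
  obtain X Y where Z: "Z = cmat X Y" "sym_mat X" "sym_mat Y" "0 \<prec>\<^sub>L Y"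
    using assms by (auto simp: siegel_eq)
  define W where "W = map_matrix cnj Z"
  define a b where "a = (mat (complex_of_real p) :: complex^2^2)" and "b = (mat (complex_of_real q) :: complex^2^2)"
  have Y': "0 \<prec>\<^sub>L - (- Y)" using Z by simp
  have inv: "invertible (a - Z)" "invertible (b - W)"
    using Z Y' by (auto simp: a_def b_def W_def cmat_mat_real cnj_cmat cmat_diff intro!: siegel_invertible)
  have comm: "a ** M = M ** a" "b ** M = M ** b" for M
    by (simp_all add: a_def b_def vec2_eq_iff matrix_matrix_mult_def mat_def sum_2)
  have cr: "cross_ratio (lag a) (lag Z) (lag W) (lag b) (vpair (a *v ((b - W) *v t)) ((b - W) *v t)) =
     vpair (a *v u') u'" if "(a - Z) *v u' = ((b - Z) ** (a - W)) *v t" for t u'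
  proof -
    have "(b - W) ** (a - W) = a ** (b - W) - W ** (b - W)"
      by (simp add: matrix_diff_mult matrix_mult_diff comm(1)[of W] comm(2)[of W] comm(2)[of a])
    then have 1: "(b - W) *v ((a - W) *v t) = a *v ((b - W) *v t) - W *v ((b - W) *v t)"
      by (simp add: matrix_vector_mul_assoc matrix_vector_mult_diff_rdistrib[symmetric])
    have 2: "(a - Z) *v u' = b *v ((a - W) *v t) - Z *v ((a - W) *v t)"
      using that by (simp add: matrix_vector_mul_assoc[symmetric] matrix_vector_mult_diff_rdistrib)
    have "proj_par (lag b) (lag W) (vpair (a *v ((b - W) *v t)) ((b - W) *v t))
        = vpair (b *v ((a - W) *v t)) ((a - W) *v t)"
      by (rule proj_par_lag[OF inv(2)]) (use 1 in simp)
    moreover have "proj_par (lag a) (lag Z) (vpair (b *v ((a - W) *v t)) ((a - W) *v t)) = vpair (a *v u') u'"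
      by (rule proj_par_lag[OF inv(1)]) (use 2 in simp)
    ultimately show ?thesis
      by (auto simp: cross_ratio_def lag_eq[of a])
  qed
  have surj: "\<exists>t. u = (b - W) *v t" for u
    using inv(2) by (metis invertible_def matrix_vector_mul_assoc matrix_vector_mul_lid)
  have ex: "\<exists>u'. (a - Z) *v u' = x" for x
    using inv(1) by (metis invertible_def matrix_vector_mul_assoc matrix_vector_mul_lid)
  have inj: "u = u'" if "(a - Z) *v u = (a - Z) *v u'" for u u'
    using inv(1) that by (metis inj_matrix_vector_mult injD)
  have "Z \<in> tube (lag (mat p)) (lag (mat q)) \<longleftrightarrow>
    (\<forall>v\<in>lag a. cross_ratio (lag a) (lag Z) (lag W) (lag b) v = - v)"
    using assms by (simp add: tube_def complexify_lag conj_space_lag W_def a_def b_def)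
  also have "\<dots> \<longleftrightarrow> (\<forall>u. cross_ratio (lag a) (lag Z) (lag W) (lag b) (vpair (a *v u) u) = - vpair (a *v u) u)"
    by (auto simp: lag_eq[of a])
  also have "\<dots> \<longleftrightarrow> (\<forall>t. cross_ratio (lag a) (lag Z) (lag W) (lag b)
      (vpair (a *v ((b - W) *v t)) ((b - W) *v t)) = - vpair (a *v ((b - W) *v t)) ((b - W) *v t))"
    by (metis surj)
  also have "\<dots> \<longleftrightarrow> (\<forall>t. (a - Z) *v (- ((b - W) *v t)) = ((b - Z) ** (a - W)) *v t)"
  proof (intro iff_allI iffI)
    fix t
    assume *: "cross_ratio (lag a) (lag Z) (lag W) (lag b)
      (vpair (a *v ((b - W) *v t)) ((b - W) *v t)) = - vpair (a *v ((b - W) *v t)) ((b - W) *v t)"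
    obtain u' where u': "(a - Z) *v u' = ((b - Z) ** (a - W)) *v t" using ex by blast
    with cr * have "u' = - ((b - W) *v t)" by (simp add: vpair_uminus)
    then show "(a - Z) *v (- ((b - W) *v t)) = ((b - Z) ** (a - W)) *v t" using u' by simp
  next
    fix t
    assume "(a - Z) *v (- ((b - W) *v t)) = ((b - Z) ** (a - W)) *v t"
    from cr[OF this] show "cross_ratio (lag a) (lag Z) (lag W) (lag b)
      (vpair (a *v ((b - W) *v t)) ((b - W) *v t)) = - vpair (a *v ((b - W) *v t)) ((b - W) *v t)"
      by (simp add: vpair_uminus matrix_ring_simps)
  qed
  also have "\<dots> \<longleftrightarrow> - ((a - Z) ** (b - W)) = (b - Z) ** (a - W)"
    by (simp add: matrix_eq matrix_vec_uminus matrix_uminus_vec matrix_vector_mul_assoc)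
  also have "\<dots> \<longleftrightarrow> (b - Z) ** (a - W) + (a - Z) ** (b - W) = 0"
    by (metis add.commute add_eq_0_iff)
  also have "(b - Z) ** (a - W) + (a - Z) ** (b - W) = (Z - b) ** (W - a) + (Z - a) ** (W - b)"
    by (simp add: matrix_mult_diff matrix_diff_mult)
  finally show ?thesis by (simp add: W_def a_def b_def)
qed

text \<open>The imaginary part of the polynomial identity says that X and Y commute. The real part
  is the matrix form of |z|^2 = (p + q) Re z - pq, the circle over the diameter from p to q.\<close>

lemma tube_iff:
  "Z \<in> tube (lag (mat p)) (lag (mat q)) \<longleftrightarrow>
    (\<exists>X Y. Z = cmat X Y \<and> sym_mat X \<and> sym_mat Y \<and> 0 \<prec>\<^sub>L Y \<and> X ** Y = Y ** X \<and>
       X ** X + Y ** Y = (p + q) *\<^sub>R X - mat (p * q))"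
proof -
  have "Z \<in> tube (lag (mat p)) (lag (mat q)) \<longleftrightarrow> X ** Y = Y ** X \<and>
       X ** X + Y ** Y = (p + q) *\<^sub>R X - mat (p * q)"
    if Z: "Z = cmat X Y" "sym_mat X" "sym_mat Y" "0 \<prec>\<^sub>L Y" for X Y
  proof -
    have ms: "mat r ** M = r *\<^sub>R M" "M ** mat r = r *\<^sub>R M" for r and M :: "real^2^2"
      by (simp_all add: vec2_eq_iff matrix_matrix_mult_def mat_def sum_2)
    have "Z \<in> siegel" using Z by (auto simp: siegel_eq)
    have "(Z - mat (of_real q)) ** (map_matrix cnj Z - mat (of_real p)) +
      (Z - mat (of_real p)) ** (map_matrix cnj Z - mat (of_real q)) =
      cmat (2 *\<^sub>R (X ** X + Y ** Y - ((p + q) *\<^sub>R X - mat (p * q)))) (2 *\<^sub>R (Y ** X - X ** Y))"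
      by (simp add: Z(1) cnj_cmat cmat_mat_real cmat_diff cmat_mult cmat_add cmat_eq_iff matrix_ring_simps ms)
        (simp add: vec2_eq_iff mat_def algebra_simps)
    then show ?thesis
      unfolding tube_complex_eq[OF \<open>Z \<in> siegel\<close>]
      by (auto simp: cmat_zero cmat_eq_iff)
  qed
  moreover have "Z \<in> siegel" if "Z \<in> tube (lag (mat p)) (lag (mat q))"
    using that by (simp add: tube_def)
  ultimately show ?thesis
    unfolding siegel_eq by blast
qed

lemma mat_mult_scaleR: "mat r ** M = r *\<^sub>R M" "M ** mat r = r *\<^sub>R M" for r :: real and M :: "real^2^2"
  by (simp_all add: vec2_eq_iff matrix_matrix_mult_def mat_def sum_2)

lemma mat_vec: "mat r *v v = r *\<^sub>R v" for v :: "real^'n"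
  by (simp add: vec_eq_iff matrix_vector_mult_def mat_def if_distrib[of "\<lambda>x. x * _"] cong: if_cong)

lemma loewner_mat: "\<eta> > 0 \<Longrightarrow> 0 \<prec>\<^sub>L mat \<eta>"
  by (simp add: loewner_def mat_vec)

text \<open>Subtracting the two circle equations leaves a linear one, so X is scalar. Then (Y -
  \<eta>)(Y + \<eta>) = 0, and the second factor is invertible because it is positive
  definite.\<close>

lemma tube_inter:
  assumes Z: "Z \<in> tube (lag (mat p)) (lag (mat q))" "Z \<in> tube (lag (mat x)) (lag (mat y))"
    and ne: "p + q \<noteq> x + y" and \<xi>: "\<xi> * (p + q - x - y) = p * q - x * y"
    and \<eta>: "\<eta> > 0" "\<xi>\<^sup>2 + \<eta>\<^sup>2 = (p + q) * \<xi> - p * q"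
  shows "Z = mat (Complex \<xi> \<eta>)"
proof -
  obtain X Y where X: "Z = cmat X Y" "0 \<prec>\<^sub>L Y" "X ** X + Y ** Y = (p + q) *\<^sub>R X - mat (p * q)"
    using Z(1) by (auto simp: tube_iff)
  have X': "X ** X + Y ** Y = (x + y) *\<^sub>R X - mat (x * y)"
    using Z(2) X(1) by (auto simp: tube_iff cmat_eq_iff)
  have "(p + q - x - y) *\<^sub>R X = (p + q - x - y) *\<^sub>R mat \<xi>"
    using X(3) X' \<xi> by (simp add: vec2_eq_iff mat_def algebra_simps)
  then have eqX: "X = mat \<xi>" using ne by simp
  have "(Y - mat \<eta>) ** (Y + mat \<eta>) = 0"
    using X(3) \<eta>(2) unfolding eqX
    by (simp add: matrix_ring_simps mat_mult_scaleR)
      (simp add: vec2_eq_iff mat_def power2_eq_square algebra_simps)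
  moreover have "0 \<prec>\<^sub>L Y + mat \<eta>"
    using X(2) \<eta>(1) unfolding loewner_def
    by (simp add: matrix_vector_mult_add_rdistrib inner_add_right mat_vec add_pos_pos)
  then have "invertible (Y + mat \<eta>)" by (rule pos_invertible)
  ultimately have "Y - mat \<eta> = 0"
    by (metis invertible_def matrix_mul_assoc matrix_mul_rid matrix_zero_mult)
  then show ?thesis using X eqX by (simp add: cmat_mat)
qed

lemma mat_mem_tube:
  assumes "\<eta> > 0" "\<xi>\<^sup>2 + \<eta>\<^sup>2 = (p + q) * \<xi> - p * q"
  shows "mat (Complex \<xi> \<eta>) \<in> tube (lag (mat p)) (lag (mat q))"
  unfolding tube_iff
proof (intro exI conjI)
  show "mat (Complex \<xi> \<eta>) = cmat (mat \<xi>) (mat \<eta>)" by (rule cmat_mat)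
  show "0 \<prec>\<^sub>L (mat \<eta> :: real^2^2)"
    using assms(1) by (rule loewner_mat)
  show "mat \<xi> ** mat \<xi> + mat \<eta> ** mat \<eta> = (p + q) *\<^sub>R mat \<xi> - (mat (p * q) :: real^2^2)"
    unfolding mat_mult_scaleR using assms(2)
    by (simp add: vec2_eq_iff mat_def power2_eq_square algebra_simps)
  show "mat \<xi> ** mat \<eta> = mat \<eta> ** (mat \<xi> :: real^2^2)"
    unfolding mat_mult_scaleR by (simp add: vec2_eq_iff mat_def)
qed simp_all

text \<open>Differentiating the polynomial equation of the tube along a curve. At a scalar point the
  result decouples: every entry of V, as a vector in the plane, is orthogonal to the radius of the
  circle through p and q.\<close>

lemma tube_tangent:
  assumes V: "V \<in> tangent_vectors (tube (lag (mat p)) (lag (mat q))) (mat z)"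
  shows "Re (V $ i $ j * cnj (2 * z - of_real (p + q))) = 0"
proof -
  obtain c where c: "\<And>t::real. c t \<in> tube (lag (mat p)) (lag (mat q))" "c 0 = mat z"
    "(c has_vector_derivative V) (at 0)"
    using V by (auto simp: tangent_vectors_def)
  define F where "F t = (\<Sum>k\<in>UNIV. (c t $ i $ k - mat (of_real q) $ i $ k) * (cnj (c t $ k $ j) - mat (of_real p) $ k $ j)) +
      (\<Sum>k\<in>UNIV. (c t $ i $ k - mat (of_real p) $ i $ k) * (cnj (c t $ k $ j) - mat (of_real q) $ k $ j))" for t
  have F0: "F t = 0" for t
  proof -
    have "c t \<in> siegel" using c(1)[of t] by (simp add: tube_def)
    from tube_complex_eq[OF this, of p q] c(1)[of t] have
      "((c t - mat (of_real q)) ** (map_matrix cnj (c t) - mat (of_real p)) +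
       (c t - mat (of_real p)) ** (map_matrix cnj (c t) - mat (of_real q))) $ i $ j = 0" by simp
    then show ?thesis by (simp add: F_def matrix_matrix_mult_def map_matrix_def)
  qed
  have d: "((\<lambda>t. c t $ a $ b) has_vector_derivative V $ a $ b) (at 0)" for a b
    using bounded_linear.has_vector_derivative[OF bounded_linear_vec_nth[of b]
       bounded_linear.has_vector_derivative[OF bounded_linear_vec_nth[of a] c(3)]] .
  have dc: "((\<lambda>t. cnj (c t $ a $ b)) has_vector_derivative cnj (V $ a $ b)) (at 0)" for a b
    using bounded_linear.has_vector_derivative[OF bounded_linear_cnj d] .
  have "(F has_vector_derivative
     ((\<Sum>k\<in>UNIV. (mat z $ i $ k - mat (of_real q) $ i $ k) * cnj (V $ k $ j) +
          V $ i $ k * (cnj (mat z $ k $ j) - mat (of_real p) $ k $ j)) +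
      (\<Sum>k\<in>UNIV. (mat z $ i $ k - mat (of_real p) $ i $ k) * cnj (V $ k $ j) +
          V $ i $ k * (cnj (mat z $ k $ j) - mat (of_real q) $ k $ j)))) (at 0)"
    unfolding F_def
    by (rule derivative_eq_intros has_vector_derivative_mult d dc refl | simp add: c(2))+
  moreover have "(F has_vector_derivative 0) (at 0)"
    using F0 by (simp add: fun_eq_iff[symmetric] ext[of F "\<lambda>_. 0"])
  ultimately have "(\<Sum>k\<in>UNIV. (mat z $ i $ k - mat (of_real q) $ i $ k) * cnj (V $ k $ j) +
          V $ i $ k * (cnj (mat z $ k $ j) - mat (of_real p) $ k $ j)) +
      (\<Sum>k\<in>UNIV. (mat z $ i $ k - mat (of_real p) $ i $ k) * cnj (V $ k $ j) +
          V $ i $ k * (cnj (mat z $ k $ j) - mat (of_real q) $ k $ j)) = 0"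
    using vector_derivative_unique_at by blast
  then have "(z - of_real q) * cnj (V $ i $ j) + V $ i $ j * (cnj z - of_real p) +
     ((z - of_real p) * cnj (V $ i $ j) + V $ i $ j * (cnj z - of_real q)) = 0"
    using exhaust_2[of i] exhaust_2[of j] by (auto simp: sum_2 mat_def ac_simps)
  then show ?thesis by (simp add: complex_eq_iff algebra_simps)
qed

lemma siegel_metric_mat:
  assumes "\<eta> > 0"
  shows "siegel_metric (mat (Complex \<xi> \<eta>)) V W = (\<Sum>i\<in>UNIV. \<Sum>j\<in>UNIV. Re (V $ i $ j * cnj (W $ j $ i))) / \<eta>\<^sup>2"
proof -
  have "map_matrix Im (mat (Complex \<xi> \<eta>)) = (mat \<eta> :: real^2^2)"
    by (simp add: vec2_eq_iff map_matrix_def mat_def)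
  moreover have "matrix_inv (mat \<eta> :: real^2^2) = mat (1 / \<eta>)"
    by (rule matrix_inv_unique, unfold mat_mult_scaleR) (use assms in \<open>simp add: vec2_eq_iff mat_def\<close>)
  moreover have "map_matrix of_real (mat (1 / \<eta>) :: real^2^2) = (mat (of_real (1 / \<eta>)) :: complex^2^2)"
    by (simp add: vec2_eq_iff map_matrix_def mat_def)
  ultimately show ?thesis
    by (simp add: siegel_metric_def trace_def matrix_matrix_mult_def mat_def sum_2 map_matrix_def
       add_divide_distrib diff_divide_distrib power2_eq_square)
qed

text \<open>The hypotheses are those for two orthogonal geodesics of the hyperbolic plane: \<xi> is
  the abscissa of their intersection, \<open>e\<close> says that the squared height there is
  positive, and \<open>orth\<close> says that the two radii are perpendicular. The metric at the
  intersection then vanishes entry by entry.\<close>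

lemma tubes_orthogonal:
  assumes ne: "p + q \<noteq> x + y" and \<xi>: "\<xi> * (p + q - x - y) = p * q - x * y"
    and e: "(p + q) * \<xi> - p * q - \<xi>\<^sup>2 > 0"
    and orth: "(2 * \<xi> - p - q) * (2 * \<xi> - x - y) + 4 * ((p + q) * \<xi> - p * q - \<xi>\<^sup>2) = 0"
  shows "tube (lag (mat p)) (lag (mat q)) \<bottom>\<^sub>X tube (lag (mat x)) (lag (mat y))"
proof -
  define \<eta> where "\<eta> = sqrt ((p + q) * \<xi> - p * q - \<xi>\<^sup>2)"
  have \<eta>: "\<eta> > 0" "\<xi>\<^sup>2 + \<eta>\<^sup>2 = (p + q) * \<xi> - p * q" using e by (simp_all add: \<eta>_def)
  then have \<eta>': "\<xi>\<^sup>2 + \<eta>\<^sup>2 = (x + y) * \<xi> - x * y" using \<xi> by (simp add: algebra_simps)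
  define z where "z = Complex \<xi> \<eta>"
  have "mat z \<in> tube (lag (mat p)) (lag (mat q))" "mat z \<in> tube (lag (mat x)) (lag (mat y))"
    unfolding z_def using mat_mem_tube \<eta> \<eta>' by blast+
  moreover have "siegel_metric Z V W = 0"
    if Z: "Z \<in> tube (lag (mat p)) (lag (mat q))" "Z \<in> tube (lag (mat x)) (lag (mat y))"
    and V: "V \<in> tangent_vectors (tube (lag (mat p)) (lag (mat q))) Z"
    and W: "W \<in> tangent_vectors (tube (lag (mat x)) (lag (mat y))) Z" for Z V W
  proof -
    have Zz: "Z = mat z" unfolding z_def by (rule tube_inter[OF Z ne \<xi> \<eta>])
    have "Re (V $ i $ j * cnj (W $ j $ i)) = 0" for i j
    proof -
      define a b where "a = 2 * z - of_real (p + q)" and "b = 2 * z - of_real (x + y)"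
      define v w where "v = V $ i $ j" and "w = W $ j $ i"
      have v: "Re v * Re a + Im v * Im a = 0" and w: "Re w * Re b + Im w * Im b = 0"
        using tube_tangent[OF V[unfolded Zz], of i j] tube_tangent[OF W[unfolded Zz], of j i]
        by (simp_all add: a_def b_def v_def w_def)
      have "Re a * Re b + Im a * Im b = 0"
        using orth \<eta>(2) by (simp add: a_def b_def z_def power2_eq_square algebra_simps)
      moreover have "Im a \<noteq> 0" "Im b \<noteq> 0" using \<eta> by (simp_all add: a_def b_def z_def)
      \<comment> \<open>Multiplying by the nonzero ordinates allows Im v and Im w to be eliminated
        by the two tangency equations.\<close>
      moreover have "(Re v * Re w + Im v * Im w) * (Im a * Im b) =
         Re v * Re w * (Im a * Im b) + (Im v * Im a) * (Im w * Im b)" by algebra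
      then have "(Re v * Re w + Im v * Im w) * (Im a * Im b) = Re v * Re w * (Re a * Re b + Im a * Im b)"
        using v w by algebra
      ultimately have "Re v * Re w + Im v * Im w = 0" by simp
      then show ?thesis by (simp add: v_def w_def)
    qed
    then show ?thesis unfolding Zz z_def siegel_metric_mat[OF \<eta>(1)] by simp
  qed
  ultimately show ?thesis by (auto simp: orthogonal_submanifolds_def)
qed

section \<open>Failure of injectivity\<close>

text \<open>On scalars this is x to ((p + q) x - 2 p q) / (2 x - (p + q)), the reflection in the
  geodesic from p to q, tensored with r. The factor 1 / (q - p) makes its square the identity when r
  squares to it.\<close>

definition hyp_refl :: "real \<Rightarrow> real \<Rightarrow> real^2^2 \<Rightarrow> real^4^4" where
  "hyp_refl p q r = block (((p + q) / (q - p)) *\<^sub>R r) ((- (2 * p * q / (q - p))) *\<^sub>R r)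
     ((2 / (q - p)) *\<^sub>R r) ((- ((p + q) / (q - p))) *\<^sub>R r)"

lemma scaleR_matrix_mult: "(c *\<^sub>R A) ** B = c *\<^sub>R (A ** B)" "A ** (c *\<^sub>R B) = c *\<^sub>R (A ** B)"
  for A :: "real^'n^'m"
  by (simp_all add: vec_eq_iff matrix_matrix_mult_def sum_distrib_left algebra_simps)

lemma
  assumes "p \<noteq> q" "transpose r = r" "r ** r = mat 1"
  shows hyp_refl_Sp_minus: "hyp_refl p q r \<in> Sp_minus"
    and hyp_refl_square: "hyp_refl p q r ** hyp_refl p q r = mat 1"
proof -
  define A B C where "A = (p + q) / (q - p)" and "B = 2 * p * q / (q - p)" and "C = 2 / (q - p)"
  have "A * A - B * C = ((p + q) * (p + q) - 4 * p * q) / ((q - p) * (q - p))"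
    by (simp add: A_def B_def C_def diff_divide_distrib)
  also have "(p + q) * (p + q) - 4 * p * q = (q - p) * (q - p)" by algebra
  finally have e: "A * A - B * C = 1" using assms(1) by simp
  have e1: "a *\<^sub>R (mat 1 :: real^2^2) + b *\<^sub>R mat 1 = mat 1" if "a + b = 1" for a b
    using that by (metis scaleR_add_left scaleR_one)
  have e2: "a *\<^sub>R (mat 1 :: real^2^2) - b *\<^sub>R mat 1 = - mat 1" if "a - b = - 1" for a b
    using that by (metis scaleR_diff_left scaleR_minus_left scaleR_one)
  have e3: "a *\<^sub>R (mat 1 :: real^2^2) + b *\<^sub>R mat 1 = 0" if "a + b = 0" for a b
    using that by (metis scaleR_add_left scaleR_zero_left)
  show "hyp_refl p q r ** hyp_refl p q r = mat 1"
    unfolding mat1_block hyp_refl_def A_def[symmetric] B_def[symmetric] C_def[symmetric]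
      block_mult block_eq_iff scaleR_matrix_mult assms scaleR_scaleR
    using e by (intro conjI e1 e3) (auto simp: mult.commute)
  show "hyp_refl p q r \<in> Sp_minus"
    unfolding hyp_refl_def A_def[symmetric] B_def[symmetric] C_def[symmetric]
      Sp_minus_block_iff transpose_scalar scaleR_matrix_mult assms scaleR_scaleR
    using e by (intro conjI e2) (auto simp: mult.commute)
qed

lemma image_lag: "(*v) (block A B C D) ` lag X = frame (A ** X + B) (C ** X + D)"
  by (simp add: lag_frame image_frame)

lemma act_hyp_refl:
  assumes "p \<noteq> q" "r ** r = mat 1" "2 * a \<noteq> p + q" "(p + q) * a - 2 * p * q = b * (2 * a - (p + q))"
  shows "act (pm (hyp_refl p q r)) (lag (mat a)) = lag (mat b)"
proof -
  have "invertible (((2 * a - (p + q)) / (q - p)) *\<^sub>R r)"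
    unfolding invertible_def
    by (rule exI[of _ "((q - p) / (2 * a - (p + q))) *\<^sub>R r"])
      (use assms in \<open>simp add: scaleR_matrix_mult\<close>)
  moreover have "((p + q) / (q - p)) *\<^sub>R r ** mat a + (- (2 * p * q / (q - p))) *\<^sub>R r =
      mat b ** (((2 * a - (p + q)) / (q - p)) *\<^sub>R r)"
  proof -
    have "(p + q) / (q - p) * a - 2 * p * q / (q - p) = b * ((2 * a - (p + q)) / (q - p))"
      using assms(1,4) by (simp add: diff_divide_distrib[symmetric])
    then show ?thesis
      by (simp only: mat_mult_scaleR scaleR_scaleR flip: scaleR_add_left) (simp add: mult.commute)
  qed
  moreover have "(2 / (q - p)) *\<^sub>R r ** mat a + (- ((p + q) / (q - p))) *\<^sub>R r =
     ((2 * a - (p + q)) / (q - p)) *\<^sub>R r"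
    by (simp only: mat_mult_scaleR scaleR_scaleR flip: scaleR_add_left) (simp add: diff_divide_distrib mult.commute)
  moreover note frame_eq_lag
  ultimately show ?thesis
    unfolding act_pm[OF subspace_lag] hyp_refl_def image_lag by metis
qed

lemma loewner_mat_mat: "p < q \<Longrightarrow> mat p \<prec>\<^sub>L mat q"
  by (simp add: loewner_def mat_vec)

lemma maximal_tuple_scalar:
  assumes "sorted_wrt (<) ps"
  shows "maximal_tuple (map (\<lambda>p. lag (mat p)) ps)"
  using assms by (auto simp: maximal_tuple_def sorted_wrt_iff_nth_less intro!: maximal_triple_lag loewner_mat_mat)

text \<open>A subtriple containing the moved entry is a rotation of an old one, and maximality of
  triples is invariant under rotation.\<close>

lemma maximal_tuple_rotate:
  assumes "maximal_tuple (l # ls)" shows "maximal_tuple (ls @ [l])"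
  unfolding maximal_tuple_def
proof (intro allI impI)
  fix i j k assume *: "i < j \<and> j < k \<and> k < length (ls @ [l])"
  show "maximal_triple ((ls @ [l]) ! i) ((ls @ [l]) ! j) ((ls @ [l]) ! k)"
  proof (cases "k < length ls")
    case True
    then show ?thesis
      using * assms[unfolded maximal_tuple_def, rule_format, of "Suc i" "Suc j" "Suc k"]
      by (simp add: nth_append)
  next
    case False
    then have "k = length ls" using * by simp
    then show ?thesis
      using * assms[unfolded maximal_tuple_def, rule_format, of 0 "Suc i" "Suc j"]
      by (simp add: nth_append maximal_triple_rotate)
  qed
qed

lemma is_reflection_pm: "R \<in> Sp_minus \<Longrightarrow> R ** R = mat 1 \<Longrightarrow> is_reflection (pm R)"
  by (auto simp: is_reflection_def pm_def)

text \<open>The pairs of numbers are the end points of alternate sides of a right-angled hexagon in the upper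
  half-plane; the other sides have end points \<open>(-6/7, 0)\<close>, \<open>(4/7, 28/9)\<close>, \<open>(30/7, -42/19)\<close>.\<close>

fun hexagon_refl :: "real^2^2 \<Rightarrow> W3_gen \<Rightarrow> real^4^4" where
  "hexagon_refl r S1 = hyp_refl (- 6) (- 6 / 13) r"
| "hexagon_refl r S2 = hyp_refl (- 4 / 13) (12 / 11) r"
| "hexagon_refl r S3 = hyp_refl 2 12 r"

lemma hexagon_refl:
  assumes "transpose r = r" "r ** r = mat 1"
  shows "hexagon_refl r x \<in> Sp_minus" "hexagon_refl r x ** hexagon_refl r x = mat 1"
  using assms by (cases x; simp add: hyp_refl_Sp_minus hyp_refl_square)+

lemma maximal_W3_hexagon:
  assumes r: "transpose r = r" "r ** r = mat 1"
    and \<rho>: "\<rho> \<in> hom W3 PSp_pm" "\<And>x. \<rho> [x] = pm (hexagon_refl r x)"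
  shows "maximal_W3 \<rho>"
  unfolding maximal_W3_def
proof (intro conjI exI)
  let ?l = "\<lambda>p::real. lag (mat p :: real^2^2)"
  have "maximal_tuple (map ?l [- 6, - 6 / 13, - 4 / 13, 12 / 11, 2, 12])"
    by (rule maximal_tuple_scalar) simp
  then show "maximal_tuple [?l (- 6), ?l (- 6 / 13), ?l (- 4 / 13), ?l (12 / 11), ?l 2, ?l 12]" by simp
  \<comment> \<open>Sorted by size this tuple begins with Z2; one rotation puts that entry
    last.\<close>
  have "maximal_tuple (map ?l [- 42 / 19, - 6 / 7, 0, 4 / 7, 28 / 9, 30 / 7])"
    by (rule maximal_tuple_scalar) simp
  then show "maximal_tuple [?l (- 6 / 7), ?l 0, ?l (4 / 7), ?l (28 / 9), ?l (30 / 7), ?l (- 42 / 19)]"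
    using maximal_tuple_rotate by fastforce
  show "tube (?l (- 6)) (?l (- 6 / 13)) \<bottom>\<^sub>X tube (?l (- 6 / 7)) (?l 0)"
    \<comment> \<open>The number is the abscissa (pq - xy) / (p + q - x - y) of the corner of the
      hexagon, and likewise for the other five corners.\<close>
    by (rule tubes_orthogonal[of _ _ _ _ "- 42 / 85"]) (simp_all add: power2_eq_square)
  show "tube (?l (- 6 / 7)) (?l 0) \<bottom>\<^sub>X tube (?l (- 4 / 13)) (?l (12 / 11))"
    by (rule tubes_orthogonal[of _ _ _ _ "- 168 / 821"]) (simp_all add: power2_eq_square)
  show "tube (?l (- 4 / 13)) (?l (12 / 11)) \<bottom>\<^sub>X tube (?l (4 / 7)) (?l (28 / 9))"
    by (rule tubes_orthogonal[of _ _ _ _ "476 / 653"]) (simp_all add: power2_eq_square)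
  show "tube (?l (4 / 7)) (?l (28 / 9)) \<bottom>\<^sub>X tube (?l 2) (?l 12)"
    by (rule tubes_orthogonal[of _ _ _ _ "28 / 13"]) (simp_all add: power2_eq_square)
  show "tube (?l 2) (?l 12) \<bottom>\<^sub>X tube (?l (30 / 7)) (?l (- 42 / 19))"
    by (rule tubes_orthogonal[of _ _ _ _ "2226 / 793"]) (simp_all add: power2_eq_square)
  show "tube (?l (30 / 7)) (?l (- 42 / 19)) \<bottom>\<^sub>X tube (?l (- 6)) (?l (- 6 / 13))"
    by (rule tubes_orthogonal[of _ _ _ _ "- 294 / 205"]) (simp_all add: power2_eq_square)
  show "is_reflection (\<rho> s1)" "is_reflection (\<rho> s2)" "is_reflection (\<rho> s3)"
    unfolding \<rho> s1_def s2_def s3_def by (intro is_reflection_pm hexagon_refl[OF r])+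
  note defs = \<rho> s1_def s2_def s3_def hexagon_refl.simps
  show "act (\<rho> s1) (?l (- 6)) = ?l (- 6)" "act (\<rho> s1) (?l (- 6 / 13)) = ?l (- 6 / 13)"
    "act (\<rho> s1) (?l (- 6 / 7)) = ?l 0" "act (\<rho> s1) (?l (30 / 7)) = ?l (- 42 / 19)"
    "act (\<rho> s2) (?l (- 4 / 13)) = ?l (- 4 / 13)" "act (\<rho> s2) (?l (12 / 11)) = ?l (12 / 11)"
    "act (\<rho> s2) (?l (- 6 / 7)) = ?l 0" "act (\<rho> s2) (?l (4 / 7)) = ?l (28 / 9)"
    "act (\<rho> s3) (?l 2) = ?l 2" "act (\<rho> s3) (?l 12) = ?l 12"
    "act (\<rho> s3) (?l (4 / 7)) = ?l (28 / 9)" "act (\<rho> s3) (?l (30 / 7)) = ?l (- 42 / 19)"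
    unfolding defs by (rule act_hyp_refl[OF _ r(2)]; simp)+
qed (rule \<rho>(1))

section \<open>Homomorphisms on the free group and conjugacy classes\<close>

lemma \<Gamma>03_bar: "(\<lambda>(x, e). (x, \<not> e)) ((\<lambda>(x, e). (x, \<not> e)) l) = l"
  by (cases l) simp

lemma group_\<Gamma>03: "group \<Gamma>03"
  unfolding \<Gamma>03_def by (rule group_word_group) (rule \<Gamma>03_bar)

lemma group_W3: "group W3"
  unfolding W3_def by (rule group_word_group) simp

lemma \<Gamma>03_hom_eq:
  assumes "group G" and h: "h \<in> hom \<Gamma>03 G" "h' \<in> hom \<Gamma>03 G"
    and eq: "h \<alpha> = h' \<alpha>" "h \<beta> = h' \<beta>" and w: "w \<in> carrier \<Gamma>03"
  shows "h w = h' w"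
proof -
  interpret G: group G by fact
  interpret F: group \<Gamma>03 by (rule group_\<Gamma>03)
  let ?bar = "\<lambda>(x::pants_gen, e). (x, \<not> e)"
  have c: "[l] \<in> carrier \<Gamma>03" for l by (simp add: \<Gamma>03_def word_group_def reduced_def)
  have m: "[l] \<otimes>\<^bsub>\<Gamma>03\<^esub> [?bar l] = \<one>\<^bsub>\<Gamma>03\<^esub>" for l
    by (cases l) (simp add: \<Gamma>03_def word_group_def)
  have one: "k \<one>\<^bsub>\<Gamma>03\<^esub> = \<one>\<^bsub>G\<^esub>" if "k \<in> hom \<Gamma>03 G" for k
    using that hom_one F.is_group G.is_group by blast
  have inv: "k [l] \<otimes>\<^bsub>G\<^esub> k [?bar l] = \<one>\<^bsub>G\<^esub>" if "k \<in> hom \<Gamma>03 G" for k l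
    using hom_mult[OF that c c] m one[OF that] by metis
  have kc: "k [l] \<in> carrier G" if "k \<in> hom \<Gamma>03 G" for k l
    using hom_in_carrier[OF that c] .
  have pos: "h [(x, True)] = h' [(x, True)]" for x
    using eq by (cases x) (auto simp: \<alpha>_def \<beta>_def)
  have neg: "h [(x, False)] = h' [(x, False)]" for x
    using inv[OF h(1), of "(x, True)"] inv[OF h(2), of "(x, True)"] pos[of x] kc h
    by simp (metis G.inv_equality G.inv_inv)
  have "h [l] = h' [l]" for l using pos neg by (cases l; cases "snd l") auto
  moreover obtain k where "\<forall>k' \<in> hom \<Gamma>03 G. (\<forall>x. k' [x] = h' [x]) \<longrightarrow> (\<forall>w \<in> carrier \<Gamma>03. k' w = k w)"
    using word_group_hom[OF assms(1), of "\<lambda>l. h' [l]" ?bar] kc[OF h(2)] inv[OF h(2)] unfolding \<Gamma>03_def by blast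
  ultimately show ?thesis using h w by metis
qed

lemma mult_PSp_eq: "a \<otimes>\<^bsub>PSp\<^esub> b = a \<otimes>\<^bsub>PSp_pm\<^esub> b"
  by (simp add: PSp_def PSp_pm_def FactGroup_def set_mult_def matrix_monoid_def)

lemma inv_PSp_eq: "a \<in> carrier PSp \<Longrightarrow> inv\<^bsub>PSp\<^esub> a = inv\<^bsub>PSp_pm\<^esub> a"
proof -
  assume "a \<in> carrier PSp"
  then obtain M where "M \<in> Sp" "a = pm M" by (auto simp: carrier_PSp)
  then show "inv\<^bsub>PSp\<^esub> a = inv\<^bsub>PSp_pm\<^esub> a"
    using Sp_left_inverse[of M] inv_PSp[of M] inv_PSp_pm[of M] by simp
qed

lemma PSp_subset: "carrier PSp \<subseteq> carrier PSp_pm"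
  by (auto simp: carrier_PSp carrier_PSp_pm)

lemma conj_rel_refl:
  assumes "\<rho> \<in> hom D PSp_pm"
  shows "(\<rho>, \<rho>) \<in> conj_rel D PSp_pm (carrier PSp)"
proof -
  interpret G: group PSp_pm by (rule group_PSp_pm)
  have "\<rho> x = \<one>\<^bsub>PSp_pm\<^esub> \<otimes>\<^bsub>PSp_pm\<^esub> \<rho> x \<otimes>\<^bsub>PSp_pm\<^esub> inv\<^bsub>PSp_pm\<^esub> \<one>\<^bsub>PSp_pm\<^esub>" if "x \<in> carrier D" for x
    using hom_in_carrier[OF assms that] by simp
  moreover have "\<one>\<^bsub>PSp_pm\<^esub> \<in> carrier PSp" by (auto simp: one_PSp_pm carrier_PSp mat1_Sp)
  ultimately show ?thesis using assms unfolding conj_rel_def by blast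
qed

text \<open>One conjugator g links the class of \<open>\<rho>\<^sub>1\<close> to the chosen
  representative and a second one k links the restriction to \<tau>. Since both representations
  agree on the image of \<phi>, the product k g links \<open>\<rho>\<^sub>2 \<circ> \<phi>\<close>
  to \<tau>.\<close>

lemma restriction_map_cong:
  assumes \<phi>: "\<phi> \<in> hom \<Gamma>03 W3" and \<rho>: "\<rho>\<^sub>1 \<in> hom W3 PSp_pm" "\<rho>\<^sub>2 \<in> hom W3 PSp_pm"
    and eq: "\<And>x. x \<in> carrier \<Gamma>03 \<Longrightarrow> \<rho>\<^sub>1 (\<phi> x) = \<rho>\<^sub>2 (\<phi> x)"
  shows "restriction_map \<phi> (conj_rel W3 PSp_pm (carrier PSp) `` {\<rho>\<^sub>1}) \<subseteq>
    restriction_map \<phi> (conj_rel W3 PSp_pm (carrier PSp) `` {\<rho>\<^sub>2})"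
proof
  interpret G: group PSp_pm by (rule group_PSp_pm)
  interpret P: group PSp by (rule group_PSp)
  have \<phi>c: "\<phi> x \<in> carrier W3" if "x \<in> carrier \<Gamma>03" for x using \<phi> that by (auto simp: hom_def)
  fix \<tau> assume "\<tau> \<in> restriction_map \<phi> (conj_rel W3 PSp_pm (carrier PSp) `` {\<rho>\<^sub>1})"
  then obtain \<rho>' where \<rho>': "(\<rho>\<^sub>1, \<rho>') \<in> conj_rel W3 PSp_pm (carrier PSp)"
    and \<tau>: "(\<rho>' \<circ> \<phi>, \<tau>) \<in> conj_rel \<Gamma>03 PSp (carrier PSp)"
    by (auto simp: restriction_map_def)
  obtain g where g: "g \<in> carrier PSp" "\<And>x. x \<in> carrier W3 \<Longrightarrow> \<rho>' x = g \<otimes>\<^bsub>PSp_pm\<^esub> \<rho>\<^sub>1 x \<otimes>\<^bsub>PSp_pm\<^esub> inv\<^bsub>PSp_pm\<^esub> g"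
    using \<rho>' by (auto simp: conj_rel_def)
  obtain k where k: "k \<in> carrier PSp" "\<And>x. x \<in> carrier \<Gamma>03 \<Longrightarrow> \<tau> x = k \<otimes>\<^bsub>PSp\<^esub> \<rho>' (\<phi> x) \<otimes>\<^bsub>PSp\<^esub> inv\<^bsub>PSp\<^esub> k"
    and \<rho>'h: "\<rho>' \<circ> \<phi> \<in> hom \<Gamma>03 PSp" and \<tau>h: "\<tau> \<in> hom \<Gamma>03 PSp"
    using \<tau> by (auto simp: conj_rel_def)
  have gc: "g \<in> carrier PSp_pm" "k \<in> carrier PSp_pm" using g k PSp_subset by auto
  have rc: "\<rho>\<^sub>2 (\<phi> x) \<in> carrier PSp_pm" if "x \<in> carrier \<Gamma>03" for x
    using \<phi>c[OF that] \<rho>(2) by (auto simp: hom_def)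
  have conj: "\<rho>' (\<phi> x) = g \<otimes>\<^bsub>PSp_pm\<^esub> \<rho>\<^sub>2 (\<phi> x) \<otimes>\<^bsub>PSp_pm\<^esub> inv\<^bsub>PSp_pm\<^esub> g" if "x \<in> carrier \<Gamma>03" for x
    using g(2)[OF \<phi>c[OF that]] eq[OF that] by simp
  \<comment> \<open>Values in \<open>PSp\<close> are known for
    \<open>\<rho>' \<circ> \<phi>\<close>; undoing the conjugation by g, which lies in
    \<open>PSp\<close>, transfers them to \<open>\<rho>\<^sub>2 \<circ> \<phi>\<close>.\<close>
  have "\<rho>\<^sub>2 (\<phi> x) = inv\<^bsub>PSp_pm\<^esub> g \<otimes>\<^bsub>PSp_pm\<^esub> \<rho>' (\<phi> x) \<otimes>\<^bsub>PSp_pm\<^esub> g" if "x \<in> carrier \<Gamma>03" for x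
    using rc[OF that] gc unfolding conj[OF that] by (simp add: G.m_assoc) (simp add: G.m_assoc[symmetric])
  then have "\<rho>\<^sub>2 (\<phi> x) = inv\<^bsub>PSp\<^esub> g \<otimes>\<^bsub>PSp\<^esub> \<rho>' (\<phi> x) \<otimes>\<^bsub>PSp\<^esub> g" if "x \<in> carrier \<Gamma>03" for x
    using that g by (simp add: mult_PSp_eq inv_PSp_eq)
  moreover have "\<rho>' (\<phi> x) \<in> carrier PSp" if "x \<in> carrier \<Gamma>03" for x
    using \<rho>'h that by (auto simp: hom_def)
  ultimately have r2c: "\<rho>\<^sub>2 (\<phi> x) \<in> carrier PSp" if "x \<in> carrier \<Gamma>03" for x
    using that g by simp
  have r2h: "\<rho>\<^sub>2 \<circ> \<phi> \<in> hom \<Gamma>03 PSp"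
    using r2c \<phi> \<rho>(2) by (auto simp: hom_def mult_PSp_eq Pi_iff)
  have "\<tau> x = (k \<otimes>\<^bsub>PSp\<^esub> g) \<otimes>\<^bsub>PSp\<^esub> \<rho>\<^sub>2 (\<phi> x) \<otimes>\<^bsub>PSp\<^esub> inv\<^bsub>PSp\<^esub> (k \<otimes>\<^bsub>PSp\<^esub> g)" if "x \<in> carrier \<Gamma>03" for x
    unfolding k(2)[OF that] conj[OF that] using r2c[OF that] g k
    by (simp add: mult_PSp_eq[symmetric] inv_PSp_eq[symmetric] P.inv_mult_group P.m_assoc)
  then have "(\<rho>\<^sub>2 \<circ> \<phi>, \<tau>) \<in> conj_rel \<Gamma>03 PSp (carrier PSp)"
    using r2h \<tau>h g k unfolding conj_rel_def by (auto intro!: bexI[of _ "k \<otimes>\<^bsub>PSp\<^esub> g"])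
  moreover have "(\<rho>\<^sub>2, \<rho>\<^sub>2) \<in> conj_rel W3 PSp_pm (carrier PSp)"
    by (rule conj_rel_refl[OF \<rho>(2)])
  ultimately show "\<tau> \<in> restriction_map \<phi> (conj_rel W3 PSp_pm (carrier PSp) `` {\<rho>\<^sub>2})"
    by (auto simp: restriction_map_def)
qed

lemma trace_conj: "N ** M = mat 1 \<Longrightarrow> trace (M ** A ** N) = trace A" for A :: "'a::comm_ring_1^'n^'n"
  using trace_mul_sym[of "M ** A" N] by (simp add: matrix_mul_assoc)

lemma restriction_not_injective:
  assumes \<phi>: "\<phi> \<in> hom \<Gamma>03 W3" and "\<phi> \<alpha> = s1 \<otimes>\<^bsub>W3\<^esub> s2" "\<phi> \<beta> = s2 \<otimes>\<^bsub>W3\<^esub> s3"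
  shows "\<not> inj_on (restriction_map \<phi>) chi_max_W3"
proof
  assume inj: "inj_on (restriction_map \<phi>) chi_max_W3"
  interpret G: group PSp_pm by (rule group_PSp_pm)
  have ex: "\<exists>\<rho>\<in>hom W3 PSp_pm. \<forall>x. \<rho> [x] = pm (hexagon_refl r x)"
    if "transpose r = r" "r ** r = mat 1" for r
    unfolding W3_def
    using word_group_hom[OF group_PSp_pm, of "\<lambda>x. pm (hexagon_refl r x)" id] hexagon_refl[OF that]
    by (auto simp: mult_PSp_pm one_PSp_pm carrier_PSp_pm)
  \<comment> \<open>A symmetric involution of trace 0.\<close>
  define r :: "real^2^2" where "r = mat2 1 0 0 (- 1)"
  have r: "transpose r = r" "r ** r = mat 1"
    by (simp_all add: r_def vec2_eq_iff transpose_def matrix_matrix_mult_def sum_2 mat_def)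
  obtain \<rho>\<^sub>1 where \<rho>1: "\<rho>\<^sub>1 \<in> hom W3 PSp_pm" "\<And>x. \<rho>\<^sub>1 [x] = pm (hexagon_refl (mat 1) x)"
    using ex[of "mat 1"] by auto
  obtain \<rho>\<^sub>2 where \<rho>2: "\<rho>\<^sub>2 \<in> hom W3 PSp_pm" "\<And>x. \<rho>\<^sub>2 [x] = pm (hexagon_refl r x)"
    using ex[OF r] by auto
  have max: "maximal_W3 \<rho>\<^sub>1" "maximal_W3 \<rho>\<^sub>2"
    using maximal_W3_hexagon[OF _ _ \<rho>1] maximal_W3_hexagon[OF r \<rho>2] by simp_all
  have sc: "[x] \<in> carrier W3" for x by (simp add: W3_def word_group_def reduced_def)
  \<comment> \<open>Each block of the product contains r ** r, which is the identity.\<close>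
  have prod: "hexagon_refl r x ** hexagon_refl r y = hexagon_refl (mat 1) x ** hexagon_refl (mat 1) y" for x y
    by (cases x; cases y; simp only: hexagon_refl.simps hyp_refl_def block_mult scaleR_matrix_mult r matrix_mul_lid)
  have s2: "\<rho> (s1 \<otimes>\<^bsub>W3\<^esub> s2) = \<rho> [S1] \<otimes>\<^bsub>PSp_pm\<^esub> \<rho> [S2]" "\<rho> (s2 \<otimes>\<^bsub>W3\<^esub> s3) = \<rho> [S2] \<otimes>\<^bsub>PSp_pm\<^esub> \<rho> [S3]"
    if "\<rho> \<in> hom W3 PSp_pm" for \<rho>
    using that sc by (auto simp: s1_def s2_def s3_def hom_def)
  have eq: "\<rho>\<^sub>1 (\<phi> x) = \<rho>\<^sub>2 (\<phi> x)" if "x \<in> carrier \<Gamma>03" for x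
  proof -
    have "(\<rho>\<^sub>1 \<circ> \<phi>) x = (\<rho>\<^sub>2 \<circ> \<phi>) x"
    proof (rule \<Gamma>03_hom_eq[OF group_PSp_pm _ _ _ _ that])
      show "\<rho>\<^sub>1 \<circ> \<phi> \<in> hom \<Gamma>03 PSp_pm" "\<rho>\<^sub>2 \<circ> \<phi> \<in> hom \<Gamma>03 PSp_pm"
        using hom_compose \<phi> \<rho>1(1) \<rho>2(1) by blast+
    qed (simp_all add: assms s2 \<rho>1 \<rho>2 mult_PSp_pm prod del: hexagon_refl.simps)
    then show ?thesis by simp
  qed
  let ?r = "conj_rel W3 PSp_pm (carrier PSp)"
  have "restriction_map \<phi> (?r `` {\<rho>\<^sub>1}) = restriction_map \<phi> (?r `` {\<rho>\<^sub>2})"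
    using restriction_map_cong[OF \<phi> \<rho>1(1) \<rho>2(1)] restriction_map_cong[OF \<phi> \<rho>2(1) \<rho>1(1)] eq
    by (metis subset_antisym)
  moreover have "?r `` {\<rho>\<^sub>1} \<in> chi_max_W3" "?r `` {\<rho>\<^sub>2} \<in> chi_max_W3"
    using max by (auto simp: chi_max_W3_def intro!: quotientI)
  ultimately have "?r `` {\<rho>\<^sub>1} = ?r `` {\<rho>\<^sub>2}" using inj by (metis inj_onD)
  moreover have "(\<rho>\<^sub>2, \<rho>\<^sub>2) \<in> ?r"
    by (rule conj_rel_refl[OF \<rho>2(1)])
  ultimately have "(\<rho>\<^sub>1, \<rho>\<^sub>2) \<in> ?r" by blast
  then obtain g where g: "g \<in> carrier PSp"
    "\<And>x. x \<in> carrier W3 \<Longrightarrow> \<rho>\<^sub>2 x = g \<otimes>\<^bsub>PSp_pm\<^esub> \<rho>\<^sub>1 x \<otimes>\<^bsub>PSp_pm\<^esub> inv\<^bsub>PSp_pm\<^esub> g"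
    by (auto simp: conj_rel_def)
  obtain M where M: "M \<in> Sp" "g = pm M" using g(1) by (auto simp: carrier_PSp)
  obtain N where N: "N ** M = mat 1" using Sp_inverse_ex[OF M(1)] by blast
  have trace_scaleR: "trace (c *\<^sub>R A) = c * trace A" for c and A :: "real^2^2"
    by (simp add: trace_def sum_distrib_left)
  have tr: "trace r = 0" "trace (mat 1 :: real^2^2) = 2"
    by (simp_all add: trace_def sum_2 r_def mat_def)
  define R where "R r = hexagon_refl r S1 ** hexagon_refl r S2 ** hexagon_refl r S3" for r
  \<comment> \<open>An element of odd length: one factor r remains in every block, so its trace is a
    multiple of the trace of the twist.\<close>
  let ?x = "[S1] \<otimes>\<^bsub>W3\<^esub> [S2] \<otimes>\<^bsub>W3\<^esub> [S3]"
  have xc: "?x \<in> carrier W3" using sc by (simp add: group.is_monoid group_W3 monoid.m_closed)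
  have x: "\<rho> ?x = pm (R q)" if "\<rho> \<in> hom W3 PSp_pm" "\<And>x. \<rho> [x] = pm (hexagon_refl q x)" for \<rho> q
    using hom_mult[OF that(1)] sc monoid.m_closed[OF group.is_monoid[OF group_W3]]
    by (simp add: that(2) mult_PSp_pm R_def)
  have "pm (R r) = pm (M ** R (mat 1) ** N)"
    using g(2)[OF xc] x[OF \<rho>1] x[OF \<rho>2] M N by (simp add: mult_PSp_pm inv_PSp_pm)
  then have "R r = M ** R (mat 1) ** N \<or> R r = - (M ** R (mat 1) ** N)" by (simp add: pm_eq_iff)
  then have "\<bar>trace (R r)\<bar> = \<bar>trace (R (mat 1))\<bar>"
    by (auto simp: trace_uminus trace_conj[OF N])
  moreover have "trace (R r) = 0"
    by (simp add: R_def hyp_refl_def block_mult scaleR_matrix_mult trace_block matrix_ring_simps r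
      trace_add trace_sub trace_uminus trace_scaleR tr)
  moreover have "trace (R (mat 1)) \<noteq> 0"
    by (simp add: R_def hyp_refl_def block_mult scaleR_matrix_mult trace_block matrix_ring_simps
      trace_add trace_sub trace_uminus trace_scaleR tr)
  ultimately show False by simp
qed

section \<open>The circle at infinity\<close>

text \<open>A Cayley transform with y at infinity: for x on the circle the quotient is purely
  imaginary, and its imaginary part increases as x runs counterclockwise from y back to y.\<close>

definition chart :: "complex \<Rightarrow> complex \<Rightarrow> real" where
  "chart y x = Im ((x + y) / (x - y))"

lemma chart_eq:
  assumes "cmod x = 1" "cmod y = 1" "x \<noteq> y"
  shows "x - y = 2 * y / (\<i> * chart y x - 1)"
proof -
  have "Re x * Re x + Im x * Im x = 1" "Re y * Re y + Im y * Im y = 1"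
    using assms by (simp_all add: cmod_def power2_eq_square)
  then have "Re ((x + y) * cnj (x - y)) = 0"
    by (simp add: algebra_simps)
  then have "Re ((x + y) / (x - y)) = 0"
    by (simp add: complex_div_cnj[of "x + y"] Re_divide_of_real[symmetric] del: Re_divide_of_real)
  then have "(x + y) / (x - y) = \<i> * chart y x"
    by (simp add: complex_eq_iff chart_def)
  then have "\<i> * chart y x - 1 = 2 * y / (x - y)"
    using assms(3) by (simp add: field_simps)
  moreover have "y \<noteq> 0" using assms by auto
  ultimately show ?thesis using assms(3) by simp
qed

lemma i_chart_nz: "\<i> * complex_of_real t - 1 \<noteq> 0" "\<i> * complex_of_real t + 1 \<noteq> 0"
  by (auto simp: complex_eq_iff)

definition unchart :: "complex \<Rightarrow> real \<Rightarrow> complex" where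
  "unchart y t = y * (\<i> * t + 1) / (\<i> * t - 1)"

lemma unchart:
  assumes "cmod y = 1"
  shows "cmod (unchart y t) = 1" "unchart y t \<noteq> y" "chart y (unchart y t) = t"
proof -
  have y: "y \<noteq> 0" using assms by auto
  have "cmod (\<i> * t + 1) = cmod (\<i> * t - 1)" by (simp add: cmod_def)
  then show "cmod (unchart y t) = 1"
    using assms i_chart_nz[of t] by (simp add: unchart_def norm_mult norm_divide)
  have d: "unchart y t - y = 2 * y / (\<i> * t - 1)"
    using i_chart_nz[of t] by (simp add: unchart_def field_simps)
  then show "unchart y t \<noteq> y" using y i_chart_nz[of t] by auto
  have "unchart y t + y = 2 * y * (\<i> * t) / (\<i> * t - 1)"
    using i_chart_nz[of t] by (simp add: unchart_def field_simps)
  then have "(unchart y t + y) / (unchart y t - y) = \<i> * t"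
    using d y i_chart_nz[of t] by simp
  then show "chart y (unchart y t) = t" by (simp add: chart_def)
qed

lemma unchart_chart:
  assumes "cmod x = 1" "cmod y = 1" "x \<noteq> y"
  shows "unchart y (chart y x) = x"
proof -
  have "x = y + 2 * y / (\<i> * chart y x - 1)" using chart_eq[OF assms] by (metis add.commute diff_add_cancel)
  also have "\<dots> = unchart y (chart y x)"
    using i_chart_nz[of "chart y x"] by (simp add: unchart_def field_simps)
  finally show ?thesis by simp
qed

lemma chart_inj:
  assumes "cmod x = 1" "cmod z = 1" "cmod y = 1" "x \<noteq> y" "z \<noteq> y" "chart y x = chart y z"
  shows "x = z"
  using unchart_chart[of x y] unchart_chart[of z y] assms by metis

lemma positively_oriented_chart:
  assumes "cmod x = 1" "cmod z = 1" "cmod y = 1" "x \<noteq> y" "z \<noteq> y"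
  shows "positively_oriented y x z \<longleftrightarrow> chart y x < chart y z"
proof -
  define t s where "t = chart y x" and "s = chart y z"
  have "cnj (x - y) * (z - y) = cnj (2 * y / (\<i> * t - 1)) * (2 * y / (\<i> * s - 1))"
    using chart_eq[of x y] chart_eq[of z y] assms by (simp add: t_def s_def)
  also have "\<dots> = 4 * (cnj y * y) / ((\<i> * t + 1) * (1 - \<i> * s))"
    using i_chart_nz[of t] i_chart_nz[of s] by (simp add: divide_simps algebra_simps)
  also have "cnj y * y = 1" using assms(3) by (simp add: complex_norm_square[symmetric] mult.commute)
  also have "(\<i> * t + 1) * (1 - \<i> * s) = Complex (1 + t * s) (t - s)"
    by (simp add: complex_eq_iff algebra_simps)
  also have "Im (4 * 1 / Complex (1 + t * s) (t - s)) = 4 * (s - t) / ((1 + t * s)\<^sup>2 + (t - s)\<^sup>2)"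
    by (simp add: Im_divide power2_eq_square algebra_simps)
  finally have *: "Im (cnj (x - y) * (z - y)) = 4 * (s - t) / ((1 + t * s)\<^sup>2 + (t - s)\<^sup>2)" .
  have "(1 + t * s)\<^sup>2 + (t - s)\<^sup>2 = (1 + t\<^sup>2) * (1 + s\<^sup>2)"
    by (simp add: power2_eq_square algebra_simps)
  then have "(1 + t * s)\<^sup>2 + (t - s)\<^sup>2 > 0" by (simp add: add_pos_nonneg)
  then have "Im (cnj (x - y) * (z - y)) > 0 \<longleftrightarrow> t < s"
    unfolding * by (simp add: zero_less_divide_iff)
  then show ?thesis using assms by (simp add: positively_oriented_def t_def s_def)
qed

section \<open>The cyclic order of the circle\<close>

lemma positively_orientedD:
  assumes "positively_oriented x y z"
  shows "cmod x = 1" "cmod y = 1" "cmod z = 1" "x \<noteq> y" "y \<noteq> z" "x \<noteq> z"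
  using assms by (auto simp: positively_oriented_def algebra_simps)

lemma positively_oriented_rotate: "positively_oriented x y z \<longleftrightarrow> positively_oriented y z x"
  by (auto simp: positively_oriented_def algebra_simps)

lemma positively_oriented_trans:
  assumes "positively_oriented x y z" "positively_oriented x z w"
  shows "positively_oriented x y w"
  using positively_oriented_chart[of y z x] positively_oriented_chart[of z w x]
    positively_oriented_chart[of y w x] assms
    positively_orientedD[OF assms(1)] positively_orientedD[OF assms(2)] by auto

lemma positively_oriented_total:
  assumes "cmod x = 1" "cmod y = 1" "cmod z = 1" "x \<noteq> y" "y \<noteq> z" "x \<noteq> z"
  shows "positively_oriented x y z \<or> positively_oriented x z y"
  using assms positively_oriented_chart[of y z x] positively_oriented_chart[of z y x] chart_inj[of y z x]
  by force

lemma positively_oriented_asym: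
  assumes "positively_oriented x y z" shows "\<not> positively_oriented x z y"
  using positively_oriented_chart[of y z x] positively_oriented_chart[of z y x] assms
    positively_orientedD[OF assms] by auto

section \<open>Automorphisms of the disc\<close>

definition disc_aut :: "complex \<Rightarrow> complex \<Rightarrow> complex \<Rightarrow> complex" where
  "disc_aut a b z = (a * z + b) / (cnj b * z + cnj a)"

lemma disc_aut_denom:
  assumes "(cmod a)\<^sup>2 - (cmod b)\<^sup>2 = 1" "cmod z \<le> 1"
  shows "cnj b * z + cnj a \<noteq> 0"
proof
  assume "cnj b * z + cnj a = 0"
  then have "cmod (cnj a) = cmod (cnj b * z)" by (metis add_eq_0_iff norm_minus_cancel)
  then have "cmod a \<le> cmod b" using assms(2) by (simp add: norm_mult mult_left_le)
  then have "(cmod a)\<^sup>2 \<le> (cmod b)\<^sup>2" by (simp add: power_mono)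
  then show False using assms(1) by linarith
qed

lemma cmod_sq: "complex_of_real ((cmod a)\<^sup>2) = a * cnj a"
  by (rule complex_norm_square)

lemma disc_aut_diff:
  assumes ab: "(cmod a)\<^sup>2 - (cmod b)\<^sup>2 = 1" and "cmod z \<le> 1" "cmod w \<le> 1"
  shows "disc_aut a b z - disc_aut a b w = (z - w) / ((cnj b * z + cnj a) * (cnj b * w + cnj a))"
proof -
  have "a * cnj a - b * cnj b = 1"
    using arg_cong[OF ab, of complex_of_real] by (simp add: cmod_sq del: of_real_power)
  then have "(a * z + b) * (cnj b * w + cnj a) - (a * w + b) * (cnj b * z + cnj a) = z - w"
    by algebra
  then show ?thesis
    using disc_aut_denom[OF ab assms(2)] disc_aut_denom[OF ab assms(3)]
    by (simp add: disc_aut_def diff_frac_eq)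
qed

lemma disc_aut_sphere:
  assumes ab: "(cmod a)\<^sup>2 - (cmod b)\<^sup>2 = 1" and z: "cmod z = 1"
  shows "cmod (disc_aut a b z) = 1"
proof -
  have "z * cnj z = 1" using z by (simp add: complex_norm_square[symmetric])
  then have "a * z + b = z * cnj (cnj b * z + cnj a)" by (simp add: algebra_simps)
  then have "cmod (a * z + b) = cmod (cnj b * z + cnj a)"
    using z by (metis complex_mod_cnj mult_1 norm_mult)
  then show ?thesis using disc_aut_denom[OF ab, of z] z by (simp add: disc_aut_def norm_divide)
qed

text \<open>On the unit circle conjugation is inversion, so the orientation can be read off from the
  product K of differences and conjugates. In K the denominators of the automorphism combine to
  absolute values, and K changes only by a positive factor.\<close>

lemma disc_aut_positively_oriented:
  assumes ab: "(cmod a)\<^sup>2 - (cmod b)\<^sup>2 = 1" and T: "positively_oriented x y z"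
  shows "positively_oriented (disc_aut a b x) (disc_aut a b y) (disc_aut a b z)"
proof -
  note c = positively_orientedD[OF T]
  define D where "D w = cnj b * w + cnj a" for w
  have D: "D w \<noteq> 0" if "cmod w = 1" for w
    using disc_aut_denom[OF ab, of w] that by (simp add: D_def)
  have e: "disc_aut a b w = w * cnj (D w) / D w" if "cmod w = 1" for w
  proof -
    have "w * cnj w = 1" using that by (simp add: complex_norm_square[symmetric])
    then have "a * w + b = w * cnj (D w)" by (simp add: D_def algebra_simps)
    then show ?thesis by (simp add: disc_aut_def D_def)
  qed
  define u where "u w = disc_aut a b w" for w
  define K where "K p q r = (q - p) * (r - q) * (p - r) * cnj p * cnj q * cnj r" for p q r
  have P: "Im (cnj (q - p) * (r - p)) = Im (K p q r) / 2"
    if "cmod p = 1" "cmod q = 1" "cmod r = 1" for p q r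
  proof -
    have "p * cnj p = 1" "q * cnj q = 1" "r * cnj r = 1"
      using that by (simp_all add: complex_norm_square[symmetric])
    then have "K p q r =
       cnj (q - p) * (r - p) - (q - p) * cnj (r - p)"
      unfolding K_def complex_cnj_diff by algebra
    also have "Im \<dots> = 2 * Im (cnj (q - p) * (r - p))" by (simp add: algebra_simps)
    finally show ?thesis by simp
  qed
  have prod: "K (u x) (u y) (u z) = K x y z / of_real ((cmod (D x))\<^sup>2 * (cmod (D y))\<^sup>2 * (cmod (D z))\<^sup>2)"
  proof -
    have 1: "u p - u q = (p - q) / (D p * D q)" if "cmod p = 1" "cmod q = 1" for p q
      using disc_aut_diff[OF ab, of p q] that by (simp add: u_def D_def)
    have 2: "cnj (u p) = cnj p * D p / cnj (D p)" if "cmod p = 1" for p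
      using e[OF that] by (simp add: u_def)
    show ?thesis
      using c(1-3) D by (simp add: K_def 1 2 cmod_sq field_simps del: of_real_power)
  qed
  have "Im (cnj (u y - u x) * (u z - u x)) = Im (K (u x) (u y) (u z)) / 2"
    by (rule P) (simp_all add: u_def disc_aut_sphere[OF ab] c(1-3))
  also have "\<dots> = Im (K x y z) / 2 / ((cmod (D x))\<^sup>2 * (cmod (D y))\<^sup>2 * (cmod (D z))\<^sup>2)"
    by (simp only: prod Im_divide_of_real) simp
  also have "Im (K x y z) / 2 = Im (cnj (y - x) * (z - x))"
    by (rule P[symmetric]) (simp_all add: c(1-3))
  finally have "Im (cnj (u y - u x) * (u z - u x)) =
      Im (cnj (y - x) * (z - x)) / ((cmod (D x))\<^sup>2 * (cmod (D y))\<^sup>2 * (cmod (D z))\<^sup>2)" .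
  moreover have "(cmod (D x))\<^sup>2 * (cmod (D y))\<^sup>2 * (cmod (D z))\<^sup>2 > 0" using D c(1-3) by simp
  ultimately show ?thesis
    using T disc_aut_sphere[OF ab] c(1-3) by (simp add: positively_oriented_def u_def)
qed

text \<open>With the fixed point y at infinity of the chart, an automorphism becomes affine. Since y
  is fixed, the denominator at y is real, and the slope is its square, hence positive.\<close>

lemma disc_aut_fixed_affine:
  assumes ab: "(cmod a)\<^sup>2 - (cmod b)\<^sup>2 = 1" and y: "cmod y = 1" "disc_aut a b y = y"
  shows "\<exists>q. \<forall>x. cmod x = 1 \<and> x \<noteq> y \<longrightarrow>
    chart y (disc_aut a b x) = (cmod (cnj b * y + cnj a))\<^sup>2 * chart y x + q"
proof -
  define D where "D w = cnj b * w + cnj a" for w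
  have D: "D w \<noteq> 0" if "cmod w = 1" for w
    using disc_aut_denom[OF ab, of w] that by (simp add: D_def)
  have yy: "y * cnj y = 1" using y by (simp add: complex_norm_square[symmetric])
  have "y * D y = a * y + b" using y D[of y] by (simp add: disc_aut_def D_def field_simps)
  also have "\<dots> = y * cnj (D y)" using yy by (simp add: D_def algebra_simps)
  finally have "D y = cnj (D y)" using y by auto
  define d where "d = Re (D y)"
  have Dy: "D y = of_real d" using \<open>D y = cnj (D y)\<close> by (simp add: d_def complex_eq_iff)
  then have "d \<noteq> 0" using D[OF y(1)] by auto
  have "chart y (disc_aut a b x) = d\<^sup>2 * chart y x + Im (2 * y * d * cnj b)" if x: "cmod x = 1" "x \<noteq> y" for x
  proof -
    have e: "disc_aut a b x - y = (x - y) / (D x * d)"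
      using disc_aut_diff[OF ab, of x y] x y by (simp add: D_def[symmetric] Dy)
    have Dx: "D x = cnj b * (x - y) + d" using Dy by (simp add: D_def algebra_simps)
    then have "(disc_aut a b x + y) / (disc_aut a b x - y) = 1 + 2 * y * d * cnj b + d\<^sup>2 * (2 * y / (x - y))"
    proof -
      have "disc_aut a b x \<noteq> y" using e x D[OF x(1)] \<open>d \<noteq> 0\<close> by auto
      then have "(disc_aut a b x + y) / (disc_aut a b x - y) = 1 + 2 * y / (disc_aut a b x - y)"
        by (simp add: field_simps)
      also have "2 * y / (disc_aut a b x - y) = 2 * y * d * (cnj b * (x - y) + d) / (x - y)"
        using e x D[OF x(1)] \<open>d \<noteq> 0\<close> Dx by simp
      also have "\<dots> = 2 * y * d * cnj b + d\<^sup>2 * (2 * y / (x - y))"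
        using x by (simp add: field_simps power2_eq_square)
      finally show ?thesis by simp
    qed
    moreover have "(x + y) / (x - y) = 1 + 2 * y / (x - y)" using x by (simp add: field_simps)
    ultimately have "(disc_aut a b x + y) / (disc_aut a b x - y) =
        1 + 2 * y * d * cnj b + of_real (d\<^sup>2) * ((x + y) / (x - y) - 1)" by simp
    then show ?thesis by (simp add: chart_def del: of_real_power)
  qed
  moreover have "(cmod (cnj b * y + cnj a))\<^sup>2 = d\<^sup>2"
    unfolding D_def[symmetric] Dy by simp
  ultimately show ?thesis
    by (intro exI[of _ "Im (2 * y * d * cnj b)"]) auto
qed

lemma disc_aut_ball:
  assumes ab: "(cmod a)\<^sup>2 - (cmod b)\<^sup>2 = 1" and z: "cmod z \<le> 1"
  shows "cmod (disc_aut a b z) \<le> 1"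
proof -
  have "complex_of_real ((cmod (cnj b * z + cnj a))\<^sup>2 - (cmod (a * z + b))\<^sup>2) =
     complex_of_real (((cmod a)\<^sup>2 - (cmod b)\<^sup>2) * (1 - (cmod z)\<^sup>2))"
    by (simp add: cmod_sq algebra_simps del: of_real_power)
  then have "(cmod (cnj b * z + cnj a))\<^sup>2 - (cmod (a * z + b))\<^sup>2 = ((cmod a)\<^sup>2 - (cmod b)\<^sup>2) * (1 - (cmod z)\<^sup>2)"
    using of_real_eq_iff by blast
  moreover have "1 - (cmod z)\<^sup>2 \<ge> 0" using z by (simp add: abs_square_le_1)
  ultimately have "(cmod (a * z + b))\<^sup>2 \<le> (cmod (cnj b * z + cnj a))\<^sup>2"
    unfolding ab mult_1_left by linarith
  then have "cmod (a * z + b) \<le> cmod (cnj b * z + cnj a)" using power2_le_imp_le norm_ge_zero by blast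
  then show ?thesis
    using disc_aut_denom[OF ab z] by (simp add: disc_aut_def norm_divide)
qed

lemma disc_aut_zero:
  assumes ab: "(cmod a)\<^sup>2 - (cmod b)\<^sup>2 = 1"
  shows "1 - (cmod (disc_aut a b 0))\<^sup>2 = 1 / (cmod a)\<^sup>2"
proof -
  have "(cmod a)\<^sup>2 > 0" using ab by (smt (verit) zero_le_power2)
  then have "1 - (cmod b)\<^sup>2 / (cmod a)\<^sup>2 = ((cmod a)\<^sup>2 - (cmod b)\<^sup>2) / (cmod a)\<^sup>2"
    by (simp add: diff_divide_distrib)
  then show ?thesis unfolding ab by (simp add: disc_aut_def norm_divide power_divide)
qed

section \<open>The free group acting through a hyperbolization\<close>

definition gbar :: "pants_gen \<times> bool \<Rightarrow> pants_gen \<times> bool" where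
  "gbar = (\<lambda>(x, e). (x, \<not> e))"

lemma gbar_gbar [simp]: "gbar (gbar l) = l"
  by (cases l) (simp add: gbar_def)

lemma gbar_neq [simp]: "gbar l \<noteq> l" "l \<noteq> gbar l"
  by (cases l; simp add: gbar_def)+

lemma \<Gamma>03_gbar: "\<Gamma>03 = word_group gbar"
  by (simp add: \<Gamma>03_def gbar_def)

lemma carrier_\<Gamma>03: "carrier \<Gamma>03 = {w. reduced gbar w}"
  by (simp add: \<Gamma>03_gbar word_group_def)

lemma one_\<Gamma>03: "\<one>\<^bsub>\<Gamma>03\<^esub> = []"
  by (simp add: \<Gamma>03_gbar word_group_def)

lemma mult_\<Gamma>03: "u \<otimes>\<^bsub>\<Gamma>03\<^esub> v = foldr (push gbar) u v"
  by (simp add: \<Gamma>03_gbar word_group_def)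

lemma letter_\<Gamma>03 [simp]: "[l] \<in> carrier \<Gamma>03"
  by (simp add: carrier_\<Gamma>03 reduced_def)

interpretation F: group \<Gamma>03
  by (rule group_\<Gamma>03)

lemma reduced_Cons_mult: "reduced gbar (l # w) \<Longrightarrow> l # w = [l] \<otimes>\<^bsub>\<Gamma>03\<^esub> w"
  by (simp add: mult_\<Gamma>03 push_reduced_Cons)

lemma letter_mult_gbar: "[l] \<otimes>\<^bsub>\<Gamma>03\<^esub> [gbar l] = \<one>\<^bsub>\<Gamma>03\<^esub>"
  by (simp add: mult_\<Gamma>03 one_\<Gamma>03)

locale hyp =
  fixes H :: "(pants_gen \<times> bool) list \<Rightarrow> complex \<Rightarrow> complex"
  assumes hyp: "hyperbolization H"
begin

lemma coeffs:
  assumes "\<gamma> \<in> carrier \<Gamma>03"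
  obtains a b where "(cmod a)\<^sup>2 - (cmod b)\<^sup>2 = 1" "\<And>z. cmod z \<le> 1 \<Longrightarrow> H \<gamma> z = disc_aut a b z"
proof -
  have "\<forall>\<gamma>\<in>carrier \<Gamma>03. \<exists>a b. (cmod a)\<^sup>2 - (cmod b)\<^sup>2 = 1 \<and>
        (\<forall>z\<in>cball 0 1. H \<gamma> z = (a * z + b) / (cnj b * z + cnj a))"
    using hyp unfolding hyperbolization_def by (rule conjunct1)
  then obtain a b where "(cmod a)\<^sup>2 - (cmod b)\<^sup>2 = 1"
    "\<forall>z\<in>cball 0 1. H \<gamma> z = (a * z + b) / (cnj b * z + cnj a)"
    using assms by blast
  then show ?thesis using that by (simp add: disc_aut_def)
qed

lemma H_mult: "\<gamma> \<in> carrier \<Gamma>03 \<Longrightarrow> \<delta> \<in> carrier \<Gamma>03 \<Longrightarrow> cmod z \<le> 1 \<Longrightarrow> H (\<gamma> \<otimes>\<^bsub>\<Gamma>03\<^esub> \<delta>) z = H \<gamma> (H \<delta> z)"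
  using hyp unfolding hyperbolization_def by simp

lemma H_inj:
  assumes "\<gamma> \<in> carrier \<Gamma>03" "\<delta> \<in> carrier \<Gamma>03" "\<And>z. cmod z \<le> 1 \<Longrightarrow> H \<gamma> z = H \<delta> z"
  shows "\<gamma> = \<delta>"
proof -
  have "inj_on (\<lambda>\<gamma>. restrict (H \<gamma>) (cball 0 1)) (carrier \<Gamma>03)"
    using hyp unfolding hyperbolization_def by blast
  moreover have "restrict (H \<gamma>) (cball 0 1) = restrict (H \<delta>) (cball 0 1)"
    using assms(3) by (auto simp: restrict_def)
  ultimately show ?thesis using assms(1,2) by (metis inj_onD)
qed

lemma H_discrete: "r < 1 \<Longrightarrow> finite {\<gamma>\<in>carrier \<Gamma>03. cmod (H \<gamma> 0) \<le> r}"
  using hyp unfolding hyperbolization_def by blast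

lemma H_right: "surface_on_right H \<alpha>" "surface_on_right H \<beta>" "surface_on_right H (inv\<^bsub>\<Gamma>03\<^esub> (\<alpha> \<otimes>\<^bsub>\<Gamma>03\<^esub> \<beta>))"
  using hyp unfolding hyperbolization_def by blast+

lemma H_ball: "\<gamma> \<in> carrier \<Gamma>03 \<Longrightarrow> cmod z \<le> 1 \<Longrightarrow> cmod (H \<gamma> z) \<le> 1"
  using coeffs[of \<gamma>] disc_aut_ball by metis

lemma H_sphere: "\<gamma> \<in> carrier \<Gamma>03 \<Longrightarrow> cmod z = 1 \<Longrightarrow> cmod (H \<gamma> z) = 1"
  using coeffs[of \<gamma>] disc_aut_sphere by (metis order_refl)

lemma H_positively_oriented:
  assumes "\<gamma> \<in> carrier \<Gamma>03" "positively_oriented x y z"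
  shows "positively_oriented (H \<gamma> x) (H \<gamma> y) (H \<gamma> z)"
proof -
  obtain a b where "(cmod a)\<^sup>2 - (cmod b)\<^sup>2 = 1" "\<And>z. cmod z \<le> 1 \<Longrightarrow> H \<gamma> z = disc_aut a b z"
    using coeffs[OF assms(1)] by blast
  then show ?thesis using disc_aut_positively_oriented assms(2) positively_orientedD[OF assms(2)] by simp
qed

text \<open>By multiplicativity the map of the neutral element is idempotent; being an automorphism
  of the disc it is injective, hence the identity.\<close>

lemma H_one: assumes "cmod z \<le> 1" shows "H \<one>\<^bsub>\<Gamma>03\<^esub> z = z"
proof -
  obtain a b where ab: "(cmod a)\<^sup>2 - (cmod b)\<^sup>2 = 1" "\<And>z. cmod z \<le> 1 \<Longrightarrow> H \<one>\<^bsub>\<Gamma>03\<^esub> z = disc_aut a b z"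
    using coeffs[OF F.one_closed] by blast
  define w where "w = H \<one>\<^bsub>\<Gamma>03\<^esub> z"
  have w: "cmod w \<le> 1" "H \<one>\<^bsub>\<Gamma>03\<^esub> w = H \<one>\<^bsub>\<Gamma>03\<^esub> z"
    using H_ball assms H_mult[OF F.one_closed F.one_closed assms] by (simp_all add: w_def)
  then have "(w - z) / ((cnj b * w + cnj a) * (cnj b * z + cnj a)) = 0"
    using disc_aut_diff[OF ab(1) w(1) assms] ab(2)[OF w(1)] ab(2)[OF assms] by simp
  then show ?thesis
    using disc_aut_denom[OF ab(1)] w(1) assms by (simp add: w_def)
qed

lemma H_inv:
  assumes "\<gamma> \<in> carrier \<Gamma>03" "cmod z \<le> 1"
  shows "H \<gamma> (H (inv\<^bsub>\<Gamma>03\<^esub> \<gamma>) z) = z" "H (inv\<^bsub>\<Gamma>03\<^esub> \<gamma>) (H \<gamma> z) = z"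
  using H_mult[of \<gamma> "inv\<^bsub>\<Gamma>03\<^esub> \<gamma>" z] H_mult[of "inv\<^bsub>\<Gamma>03\<^esub> \<gamma>" \<gamma> z] H_one[OF assms(2)] assms by simp_all

lemma H_eq_iff:
  assumes "\<gamma> \<in> carrier \<Gamma>03" "cmod z \<le> 1" "cmod w \<le> 1"
  shows "H \<gamma> z = H \<gamma> w \<longleftrightarrow> z = w"
  using H_inv(2)[OF assms(1)] assms(2,3) by metis

text \<open>Fixing the three points 1, -1 and i determines an automorphism of the disc: it forces b
  = 0 and a real.\<close>

lemma H_trivial:
  assumes g: "\<gamma> \<in> carrier \<Gamma>03" and fx: "\<And>x. cmod x = 1 \<Longrightarrow> H \<gamma> x = x"
  shows "\<gamma> = \<one>\<^bsub>\<Gamma>03\<^esub>"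
proof (rule H_inj[OF g F.one_closed])
  obtain a b where ab: "(cmod a)\<^sup>2 - (cmod b)\<^sup>2 = 1" "\<And>z. cmod z \<le> 1 \<Longrightarrow> H \<gamma> z = disc_aut a b z"
    using coeffs[OF g] by blast
  have "a * x + b = x * (cnj b * x + cnj a)" if "cmod x = 1" for x
    using fx[OF that] ab(2)[of x] disc_aut_denom[OF ab(1), of x] that
    by (simp add: disc_aut_def divide_eq_eq)
  from this[of 1] this[of "-1"] this[of \<i>] have "b = 0" "cnj a = a"
    by (auto simp: complex_eq_iff)
  moreover have "a \<noteq> 0" using ab(1) \<open>b = 0\<close> by auto
  ultimately show "H \<gamma> z = H \<one>\<^bsub>\<Gamma>03\<^esub> z" if "cmod z \<le> 1" for z
    using ab(2)[OF that] H_one[OF that] by (simp add: disc_aut_def)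
qed

lemma H_eq_on_sphere:
  assumes g: "\<gamma> \<in> carrier \<Gamma>03" "\<delta> \<in> carrier \<Gamma>03" and eq: "\<And>x. cmod x = 1 \<Longrightarrow> H \<gamma> x = H \<delta> x"
  shows "\<gamma> = \<delta>"
proof -
  have "inv\<^bsub>\<Gamma>03\<^esub> \<delta> \<otimes>\<^bsub>\<Gamma>03\<^esub> \<gamma> = \<one>\<^bsub>\<Gamma>03\<^esub>"
    using g eq by (intro H_trivial) (auto simp: H_mult H_inv)
  then show ?thesis using g by (metis F.inv_equality F.inv_inv F.inv_closed)
qed

text \<open>The same denominator at y gives the slope p and the distance of the orbit point from y.
  For slope at least 1, an orbit point near the circle is therefore near y.\<close>

lemma fixed_affine:
  assumes g: "\<gamma> \<in> carrier \<Gamma>03" and y: "cmod y = 1" "H \<gamma> y = y"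
  obtains p q where "p > 0" "\<And>x. cmod x = 1 \<Longrightarrow> x \<noteq> y \<Longrightarrow> chart y (H \<gamma> x) = p * chart y x + q"
    "cmod (H \<gamma> 0 - y) = sqrt (1 - (cmod (H \<gamma> 0))\<^sup>2) / sqrt p"
proof -
  obtain a b where ab: "(cmod a)\<^sup>2 - (cmod b)\<^sup>2 = 1" "\<And>z. cmod z \<le> 1 \<Longrightarrow> H \<gamma> z = disc_aut a b z"
    using coeffs[OF g] by blast
  have fy: "disc_aut a b y = y" using ab(2)[of y] y by simp
  define D where "D = cnj b * y + cnj a"
  have D: "D \<noteq> 0" using disc_aut_denom[OF ab(1), of y] y by (simp add: D_def)
  obtain q where "\<And>x. cmod x = 1 \<Longrightarrow> x \<noteq> y \<Longrightarrow> chart y (H \<gamma> x) = (cmod D)\<^sup>2 * chart y x + q"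
    using disc_aut_fixed_affine[OF ab(1) y(1) fy] ab(2) by (auto simp: D_def)
  moreover have "H \<gamma> 0 - y = (0 - y) / (cnj a * D)"
    using disc_aut_diff[OF ab(1), of 0 y] y ab(2)[of 0] fy by (simp add: D_def)
  then have "cmod (H \<gamma> 0 - y) = 1 / (cmod a * cmod D)"
    using y by (simp add: norm_divide norm_mult)
  moreover have "sqrt (1 - (cmod (H \<gamma> 0))\<^sup>2) = 1 / cmod a"
    using disc_aut_zero[OF ab(1)] ab(2)[of 0] by (simp add: real_sqrt_divide)
  ultimately show ?thesis using that[of "(cmod D)\<^sup>2" q] D by simp
qed

abbreviation Lam :: "complex set" where "Lam \<equiv> limit_set H"

lemma Lam_sphere: "x \<in> Lam \<Longrightarrow> cmod x = 1"
  by (simp add: limit_set_def)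

lemma H_continuous: assumes "\<gamma> \<in> carrier \<Gamma>03" shows "continuous_on (cball 0 1) (H \<gamma>)"
proof -
  obtain a b where ab: "(cmod a)\<^sup>2 - (cmod b)\<^sup>2 = 1" "\<And>z. cmod z \<le> 1 \<Longrightarrow> H \<gamma> z = disc_aut a b z"
    using coeffs[OF assms] by blast
  have "continuous_on (cball 0 1) (disc_aut a b)"
    unfolding disc_aut_def using disc_aut_denom[OF ab(1)] by (intro continuous_intros) auto
  then show ?thesis using ab(2) by (subst continuous_on_cong[of _ "cball 0 1" _ "disc_aut a b"]) auto
qed

lemma Lam_invariant:
  assumes "x \<in> Lam" "\<gamma> \<in> carrier \<Gamma>03"
  shows "H \<gamma> x \<in> Lam"
proof -
  let ?O = "(\<lambda>\<gamma>. H \<gamma> 0) ` carrier \<Gamma>03"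
  have "?O \<subseteq> cball 0 1" using H_ball by auto
  then have c: "closure ?O \<subseteq> cball 0 1" by (rule closure_minimal) simp
  have "H \<gamma> ` closure ?O \<subseteq> closure ?O"
  proof (rule image_closure_subset)
    show "continuous_on (closure ?O) (H \<gamma>)" using H_continuous[OF assms(2)] c continuous_on_subset by blast
    have "H \<gamma> (H \<delta> 0) \<in> ?O" if "\<delta> \<in> carrier \<Gamma>03" for \<delta>
      using H_mult[OF assms(2) that, of 0] assms(2) that by (metis F.m_closed imageI norm_zero zero_le_one)
    then show "H \<gamma> ` ?O \<subseteq> closure ?O" using closure_subset[of ?O] by blast
  qed simp
  then show ?thesis using assms H_sphere by (auto simp: limit_set_def)
qed

text \<open>By discreteness some element of the infinite stabilizer, together with its inverse,
  moves 0 close to the circle. The two slopes at y are reciprocal, so one of them is at least 1, and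
  that element moves 0 close to y.\<close>

lemma fixed_in_Lam:
  assumes inf: "infinite {\<gamma> \<in> carrier \<Gamma>03. H \<gamma> y = y}" and y: "cmod y = 1"
  shows "y \<in> Lam"
proof -
  have "\<exists>\<gamma>\<in>carrier \<Gamma>03. dist (H \<gamma> 0) y < e" if "e > 0" for e
  proof -
    \<comment> \<open>Chosen such that sqrt (1 - s^2) < min e 1 for every s > r.\<close>
    define r where "r = sqrt (1 - (min e 1)\<^sup>2)"
    have e1: "0 < (min e 1)\<^sup>2" "(min e 1)\<^sup>2 \<le> 1" using that by (auto simp: abs_square_le_1)
    then have r: "0 \<le> r" "r < 1" "r\<^sup>2 = 1 - (min e 1)\<^sup>2" by (auto simp: r_def)
    let ?S = "{\<gamma> \<in> carrier \<Gamma>03. H \<gamma> y = y}" and ?R = "{\<gamma>\<in>carrier \<Gamma>03. cmod (H \<gamma> 0) \<le> r}"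
    have "finite ?R" using H_discrete r by blast
    then have "finite (?R \<union> (\<lambda>\<gamma>. inv\<^bsub>\<Gamma>03\<^esub> \<gamma>) ` ?R)" by simp
    then obtain \<gamma> where \<gamma>: "\<gamma> \<in> ?S" "\<gamma> \<notin> ?R" "\<gamma> \<notin> (\<lambda>\<gamma>. inv\<^bsub>\<Gamma>03\<^esub> \<gamma>) ` ?R"
      using inf by (metis (no_types, lifting) UnCI finite_subset subsetI)
    let ?i = "inv\<^bsub>\<Gamma>03\<^esub> \<gamma>"
    have g: "\<gamma> \<in> carrier \<Gamma>03" "H \<gamma> y = y" "?i \<in> carrier \<Gamma>03" using \<gamma> by auto
    have iy: "H ?i y = y" using H_inv(2)[OF g(1), of y] g(2) y by simp
    have "?i \<notin> ?R"
    proof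
      assume "?i \<in> ?R"
      then have "\<gamma> \<in> (\<lambda>\<gamma>. inv\<^bsub>\<Gamma>03\<^esub> \<gamma>) ` ?R" using g by (intro image_eqI[of _ _ ?i]) auto
      then show False using \<gamma> by blast
    qed
    then have big: "r < cmod (H \<gamma> 0)" "r < cmod (H ?i 0)" using \<gamma> g by auto
    obtain p q where p: "p > 0" "\<And>x. cmod x = 1 \<Longrightarrow> x \<noteq> y \<Longrightarrow> chart y (H \<gamma> x) = p * chart y x + q"
      "cmod (H \<gamma> 0 - y) = sqrt (1 - (cmod (H \<gamma> 0))\<^sup>2) / sqrt p"
      using fixed_affine[OF g(1) y g(2)] by blast
    obtain p' q' where p': "p' > 0" "\<And>x. cmod x = 1 \<Longrightarrow> x \<noteq> y \<Longrightarrow> chart y (H ?i x) = p' * chart y x + q'"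
      "cmod (H ?i 0 - y) = sqrt (1 - (cmod (H ?i 0))\<^sup>2) / sqrt p'"
      using fixed_affine[OF g(3) y iy] by blast
    have "t = p' * (p * t + q) + q'" for t
    proof -
      let ?x = "unchart y t"
      have x: "cmod ?x = 1" "?x \<noteq> y" "chart y ?x = t" using unchart[OF y] by auto
      have "H \<gamma> ?x \<noteq> y" using H_eq_iff[OF g(1), of ?x y] x y g(2) by simp
      then show ?thesis
        using p(2)[OF x(1,2)] p'(2)[of "H \<gamma> ?x"] H_sphere[OF g(1) x(1)] H_inv(2)[OF g(1), of ?x] x by simp
    qed
    from this[of 0] this[of 1] have "p' * p = 1" by (simp add: algebra_simps)
    then have "p \<ge> 1 \<or> p' \<ge> 1" using p(1) p'(1) by (metis less_eq_real_def linorder_not_less mult_less_cancel_left_pos mult.right_neutral)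
    have small: "sqrt (1 - s\<^sup>2) / sqrt P < e" if "r < s" "P \<ge> 1" for s P
    proof -
      have "r\<^sup>2 < s\<^sup>2" using r that by (intro power_strict_mono) auto
      then have less: "1 - s\<^sup>2 < (min e 1)\<^sup>2" using r by linarith
      have "sqrt (1 - s\<^sup>2) < min e 1" using real_sqrt_less_mono[OF less] \<open>e > 0\<close> by simp
      moreover have "sqrt (1 - s\<^sup>2) / sqrt P \<le> sqrt (1 - s\<^sup>2) \<or> sqrt (1 - s\<^sup>2) < 0"
        using that by (smt (verit) div_by_1 frac_le real_sqrt_ge_1_iff)
      moreover have "sqrt (1 - s\<^sup>2) < 0 \<Longrightarrow> sqrt (1 - s\<^sup>2) / sqrt P < 0" using that by (simp add: divide_neg_pos)
      ultimately show ?thesis using \<open>e > 0\<close> by linarith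
    qed
    from \<open>p \<ge> 1 \<or> p' \<ge> 1\<close> show ?thesis
      using small[OF big(1), of p] small[OF big(2), of p'] p(3) p'(3) g by (metis dist_norm)
  qed
  then have "y \<in> closure ((\<lambda>\<gamma>. H \<gamma> 0) ` carrier \<Gamma>03)"
    by (auto simp: closure_approachable)
  then show ?thesis using y by (simp add: limit_set_def)
qed

end

section \<open>Stabilizers of boundary points and gaps of the limit set\<close>

context hyp
begin

lemma H_pow:
  assumes "\<gamma> \<in> carrier \<Gamma>03" "cmod x \<le> 1"
  shows "H (\<gamma> [^]\<^bsub>\<Gamma>03\<^esub> n) x = (H \<gamma> ^^ n) x"
  using assms(2)
proof (induction n arbitrary: x)
  case 0
  then show ?case by (simp add: H_one)
next
  case (Suc n)
  then show ?case
    using assms(1) by (simp add: H_mult H_ball funpow_Suc_right del: funpow.simps)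
qed

lemma fixed_affine_chart:
  assumes "\<gamma> \<in> carrier \<Gamma>03" "cmod y = 1" "H \<gamma> y = y"
  obtains p q where "p > 0" "\<And>x. cmod x = 1 \<Longrightarrow> x \<noteq> y \<Longrightarrow> chart y (H \<gamma> x) = p * chart y x + q"
  by (rule fixed_affine[OF assms]) (rule that)

text \<open>In the chart at y the element is affine with positive slope. Such a map of finite order
  is the identity, so two equal powers would make the element trivial.\<close>

lemma infinite_stabilizer:
  assumes g: "\<gamma> \<in> carrier \<Gamma>03" "\<gamma> \<noteq> \<one>\<^bsub>\<Gamma>03\<^esub>" and y: "cmod y = 1" "H \<gamma> y = y"
  shows "infinite {\<gamma> \<in> carrier \<Gamma>03. H \<gamma> y = y}"
proof -
  obtain p q where p: "p > 0" "\<And>x. cmod x = 1 \<Longrightarrow> x \<noteq> y \<Longrightarrow> chart y (H \<gamma> x) = p * chart y x + q"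
    by (rule fixed_affine_chart[OF g(1) y]) (rule that)
  have ny: "H \<gamma> x \<noteq> y" if "cmod x = 1" "x \<noteq> y" for x
    using H_eq_iff[OF g(1), of x y] that y by simp
  have it: "cmod ((H \<gamma> ^^ n) x) = 1 \<and> (H \<gamma> ^^ n) x \<noteq> y \<and>
      chart y ((H \<gamma> ^^ n) x) = p ^ n * chart y x + q * (\<Sum>i<n. p ^ i)" if "cmod x = 1" "x \<noteq> y" for n x
    using that
  proof (induction n)
    case (Suc n)
    then show ?case using p(2)[of "(H \<gamma> ^^ n) x"] ny H_sphere[OF g(1)]
      by (simp add: sum_distrib_left algebra_simps sum.lessThan_Suc_shift del: sum.lessThan_Suc)
  qed simp
  have "inj (\<lambda>n::nat. \<gamma> [^]\<^bsub>\<Gamma>03\<^esub> n)"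
  proof (rule linorder_injI, rule notI)
    fix i j :: nat assume "i < j" and eq: "\<gamma> [^]\<^bsub>\<Gamma>03\<^esub> i = \<gamma> [^]\<^bsub>\<Gamma>03\<^esub> j"
    then obtain k where k: "j = i + k" "k > 0" using less_imp_add_positive by blast
    have "\<gamma> [^]\<^bsub>\<Gamma>03\<^esub> i \<otimes>\<^bsub>\<Gamma>03\<^esub> \<gamma> [^]\<^bsub>\<Gamma>03\<^esub> k = \<gamma> [^]\<^bsub>\<Gamma>03\<^esub> i \<otimes>\<^bsub>\<Gamma>03\<^esub> \<one>\<^bsub>\<Gamma>03\<^esub>"
      using eq[symmetric] g unfolding k(1) by (simp add: F.nat_pow_mult)
    then have one: "\<gamma> [^]\<^bsub>\<Gamma>03\<^esub> k = \<one>\<^bsub>\<Gamma>03\<^esub>" using g by (simp only: F.Units_eq F.Units_l_cancel F.nat_pow_closed F.one_closed)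
    have id: "t = p ^ k * t + q * (\<Sum>i<k. p ^ i)" for t
      using it[of "unchart y t" k] unchart[OF y(1), of t] H_pow[OF g(1), of "unchart y t" k] H_one[of "unchart y t"] one
      by simp
    have "(\<Sum>i<k. p ^ i) > 0" using k p(1) by (intro sum_pos) auto
    then have "q = 0" using id[of 0] by simp
    then have "p ^ k = 1" using id[of 1] by simp
    then have "p = 1" using p(1) k(2) power_eq_1_iff[of p k] by auto
    have "H \<gamma> x = x" if "cmod x = 1" for x
      using p(2)[OF that] \<open>p = 1\<close> \<open>q = 0\<close> chart_inj[of "H \<gamma> x" x y] that y H_sphere[OF g(1) that] ny[OF that]
      by (cases "x = y") auto
    then show False using H_trivial g by blast
  qed
  then have "infinite (range (\<lambda>n::nat. \<gamma> [^]\<^bsub>\<Gamma>03\<^esub> n))"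
    using finite_imageD infinite_UNIV_nat by blast
  moreover have "(H \<gamma> ^^ n) y = y" for n by (induction n) (simp_all add: y)
  then have "range (\<lambda>n::nat. \<gamma> [^]\<^bsub>\<Gamma>03\<^esub> n) \<subseteq> {\<gamma> \<in> carrier \<Gamma>03. H \<gamma> y = y}"
    using g y H_pow[OF g(1), of y] by auto
  ultimately show ?thesis using finite_subset by blast
qed

lemma H_Cons: "reduced gbar (l # w) \<Longrightarrow> cmod z \<le> 1 \<Longrightarrow> H (l # w) z = H [l] (H w z)"
  using reduced_Cons_mult[of l w] H_mult[of "[l]" w z] reduced_ConsD[of gbar l w]
  by (simp add: carrier_\<Gamma>03 reduced_def)

lemma H_letter_inv: "cmod z \<le> 1 \<Longrightarrow> H [l] (H [gbar l] z) = z"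
  using H_mult[of "[l]" "[gbar l]" z] by (simp add: letter_mult_gbar H_one)

text \<open>Two elements of the affine group of the line have commuting commutators, which is impossible
  in a free group on two generators.\<close>

lemma no_common_fixed:
  assumes y: "cmod y = 1" and fixed: "H \<alpha> y = y" "H \<beta> y = y"
  shows False
proof -
  define a A b B where "a = (Gen_\<alpha>, True)" and "A = (Gen_\<alpha>, False)" and "b = (Gen_\<beta>, True)" and "B = (Gen_\<beta>, False)"
  note ab = a_def A_def b_def B_def
  have g: "gbar a = A" "gbar A = a" "gbar b = B" "gbar B = b" by (simp_all add: ab gbar_def)
  obtain p1 q1 where p1: "p1 > 0" "\<And>x. cmod x = 1 \<Longrightarrow> x \<noteq> y \<Longrightarrow> chart y (H [a] x) = p1 * chart y x + q1"
    using fixed_affine_chart[of "[a]" y] y fixed by (auto simp: \<alpha>_def a_def)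
  obtain p2 q2 where p2: "p2 > 0" "\<And>x. cmod x = 1 \<Longrightarrow> x \<noteq> y \<Longrightarrow> chart y (H [b] x) = p2 * chart y x + q2"
    using fixed_affine_chart[of "[b]" y] y fixed by (auto simp: \<beta>_def b_def)
  have fx: "H [l] y = y" for l
  proof -
    have "H [a] y = y" "H [b] y = y" using fixed by (simp_all add: \<alpha>_def \<beta>_def ab)
    moreover have "H [A] y = y" "H [B] y = y"
      using H_letter_inv[of y A] H_letter_inv[of y B] calculation y by (simp_all add: g)
    ultimately show ?thesis by (cases l; cases "fst l"; cases "snd l") (auto simp: ab)
  qed
  have st: "cmod (H [l] x) = 1 \<and> H [l] x \<noteq> y" if "cmod x = 1" "x \<noteq> y" for l x
    using H_eq_iff[of "[l]" x y] that y H_sphere[of "[l]" x] fx[of l] by simp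
  have A: "chart y (H [A] x) = (chart y x - q1) / p1" if "cmod x = 1" "x \<noteq> y" for x
    using p1(2)[of "H [A] x"] st[OF that] p1(1) H_letter_inv[of x a] that by (simp add: g field_simps)
  have B: "chart y (H [B] x) = (chart y x - q2) / p2" if "cmod x = 1" "x \<noteq> y" for x
    using p2(2)[of "H [B] x"] st[OF that] p2(1) H_letter_inv[of x b] that by (simp add: g field_simps)
  define u v where "u = [a, b, A, B]" and "v = [a, B, A, b]"
  have red: "reduced gbar u" "reduced gbar v"
    by (simp_all add: u_def v_def reduced_def ab gbar_def)
  have uv: "u \<in> carrier \<Gamma>03" "v \<in> carrier \<Gamma>03" using red by (simp_all add: carrier_\<Gamma>03)
  have Hu: "H u x = H [a] (H [b] (H [A] (H [B] x)))" and Hv: "H v x = H [a] (H [B] (H [A] (H [b] x)))"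
    if "cmod x = 1" for x
    using that by (simp_all add: u_def v_def H_Cons reduced_def ab gbar_def H_ball)
  obtain c where c: "\<And>x. cmod x = 1 \<Longrightarrow> x \<noteq> y \<Longrightarrow> chart y (H u x) = chart y x + c"
  proof
    show "chart y (H u x) = chart y x + (p1 * q2 - p2 * q1 - q2 + q1)" if "cmod x = 1" "x \<noteq> y" for x
      using that p1(1) p2(1) by (simp add: Hu p1(2) p2(2) A B st field_simps)
  qed
  obtain d where d: "\<And>x. cmod x = 1 \<Longrightarrow> x \<noteq> y \<Longrightarrow> chart y (H v x) = chart y x + d"
  proof
    show "chart y (H v x) = chart y x + ((q2 - q1 - p1 * q2) / p2 + q1)" if "cmod x = 1" "x \<noteq> y" for x
      using that p1(1) p2(1) by (simp add: Hv p1(2) p2(2) A B st field_simps)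
  qed
  have stu: "cmod (H w x) = 1 \<and> H w x \<noteq> y" if "cmod x = 1" "x \<noteq> y" "w = u \<or> w = v" for x w
    using that(3)
  proof
    assume "w = u" then show ?thesis using that(1,2) by (simp add: Hu st)
  next
    assume "w = v" then show ?thesis using that(1,2) by (simp add: Hv st)
  qed
  have "u \<otimes>\<^bsub>\<Gamma>03\<^esub> v = v \<otimes>\<^bsub>\<Gamma>03\<^esub> u"
  proof (rule H_eq_on_sphere)
    fix x :: complex assume x: "cmod x = 1"
    show "H (u \<otimes>\<^bsub>\<Gamma>03\<^esub> v) x = H (v \<otimes>\<^bsub>\<Gamma>03\<^esub> u) x"
    proof (cases "x = y")
      case True
      then show ?thesis using uv x fx by (simp add: H_mult Hu Hv)
    next
      case False
      have "chart y (H u (H v x)) = chart y (H v (H u x))"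
        using c d stu x False by simp
      then show ?thesis
        using chart_inj[of "H u (H v x)" "H v (H u x)" y] stu x False y uv by (simp add: H_mult)
    qed
  qed (simp_all add: uv)
  then show False
    by (simp add: u_def v_def mult_\<Gamma>03 ab gbar_def)
qed

text \<open>The open arc from d' counterclockwise to d is the gap of the limit set cut off by the
  boundary element \<delta>: d' is attracting, d repelling, and inside the gap \<delta> moves m
  backwards. At a cusp d', m and d coincide, and orbits run counterclockwise into d. Outside the
  closed gap \<delta> moves points forwards.\<close>

definition gap :: "(pants_gen \<times> bool) list \<Rightarrow> complex \<Rightarrow> complex \<Rightarrow> complex \<Rightarrow> bool" where
  "gap \<delta> d' m d \<longleftrightarrow> cmod d' = 1 \<and> cmod m = 1 \<and> cmod d = 1 \<and> H \<delta> d' = d' \<and> H \<delta> d = d \<and>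
     (\<forall>x\<in>Lam. \<not> positively_oriented d' x d) \<and>
     (\<forall>x. cmod x = 1 \<and> x \<noteq> d \<and> x \<noteq> d' \<and> \<not> positively_oriented d' x d \<longrightarrow> positively_oriented d x (H \<delta> x)) \<and>
     ((d' = d \<and> m = d \<and> (\<forall>x w. cmod x = 1 \<and> cmod w = 1 \<and> x \<noteq> d \<and> w \<noteq> d \<longrightarrow>
          (\<exists>n. positively_oriented d w ((H \<delta> ^^ n) x)))) \<or>
      (positively_oriented d' (H \<delta> m) m \<and> positively_oriented d' m d))"

text \<open>The slope p at the point y from \<open>surface_on_right\<close> distinguishes the cases.
  For p = 1 it is a cusp; for p > 1, y is attracting and the gap starts there; for p < 1, y is
  repelling and the gap ends there. No moved limit point may lie on the side where the chart
  decreases.\<close>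

lemma gap_exists:
  assumes \<delta>: "\<delta> \<in> carrier \<Gamma>03" and right: "surface_on_right H \<delta>" and c: "c \<in> Lam" "H \<delta> c \<noteq> c"
  shows "\<exists>d' m d. gap \<delta> d' m d"
proof -
  obtain y where y: "cmod y = 1" "H \<delta> y = y"
    "\<And>x. x \<in> Lam \<Longrightarrow> H \<delta> x \<noteq> x \<Longrightarrow> positively_oriented y x (H \<delta> x)"
    using right by (auto simp: surface_on_right_def)
  obtain p q where p: "p > 0" "\<And>x. cmod x = 1 \<Longrightarrow> x \<noteq> y \<Longrightarrow> chart y (H \<delta> x) = p * chart y x + q"
    by (rule fixed_affine_chart[OF \<delta> y(1,2)]) (rule that)
  have st: "cmod (H \<delta> x) = 1" "H \<delta> x \<noteq> y" if "cmod x = 1" "x \<noteq> y" for x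
    using H_eq_iff[OF \<delta>, of x y] that y H_sphere[OF \<delta>, of x] by auto
  have T: "positively_oriented y x z \<longleftrightarrow> chart y x < chart y z" if "cmod x = 1" "x \<noteq> y" "cmod z = 1" "z \<noteq> y" for x z
    using positively_oriented_chart[of x z y] that y by simp
  have cy: "c \<noteq> y" using c y by auto
  have mv: "chart y x < p * chart y x + q" if "x \<in> Lam" "H \<delta> x \<noteq> x" for x
  proof -
    have "x \<noteq> y" using that y by auto
    then show ?thesis using y(3)[OF that] T[of x "H \<delta> x"] st[of x] p(2)[of x] Lam_sphere[OF that(1)] by simp
  qed
  show ?thesis
  proof (cases "p = 1")
    case True
    \<comment> \<open>The moved limit point c decides the direction of the translation.\<close>
    then have q: "q > 0" using mv[OF c] by simp
    have it: "cmod ((H \<delta> ^^ n) x) = 1 \<and> (H \<delta> ^^ n) x \<noteq> y \<and> chart y ((H \<delta> ^^ n) x) = chart y x + n * q"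
      if "cmod x = 1" "x \<noteq> y" for n x
      using that
    proof (induction n)
      case (Suc n)
      then show ?case using p(2)[of "(H \<delta> ^^ n) x"] True st by (simp add: algebra_simps)
    qed simp
    have "\<exists>n. positively_oriented y w ((H \<delta> ^^ n) x)" if "cmod x = 1" "cmod w = 1" "x \<noteq> y" "w \<noteq> y" for x w
    proof -
      obtain n :: nat where "chart y w - chart y x < n * q" using q reals_Archimedean3 by blast
      then show ?thesis using T[of w "(H \<delta> ^^ n) x"] it[of x n] that by (intro exI[of _ n]) simp
    qed
    moreover have "\<not> positively_oriented y x y" for x using positively_orientedD by blast
    moreover have "positively_oriented y x (H \<delta> x)" if "cmod x = 1" "x \<noteq> y" for x
      using T[of x "H \<delta> x"] st[OF that] p(2)[OF that] that True q by simp
    ultimately have "gap \<delta> y y y" using y by (simp add: gap_def)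
    then show ?thesis by blast
  next
    case False
    \<comment> \<open>The coordinate of the second fixed point of the affine map.\<close>
    define t0 where "t0 = q / (1 - p)"
    have t0: "p * t + q - t = (p - 1) * (t - t0)" for t using False by (simp add: t0_def field_simps)
    define z where "z = unchart y t0"
    have z: "cmod z = 1" "z \<noteq> y" "chart y z = t0" using unchart[OF y(1)] by (auto simp: z_def)
    have "p * t0 + q = t0" using t0[of t0] by simp
    then have Hz: "H \<delta> z = z" using chart_inj[of "H \<delta> z" z y] st[of z] p(2)[of z] z y by simp
    show ?thesis
    proof (cases "p > 1")
      case True
      define m where "m = unchart y (t0 - 1)"
      have m: "cmod m = 1" "m \<noteq> y" "chart y m = t0 - 1" using unchart[OF y(1)] by (auto simp: m_def)
      have "chart y (H \<delta> m) = t0 - p" using p(2)[OF m(1,2)] m(3) \<open>p * t0 + q = t0\<close> by (simp add: algebra_simps)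
      then have "positively_oriented y (H \<delta> m) m" "positively_oriented y m z"
        using T[of "H \<delta> m" m] T[of m z] st[of m] m z True by simp_all
      moreover have "\<not> positively_oriented y x z" if "x \<in> Lam" for x
      proof
        assume *: "positively_oriented y x z"
        then have x: "cmod x = 1" "x \<noteq> y" "chart y x < t0" using T[of x z] z positively_orientedD[OF *] by auto
        have "x \<noteq> z" using x z by auto
        then have "H \<delta> x \<noteq> x" using t0[of "chart y x"] p(2)[OF x(1,2)] x z True by force
        then show False using mv[OF that] t0[of "chart y x"] x True by (smt (verit) mult_pos_neg)
      qed
      moreover have "positively_oriented z x (H \<delta> x)"
        if x: "cmod x = 1" "x \<noteq> z" "x \<noteq> y" "\<not> positively_oriented y x z" for x
      proof -
        have "chart y x > t0"
          using T[of x z] x z chart_inj[of x z y] y by force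
        then have "chart y (H \<delta> x) > chart y x" using t0[of "chart y x"] p(2)[of x] x True
          by (smt (verit) mult_pos_pos)
        then have 1: "positively_oriented y z x" "positively_oriented y x (H \<delta> x)"
          using T[of z x] T[of x "H \<delta> x"] st[of x] x z \<open>chart y x > t0\<close> by simp_all
        have "positively_oriented x (H \<delta> x) z"
          using positively_oriented_trans[of x "H \<delta> x" y z] 1 positively_oriented_rotate by blast
        then show ?thesis using positively_oriented_rotate by blast
      qed
      ultimately have "gap \<delta> y m z" using y z m Hz by (simp add: gap_def)
      then show ?thesis by blast
    next
      case False
      then have p1: "p < 1" using \<open>p \<noteq> 1\<close> by simp
      define m where "m = unchart y (t0 + 1)"
      have m: "cmod m = 1" "m \<noteq> y" "chart y m = t0 + 1" using unchart[OF y(1)] by (auto simp: m_def)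
      have "chart y (H \<delta> m) = t0 + p" using p(2)[OF m(1,2)] m(3) \<open>p * t0 + q = t0\<close> by (simp add: algebra_simps)
      then have 1: "positively_oriented y z (H \<delta> m)" "positively_oriented y (H \<delta> m) m" "positively_oriented y z m"
        using T[of "H \<delta> m" m] T[of z "H \<delta> m"] T[of z m] st[of m] m z p1 p(1) by simp_all
      have "positively_oriented z (H \<delta> m) m" "positively_oriented z m y"
        using positively_oriented_trans[of "H \<delta> m" m y z] 1 positively_oriented_rotate by blast+
      moreover have zx: "positively_oriented z x y \<longleftrightarrow> positively_oriented y z x" for x
        using positively_oriented_rotate by blast
      moreover have "\<not> positively_oriented y z x" if "x \<in> Lam" for x
      proof
        assume *: "positively_oriented y z x"
        then have x: "cmod x = 1" "x \<noteq> y" "chart y x > t0" using T[of z x] z positively_orientedD[OF *] by auto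
        then have "H \<delta> x \<noteq> x" using t0[of "chart y x"] p(2)[OF x(1,2)] x z p1 by force
        then show False using mv[OF that] t0[of "chart y x"] x p1 by (smt (verit) mult_neg_pos)
      qed
      moreover have "positively_oriented y x (H \<delta> x)"
        if x: "cmod x = 1" "x \<noteq> y" "x \<noteq> z" "\<not> positively_oriented y z x" for x
      proof -
        have "chart y x < t0"
          using T[of z x] x z chart_inj[of x z y] y by force
        then have "chart y (H \<delta> x) > chart y x" using t0[of "chart y x"] p(2)[of x] x p1
          by (smt (verit) mult_neg_neg)
        then show ?thesis using T[of x "H \<delta> x"] st[of x] x by simp
      qed
      ultimately have "gap \<delta> z m y" using y z m Hz by (simp add: gap_def)
      then show ?thesis by blast
    qed
  qed
qed

end

text \<open>The circle cut open at k. Bounding the chart by arctan leaves room to put k itself at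
  -2, below all other points, and to use 2 as an upper end.\<close>

definition pos :: "complex \<Rightarrow> complex \<Rightarrow> real" where
  "pos k x = (if x = k then - 2 else arctan (chart k x))"

definition cyc3 :: "real \<Rightarrow> real \<Rightarrow> real \<Rightarrow> bool" where
  "cyc3 a b c \<longleftrightarrow> a < b \<and> b < c \<or> b < c \<and> c < a \<or> c < a \<and> a < b"

lemma pos_bounds: "- 2 \<le> pos k x" "pos k x < 2" "x \<noteq> k \<Longrightarrow> - 2 < pos k x"
  using arctan_bounded[of "chart k x"] pi_less_4 by (auto simp: pos_def)

lemma pos_self [simp]: "pos k k = - 2"
  by (simp add: pos_def)

lemma pos_eq_iff:
  assumes "cmod k = 1" "cmod x = 1" "cmod y = 1"
  shows "pos k x = pos k y \<longleftrightarrow> x = y"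
  using chart_inj[of x y k] assms pos_bounds(3)[of x k] pos_bounds(3)[of y k]
  by (cases "x = k"; cases "y = k") (auto simp: pos_def arctan_eq_iff)

lemma pos_from:
  assumes "cmod k = 1" "cmod x = 1" "cmod y = 1"
  shows "positively_oriented k x y \<longleftrightarrow> pos k k < pos k x \<and> pos k x < pos k y"
proof (cases "x = k \<or> y = k")
  case True
  then show ?thesis using positively_orientedD[of k x y] pos_bounds(1)[of k x] by force
next
  case False
  then show ?thesis
    using positively_oriented_chart[of x y k] assms pos_bounds(3)[of x k] by (simp add: pos_def arctan_less_iff)
qed

lemma positively_oriented_pos:
  assumes k: "cmod k = 1" and "cmod x = 1" "cmod y = 1" "cmod z = 1"
  shows "positively_oriented x y z \<longleftrightarrow> cyc3 (pos k x) (pos k y) (pos k z)"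
proof -
  have *: "positively_oriented x y z"
    if "cmod x = 1" "cmod y = 1" "cmod z = 1" "pos k x < pos k y" "pos k y < pos k z" for x y z
  proof (cases "x = k")
    case True
    then show ?thesis using that pos_from[OF k, of y z] by simp
  next
    case False
    then have "positively_oriented k x y" "positively_oriented k y z"
      using that pos_from[OF k, of x y] pos_from[OF k, of y z] pos_bounds(3)[of x k] by auto
    then show ?thesis
      using positively_oriented_trans[of y z k x] positively_oriented_rotate by blast
  qed
  have r: "positively_oriented x y z" if "cyc3 (pos k x) (pos k y) (pos k z)"
      "cmod x = 1" "cmod y = 1" "cmod z = 1" for x y z
    using that *[of x y z] *[of y z x] *[of z x y] positively_oriented_rotate unfolding cyc3_def by blast
  have "cyc3 (pos k x) (pos k y) (pos k z)" if T: "positively_oriented x y z"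
  proof (rule ccontr)
    assume n: "\<not> cyc3 (pos k x) (pos k y) (pos k z)"
    have "pos k x \<noteq> pos k y" "pos k y \<noteq> pos k z" "pos k x \<noteq> pos k z"
      using positively_orientedD[OF T] pos_eq_iff[OF k] by auto
    then have "cyc3 (pos k x) (pos k z) (pos k y)" using n unfolding cyc3_def by linarith
    then show False using r[of x z y] assms positively_oriented_asym[OF T] by blast
  qed
  then show ?thesis using r assms by blast
qed

text \<open>Cutting the circle at w makes e', x, e linearly ordered, because w lies outside the
  arc.\<close>

lemma arc_outside:
  assumes T: "positively_oriented e' x e" and w: "cmod w = 1" "w \<noteq> e'" "w \<noteq> e" "\<not> positively_oriented e' w e"
  shows "positively_oriented w e' x" "positively_oriented w x e"
proof -
  note u = positively_orientedD[OF T]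
  have "pos w w < pos w e'" "pos w w < pos w e" using w pos_bounds(3) by auto
  moreover have "x \<noteq> w" using T w by auto
  then have "pos w w < pos w x" using pos_bounds(3) by auto
  moreover have "cyc3 (pos w e') (pos w x) (pos w e)" "\<not> cyc3 (pos w e') (pos w w) (pos w e)"
    using T w u positively_oriented_pos[OF w(1)] by auto
  ultimately have "pos w w < pos w e' \<and> pos w e' < pos w x \<and> pos w x < pos w e"
    unfolding cyc3_def by linarith
  then show "positively_oriented w e' x" "positively_oriented w x e"
    using pos_from[OF w(1)] u by auto
qed

section \<open>Placing the three gaps on the circle\<close>

context hyp
begin

text \<open>The part of parabolicity that the coding needs: every orbit eventually passes every
  point on its way counterclockwise into d.\<close>

definition contracting :: "(complex \<Rightarrow> complex) \<Rightarrow> complex \<Rightarrow> bool" where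
  "contracting g d \<longleftrightarrow> (\<forall>x w. cmod x = 1 \<and> cmod w = 1 \<and> x \<noteq> d \<and> w \<noteq> d \<longrightarrow>
          (\<exists>n. positively_oriented d w ((g ^^ n) x)))"

lemma gap_arc_invariant:
  assumes \<delta>: "\<delta> \<in> carrier \<Gamma>03" and d: "H \<delta> d' = d'" "H \<delta> d = d" "cmod d' = 1" "cmod d = 1" and x: "cmod x = 1"
  shows "(H \<delta> x = d' \<or> H \<delta> x = d \<or> positively_oriented d' (H \<delta> x) d) \<longleftrightarrow>
    (x = d' \<or> x = d \<or> positively_oriented d' x d)"
proof -
  have "positively_oriented d' (H \<delta> x) d \<Longrightarrow> positively_oriented d' x d"
    using H_positively_oriented[of "inv\<^bsub>\<Gamma>03\<^esub> \<delta>" d' "H \<delta> x" d] H_inv(2)[OF \<delta>, of d'] H_inv(2)[OF \<delta>, of d]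
      H_inv(2)[OF \<delta>, of x] assms by simp
  then show ?thesis
    using H_positively_oriented[OF \<delta>, of d' x d] H_eq_iff[OF \<delta>, of x d'] H_eq_iff[OF \<delta>, of x d] assms by auto
qed

text \<open>A common point x would lie in both open arcs. Cutting the circle at x, each arc becomes
  the outside of an interval, and the end points of each interval would have to lie strictly within
  the other.\<close>

lemma arcs_disjoint:
  assumes unit: "cmod d' = 1" "cmod d = 1" "cmod e' = 1" "cmod e = 1" "cmod x = 1"
    and d: "\<not> positively_oriented d' e' d" "\<not> positively_oriented d' e d"
    and e: "\<not> positively_oriented e' d' e" "\<not> positively_oriented e' d e"
    and ne: "d \<noteq> e" "d \<noteq> e'" "d' \<noteq> e" "d' \<noteq> e'"
    and x: "x = d' \<or> x = d \<or> positively_oriented d' x d"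
  shows "\<not> (x = e' \<or> x = e \<or> positively_oriented e' x e)"
proof
  assume x': "x = e' \<or> x = e \<or> positively_oriented e' x e"
  then have T: "positively_oriented d' x d" "positively_oriented e' x e" using x d e ne by auto
  have "pos x d \<noteq> pos x e" "pos x d \<noteq> pos x e'" "pos x d' \<noteq> pos x e" "pos x d' \<noteq> pos x e'"
    using ne pos_eq_iff[OF unit(5)] unit by auto
  then show False
    using T d e unit by (simp add: positively_oriented_pos[OF unit(5)]) (smt (verit) cyc3_def)
qed

text \<open>The points k, m, n are taken from the gaps of \<open>inv (\<alpha>\<beta>)\<close>,
  \<alpha> and \<beta>, which are disjoint because these elements share no fixed point. With A and B
  for the inverses of \<alpha> and \<beta>, the cyclic order is k, \<alpha> m, m, A k, \<beta> n, n,
  B A k, with coincidences at cusps. These are the end points of the four coding arcs.\<close>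

lemma fundamental_points:
  obtains k m n where "cmod k = 1" "cmod m = 1" "cmod n = 1"
    "H \<alpha> m = m \<or> positively_oriented k (H \<alpha> m) m"
    "positively_oriented k (H \<alpha> m) (H [(Gen_\<alpha>, False)] k)" "positively_oriented k m (H [(Gen_\<alpha>, False)] k)"
    "positively_oriented k (H [(Gen_\<alpha>, False)] k) (H \<beta> n)"
    "positively_oriented k (H [(Gen_\<alpha>, False)] k) n"
    "H \<beta> n = n \<or> positively_oriented k (H \<beta> n) n"
    "H [(Gen_\<beta>, False)] (H [(Gen_\<alpha>, False)] k) = k \<or>
       positively_oriented k n (H [(Gen_\<beta>, False)] (H [(Gen_\<alpha>, False)] k))"
    "H \<alpha> m = m \<Longrightarrow> contracting (H \<alpha>) m"
    "H \<beta> n = n \<Longrightarrow> contracting (H \<beta>) n"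
    "H [(Gen_\<beta>, False)] (H [(Gen_\<alpha>, False)] k) = k \<Longrightarrow>
       contracting (H [(Gen_\<beta>, False)] \<circ> H [(Gen_\<alpha>, False)]) k"
proof -
  define A B where "A = H [(Gen_\<alpha>, False)]" and "B = H [(Gen_\<beta>, False)]"
  define \<gamma> where "\<gamma> = inv\<^bsub>\<Gamma>03\<^esub> (\<alpha> \<otimes>\<^bsub>\<Gamma>03\<^esub> \<beta>)"
  have c: "\<alpha> \<in> carrier \<Gamma>03" "\<beta> \<in> carrier \<Gamma>03" "\<gamma> \<in> carrier \<Gamma>03"
    by (simp_all add: \<alpha>_def \<beta>_def \<gamma>_def)
  have ne1: "\<alpha> \<noteq> \<one>\<^bsub>\<Gamma>03\<^esub>" "\<beta> \<noteq> \<one>\<^bsub>\<Gamma>03\<^esub>" by (simp_all add: \<alpha>_def \<beta>_def one_\<Gamma>03)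
  have "\<alpha> \<otimes>\<^bsub>\<Gamma>03\<^esub> \<beta> \<noteq> \<one>\<^bsub>\<Gamma>03\<^esub>" by (simp add: \<alpha>_def \<beta>_def mult_\<Gamma>03 one_\<Gamma>03 gbar_def)
  then have ne2: "\<gamma> \<noteq> \<one>\<^bsub>\<Gamma>03\<^esub>" using c unfolding \<gamma>_def by simp
  have A: "H \<alpha> (A z) = z" "A (H \<alpha> z) = z" if "cmod z \<le> 1" for z
    using H_letter_inv[OF that, of "(Gen_\<alpha>, True)"] H_letter_inv[OF that, of "(Gen_\<alpha>, False)"]
    by (simp_all add: A_def \<alpha>_def gbar_def)
  have B: "H \<beta> (B z) = z" "B (H \<beta> z) = z" if "cmod z \<le> 1" for z
    using H_letter_inv[OF that, of "(Gen_\<beta>, True)"] H_letter_inv[OF that, of "(Gen_\<beta>, False)"]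
    by (simp_all add: B_def \<beta>_def gbar_def)
  have un: "cmod (A z) = 1" "cmod (B z) = 1" "cmod (H \<alpha> z) = 1" "cmod (H \<beta> z) = 1" "cmod (H \<gamma> z) = 1" if "cmod z = 1" for z
    using that H_sphere c by (simp_all add: A_def B_def)
  have AT: "positively_oriented x y z \<Longrightarrow> positively_oriented (A x) (A y) (A z)" for x y z
    unfolding A_def by (rule H_positively_oriented) simp
  have \<gamma>BA: "H \<gamma> z = B (A z)" if "cmod z = 1" for z
  proof -
    have "H \<alpha> (H \<beta> (H \<gamma> z)) = z"
      using H_inv(1)[of "\<alpha> \<otimes>\<^bsub>\<Gamma>03\<^esub> \<beta>" z] c that H_ball[OF c(3), of z] by (simp add: H_mult \<gamma>_def)
    then show ?thesis using A(2)[of "H \<beta> (H \<gamma> z)"] B(2)[of "H \<gamma> z"] un that by simp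
  qed
  \<comment> \<open>Of \<alpha>, \<beta> and their inverse product, any two generate the group, so a
    common fixed point of two is fixed by both generators.\<close>
  have two: False if "cmod y = 1" "H \<delta> y = y" "H \<epsilon> y = y" "\<delta> \<noteq> \<epsilon>" "{\<delta>, \<epsilon>} \<subseteq> {\<alpha>, \<beta>, \<gamma>}" for y \<delta> \<epsilon>
  proof -
    have "H \<beta> y = y" if "H \<alpha> y = y" "H \<gamma> y = y"
      using that A(2)[of y] B(1)[of y] \<gamma>BA[of y] \<open>cmod y = 1\<close> by simp
    moreover have "H \<alpha> y = y" if "H \<beta> y = y" "H \<gamma> y = y"
      using that A(1)[of y] B(1)[of "A y"] \<gamma>BA[of y] un(1)[of y] \<open>cmod y = 1\<close> by simp
    ultimately have "H \<alpha> y = y \<and> H \<beta> y = y"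
      using that by blast
    then show False using no_common_fixed that(1) by blast
  qed
  have dist: "\<alpha> \<noteq> \<beta>" "\<gamma> \<noteq> \<alpha>" "\<gamma> \<noteq> \<beta>"
  proof -
    show "\<alpha> \<noteq> \<beta>" by (simp add: \<alpha>_def \<beta>_def)
    have "inv\<^bsub>\<Gamma>03\<^esub> \<gamma> = \<alpha> \<otimes>\<^bsub>\<Gamma>03\<^esub> \<beta>" using c by (simp add: \<gamma>_def)
    moreover have "inv\<^bsub>\<Gamma>03\<^esub> \<alpha> = [(Gen_\<alpha>, False)]" "inv\<^bsub>\<Gamma>03\<^esub> \<beta> = [(Gen_\<beta>, False)]"
      using c by (auto intro!: F.inv_equality simp: mult_\<Gamma>03 one_\<Gamma>03 \<alpha>_def \<beta>_def gbar_def)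
    ultimately show "\<gamma> \<noteq> \<alpha>" "\<gamma> \<noteq> \<beta>" by (auto simp: mult_\<Gamma>03 \<alpha>_def \<beta>_def gbar_def)
  qed
  have fixLam: "y \<in> Lam" if "cmod y = 1" "H \<delta> y = y" "\<delta> \<in> {\<alpha>, \<beta>, \<gamma>}" for y \<delta>
    using fixed_in_Lam[OF infinite_stabilizer[of \<delta> y]] that c ne1 ne2 by auto
  have ex: "\<exists>y. cmod y = 1 \<and> H \<delta> y = y" if "\<delta> \<in> {\<alpha>, \<beta>, \<gamma>}" for \<delta>
    using that H_right unfolding surface_on_right_def \<gamma>_def by auto
  obtain ya yc where y: "cmod ya = 1" "H \<alpha> ya = ya" "cmod yc = 1" "H \<gamma> yc = yc"
    using ex[of \<alpha>] ex[of \<gamma>] by auto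
  have yL: "ya \<in> Lam" "yc \<in> Lam" using fixLam y by auto
  have nf: "H \<gamma> ya \<noteq> ya" "H \<alpha> yc \<noteq> yc" "H \<beta> yc \<noteq> yc"
    using two[of ya \<gamma> \<alpha>] two[of yc \<gamma> \<alpha>] two[of yc \<gamma> \<beta>] y dist by auto
  obtain a' m a where ga: "gap \<alpha> a' m a" using gap_exists[OF c(1) H_right(1) yL(2) nf(2)] by blast
  obtain b' n b where gb: "gap \<beta> b' n b" using gap_exists[OF c(2) H_right(2) yL(2) nf(3)] by blast
  obtain c' k d where gc: "gap \<gamma> c' k d" using gap_exists[OF c(3) H_right(3)[folded \<gamma>_def] yL(1) nf(1)] by blast
  have u: "cmod a' = 1" "cmod m = 1" "cmod a = 1" "cmod b' = 1" "cmod n = 1" "cmod b = 1"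
     "cmod c' = 1" "cmod k = 1" "cmod d = 1"
    using ga gb gc by (auto simp: gap_def)
  have fixd: "H \<alpha> a' = a'" "H \<alpha> a = a" "H \<beta> b' = b'" "H \<beta> b = b" "H \<gamma> c' = c'" "H \<gamma> d = d"
    using ga gb gc by (auto simp: gap_def)
  have L: "a' \<in> Lam" "a \<in> Lam" "b' \<in> Lam" "b \<in> Lam" "c' \<in> Lam" "d \<in> Lam"
    using fixLam u fixd by auto
  have nab: "x \<noteq> z" if "x \<in> {a', a}" "z \<in> {b', b}" for x z
    using two[of x \<alpha> \<beta>] that fixd u dist by auto
  have nac: "x \<noteq> z" if "x \<in> {a', a}" "z \<in> {c', d}" for x z
    using two[of x \<alpha> \<gamma>] that fixd u dist by auto
  have nbc: "x \<noteq> z" if "x \<in> {b', b}" "z \<in> {c', d}" for x z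
    using two[of x \<beta> \<gamma>] that fixd u dist by auto
  have Lf: "\<not> positively_oriented a' x a" "\<not> positively_oriented b' x b" "\<not> positively_oriented c' x d" if "x \<in> Lam" for x
    using that ga gb gc by (auto simp: gap_def)
  define U where "U e' e x \<longleftrightarrow> x = e' \<or> x = e \<or> positively_oriented e' x e" for e' e x :: complex
  have Uac: "U c' d x \<Longrightarrow> cmod x = 1 \<Longrightarrow> \<not> U a' a x" and Ubc: "U c' d x \<Longrightarrow> cmod x = 1 \<Longrightarrow> \<not> U b' b x"
    and Uab: "U a' a x \<Longrightarrow> cmod x = 1 \<Longrightarrow> \<not> U b' b x" for x
  proof -
    note Ls = Lf[OF L(1)] Lf[OF L(2)] Lf[OF L(3)] Lf[OF L(4)] Lf[OF L(5)] Lf[OF L(6)]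
    note ns = nab[of a' b'] nab[of a' b] nab[of a b'] nab[of a b] nac[of a' c'] nac[of a' d] nac[of a c'] nac[of a d]
      nbc[of b' c'] nbc[of b' d] nbc[of b c'] nbc[of b d]
    show "\<not> U a' a x" if "U c' d x" "cmod x = 1"
      using arcs_disjoint[of c' d a' a x] u Ls ns that by (simp add: U_def)
    show "\<not> U b' b x" if "U c' d x" "cmod x = 1"
      using arcs_disjoint[of c' d b' b x] u Ls ns that by (simp add: U_def)
    show "\<not> U b' b x" if "U a' a x" "cmod x = 1"
      using arcs_disjoint[of a' a b' b x] u Ls ns that by (simp add: U_def)
  qed
  have gU: "U e' e m" "U e' e (H \<delta> m)" "H \<delta> m = m \<or> positively_oriented e' (H \<delta> m) m \<and> positively_oriented e' m e"
      "H \<delta> m = m \<Longrightarrow> e' = e \<and> m = e \<and> contracting (H \<delta>) m"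
    if "gap \<delta> e' m e" for \<delta> e' m e
  proof -
    have *: "(e' = e \<and> m = e \<and> contracting (H \<delta>) m) \<or> (positively_oriented e' (H \<delta> m) m \<and> positively_oriented e' m e)"
      "H \<delta> e = e" using that by (auto simp: gap_def contracting_def)
    then show "U e' e m" "H \<delta> m = m \<or> positively_oriented e' (H \<delta> m) m \<and> positively_oriented e' m e"
      by (auto simp: U_def)
    show "U e' e (H \<delta> m)" using * positively_oriented_trans by (auto simp: U_def)
    show "e' = e \<and> m = e \<and> contracting (H \<delta>) m" if "H \<delta> m = m"
      using * that positively_orientedD(5)[of e' m m] by auto
  qed
  have gdyn: "positively_oriented e x (H \<delta> x)" if "gap \<delta> e' m e" "cmod x = 1" "\<not> U e' e x" for \<delta> e' m e x
    using that by (auto simp: gap_def U_def)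
  have \<beta>\<gamma>: "H \<beta> (H \<gamma> z) = A z" if "cmod z = 1" for z
    using \<gamma>BA[OF that] B(1)[of "A z"] un(1)[OF that] by simp
  have Uinv: "U a' a (H \<alpha> x) \<longleftrightarrow> U a' a x" "U b' b (H \<beta> x) \<longleftrightarrow> U b' b x" if "cmod x = 1" for x
    unfolding U_def using gap_arc_invariant[OF c(1) fixd(1,2) u(1,3) that]
      gap_arc_invariant[OF c(2) fixd(3,4) u(4,6) that] by blast+
  \<comment> \<open>A point of the gap of \<gamma>, and hence also its image under A, is outside the
    gap of \<alpha>, so \<alpha> moves A x forwards to x.\<close>
  have d1: "positively_oriented a (A x) x" if "U c' d x" "cmod x = 1" for x
    using gdyn[OF ga, of "A x"] Uinv(1)[of "A x"] Uac[OF that] A(1)[of x] un(1)[of x] that by simp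
  have d2: "positively_oriented b (H \<gamma> k) (A k)"
    using gdyn[OF gb, of "H \<gamma> k"] Ubc[OF gU(2)[OF gc]] \<beta>\<gamma>[of k] un u by simp
  have nUb: "\<not> U b' b (A k)"
    using Uinv(2)[of "H \<gamma> k"] Ubc[OF gU(2)[OF gc]] \<beta>\<gamma>[of k] un u by simp
  have aUc: "\<not> U c' d a" using Uac[of a] u by (auto simp: U_def)
  have aUb: "\<not> U b' b a" using Uab[of a] u by (auto simp: U_def)
  have bUc: "\<not> U c' d b" using Ubc[of b] u by (auto simp: U_def)
  have d3: "positively_oriented a (A k) (A d)" if "k \<noteq> d"
  proof -
    have "positively_oriented a k d"
      using arc_outside(2)[of c' k d a] aUc gU(3,4)[OF gc] that u by (auto simp: U_def)
    then show ?thesis using AT A(2)[of a] fixd(2) u by force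
  qed
  have ALam: "A d \<in> Lam" using Lam_invariant[OF L(6)] by (simp add: A_def)
  note P = positively_oriented_pos[of a, OF u(3)]
  \<comment> \<open>Positions are measured from a, where the order to prove is A k, \<beta> n, n, b,
    c', \<gamma> k, k; after these come \<alpha> m and m, unless m = a.\<close>
  define p where "p = pos a"
  have p0: "p a = - 2" by (simp add: p_def)
  have pa: "- 2 < p x" if "x \<noteq> a" for x using pos_bounds(3)[OF that] by (simp add: p_def)
  have from_a: "- 2 < p x \<and> p x < p z" if "positively_oriented a x z" for x z
    using pos_from[OF u(3), of x z] positively_orientedD[OF that] that by (simp add: p_def)
  have c1: "p c' \<le> p (H \<gamma> k)" "p (H \<gamma> k) \<le> p k" "p k \<le> p d" "H \<gamma> k = k \<and> c' = k \<and> k = d \<or>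
      p c' < p (H \<gamma> k) \<and> p (H \<gamma> k) < p k \<and> p k < p d"
  proof -
    have "p c' < p (H \<gamma> k) \<and> p (H \<gamma> k) < p k \<and> p k < p d" if "positively_oriented c' (H \<gamma> k) k" "positively_oriented c' k d"
    proof -
      have a: "a \<noteq> c'" "a \<noteq> d" "\<not> positively_oriented c' a d" using aUc by (auto simp: U_def)
      have "positively_oriented a c' k" "positively_oriented a k d"
        using arc_outside[OF that(2) u(3) a] by auto
      moreover have "a \<noteq> k" "\<not> positively_oriented c' a k"
        using that a positively_oriented_trans by blast+
      then have "positively_oriented a c' (H \<gamma> k)" "positively_oriented a (H \<gamma> k) k"
        using arc_outside[OF that(1) u(3) a(1)] by auto
      ultimately show ?thesis using from_a by blast
    qed
    then show "H \<gamma> k = k \<and> c' = k \<and> k = d \<or> p c' < p (H \<gamma> k) \<and> p (H \<gamma> k) < p k \<and> p k < p d"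
      using gU(3,4)[OF gc] by auto
    then show "p c' \<le> p (H \<gamma> k)" "p (H \<gamma> k) \<le> p k" "p k \<le> p d" by auto
  qed
  have Akc: "- 2 < p (A k)" "p (A k) < p c'"
  proof -
    have 1: "- 2 < p (A k) \<and> p (A k) < p k" using from_a[OF d1[OF gU(1)[OF gc] u(8)]] .
    then show "- 2 < p (A k)" by simp
    show "p (A k) < p c'"
    proof (cases "k = d")
      case True
      then show ?thesis using c1(4) 1 by auto
    next
      case False
      have "p (A k) < p (A d)" using from_a[OF d3[OF False]] by simp
      moreover have "p (A d) < p d" using from_a[OF d1[of d]] u by (simp add: U_def)
      moreover have "\<not> cyc3 (p c') (p (A d)) (p d)"
        using Lf(3)[OF ALam] P[of c' "A d" d] u un by (simp add: p_def)
      ultimately show ?thesis using c1 unfolding cyc3_def by linarith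
    qed
  qed
  have pb: "p (A k) < p b" "p b < p c'"
  proof -
    have "cyc3 (p b) (p (H \<gamma> k)) (p (A k))" using d2 P[of b "H \<gamma> k" "A k"] u un by (simp add: p_def)
    then have 1: "p (A k) < p b" "p b < p (H \<gamma> k)" using Akc c1 unfolding cyc3_def by linarith+
    then show "p (A k) < p b" by simp
    have "\<not> cyc3 (p c') (p b) (p d)" "p b \<noteq> p c'"
      using bUc P[of c' b d] pos_eq_iff[of a b c'] u by (auto simp: U_def p_def)
    then show "p b < p c'" using 1 c1 unfolding cyc3_def by linarith
  qed
  have b1: "p (A k) < p (H \<beta> n)" "p (H \<beta> n) \<le> p n" "p n \<le> p b" "H \<beta> n = n \<or> p (H \<beta> n) < p n"
  proof -
    have "H \<beta> n = n \<and> n = b \<or> p (A k) < p (H \<beta> n) \<and> p (H \<beta> n) < p n \<and> p n < p b"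
    proof (cases "H \<beta> n = n")
      case False
      then have T: "positively_oriented b' (H \<beta> n) n" "positively_oriented b' n b" using gU(3)[OF gb] by auto
      have a: "a \<noteq> b'" "a \<noteq> b" "\<not> positively_oriented b' a b" using aUb by (auto simp: U_def)
      have "positively_oriented a b' n" "positively_oriented a n b"
        using arc_outside[OF T(2) u(3) a] by auto
      moreover have "a \<noteq> n" "\<not> positively_oriented b' a n"
        using T a positively_oriented_trans by blast+
      then have "positively_oriented a b' (H \<beta> n)" "positively_oriented a (H \<beta> n) n"
        using arc_outside[OF T(1) u(3) a(1)] by auto
      ultimately have 1: "p b' < p (H \<beta> n)" "p (H \<beta> n) < p n" "p n < p b" using from_a by blast+
      have "\<not> cyc3 (p b') (p (A k)) (p b)" using nUb P[of b' "A k" b] u un by (simp add: U_def p_def)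
      then have "p (A k) \<le> p b'" using 1 pb unfolding cyc3_def by linarith
      then show ?thesis using 1 by auto
    qed (use gU(4)[OF gb] in auto)
    then show "p (A k) < p (H \<beta> n)" "p (H \<beta> n) \<le> p n" "p n \<le> p b" "H \<beta> n = n \<or> p (H \<beta> n) < p n"
      using pb by auto
  qed
  have a1: "H \<alpha> m = m \<and> p (H \<alpha> m) = - 2 \<and> p m = - 2 \<or> p k < p (H \<alpha> m) \<and> p (H \<alpha> m) < p m"
  proof (cases "H \<alpha> m = m")
    case True
    then show ?thesis using gU(4)[OF ga] p0 by auto
  next
    case False
    then have T: "positively_oriented a' (H \<alpha> m) m" "positively_oriented a' m a" using gU(3)[OF ga] by auto
    then have cy: "cyc3 (p a') (p (H \<alpha> m)) (p m)" "cyc3 (p a') (p m) (- 2)"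
      using P[of a' "H \<alpha> m" m] P[of a' m a] u un by (simp_all add: p_def)
    have "\<not> U a' a k" using Uac[OF gU(1)[OF gc] u(8)] .
    then have "\<not> cyc3 (p a') (p k) (- 2)" "p k \<noteq> p a'"
      using P[of a' k a] pos_eq_iff[of a k a'] u by (auto simp: U_def p_def)
    moreover have "- 2 < p m" "- 2 < p a'" "- 2 < p k" using pa[of m] pa[of a'] T positively_orientedD[OF T(2)] Akc c1 by auto
    ultimately show ?thesis using cy unfolding cyc3_def by linarith
  qed
  have \<gamma>k: "H [(Gen_\<beta>, False)] (H [(Gen_\<alpha>, False)] k) = H \<gamma> k"
    using \<gamma>BA[OF u(8)] by (simp add: A_def B_def)
  have contr: "contracting (H [(Gen_\<beta>, False)] \<circ> H [(Gen_\<alpha>, False)]) k" if "H \<gamma> k = k"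
  proof -
    have "((H [(Gen_\<beta>, False)] \<circ> H [(Gen_\<alpha>, False)]) ^^ i) x = (H \<gamma> ^^ i) x \<and> cmod ((H \<gamma> ^^ i) x) = 1"
      if "cmod x = 1" for i x
    proof (induction i)
      case (Suc i)
      then show ?case using \<gamma>BA[of "(H \<gamma> ^^ i) x"] un by (simp add: A_def B_def)
    qed (simp add: that)
    moreover have "contracting (H \<gamma>) k" using gU(4)[OF gc that] by blast
    ultimately show ?thesis by (simp add: contracting_def)
  qed
  have Pk: "positively_oriented x y z \<longleftrightarrow> cyc3 (p x) (p y) (p z)"
    if "cmod x = 1" "cmod y = 1" "cmod z = 1" for x y z
    using P[OF that] by (simp add: p_def)
  have "H \<alpha> m = m \<or> cyc3 (p k) (p (H \<alpha> m)) (p m)"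
    "cyc3 (p k) (p (H \<alpha> m)) (p (A k))" "cyc3 (p k) (p m) (p (A k))"
    using a1 Akc c1(1,2) unfolding cyc3_def by linarith+
  then have r1: "H \<alpha> m = m \<or> positively_oriented k (H \<alpha> m) m"
    "positively_oriented k (H \<alpha> m) (A k)" "positively_oriented k m (A k)"
    using Pk[OF u(8) un(3)[OF u(2)] u(2)] Pk[OF u(8) un(3)[OF u(2)] un(1)[OF u(8)]]
      Pk[OF u(8) u(2) un(1)[OF u(8)]] by blast+
  have "cyc3 (p k) (p (A k)) (p (H \<beta> n))" "cyc3 (p k) (p (A k)) (p n)"
    "H \<beta> n = n \<or> cyc3 (p k) (p (H \<beta> n)) (p n)"
    using b1 Akc c1(1,2) pb unfolding cyc3_def by linarith+
  then have r2: "positively_oriented k (A k) (H \<beta> n)" "positively_oriented k (A k) n"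
    "H \<beta> n = n \<or> positively_oriented k (H \<beta> n) n"
    using Pk[OF u(8) un(1)[OF u(8)] un(4)[OF u(5)]] Pk[OF u(8) un(1)[OF u(8)] u(5)]
      Pk[OF u(8) un(4)[OF u(5)] u(5)] by blast+
  have "H \<gamma> k = k \<or> cyc3 (p k) (p n) (p (H \<gamma> k))"
    using b1 Akc c1 pb unfolding cyc3_def by linarith
  then have r3: "H \<gamma> k = k \<or> positively_oriented k n (H \<gamma> k)"
    using Pk[OF u(8) u(5) un(5)[OF u(8)]] by blast
  show thesis
    by (rule that[of k m n])
      (use u gU(4)[OF ga] gU(4)[OF gb] contr r1 r2 r3 in \<open>simp_all only: \<gamma>k A_def\<close>)
qed

end

section \<open>Coding of the circle\<close>

abbreviation (input) "la \<equiv> (Gen_\<alpha>, True)"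
abbreviation (input) "lA \<equiv> (Gen_\<alpha>, False)"
abbreviation (input) "lb \<equiv> (Gen_\<beta>, True)"
abbreviation (input) "lB \<equiv> (Gen_\<beta>, False)"

lemma letter_cases: "l = la \<or> l = lA \<or> l = lb \<or> l = lB"
  by (cases l; cases "fst l"; cases "snd l") auto

lemma gbar_letters [simp]: "gbar la = lA" "gbar lA = la" "gbar lb = lB" "gbar lB = lb"
  by (simp_all add: gbar_def)

text \<open>The inequalities place the arcs of a, A, b, B one after the other: from k to a m, from m
  to A k, from A k to b n, from n to B A k. The second and third always touch; the alternatives with
  an equation describe cusps, where further neighbours touch.\<close>

locale pants = hyp +
  fixes k m n :: complex
  assumes unit: "cmod k = 1" "cmod m = 1" "cmod n = 1"
    and m_gap: "H [la] m = m \<or> positively_oriented k (H [la] m) m"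
    and m_pos: "positively_oriented k (H [la] m) (H [lA] k)" "positively_oriented k m (H [lA] k)"
    and n_pos: "positively_oriented k (H [lA] k) (H [lb] n)" "positively_oriented k (H [lA] k) n"
    and n_gap: "H [lb] n = n \<or> positively_oriented k (H [lb] n) n"
    and k_gap: "H [lB] (H [lA] k) = k \<or> positively_oriented k n (H [lB] (H [lA] k))"
    and m_contracting: "H [la] m = m \<Longrightarrow> contracting (H [la]) m"
    and n_contracting: "H [lb] n = n \<Longrightarrow> contracting (H [lb]) n"
    and k_contracting: "H [lB] (H [lA] k) = k \<Longrightarrow> contracting (H [lB] \<circ> H [lA]) k"

lemma (in hyp) pants_exists: "\<exists>k m n. pants H k m n"
proof (rule fundamental_points[unfolded \<alpha>_def \<beta>_def])
  fix k m n
  assume "cmod k = 1" "cmod m = 1" "cmod n = 1"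
    "H [la] m = m \<or> positively_oriented k (H [la] m) m"
    "positively_oriented k (H [la] m) (H [lA] k)" "positively_oriented k m (H [lA] k)"
    "positively_oriented k (H [lA] k) (H [lb] n)" "positively_oriented k (H [lA] k) n"
    "H [lb] n = n \<or> positively_oriented k (H [lb] n) n"
    "H [lB] (H [lA] k) = k \<or> positively_oriented k n (H [lB] (H [lA] k))"
    "H [la] m = m \<Longrightarrow> contracting (H [la]) m"
    "H [lb] n = n \<Longrightarrow> contracting (H [lb]) n"
    "H [lB] (H [lA] k) = k \<Longrightarrow> contracting (H [lB] \<circ> H [lA]) k"
  then have "pants H k m n" by unfold_locales
  then show ?thesis by blast
qed

section \<open>The four arcs\<close>

context pants
begin

definition lft :: "pants_gen \<times> bool \<Rightarrow> complex" where
  "lft l = (if l = la then k else if l = lA then m else if l = lb then H [lA] k else n)"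

definition rgt :: "pants_gen \<times> bool \<Rightarrow> complex" where
  "rgt l = (if l = la then H [la] m else if l = lA then H [lA] k else if l = lb then H [lb] n
     else H [lB] (H [lA] k))"

lemma lft_simps [simp]: "lft la = k" "lft lA = m" "lft lb = H [lA] k" "lft lB = n"
  by (simp_all add: lft_def)
lemma rgt_simps [simp]: "rgt la = H [la] m" "rgt lA = H [lA] k" "rgt lb = H [lb] n" "rgt lB = H [lB] (H [lA] k)"
  by (simp_all add: rgt_def)

lemma unit_lft [simp]: "cmod (lft l) = 1" and unit_rgt [simp]: "cmod (rgt l) = 1"
  using letter_cases[of l] unit H_sphere by auto

lemma H_letter_inv': "cmod z \<le> 1 \<Longrightarrow> H [gbar l] (H [l] z) = z"
  using H_letter_inv[of z "gbar l"] by simp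

lemma H_rgt: "H [l] (rgt (gbar l)) = lft l" and H_lft: "H [l] (lft (gbar l)) = rgt l"
  using letter_cases[of l] unit H_letter_inv[of k la] H_letter_inv[of m lA] H_letter_inv[of "H [lA] k" lb]
    H_letter_inv[of n lB] H_sphere by auto

abbreviation P :: "complex \<Rightarrow> real" where "P \<equiv> pos k"

definition lp :: "pants_gen \<times> bool \<Rightarrow> real" where "lp l = P (lft l)"
text \<open>The last arc may end at k, which then has to count as the top of the cut circle instead
  of its bottom.\<close>

definition rp :: "pants_gen \<times> bool \<Rightarrow> real" where "rp l = (if rgt l = k then 2 else P (rgt l))"

lemma P_chain: "lp la = - 2" "lp la < rp la" "rp la \<le> lp lA" "lp lA < rp lA" "rp lA = lp lb"
  "lp lb < rp lb" "rp lb \<le> lp lB" "lp lB < rp lB" "rp lB \<le> 2"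
  "H [la] m \<noteq> m \<Longrightarrow> rp la < lp lA" "H [lb] n \<noteq> n \<Longrightarrow> rp lb < lp lB" "rgt lB \<noteq> k \<Longrightarrow> rp lB < 2"
  and rgt_neq_k: "rgt la \<noteq> k" "rgt lA \<noteq> k" "rgt lb \<noteq> k"
proof -
  have T: "P x < P y \<and> - 2 < P x" if "positively_oriented k x y" for x y
    using pos_from[OF unit(1), of x y] positively_orientedD[OF that] that by simp
  show ne: "rgt la \<noteq> k" "rgt lA \<noteq> k" "rgt lb \<noteq> k"
    using positively_orientedD[OF m_pos(1)] positively_orientedD[OF n_pos(1)] by auto
  note 1 = T[OF m_pos(1)] T[OF m_pos(2)] T[OF n_pos(1)] T[OF n_pos(2)]
  show "lp la = - 2" "lp la < rp la" "lp lA < rp lA" "rp lA = lp lb" "lp lb < rp lb"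
    using ne 1 by (auto simp: lp_def rp_def)
  show "rp la \<le> lp lA" "H [la] m \<noteq> m \<Longrightarrow> rp la < lp lA"
    using ne m_gap T[of "H [la] m" m] by (auto simp: lp_def rp_def)
  show "rp lb \<le> lp lB" "H [lb] n \<noteq> n \<Longrightarrow> rp lb < lp lB"
    using ne n_gap T[of "H [lb] n" n] by (auto simp: lp_def rp_def)
  show "lp lB < rp lB" using k_gap T[of n "rgt lB"] pos_bounds(2)[of k n] by (auto simp: lp_def rp_def)
  show "rp lB \<le> 2" "rgt lB \<noteq> k \<Longrightarrow> rp lB < 2" using pos_bounds(2)[of k "rgt lB"] by (auto simp: rp_def)
qed

lemma lp_less_rp: "lp l < rp l"
  using letter_cases[of l] P_chain by auto

text \<open>Half-open, so that touching arcs stay disjoint and each letter maps the complement of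
  one arc exactly onto another.\<close>

definition arc :: "pants_gen \<times> bool \<Rightarrow> complex set" where
  "arc l = {x. cmod x = 1 \<and> lp l \<le> P x \<and> P x < rp l}"

lemma P_inj: "cmod x = 1 \<Longrightarrow> cmod y = 1 \<Longrightarrow> P x = P y \<longleftrightarrow> x = y"
  by (rule pos_eq_iff[OF unit(1)])

lemma oriented_P: "cmod x = 1 \<Longrightarrow> cmod y = 1 \<Longrightarrow> cmod z = 1 \<Longrightarrow>
   positively_oriented x y z \<longleftrightarrow> cyc3 (P x) (P y) (P z)"
  by (rule positively_oriented_pos[OF unit(1)])

lemma cyc3_end:
  assumes "cmod x = 1" "cmod y = 1" "x \<noteq> rgt l"
  shows "cyc3 (P x) (P y) (P (rgt l)) \<longleftrightarrow> cyc3 (P x) (P y) (rp l)"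
    "cyc3 (P (rgt l)) (P x) (P y) \<longleftrightarrow> cyc3 (rp l) (P x) (P y)"
proof -
  have "P y < 2" "P x < 2" "- 2 \<le> P y" "- 2 \<le> P x" "y = k \<or> - 2 < P y" "x = k \<or> - 2 < P x"
    using pos_bounds by blast+
  then show "cyc3 (P x) (P y) (P (rgt l)) \<longleftrightarrow> cyc3 (P x) (P y) (rp l)"
    "cyc3 (P (rgt l)) (P x) (P y) \<longleftrightarrow> cyc3 (rp l) (P x) (P y)"
    using assms(3) by (auto simp: rp_def cyc3_def)
qed

text \<open>A description that does not mention the cut at k, so that it can be transported by the
  group.\<close>

lemma mem_arc: "x \<in> arc l \<longleftrightarrow> x = lft l \<or> positively_oriented (lft l) x (rgt l)"
proof (cases "cmod x = 1 \<and> x \<noteq> lft l")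
  case True
  have "lft l \<noteq> rgt l"
    using lp_less_rp[of l] P_chain(1) letter_cases[of l] k_gap positively_orientedD(5)[of k n n] P_chain(8)
      positively_orientedD[OF m_pos(1)] n_pos positively_orientedD[OF n_pos(2)]
    by (auto simp: lp_def rp_def split: if_splits)
  then have "positively_oriented (lft l) x (rgt l) \<longleftrightarrow> cyc3 (lp l) (P x) (rp l)"
    using True cyc3_end(1)[of "lft l" x l] oriented_P[of "lft l" x "rgt l"] by (simp add: lp_def)
  moreover have "P x \<noteq> lp l" using True P_inj[of x "lft l"] by (simp add: lp_def)
  ultimately show ?thesis
    using True lp_less_rp[of l] by (auto simp: arc_def cyc3_def)
next
  case False
  then show ?thesis
    using lp_less_rp[of l] positively_orientedD(2) by (auto simp: arc_def lp_def)
qed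

lemma lft_neq_rgt: "lft l \<noteq> rgt l"
  using mem_arc[of "rgt l" l] letter_cases[of l] P_chain lp_less_rp[of l] pos_bounds(1)[of k n] k_gap
    positively_orientedD[OF m_pos(1)] positively_orientedD[OF n_pos(2)]  positively_orientedD[of k n "rgt lB"]
  by (auto simp: lp_def rp_def split: if_splits)

lemma not_mem_arc: "cmod x = 1 \<Longrightarrow> x \<notin> arc l \<longleftrightarrow> x = rgt l \<or> positively_oriented (rgt l) x (lft l)"
  using positively_oriented_total[of "lft l" x "rgt l"] lft_neq_rgt[of l] unit_lft unit_rgt
    positively_oriented_rotate positively_oriented_asym positively_orientedD
  unfolding mem_arc by metis

lemma arc_unit: "x \<in> arc l \<Longrightarrow> cmod x = 1"
  by (simp add: arc_def)

text \<open>The ping-pong relation with equality: the letter swaps the roles of the end points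
  (\<open>H_rgt\<close>, \<open>H_lft\<close>) and preserves the orientation.\<close>

lemma H_mem_arc: assumes x: "cmod x = 1" shows "H [l] x \<in> arc l \<longleftrightarrow> x \<notin> arc (gbar l)"
proof
  assume "x \<notin> arc (gbar l)"
  then have "x = rgt (gbar l) \<or> positively_oriented (rgt (gbar l)) x (lft (gbar l))"
    using not_mem_arc[OF x] by blast
  then show "H [l] x \<in> arc l"
    using H_positively_oriented[of "[l]" "rgt (gbar l)" x "lft (gbar l)"] H_rgt[of l] H_lft[of l]
    by (auto simp: mem_arc)
next
  assume *: "H [l] x \<in> arc l"
  show "x \<notin> arc (gbar l)"
  proof
    assume "x \<in> arc (gbar l)"
    then have "H [l] x = rgt l \<or> positively_oriented (rgt l) (H [l] x) (lft l)"
      using H_positively_oriented[of "[l]" "lft (gbar l)" x "rgt (gbar l)"] H_rgt[of l] H_lft[of l]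
      by (auto simp: mem_arc)
    then show False using * not_mem_arc[of "H [l] x" l] H_sphere[of "[l]" x] x by auto
  qed
qed

lemma arc_disjoint: "x \<in> arc l \<Longrightarrow> x \<in> arc l' \<Longrightarrow> l = l'"
  using letter_cases[of l] letter_cases[of l'] P_chain by (auto simp: arc_def)

text \<open>Removing the common first letter moves both points out of the arc of the inverse letter.
  The three possible positions relative to that arc match the three cases of
  \<open>mu_strict_mono\<close>.\<close>

lemma arc_order:
  assumes x: "x \<in> arc l" "y \<in> arc l" "P x < P y"
  defines "x' \<equiv> H [gbar l] x" and "y' \<equiv> H [gbar l] y"
  shows "(rp (gbar l) \<le> P x' \<and> P x' < P y') \<or> (P x' < P y' \<and> P y' < lp (gbar l)) \<or>
     (rp (gbar l) \<le> P x' \<and> P y' < lp (gbar l))"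
proof -
  have u: "cmod x = 1" "cmod y = 1" "cmod x' = 1" "cmod y' = 1"
    using x arc_unit H_sphere by (auto simp: x'_def y'_def)
  have "x' \<notin> arc (gbar l)" "y' \<notin> arc (gbar l)"
    using x H_mem_arc[of x "gbar l"] H_mem_arc[of y "gbar l"] u
      H_mem_arc[of x' l] H_mem_arc[of y' l] H_letter_inv[of x l] H_letter_inv[of y l]
    by (auto simp: x'_def y'_def)
  then have 1: "P x' < lp (gbar l) \<or> rp (gbar l) \<le> P x'" "P y' < lp (gbar l) \<or> rp (gbar l) \<le> P y'"
    using u by (auto simp: arc_def)
  have "x \<noteq> y" using x by auto
  have "y \<noteq> lft l" using x by (auto simp: arc_def lp_def)
  then have "positively_oriented (lft l) y (rgt l)" using x by (simp add: mem_arc)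
  moreover have "x = lft l \<or> positively_oriented (lft l) x y"
    using oriented_P[of "lft l" x y] x u P_inj[of x "lft l"] by (auto simp: cyc3_def arc_def lp_def)
  ultimately have "positively_oriented x y (rgt l)"
    using positively_oriented_trans[of y "rgt l" "lft l" x] positively_oriented_rotate by blast
  then have "positively_oriented x' y' (lft (gbar l))"
    using H_positively_oriented[of "[gbar l]" x y "rgt l"] H_rgt[of "gbar l"] by (simp add: x'_def y'_def)
  then have "cyc3 (P x') (P y') (lp (gbar l))" using oriented_P[of x' y' "lft (gbar l)"] u by (simp add: lp_def)
  then show ?thesis using 1 lp_less_rp[of "gbar l"] unfolding cyc3_def by linarith
qed

end

section \<open>Separation of points by their itineraries\<close>

lemma compact_near_inter:
  fixes C D :: "'a::heine_borel set"
  assumes "compact C" "compact D" "e > 0"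
  shows "\<exists>\<delta>>0. \<forall>h. (\<exists>p\<in>C. dist h p < \<delta>) \<and> (\<exists>q\<in>D. dist h q < \<delta>) \<longrightarrow> (\<exists>v\<in>C \<inter> D. dist h v < e)"
proof -
  define U where "U = (\<Union>v\<in>C \<inter> D. ball v (e / 2))"
  have "open U" by (auto simp: U_def)
  then have "compact (C - U)" using assms(1) compact_diff by blast
  moreover have "closed D" using assms(2) compact_imp_closed by blast
  moreover have "(C - U) \<inter> D = {}" using assms(3) by (auto simp: U_def)
  ultimately obtain d where d: "d > 0" "\<And>x y. x \<in> C - U \<Longrightarrow> y \<in> D \<Longrightarrow> d \<le> dist x y"
    using separate_compact_closed by metis
  have "\<exists>v\<in>C \<inter> D. dist h v < e"
    if "p \<in> C" "q \<in> D" "dist h p < min (d / 2) (e / 2)" "dist h q < min (d / 2) (e / 2)" for h p q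
  proof -
    have "dist p q < d" using that dist_triangle3[of p q h] by (simp add: dist_commute)
    then have "p \<in> U" using d(2)[of p q] that by force
    then obtain v where "v \<in> C \<inter> D" "dist v p < e / 2" by (auto simp: U_def)
    then show ?thesis using that dist_triangle[of h v p] by (intro bexI[of _ v]) (auto simp: dist_commute)
  qed
  then show ?thesis using d assms(3) by (intro exI[of _ "min (d / 2) (e / 2)"]) auto
qed

lemma finite_separated:
  fixes F :: "'a::metric_space set"
  assumes "finite F"
  shows "\<exists>\<eta>>0. \<forall>u\<in>F. \<forall>v\<in>F. dist u v < \<eta> \<longrightarrow> u = v"
proof -
  define S where "S = insert 1 ((\<lambda>(u, v). dist u v) ` {(u, v) \<in> F \<times> F. u \<noteq> v})"
  have "finite S" using assms by (auto simp: S_def intro: finite_subset[of _ "F \<times> F"])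
  moreover have "S \<noteq> {}" "\<forall>s\<in>S. s > 0" by (auto simp: S_def)
  then have "Min S > 0" "\<And>s. s \<in> S \<Longrightarrow> Min S \<le> s" using \<open>finite S\<close> by auto
  moreover have "dist u v \<in> S" if "u \<in> F" "v \<in> F" "u \<noteq> v" for u v
    using that by (auto simp: S_def)
  ultimately show ?thesis by (metis not_less)
qed

lemma finite_letters: "finite (UNIV :: (pants_gen \<times> bool) set)"
proof -
  have "UNIV = {la, lA, lb, lB}" using letter_cases by auto
  then show ?thesis by (metis finite.emptyI finite_insert)
qed

lemma uniform_over_letters:
  assumes "\<And>l l'. \<exists>\<delta>>0. Q (l::pants_gen \<times> bool) (l'::pants_gen \<times> bool) (\<delta>::real)"
    and mono: "\<And>l l' \<delta> \<delta>'. Q l l' \<delta> \<Longrightarrow> \<delta>' \<le> \<delta> \<Longrightarrow> Q l l' \<delta>'"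
  shows "\<exists>\<delta>>0. \<forall>l l'. Q l l' \<delta>"
proof -
  obtain d where d: "\<And>l l'. d l l' > 0 \<and> Q l l' (d l l')" using assms(1) by metis
  let ?S = "range (\<lambda>(l, l'). d l l')"
  have "finite ?S" using finite_letters by (metis finite_Prod_UNIV finite_imageI)
  then have "Min ?S > 0" "\<And>l l'. Min ?S \<le> d l l'" using d by (auto intro!: Min_le)
  then show ?thesis using d mono by blast
qed

context hyp
begin

text \<open>The distance from \<gamma> 0 to \<gamma> z is inverse to the denominator at z, and the
  denominators at p and q cannot both be small, since their difference is b times p - q up to
  conjugation. So \<gamma> 0 near the circle is near \<gamma> p or near \<gamma> q.\<close>

lemma orbit_near:
  assumes g: "\<gamma> \<in> carrier \<Gamma>03" and p: "cmod p = 1" "cmod q = 1"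
  shows "min (dist (H \<gamma> 0) (H \<gamma> p)) (dist (H \<gamma> 0) (H \<gamma> q)) * (cmod (H \<gamma> 0) * dist p q) \<le> 2 * (1 - (cmod (H \<gamma> 0))\<^sup>2)"
proof -
  obtain a b where ab: "(cmod a)\<^sup>2 - (cmod b)\<^sup>2 = 1" "\<And>z. cmod z \<le> 1 \<Longrightarrow> H \<gamma> z = disc_aut a b z"
    using coeffs[OF g] by blast
  define D where "D z = cmod (cnj b * z + cnj a)" for z
  have D: "D z > 0" if "cmod z = 1" for z using disc_aut_denom[OF ab(1), of z] that by (simp add: D_def)
  have "(cmod a)\<^sup>2 \<ge> 1" using ab(1) zero_le_power2[of "cmod b"] by linarith
  then have "a \<noteq> 0" by auto
  then have a: "cmod a > 0" by simp
  have 1: "dist (H \<gamma> 0) (H \<gamma> z) = 1 / (cmod a * D z)" if "cmod z = 1" for z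
    using disc_aut_diff[OF ab(1), of 0 z] ab(2)[of 0] ab(2)[of z] that
    by (simp add: dist_norm norm_divide norm_mult D_def)
  have 2: "cmod (H \<gamma> 0) = cmod b / cmod a" using ab(2)[of 0] by (simp add: disc_aut_def norm_divide)
  have 3: "1 - (cmod (H \<gamma> 0))\<^sup>2 = 1 / (cmod a)\<^sup>2" using disc_aut_zero[OF ab(1)] ab(2)[of 0] by simp
  have "cnj b * (p - q) = (cnj b * p + cnj a) - (cnj b * q + cnj a)" by (simp add: algebra_simps)
  then have "cmod b * dist p q \<le> D p + D q"
    by (metis D_def complex_mod_cnj dist_norm norm_mult norm_triangle_ineq4)
  then have "cmod b * dist p q \<le> 2 * D p \<or> cmod b * dist p q \<le> 2 * D q" by linarith
  then obtain z where z: "z = p \<or> z = q" "cmod b * dist p q \<le> 2 * D z" "cmod z = 1" using p by blast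
  have "min (dist (H \<gamma> 0) (H \<gamma> p)) (dist (H \<gamma> 0) (H \<gamma> q)) \<le> 1 / (cmod a * D z)"
    using z 1 p by auto
  then have "min (dist (H \<gamma> 0) (H \<gamma> p)) (dist (H \<gamma> 0) (H \<gamma> q)) * (cmod (H \<gamma> 0) * dist p q) \<le>
      1 / (cmod a * D z) * (cmod (H \<gamma> 0) * dist p q)"
    by (rule mult_right_mono) simp
  also have "\<dots> = (cmod b * dist p q) / ((cmod a)\<^sup>2 * D z)" by (simp add: 2 power2_eq_square)
  also have "\<dots> \<le> 2 * D z / ((cmod a)\<^sup>2 * D z)" using z(2) D[OF z(3)] a by (intro divide_right_mono) auto
  also have "\<dots> = 2 * (1 - (cmod (H \<gamma> 0))\<^sup>2)" using D[OF z(3)] 3 by simp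
  finally show ?thesis .
qed

text \<open>A forward orbit cannot stay in an arc starting at the attracting point, because it must
  pass the other end e.\<close>

lemma contracting_forward:
  assumes "contracting g d" "cmod p = 1" "p \<noteq> d" "cmod e = 1" "e \<noteq> d"
    and "\<And>j. (g ^^ j) p = d \<or> positively_oriented d ((g ^^ j) p) e"
  shows False
proof -
  obtain j where "positively_oriented d e ((g ^^ j) p)" using assms(1-5) by (auto simp: contracting_def)
  then show False
    using assms(6)[of j] positively_oriented_asym[of d e] positively_orientedD(6)[of d e] by auto
qed

text \<open>Some iterate carries s past p. By monotonicity it also carries everything between s and
  d past p, so p has no preimage there under that iterate.\<close>

lemma contracting_backward:
  assumes "contracting g d" "g d = d" "\<And>x y z. positively_oriented x y z \<Longrightarrow> positively_oriented (g x) (g y) (g z)"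
    and s: "cmod s = 1" "s \<noteq> d" and p: "cmod p = 1" "p \<noteq> d"
    and y: "\<And>j. (g ^^ j) (y j) = p" "\<And>j. y j = s \<or> positively_oriented d s (y j)"
  shows False
proof -
  obtain j where j: "positively_oriented d p ((g ^^ j) s)" using assms(1) s p by (auto simp: contracting_def)
  have T: "positively_oriented ((g ^^ j) x) ((g ^^ j) z) ((g ^^ j) w)" if "positively_oriented x z w" for x z w
    by (induction j) (simp_all add: that assms(3))
  have "(g ^^ j) d = d" by (induction j) (simp_all add: assms(2))
  moreover have "y j \<noteq> s" using y(1)[of j] positively_orientedD(5)[OF j] by auto
  then have "positively_oriented d s (y j)" using y(2) by blast
  ultimately have "positively_oriented d ((g ^^ j) s) p" using T[of d s "y j"] y(1)[of j] by simp
  then show False using positively_oriented_asym j by blast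
qed

end

context pants
begin

definition carc :: "pants_gen \<times> bool \<Rightarrow> complex set" where
  "carc l = {x. cmod x = 1 \<and> \<not> positively_oriented (rgt l) x (lft l)}"

lemma mem_carc: "x \<in> carc l \<longleftrightarrow> x \<in> arc l \<or> x = rgt l"
  using not_mem_arc[of x l] arc_unit[of x l] unit_rgt[of l] positively_orientedD(4)
  by (auto simp: carc_def)

lemma compact_carc: "compact (carc l)"
proof -
  have "carc l = sphere 0 1 \<inter> {x. Im (cnj (x - rgt l) * (lft l - rgt l)) \<le> 0}"
    by (auto simp: carc_def positively_oriented_def not_less)
  moreover have "closed {x. Im (cnj (x - rgt l) * (lft l - rgt l)) \<le> 0}"
    by (intro closed_Collect_le continuous_intros)
  ultimately show ?thesis by (metis compact_Int_closed compact_sphere)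
qed

lemma carc_P: "x \<in> carc l \<Longrightarrow> cmod x = 1 \<and> (lp l \<le> P x \<and> P x \<le> rp l \<or> l = lB \<and> x = k \<and> rgt lB = k)"
proof (rule conjI)
  show "x \<in> carc l \<Longrightarrow> cmod x = 1" by (simp add: carc_def)
  show "x \<in> carc l \<Longrightarrow> lp l \<le> P x \<and> P x \<le> rp l \<or> l = lB \<and> x = k \<and> rgt lB = k"
    using letter_cases[of l] rgt_neq_k lp_less_rp[of l]
    by (auto simp: mem_carc arc_def rp_def)
qed

text \<open>Closed arcs meet only if they are neighbours, and then in their common end point. Apart
  from the pair A, b this happens only at a cusp.\<close>

lemma common_vertex:
  assumes "v \<in> carc l" "v \<in> carc l'" "l \<noteq> l'"
  shows "{l, l'} = {la, lA} \<and> v = m \<and> H [la] m = m \<or> {l, l'} = {lA, lb} \<and> v = H [lA] k \<or>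
    {l, l'} = {lb, lB} \<and> v = n \<and> H [lb] n = n \<or> {l, l'} = {lB, la} \<and> v = k \<and> H [lB] (H [lA] k) = k"
proof -
  have v: "cmod v = 1" using carc_P assms by blast
  have e: "P v = lp s \<Longrightarrow> v = lft s" for s using P_inj[OF v unit_lft] by (simp add: lp_def)
  have bd: "v \<in> carc la \<Longrightarrow> lp la \<le> P v \<and> P v \<le> rp la" "v \<in> carc lA \<Longrightarrow> lp lA \<le> P v \<and> P v \<le> rp lA"
    "v \<in> carc lb \<Longrightarrow> lp lb \<le> P v \<and> P v \<le> rp lb"
    "v \<in> carc lB \<Longrightarrow> lp lB \<le> P v \<or> P v = - 2 \<and> v = k \<and> rgt lB = k"
    using carc_P[of v] by fastforce+
  note ch = P_chain(1-9)
  have A: "v = m \<and> H [la] m = m" if "v \<in> carc la" "v \<in> carc lA"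
  proof -
    have "P v = lp lA" "\<not> rp la < lp lA" using bd(1,2) that ch by linarith+
    then show ?thesis using e[of lA] P_chain(10) by auto
  qed
  have B: "v = H [lA] k" if "v \<in> carc lA" "v \<in> carc lb"
  proof -
    have "P v = lp lb" using bd(2,3) that ch by linarith
    then show ?thesis using e[of lb] by simp
  qed
  have C: "v = n \<and> H [lb] n = n" if "v \<in> carc lb" "v \<in> carc lB"
  proof -
    have "P v = lp lB" "\<not> rp lb < lp lB" using bd(3,4) that ch by linarith+
    then show ?thesis using e[of lB] P_chain(11) by auto
  qed
  have D: "v = k \<and> H [lB] (H [lA] k) = k" if "v \<in> carc lB" "v \<in> carc la"
  proof -
    have "v = k \<and> rgt lB = k" using bd(1,4) that ch by linarith
    then show ?thesis by simp
  qed
  have E: "\<not> (v \<in> carc la \<and> v \<in> carc lb)" using bd(1,3) ch by linarith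
  have F: "\<not> (v \<in> carc lA \<and> v \<in> carc lB)" using bd(2,4) ch by linarith
  from letter_cases[of l] letter_cases[of l'] show ?thesis
    using assms A B C D E F by (elim disjE; simp add: insert_commute)
qed

lemma vertices_distinct:
  "m \<noteq> k" "n \<noteq> k" "H [lA] k \<noteq> k" "m \<noteq> H [lA] k" "n \<noteq> H [lA] k" "m \<noteq> n" "H [lB] (H [lA] k) \<noteq> n"
proof -
  show "m \<noteq> k" "n \<noteq> k" "H [lA] k \<noteq> k" "m \<noteq> H [lA] k" "n \<noteq> H [lA] k"
    using positively_orientedD[OF m_pos(2)] positively_orientedD[OF n_pos(2)] by auto
  show "m \<noteq> n" using m_pos(2) n_pos(2) positively_oriented_asym by blast
  show "H [lB] (H [lA] k) \<noteq> n" using k_gap \<open>n \<noteq> k\<close> positively_orientedD(5)[of k n] by metis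
qed

end

section \<open>Two points with a common itinerary\<close>

context pants
begin

context
  fixes w :: "nat \<Rightarrow> pants_gen \<times> bool" and xs ys :: "nat \<Rightarrow> complex"
  assumes xs: "\<And>i. xs i \<in> arc (w i)" "\<And>i. xs (Suc i) = H [gbar (w i)] (xs i)"
    and ys: "\<And>i. ys i \<in> arc (w i)" "\<And>i. ys (Suc i) = H [gbar (w i)] (ys i)"
    and ne: "xs 0 \<noteq> ys 0"
begin

lemma xs_unit: "cmod (xs i) = 1" and ys_unit: "cmod (ys i) = 1"
  using xs ys arc_unit by blast+

lemma xs_neq_ys: "xs i \<noteq> ys i"
proof (induction i)
  case (Suc i)
  then show ?case
    using xs(2) ys(2) H_eq_iff[of "[gbar (w i)]" "xs i" "ys i"] xs_unit[of i] ys_unit[of i] by simp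
qed (rule ne)

lemma w_Suc: "w (Suc i) \<noteq> gbar (w i)"
proof
  assume "w (Suc i) = gbar (w i)"
  then have "H [gbar (w i)] (xs i) \<in> arc (gbar (w i))" using xs(1)[of "Suc i"] xs(2)[of i] by simp
  then show False using H_mem_arc[OF xs_unit, of "gbar (w i)" i] xs(1)[of i] by simp
qed

text \<open>The element that removes the first i letters of the itinerary, as a reduced
  word.\<close>

primrec word :: "nat \<Rightarrow> (pants_gen \<times> bool) list" where
  "word 0 = []"
| "word (Suc i) = gbar (w i) # word i"

lemma length_word: "length (word i) = i"
  by (induction i) simp_all

lemma word_reduced: "reduced gbar (word i)"
proof (induction i)
  case (Suc i)
  then show ?case using w_Suc by (cases i) (auto simp: reduced_def, metis gbar_gbar)
qed (simp add: reduced_def)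

lemma word_carrier: "word i \<in> carrier \<Gamma>03"
  using word_reduced by (simp add: carrier_\<Gamma>03)

lemma H_word_Suc: "cmod z \<le> 1 \<Longrightarrow> H (word (Suc i)) z = H [gbar (w i)] (H (word i) z)"
  using H_Cons[of "gbar (w i)" "word i" z] word_reduced[of "Suc i"] by simp

lemma H_word: "H (word i) (xs 0) = xs i" "H (word i) (ys 0) = ys i"
proof -
  have "H (word 0) z = z" if "cmod z \<le> 1" for z using H_one[OF that] by (simp add: one_\<Gamma>03)
  then show "H (word i) (xs 0) = xs i" "H (word i) (ys 0) = ys i"
    using xs_unit ys_unit by (induction i) (simp_all add: H_word_Suc xs(2) ys(2) del: word.simps)
qed

lemma word_escapes:
  assumes "r < 1"
  shows "\<forall>\<^sub>F i in sequentially. r < cmod (H (word i) 0)"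
proof -
  have "inj word" by (rule injI) (metis length_word)
  moreover have "finite {\<gamma> \<in> carrier \<Gamma>03. cmod (H \<gamma> 0) \<le> r}" by (rule H_discrete[OF assms])
  ultimately have "finite (word -` {\<gamma> \<in> carrier \<Gamma>03. cmod (H \<gamma> 0) \<le> r})" by (intro finite_vimageI)
  then have "finite {i. \<not> r < cmod (H (word i) 0)}"
    by (rule finite_subset[rotated]) (use word_carrier in auto)
  then show ?thesis by (simp add: eventually_cofinite flip: cofinite_eq_sequentially)
qed

lemma pair_near:
  assumes p: "cmod p = 1" "cmod q = 1" "p \<noteq> q" and "e > 0"
  shows "\<forall>\<^sub>F i in sequentially. dist (H (word i) 0) (H (word i) p) < e \<or> dist (H (word i) 0) (H (word i) q) < e"
proof -
  define d where "d = dist p q"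
  have d: "d > 0" using p by (simp add: d_def)
  \<comment> \<open>If both distances were at least e, \<open>orbit_near\<close> with |h| > 1/2
    would give e d / 2 <= 4 (1 - h), contradicting 1 - h < e d / 16.\<close>
  have "max (1 / 2) (1 - e * d / 16) < 1" using d \<open>e > 0\<close> by simp
  from word_escapes[OF this] show ?thesis
  proof (rule eventually_mono)
    fix i assume *: "max (1 / 2) (1 - e * d / 16) < cmod (H (word i) 0)"
    define h where "h = cmod (H (word i) 0)"
    have h: "1 / 2 < h" "1 - h < e * d / 16" "h \<le> 1"
      using * H_ball[OF word_carrier, of 0] by (auto simp: h_def)
    show "dist (H (word i) 0) (H (word i) p) < e \<or> dist (H (word i) 0) (H (word i) q) < e"
    proof (rule ccontr)
      assume "\<not> ?thesis"
      then have "e \<le> min (dist (H (word i) 0) (H (word i) p)) (dist (H (word i) 0) (H (word i) q))" by simp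
      moreover have "1 / 2 * d \<le> h * d" using h d by simp
      ultimately have "e * (1 / 2 * d) \<le> min (dist (H (word i) 0) (H (word i) p)) (dist (H (word i) 0) (H (word i) q)) * (h * d)"
        using \<open>e > 0\<close> d by (intro mult_mono) auto
      also have "\<dots> \<le> 2 * (1 - h\<^sup>2)" using orbit_near[OF word_carrier p(1,2), of i] by (simp add: h_def d_def)
      also have "1 - h\<^sup>2 = (1 - h) * (1 + h)" by (simp add: power2_eq_square algebra_simps)
      also have "(1 - h) * (1 + h) \<le> (1 - h) * 2" using h by (intro mult_left_mono) auto
      finally have "e * (1 / 2 * d) \<le> 4 * (1 - h)" by simp
      then show False using h(2) d \<open>e > 0\<close> mult_pos_pos[OF \<open>e > 0\<close> d] by simp
    qed
  qed
qed

lemma that_letters: "\<exists>l l'. l \<noteq> s \<and> l' \<noteq> s \<and> l \<noteq> (l' :: pants_gen \<times> bool)"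
  using letter_cases[of s]
proof (elim disjE)
  assume "s = la" then show ?thesis by (intro exI[of _ lb] exI[of _ lB]) simp
next
  assume "s = lA" then show ?thesis by (intro exI[of _ lb] exI[of _ lB]) simp
next
  assume "s = lb" then show ?thesis by (intro exI[of _ la] exI[of _ lA]) simp
next
  assume "s = lB" then show ?thesis by (intro exI[of _ la] exI[of _ lA]) simp
qed

text \<open>Both points stay in the arc of the current letter, while two auxiliary points from
  outside the first arc stay in the arc of the inverse of the previous letter. By
  \<open>pair_near\<close> the orbit point approaches both closed arcs, hence their
  intersection.\<close>

lemma near_vertex:
  assumes "e > 0"
  shows "\<forall>\<^sub>F i in sequentially. \<exists>v\<in>carc (w (Suc i)) \<inter> carc (gbar (w i)). dist (H (word (Suc i)) 0) v < e"
proof -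
  obtain p q where p: "cmod p = 1" "cmod q = 1" "p \<noteq> q" "p \<notin> arc (w 0)" "q \<notin> arc (w 0)"
  proof -
    have l: "lft l \<in> arc l" for l by (simp add: mem_arc)
    obtain l l' where ll: "l \<noteq> w 0" "l' \<noteq> w 0" "l \<noteq> l'"
      using that_letters[of "w 0"] by blast
    then have "lft l \<notin> arc (w 0)" "lft l' \<notin> arc (w 0)" "lft l \<noteq> lft l'"
      using l arc_disjoint by metis+
    then show ?thesis using that[of "lft l" "lft l'"] by simp
  qed
  have out: "H (word (Suc i)) z \<in> arc (gbar (w i))" if "cmod z = 1" "z \<notin> arc (w 0)" for z i
  proof (induction i)
    case 0
    then show ?case using that H_mem_arc[of z "gbar (w 0)"] H_one[of z] H_word_Suc[of z 0]
      by (simp add: one_\<Gamma>03)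
  next
    case (Suc i)
    then have "H (word (Suc i)) z \<notin> arc (w (Suc i))" using arc_disjoint w_Suc by metis
    then show ?case
      using H_mem_arc[of "H (word (Suc i)) z" "gbar (w (Suc i))"] H_word_Suc[of z "Suc i"] that
        H_sphere[OF word_carrier, of z "Suc i"] by simp
  qed
  have "\<exists>\<delta>>0. \<forall>l l'. \<forall>h. (\<exists>p\<in>carc l. dist h p < \<delta>) \<and> (\<exists>q\<in>carc l'. dist h q < \<delta>) \<longrightarrow> (\<exists>v\<in>carc l \<inter> carc l'. dist h v < e)"
    by (rule uniform_over_letters) (rule compact_near_inter[OF compact_carc compact_carc assms], meson less_le_trans)
  then obtain \<delta> where \<delta>0: "\<delta> > 0 \<and> (\<forall>l l'. \<forall>h. (\<exists>p\<in>carc l. dist h p < \<delta>) \<and> (\<exists>q\<in>carc l'. dist h q < \<delta>) \<longrightarrow> (\<exists>v\<in>carc l \<inter> carc l'. dist h v < e))" ..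
  have \<delta>: "\<delta> > 0" "\<And>l l' h a b. a \<in> carc l \<Longrightarrow> dist h a < \<delta> \<Longrightarrow> b \<in> carc l' \<Longrightarrow> dist h b < \<delta> \<Longrightarrow>
      \<exists>v\<in>carc l \<inter> carc l'. dist h v < e" using \<delta>0 by (simp, meson)
  have "\<forall>\<^sub>F i in sequentially. (dist (H (word i) 0) (xs i) < \<delta> \<or> dist (H (word i) 0) (ys i) < \<delta>) \<and>
      (dist (H (word i) 0) (H (word i) p) < \<delta> \<or> dist (H (word i) 0) (H (word i) q) < \<delta>)"
    using eventually_conj[OF pair_near[OF xs_unit[of 0] ys_unit[of 0] ne \<delta>(1)] pair_near[OF p(1-3) \<delta>(1)]]
    by (simp add: H_word)
  then have "\<forall>\<^sub>F i in sequentially. (dist (H (word (Suc i)) 0) (xs (Suc i)) < \<delta> \<or> dist (H (word (Suc i)) 0) (ys (Suc i)) < \<delta>) \<and>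
      (dist (H (word (Suc i)) 0) (H (word (Suc i)) p) < \<delta> \<or> dist (H (word (Suc i)) 0) (H (word (Suc i)) q) < \<delta>)"
    by (subst eventually_sequentially_Suc)
  then show ?thesis
  proof (rule eventually_mono)
    fix i assume *: "(dist (H (word (Suc i)) 0) (xs (Suc i)) < \<delta> \<or> dist (H (word (Suc i)) 0) (ys (Suc i)) < \<delta>) \<and>
      (dist (H (word (Suc i)) 0) (H (word (Suc i)) p) < \<delta> \<or> dist (H (word (Suc i)) 0) (H (word (Suc i)) q) < \<delta>)"
    have "xs (Suc i) \<in> carc (w (Suc i))" "ys (Suc i) \<in> carc (w (Suc i))"
      "H (word (Suc i)) p \<in> carc (gbar (w i))" "H (word (Suc i)) q \<in> carc (gbar (w i))"
      using xs(1) ys(1) out p by (auto simp: mem_carc)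
    then show "\<exists>v\<in>carc (w (Suc i)) \<inter> carc (gbar (w i)). dist (H (word (Suc i)) 0) v < e"
      using * \<delta>(2) by blast
  qed
qed

text \<open>Vertices and their images under letters form a finite set. Uniform continuity brings the
  next vertex within the separation distance of the image of the present one, so they are
  equal.\<close>

lemma vertex_sequence:
  obtains N v where "\<And>i. i \<ge> N \<Longrightarrow> v i \<in> carc (w (Suc i)) \<inter> carc (gbar (w i))"
    "\<And>i. i \<ge> N \<Longrightarrow> v (Suc i) = H [gbar (w (Suc i))] (v i)"
proof -
  define V where "V = {m, H [lA] k, n, k}"
  define F where "F = V \<union> (\<Union>l\<in>{la, lA, lb, lB}. H [l] ` V)"
  have "finite F" by (simp add: F_def V_def)
  from finite_separated[OF this] obtain \<eta> where "\<eta> > 0 \<and> (\<forall>u\<in>F. \<forall>v\<in>F. dist u v < \<eta> \<longrightarrow> u = v)" ..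
  then have \<eta>: "\<eta> > 0" "\<And>u v. u \<in> F \<Longrightarrow> v \<in> F \<Longrightarrow> dist u v < \<eta> \<Longrightarrow> u = v" by simp_all
  have HF: "H [l] v \<in> F" if "v \<in> V" for l v using letter_cases[of l] that by (auto simp: F_def)
  have "\<exists>\<delta>>0. \<forall>l l'::pants_gen \<times> bool. \<forall>x z. cmod x \<le> 1 \<and> cmod z \<le> 1 \<and> dist x z < \<delta> \<longrightarrow> dist (H [l] x) (H [l] z) < \<eta> / 2"
  proof (rule uniform_over_letters)
    fix l l' :: "pants_gen \<times> bool"
    have "uniformly_continuous_on (cball 0 1) (H [l])"
      by (rule compact_uniformly_continuous[OF H_continuous]) simp_all
    then show "\<exists>\<delta>>0. \<forall>x z. cmod x \<le> 1 \<and> cmod z \<le> 1 \<and> dist x z < \<delta> \<longrightarrow> dist (H [l] x) (H [l] z) < \<eta> / 2"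
      unfolding uniformly_continuous_on_def mem_cball_0 Ball_def
      using half_gt_zero[OF \<eta>(1)] by (metis dist_commute)
  qed force
  then obtain \<delta> where "\<delta> > 0 \<and> (\<forall>l l'::pants_gen \<times> bool. \<forall>x z. cmod x \<le> 1 \<and> cmod z \<le> 1 \<and> dist x z < \<delta> \<longrightarrow> dist (H [l] x) (H [l] z) < \<eta> / 2)" ..
  then have \<delta>: "\<delta> > 0" "\<And>l x z. cmod x \<le> 1 \<Longrightarrow> cmod z \<le> 1 \<Longrightarrow> dist x z < \<delta> \<Longrightarrow> dist (H [l] x) (H [l] z) < \<eta> / 2"
    by blast+
  have "min \<delta> (\<eta> / 2) > 0" using \<eta> \<delta> by simp
  then obtain N where N: "\<And>i. i \<ge> N \<Longrightarrow> \<exists>v\<in>carc (w (Suc i)) \<inter> carc (gbar (w i)). dist (H (word (Suc i)) 0) v < min \<delta> (\<eta> / 2)"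
    using near_vertex unfolding eventually_sequentially by blast
  then obtain v where v: "\<And>i. i \<ge> N \<Longrightarrow> v i \<in> carc (w (Suc i)) \<inter> carc (gbar (w i))"
    "\<And>i. i \<ge> N \<Longrightarrow> dist (H (word (Suc i)) 0) (v i) < min \<delta> (\<eta> / 2)"
    by metis
  have vV: "v i \<in> V" if "i \<ge> N" for i
    using common_vertex[of "v i" "w (Suc i)" "gbar (w i)"] v(1)[OF that] w_Suc[of i] by (auto simp: V_def)
  have "v (Suc i) = H [gbar (w (Suc i))] (v i)" if "i \<ge> N" for i
  proof (rule \<eta>(2))
    show "v (Suc i) \<in> F" using vV[of "Suc i"] that by (simp add: F_def)
    show "H [gbar (w (Suc i))] (v i) \<in> F" using HF vV[OF that] by blast
    have "cmod (v i) = 1" using v(1)[OF that] carc_P by blast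
    then have "dist (H [gbar (w (Suc i))] (H (word (Suc i)) 0)) (H [gbar (w (Suc i))] (v i)) < \<eta> / 2"
      using \<delta>(2)[of "H (word (Suc i)) 0" "v i"] v(2)[OF that] H_ball[OF word_carrier, of 0 "Suc i"] by simp
    moreover have "dist (H (word (Suc (Suc i))) 0) (v (Suc i)) < \<eta> / 2" using v(2)[of "Suc i"] that by simp
    ultimately show "dist (v (Suc i)) (H [gbar (w (Suc i))] (v i)) < \<eta>"
      using dist_triangle3[of "v (Suc i)" "H [gbar (w (Suc i))] (v i)" "H (word (Suc (Suc i))) 0"]
        H_word_Suc[of 0 "Suc i"] by (simp add: dist_commute)
  qed
  then show ?thesis using that v(1) by blast
qed

text \<open>A vertex m or n forces the same letter forever, a vertex k or A k two alternating
  letters. In either case the itinerary ends in powers of a parabolic element that keep both points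
  in one arc, against \<open>contracting_forward\<close> or
  \<open>contracting_backward\<close>.\<close>

lemma no_common_code: False
proof -
  obtain N v where v: "\<And>i. i \<ge> N \<Longrightarrow> v i \<in> carc (w (Suc i)) \<inter> carc (gbar (w i))"
    "\<And>i. i \<ge> N \<Longrightarrow> v (Suc i) = H [gbar (w (Suc i))] (v i)"
    by (rule vertex_sequence) (rule that)
  note dist = vertices_distinct vertices_distinct[symmetric]
  have cv: "w (Suc i) \<in> {la, lA} \<and> w i = w (Suc i) \<and> v i = m \<and> H [la] m = m \<or>
    w (Suc i) = lA \<and> w i = lB \<and> v i = H [lA] k \<or> w (Suc i) = lb \<and> w i = la \<and> v i = H [lA] k \<or>
    w (Suc i) \<in> {lb, lB} \<and> w i = w (Suc i) \<and> v i = n \<and> H [lb] n = n \<or>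
    w (Suc i) = lB \<and> w i = lA \<and> v i = k \<and> H [lB] (H [lA] k) = k \<or>
    w (Suc i) = la \<and> w i = lb \<and> v i = k \<and> H [lB] (H [lA] k) = k" if "i \<ge> N" for i
  proof -
    have "v i \<in> carc (w (Suc i))" "v i \<in> carc (gbar (w i))" using v(1)[OF that] by auto
    note cv = common_vertex[OF this w_Suc]
    from letter_cases[of "w i"] show ?thesis
      by (elim disjE) (use cv in \<open>simp_all add: doubleton_eq_iff\<close>, auto)
  qed
  have Hinv: "H [la] m = m \<Longrightarrow> H [lA] m = m" "H [lb] n = n \<Longrightarrow> H [lB] n = n"
    using H_letter_inv[of m lA] H_letter_inv[of n lB] unit by auto
  have kk: "H [la] (H [lA] k) = k" "H [lb] (H [lB] (H [lA] k)) = H [lA] k"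
    using H_letter_inv[of k la] H_letter_inv[of "H [lA] k" lb] unit H_sphere[of "[lA]" k] by auto
  have step: "w (Suc (Suc i)) = w (Suc i)" if "i \<ge> N" "v i = m \<or> v i = n" for i
    using cv[OF that(1)] cv[of "Suc i"] v(2)[OF that(1)] that dist Hinv by auto
  have stepv: "v (Suc i) = v i" if "i \<ge> N" "v i = m \<or> v i = n" for i
    using cv[OF that(1)] v(2)[OF that(1)] that dist Hinv by auto
  have alt: "w (Suc (Suc i)) = w i" if "i \<ge> N" "v i = k \<or> v i = H [lA] k" for i
    using cv[OF that(1)] cv[of "Suc i"] v(2)[OF that(1)] that dist kk by auto
  have altv: "v (Suc i) = k \<or> v (Suc i) = H [lA] k" if "i \<ge> N" "v i = k \<or> v i = H [lA] k" for i
    using cv[OF that(1)] cv[of "Suc i"] v(2)[OF that(1)] that dist kk by auto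
  show False
  proof (cases "v N = m \<or> v N = n")
    case True
    have c: "w (Suc (N + j)) = w (Suc N) \<and> (v (N + j) = m \<or> v (N + j) = n)" for j
      using True
    proof (induction j)
      case (Suc j)
      then show ?case using step[of "N + j"] stepv[of "N + j"] by simp
    qed simp
    define M where "M = Suc N"
    define l where "l = w M"
    have wl: "w (M + j) = l" for j using c[of j] by (simp add: M_def l_def)
    have it: "xs (M + j) = (H [gbar l] ^^ j) (xs M)" "ys (M + j) = (H [gbar l] ^^ j) (ys M)" for j
      by (induction j) (simp_all add: xs(2) ys(2) wl)
    have ret: "(H [l] ^^ j) (xs (M + j)) = xs M" for j
    proof (induction j)
      case (Suc j)
      have "H [l] (xs (Suc (M + j))) = xs (M + j)"
        using H_letter_inv[of "xs (M + j)" l] xs_unit[of "M + j"] wl by (simp add: xs(2))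
      then show ?case using Suc by (simp add: funpow_swap1)
    qed simp
    have mem: "xs (M + j) \<in> arc l" "ys (M + j) \<in> arc l" for j
      using xs(1) ys(1) wl by metis+
    have T: "positively_oriented (H [l] x) (H [l] y) (H [l] z)" if "positively_oriented x y z" for x y z
      using that by (rule H_positively_oriented[rotated]) simp
    \<comment> \<open>The two points differ, so at least one of them is not the left end, which in
      the forward cases is the parabolic fixed point.\<close>
    obtain p where p: "\<And>j. (H [gbar l] ^^ j) p \<in> arc l" "p \<noteq> lft l"
      using mem it xs_neq_ys[of M] by metis
    have pu: "cmod p = 1" using p(1)[of 0] arc_unit by simp
    consider "l = la" "H [la] m = m" | "l = lA" "H [la] m = m" | "l = lb" "H [lb] n = n" | "l = lB" "H [lb] n = n"
      using cv[of N] True dist by (auto simp: l_def M_def)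
    then show False
    proof cases
      case 1
      show False
      proof (rule contracting_backward[OF m_contracting[OF 1(2)] 1(2)])
        show "xs (M + j) = k \<or> positively_oriented m k (xs (M + j))" for j
          using mem(1)[of j] 1 positively_oriented_rotate by (auto simp: mem_arc)
        show "xs M \<noteq> m" using mem(1)[of 0] 1 mem_arc[of m la] positively_orientedD(5)[of k m m] dist by auto
      qed (use unit dist xs_unit ret T 1 in auto)
    next
      case 2
      show False
      proof (rule contracting_forward[OF m_contracting[OF 2(2)], of p "H [lA] k"])
        show "(H [la] ^^ j) p = m \<or> positively_oriented m ((H [la] ^^ j) p) (H [lA] k)" for j
          using p(1)[of j] 2 by (auto simp: mem_arc)
      qed (use p pu 2 dist H_sphere[of "[lA]" k] unit in auto)
    next
      case 3
      show False
      proof (rule contracting_backward[OF n_contracting[OF 3(2)] 3(2)])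
        show "xs (M + j) = H [lA] k \<or> positively_oriented n (H [lA] k) (xs (M + j))" for j
          using mem(1)[of j] 3 positively_oriented_rotate by (auto simp: mem_arc)
        show "xs M \<noteq> n" using mem(1)[of 0] 3 mem_arc[of n lb] positively_orientedD(5)[of "H [lA] k" n n] dist by auto
      qed (use unit dist xs_unit ret T 3 H_sphere[of "[lA]" k] in auto)
    next
      case 4
      show False
      proof (rule contracting_forward[OF n_contracting[OF 4(2)], of p "rgt lB"])
        show "(H [lb] ^^ j) p = n \<or> positively_oriented n ((H [lb] ^^ j) p) (rgt lB)" for j
          using p(1)[of j] 4 by (auto simp: mem_arc)
      qed (use p pu 4 dist unit unit_rgt[of lB] in auto)
    qed
  next
    case False
    then have v0: "v N = k \<or> v N = H [lA] k" using cv[of N] by auto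
    have c: "v (N + j) = k \<or> v (N + j) = H [lA] k" for j
      using v0 altv by (induction j) auto
    have par: "H [lB] (H [lA] k) = k"
      using cv[of N] cv[of "Suc N"] c[of 0] c[of 1] v(2)[of N] dist kk by auto
    have per: "w (N + 2 * j + i) = w (N + i)" for i j
    proof (induction j)
      case (Suc j)
      then show ?case using alt[of "N + 2 * j + i"] c[of "2 * j + i"] by (simp add: add.assoc)
    qed simp
    have ww: "w (Suc (Suc N)) = w N" using alt[of N] v0 by simp
    have "w N = lB \<and> w (Suc N) = lA \<or> w N = la \<and> w (Suc N) = lb \<or>
      w N = lA \<and> w (Suc N) = lB \<or> w N = lb \<and> w (Suc N) = la"
      using cv[of N] v0 dist by auto
    \<comment> \<open>A shift by one step makes the period start with B or with a, which leaves two
      cases.\<close>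
    then obtain M where M: "M \<ge> N" "w M = lB \<and> w (Suc M) = lA \<or> w M = la \<and> w (Suc M) = lb"
      using ww by (metis le_SucI order_refl)
    have wM: "w (M + 2 * j) = w M" "w (Suc (M + 2 * j)) = w (Suc M)" for j
      using per[of j "M - N"] per[of j "Suc M - N"] M(1) by (simp_all add: algebra_simps Suc_diff_le)
    define g where "g = H [gbar (w (Suc M))] \<circ> H [gbar (w M)]"
    have gx: "xs (M + 2 * Suc j) = g (xs (M + 2 * j))" "ys (M + 2 * Suc j) = g (ys (M + 2 * j))" for j
      by (simp_all add: g_def xs(2) ys(2) wM)
    have it: "xs (M + 2 * j) = (g ^^ j) (xs M)" "ys (M + 2 * j) = (g ^^ j) (ys M)" for j
      by (induction j) (simp_all only: gx funpow.simps o_apply mult_0_right add_0_right id_apply)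
    have mem: "xs (M + 2 * j) \<in> arc (w M)" "ys (M + 2 * j) \<in> arc (w M)" for j
      using xs(1) ys(1) wM by metis+
    have con: "contracting (H [lB] \<circ> H [lA]) k" by (rule k_contracting[OF par])
    from M(2) show False
    proof
      assume A: "w M = lB \<and> w (Suc M) = lA"
      have ret: "((H [lB] \<circ> H [lA]) ^^ j) (xs (M + 2 * j)) = xs M" for j
      proof (induction j)
        case (Suc j)
        have "(H [lB] \<circ> H [lA]) (xs (M + 2 * Suc j)) = xs (M + 2 * j)"
          unfolding gx using A H_letter_inv'[of "xs (M + 2 * j)" lb] H_letter_inv'[of "H [lb] (xs (M + 2 * j))" la]
            xs_unit[of "M + 2 * j"] H_sphere[of "[lb]" "xs (M + 2 * j)"] by (simp add: g_def)
        then show ?case using Suc by (metis comp_apply funpow.simps(2) funpow_swap1)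
      qed simp
      show False
      proof (rule contracting_backward[OF con])
        show "(H [lB] \<circ> H [lA]) k = k" using par by simp
        show "positively_oriented ((H [lB] \<circ> H [lA]) x) ((H [lB] \<circ> H [lA]) y) ((H [lB] \<circ> H [lA]) z)"
          if "positively_oriented x y z" for x y z
          using that H_positively_oriented[of "[lB]"] H_positively_oriented[of "[lA]"] by simp
        show "xs (M + 2 * j) = n \<or> positively_oriented k n (xs (M + 2 * j))" for j
          using mem(1)[of j] A pos_from[OF unit(1) unit(3) xs_unit, of "M + 2 * j"] P_inj[OF xs_unit unit(3), of "M + 2 * j"]
            pos_bounds(3)[of n k] dist by (auto simp: arc_def lp_def)
        show "xs M \<noteq> k" using mem(1)[of 0] A P_chain(1-8) by (auto simp: arc_def)
      qed (use unit dist xs_unit ret in auto)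
    next
      assume A: "w M = la \<and> w (Suc M) = lb"
      then have g: "g = H [lB] \<circ> H [lA]" by (simp add: g_def)
      obtain p where p: "\<And>j. (g ^^ j) p \<in> arc la" "p \<noteq> k"
        using mem it xs_neq_ys[of M] A by metis
      show False
      proof (rule contracting_forward[OF con, of p "rgt la"])
        show "((H [lB] \<circ> H [lA]) ^^ j) p = k \<or> positively_oriented k (((H [lB] \<circ> H [lA]) ^^ j) p) (rgt la)" for j
          using p(1)[of j] unfolding g by (simp add: mem_arc)
        show "cmod p = 1" using p(1)[of 0] arc_unit by simp
      qed (use p rgt_neq_k unit_rgt[of la] in auto)
    qed
  qed
qed

end

definition letter :: "complex \<Rightarrow> pants_gen \<times> bool" where
  "letter x = (SOME l. x \<in> arc l)"

lemma letter_eq: "x \<in> arc l \<Longrightarrow> letter x = l"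
  unfolding letter_def by (rule some_equality) (auto dest: arc_disjoint)

text \<open>A point outside all arcs has an empty remaining itinerary and agrees with no point
  beyond length 0.\<close>

fun agree :: "nat \<Rightarrow> complex \<Rightarrow> complex \<Rightarrow> bool" where
  "agree 0 x y \<longleftrightarrow> True"
| "agree (Suc i) x y \<longleftrightarrow> (\<exists>l. x \<in> arc l \<and> y \<in> arc l \<and> agree i (H [gbar l] x) (H [gbar l] y))"

theorem codes_differ:
  assumes "x \<noteq> y" shows "\<exists>i. \<not> agree i x y"
proof (rule ccontr)
  assume "\<not> ?thesis"
  then have all: "\<And>i. agree i x y" by blast
  define st where "st = (\<lambda>(p, q). (H [gbar (letter p)] p, H [gbar (letter p)] q))"
  define s where "s i = (st ^^ i) (x, y)" for i
  have one: "p \<in> arc (letter p) \<and> q \<in> arc (letter p) \<and> (\<forall>i. agree i (fst (st (p, q))) (snd (st (p, q))))"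
    if a: "\<forall>i. agree i p q" for p q
  proof -
    from a have "agree (Suc 0) p q" by blast
    then obtain l where l: "p \<in> arc l" "q \<in> arc l" by auto
    moreover have "agree i (H [gbar l] p) (H [gbar l] q)" for i
      using a[rule_format, of "Suc i"] l arc_disjoint unfolding agree.simps by metis
    ultimately show ?thesis using letter_eq by (auto simp: st_def)
  qed
  have inv: "\<forall>j. agree j (fst (s i)) (snd (s i))" for i
  proof (induction i)
    case (Suc i)
    then show ?case using one[of "fst (s i)" "snd (s i)"] by (simp add: s_def)
  qed (simp add: s_def all)
  show False
  proof (rule no_common_code[of "\<lambda>i. fst (s i)" "\<lambda>i. letter (fst (s i))" "\<lambda>i. snd (s i)"])
    show "fst (s i) \<in> arc (letter (fst (s i)))" "snd (s i) \<in> arc (letter (fst (s i)))" for i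
      using one[OF inv[of i]] by auto
    show "fst (s (Suc i)) = H [gbar (letter (fst (s i)))] (fst (s i))"
      "snd (s (Suc i)) = H [gbar (letter (fst (s i)))] (snd (s i))" for i
      by (simp_all add: s_def st_def split: prod.split)
    show "fst (s 0) \<noteq> snd (s 0)" using assms by (simp add: s_def)
  qed
qed

end

section \<open>A Schottky group\<close>

lemma norm_mat_sq: "(norm A)\<^sup>2 = (\<Sum>i\<in>UNIV. \<Sum>j\<in>UNIV. (A$i$j)\<^sup>2)" for A :: "real^'n^'m"
  by (simp add: norm_vec_def L2_set_def sum_nonneg real_sqrt_pow2 power2_eq_square[symmetric])

text \<open>The norm of a matrix is here the Frobenius norm, computed column by column, whereas the
  hypothesis bounds the operator norm.\<close>

lemma norm_mult_left:
  fixes P D :: "real^2^2"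
  assumes "\<And>v. norm (P *v v) \<le> c * norm v" "c \<ge> 0"
  shows "norm (P ** D) \<le> c * norm D"
proof -
  have cols: "(norm X)\<^sup>2 = (norm (column 1 X))\<^sup>2 + (norm (column 2 X))\<^sup>2" for X :: "real^2^2"
    by (simp add: norm_mat_sq sum_2 column_def norm_vec_def L2_set_def)
  have "column j (P ** D) = P *v column j D" for j
    by (simp add: vec_eq_iff column_def matrix_matrix_mult_def matrix_vector_mult_def)
  then have "(norm (column j (P ** D)))\<^sup>2 \<le> c\<^sup>2 * (norm (column j D))\<^sup>2" for j
    using power_mono[OF assms(1)[of "column j D"], of 2] by (simp add: power_mult_distrib)
  from this[of 1] this[of 2] have "(norm (P ** D))\<^sup>2 \<le> (c * norm D)\<^sup>2"
    unfolding cols[of "P ** D"] power_mult_distrib cols[of D] distrib_left by linarith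
  then show ?thesis
    by (rule power2_le_imp_le[OF _ mult_nonneg_nonneg[OF assms(2) norm_ge_zero]])
qed

lemma norm_transpose: "norm (transpose A) = norm A" for A :: "real^'n^'m"
proof -
  have "(norm (transpose A))\<^sup>2 = (norm A)\<^sup>2"
    unfolding norm_mat_sq by (subst sum.swap) (simp add: transpose_def)
  then show ?thesis by (simp add: power2_eq_iff_nonneg)
qed

lemma norm_mult_right:
  fixes Q D :: "real^2^2"
  assumes "sym_mat Q" "\<And>v. norm (Q *v v) \<le> c * norm v" "c \<ge> 0"
  shows "norm (D ** Q) \<le> c * norm D"
  using norm_mult_left[OF assms(2,3), of "transpose D"] norm_transpose[of "D ** Q"] norm_transpose[of D] assms(1)
  by (simp add: matrix_transpose_mul sym_mat_def)

text \<open>Consecutive centres differ by at least 4 in the Loewner order. With diagonal centres the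
  group would lie in a product of two copies of SL(2, R), where traces cannot detect reversal; the
  entries 1 of the last centre prevent this.\<close>

definition cen :: "pants_gen \<times> bool \<Rightarrow> real^2^2" where
  "cen l = (if l = la then 0 else if l = lA then mat2 5 0 0 4 else if l = lb then mat2 9 0 0 10
     else mat2 14 1 1 16)"

lemma cen_simps [simp]: "cen la = 0" "cen lA = mat2 5 0 0 4" "cen lb = mat2 9 0 0 10" "cen lB = mat2 14 1 1 16"
  by (simp_all add: cen_def)

lemma sym_cen [simp]: "sym_mat (cen l)"
  using letter_cases[of l] by (auto simp: sym_mat_def vec2_eq_iff transpose_def)

lemma transpose_cen [simp]: "transpose (cen l) = cen l"
  using sym_cen[of l] by (simp add: sym_mat_def)

text \<open>The matrix of \<open>mu l\<close>. The matrix of the inverse letter is minus the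
  inverse, which is harmless modulo sign.\<close>

definition gen :: "pants_gen \<times> bool \<Rightarrow> real^4^4" where
  "gen l = block (- cen l) (mat 1 + cen l ** cen (gbar l)) (- mat 1) (cen (gbar l))"

lemma gen_Sp: "gen l \<in> Sp"
  by (simp add: gen_def Sp_block_iff matrix_ring_simps matrix_transpose_mul matrix_mul_assoc)

lemma gen_gbar: "gen l ** gen (gbar l) = - mat 1"
  by (simp add: gen_def block_mult mat1_block uminus_block matrix_ring_simps matrix_mul_assoc)

text \<open>The order of the arcs along the cut circle, which is also the Loewner order of the
  centres.\<close>

fun idx :: "pants_gen \<times> bool \<Rightarrow> nat" where
  "idx (Gen_\<alpha>, True) = 0" | "idx (Gen_\<alpha>, False) = 1" | "idx (Gen_\<beta>, True) = 2" | "idx (Gen_\<beta>, False) = 3"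

lemma quad_mat2: "v \<bullet> (mat2 a b c d *v v) = a * (v$1)\<^sup>2 + (b + c) * (v$1 * v$2) + d * (v$2)\<^sup>2"
  by (simp add: inner_vec_def sum_2 matrix_vector_mult_def power2_eq_square algebra_simps)

lemma cen_gap:
  assumes "idx l < idx l'" shows "v \<bullet> (cen l *v v) + 4 * (v \<bullet> v) \<le> v \<bullet> (cen l' *v v)"
proof -
  have vv: "v \<bullet> v = (v$1)\<^sup>2 + (v$2)\<^sup>2" by (simp add: inner_vec_def sum_2 power2_eq_square)
  have sq: "0 \<le> (v$1)\<^sup>2" "0 \<le> (v$2)\<^sup>2" "0 \<le> (v$1 + v$2)\<^sup>2" by simp_all
  have e: "(v$1 + v$2)\<^sup>2 = (v$1)\<^sup>2 + 2 * (v$1 * v$2) + (v$2)\<^sup>2" by (simp add: power2_eq_square algebra_simps)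
  have 1: "v \<bullet> (cen la *v v) + 4 * (v \<bullet> v) \<le> v \<bullet> (cen lA *v v)"
    unfolding cen_simps quad_mat2 vv using sq by simp
  have 2: "v \<bullet> (cen lA *v v) + 4 * (v \<bullet> v) \<le> v \<bullet> (cen lb *v v)"
    unfolding cen_simps quad_mat2 vv using sq by simp
  \<comment> \<open>After subtracting 4, the difference of the last two centres is the form (x +
    y)^2 + y^2.\<close>
  have aux: "9 * a + (0 + 0) * b + 10 * c + 4 * (a + c) \<le> 14 * a + (1 + 1) * b + 16 * c"
    if "0 \<le> c" "0 \<le> a + 2 * b + c" for a b c :: real
    using that by simp
  have 3: "v \<bullet> (cen lb *v v) + 4 * (v \<bullet> v) \<le> v \<bullet> (cen lB *v v)"
    unfolding cen_simps quad_mat2 vv by (rule aux[OF sq(2) sq(3)[unfolded e]])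
  have "0 \<le> v \<bullet> v" by simp
  with letter_cases[of l] letter_cases[of l'] show ?thesis
    using 1 2 3 assms by (elim disjE; simp del: cen_simps; linarith)
qed

lemma quad_bound_norm:
  assumes "c * (v \<bullet> v) \<le> \<bar>v \<bullet> (X *v v)\<bar>" "c \<ge> 0"
  shows "c * norm v \<le> norm ((X :: real^'n^'n) *v v)"
proof (cases "v = 0")
  case False
  have "c * norm v * norm v \<le> \<bar>v \<bullet> (X *v v)\<bar>" using assms by (simp add: power2_norm_eq_inner[symmetric] power2_eq_square)
  also have "\<dots> \<le> norm (X *v v) * norm v" using Cauchy_Schwarz_ineq2[of v "X *v v"] by (simp add: mult.commute)
  finally show ?thesis using False by simp
qed simp

lemma cen_separated: "l \<noteq> l' \<Longrightarrow> 4 * norm v \<le> norm ((cen l - cen l') *v v)"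
proof (rule quad_bound_norm)
  assume "l \<noteq> l'"
  then have "idx l < idx l' \<or> idx l' < idx l" using letter_cases[of l] letter_cases[of l'] by auto
  then show "4 * (v \<bullet> v) \<le> \<bar>v \<bullet> ((cen l - cen l') *v v)\<bar>"
    using cen_gap[of l l' v] cen_gap[of l' l v] by (auto simp: matrix_vector_mult_diff_rdistrib inner_diff_right)
qed simp

text \<open>The radii 2/3 here and 3/2 in \<open>away\<close> are reciprocal, so inversion exchanges
  the two conditions and contracts by (2/3)^2 = 4/9. Since 4 - 2/3 >= 3/2, a matrix near one centre
  is away from all others.\<close>

definition near :: "pants_gen \<times> bool \<Rightarrow> (real^2^2) set" where
  "near l = {X. sym_mat X \<and> (\<forall>v. norm ((X - cen l) *v v) \<le> 2 / 3 * norm v)}"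

definition away :: "pants_gen \<times> bool \<Rightarrow> (real^2^2) set" where
  "away l = {X. sym_mat X \<and> (\<forall>v. 3 / 2 * norm v \<le> norm ((X - cen l) *v v))}"

lemma near_away: "X \<in> near l \<Longrightarrow> l \<noteq> l' \<Longrightarrow> X \<in> away l'"
proof -
  assume X: "X \<in> near l" and "l \<noteq> l'"
  have "3 / 2 * norm v \<le> norm ((X - cen l') *v v)" for v
  proof -
    have "(X - cen l') *v v = (cen l - cen l') *v v + (X - cen l) *v v"
      by (simp add: matrix_vector_mult_diff_rdistrib)
    then have "norm ((cen l - cen l') *v v) \<le> norm ((X - cen l') *v v) + norm ((X - cen l) *v v)"
      by (metis add_diff_cancel_right' norm_triangle_ineq4)
    moreover have "norm ((X - cen l) *v v) \<le> 2 / 3 * norm v" using X by (simp add: near_def)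
    ultimately show ?thesis using cen_separated[OF \<open>l \<noteq> l'\<close>, of v] norm_ge_zero[of v] by linarith
  qed
  then show ?thesis using X by (simp add: away_def near_def)
qed

definition mu :: "pants_gen \<times> bool \<Rightarrow> real^2^2 \<Rightarrow> real^2^2" where
  "mu l X = cen l - matrix_inv (X - cen (gbar l))"

lemma away_invertible: "X \<in> away l \<Longrightarrow> invertible (X - cen l)"
proof (rule invertible_ker)
  fix v assume X: "X \<in> away l" and v: "(X - cen l) *v v = 0"
  from X have "3 / 2 * norm v \<le> norm ((X - cen l) *v v)" by (simp add: away_def)
  then show "v = 0" by (simp add: v)
qed

lemma away_inv_norm:
  assumes "X \<in> away l" shows "norm (matrix_inv (X - cen l) *v v) \<le> 2 / 3 * norm v"
proof -
  have "3 / 2 * norm (matrix_inv (X - cen l) *v v) \<le> norm ((X - cen l) *v (matrix_inv (X - cen l) *v v))"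
    using assms by (simp add: away_def)
  then show ?thesis
    using matrix_inv_mult(1)[OF away_invertible[OF assms]] by (simp add: matrix_vector_mul_assoc)
qed

lemma mu_near: assumes "X \<in> away (gbar l)" shows "mu l X \<in> near l"
proof -
  have "sym_mat (matrix_inv (X - cen (gbar l)))"
    using assms by (intro sym_mat_inv away_invertible) (auto simp: away_def)
  then show ?thesis using away_inv_norm[OF assms]
    by (simp add: near_def mu_def matrix_ring_simps)
qed

text \<open>The resolvent identity writes the difference of two inverses as a product with the
  difference of the matrices in the middle; each inverse has operator norm at most 2/3.\<close>

lemma mu_contraction:
  assumes "X \<in> away (gbar l)" "Y \<in> away (gbar l)"
  shows "norm (mu l X - mu l Y) \<le> 4 / 9 * norm (X - Y)"
proof -
  define P Q where "P = X - cen (gbar l)" and "Q = Y - cen (gbar l)"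
  have i: "P ** matrix_inv P = mat 1" "matrix_inv P ** P = mat 1" "Q ** matrix_inv Q = mat 1"
    using matrix_inv_mult[OF away_invertible[OF assms(1)]] matrix_inv_mult[OF away_invertible[OF assms(2)]]
    by (auto simp: P_def Q_def)
  have "matrix_inv P ** (P - Q) ** matrix_inv Q = matrix_inv Q - matrix_inv P"
    by (simp add: matrix_ring_simps i) (simp add: i flip: matrix_mul_assoc)
  then have "mu l X - mu l Y = matrix_inv P ** ((X - Y) ** matrix_inv Q)"
    by (simp add: mu_def P_def Q_def matrix_mul_assoc)
  then have "norm (mu l X - mu l Y) \<le> 2 / 3 * norm ((X - Y) ** matrix_inv Q)"
    using norm_mult_left[of "matrix_inv P" "2 / 3"] away_inv_norm[OF assms(1)] by (simp add: P_def)
  also have "norm ((X - Y) ** matrix_inv Q) \<le> 2 / 3 * norm (X - Y)"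
    using assms(2) away_inv_norm[OF assms(2)] unfolding Q_def
    by (intro norm_mult_right sym_mat_inv away_invertible) (auto simp: away_def)
  finally show ?thesis by simp
qed

lemma gen_image:
  assumes "X \<in> away (gbar l)" shows "(*v) (gen l) ` lag X = lag (mu l X)"
proof -
  have inv: "invertible (X - cen (gbar l))" by (rule away_invertible[OF assms])
  have "(*v) (gen l) ` lag X = frame (- cen l ** X + (mat 1 + cen l ** cen (gbar l))) (- mat 1 ** X + cen (gbar l))"
    by (simp add: gen_def image_lag)
  also have "\<dots> = lag (mu l X)"
  proof (rule frame_eq_lag)
    have "- mat 1 ** X + cen (gbar l) = - (X - cen (gbar l))" by (simp add: matrix_ring_simps)
    then show "invertible (- mat 1 ** X + cen (gbar l))" using invertible_uminus[OF inv] by simp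
    have "matrix_inv (X - cen (gbar l)) ** X - matrix_inv (X - cen (gbar l)) ** cen (gbar l) = mat 1"
      using matrix_inv_mult(2)[OF inv] by (simp add: matrix_ring_simps)
    then show "- cen l ** X + (mat 1 + cen l ** cen (gbar l)) = mu l X ** (- mat 1 ** X + cen (gbar l))"
      by (simp add: mu_def matrix_ring_simps)
  qed
  finally show ?thesis .
qed

section \<open>Words in the generators\<close>

definition word_mat :: "(pants_gen \<times> bool) list \<Rightarrow> real^4^4" where
  "word_mat w = foldr (\<lambda>l M. gen l ** M) w (mat 1)"

lemma word_mat_simps [simp]: "word_mat [] = mat 1" "word_mat (l # w) = gen l ** word_mat w"
  by (simp_all add: word_mat_def)

lemma word_mat_append: "word_mat (u @ v) = word_mat u ** word_mat v"
  by (induction u) (simp_all add: matrix_mul_assoc)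

lemma word_mat_Sp: "word_mat w \<in> Sp"
  by (induction w) (simp_all add: mat1_Sp Sp_mult gen_Sp)

lemma word_mat_inverse: "word_mat w ** word_mat (rev (map gbar w)) \<in> {mat 1, - mat 1}"
proof (induction w)
  case (Cons l w)
  have "word_mat (l # w) ** word_mat (rev (map gbar (l # w))) =
      gen l ** (word_mat w ** word_mat (rev (map gbar w))) ** gen (gbar l)"
    by (simp add: word_mat_append matrix_mul_assoc)
  then show ?case using Cons gen_gbar[of l] by (auto simp: matrix_ring_simps)
qed simp

definition mu_word :: "(pants_gen \<times> bool) list \<Rightarrow> real^2^2 \<Rightarrow> real^2^2" where
  "mu_word w X = foldr mu w X"

lemma mu_word:
  assumes "reduced gbar w" "w \<noteq> []" "X \<in> away (gbar (last w))"
  shows "mu_word w X \<in> near (hd w) \<and> (*v) (word_mat w) ` lag X = lag (mu_word w X) \<and>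
    (Y \<in> away (gbar (last w)) \<longrightarrow> norm (mu_word w X - mu_word w Y) \<le> 4 / 9 * norm (X - Y))"
  using assms
proof (induction w arbitrary: X Y)
  case (Cons l w)
  show ?case
  proof (cases "w = []")
    case True
    then show ?thesis using Cons.prems mu_near gen_image mu_contraction by (simp add: mu_word_def)
  next
    case False
    have red: "reduced gbar w" "hd w \<noteq> gbar l"
      using Cons.prems(1) False by (cases w; simp add: reduced_def)+
    have last: "last (l # w) = last w" using False by simp
    have X: "mu_word w X \<in> near (hd w)" "(*v) (word_mat w) ` lag X = lag (mu_word w X)"
      using Cons.IH[OF red(1) False] Cons.prems last by auto
    have aX: "mu_word w X \<in> away (gbar l)" using near_away[OF X(1) red(2)] .
    have "norm (mu_word (l # w) X - mu_word (l # w) Y) \<le> 4 / 9 * norm (X - Y)"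
      if Y: "Y \<in> away (gbar (last (l # w)))"
    proof -
      have "mu_word w Y \<in> away (gbar l)" using near_away[OF _ red(2)] Cons.IH[OF red(1) False, of Y] Y last by auto
      then have "norm (mu_word (l # w) X - mu_word (l # w) Y) \<le> 4 / 9 * norm (mu_word w X - mu_word w Y)"
        using mu_contraction aX by (simp add: mu_word_def)
      moreover have "norm (mu_word w X - mu_word w Y) \<le> 4 / 9 * norm (X - Y)"
        using Cons.IH[OF red(1) False, of X Y] Cons.prems Y last by auto
      ultimately show ?thesis using norm_ge_zero[of "X - Y"] by linarith
    qed
    moreover have "(*v) (word_mat (l # w)) ` lag X = (*v) (gen l) ` ((*v) (word_mat w) ` lag X)"
      by (simp add: image_image matrix_vector_mul_assoc)
    ultimately show ?thesis using mu_near[OF aX] gen_image[OF aX] X by (simp add: mu_word_def)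
  qed
qed simp

lemma complete_near: "complete (near l)"
proof -
  have "near l = {X. transpose X = X} \<inter> (\<Inter>v. {X. norm ((X - cen l) *v v) \<le> 2 / 3 * norm v})"
    by (auto simp: near_def sym_mat_def)
  moreover have "closed {X::real^2^2. transpose X = X}"
    unfolding transpose_def vec_eq_iff by (simp, intro closed_Collect_all closed_Collect_eq continuous_intros)
  moreover have cont: "continuous_on UNIV (\<lambda>X. norm ((X - cen l) *v v))" for v
    unfolding matrix_vector_mult_def by (intro continuous_intros)
  have "closed {X. norm ((X - cen l) *v v) \<le> 2 / 3 * norm v}" for v
    by (rule closed_Collect_le[OF cont continuous_on_const])
  ultimately have "closed (near l)" by (simp add: closed_INT closed_Int)
  then show ?thesis by (simp add: complete_eq_closed)
qed

text \<open>For a cyclically reduced word the ball of the first letter is away from the inverse of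
  the last one, so the word maps this ball into itself and Banach's theorem applies.\<close>

lemma word_fixed_lagrangian:
  assumes w: "reduced gbar w" "w \<noteq> []" "hd w \<noteq> gbar (last w)"
  obtains E where "E \<in> near (hd w)" "(*v) (word_mat w) ` lag E = lag E"
proof -
  have aw: "X \<in> away (gbar (last w))" if "X \<in> near (hd w)" for X using near_away[OF that w(3)] .
  have "\<exists>!E. E \<in> near (hd w) \<and> mu_word w E = E"
  proof (rule Banach_fix[OF complete_near, of _ "4 / 9"])
    show "near (hd w) \<noteq> {}" by (auto simp: near_def intro: exI[of _ "cen (hd w)"])
    show "mu_word w ` near (hd w) \<subseteq> near (hd w)" using mu_word[OF w(1,2)] aw by auto
    show "dist (mu_word w X) (mu_word w Y) \<le> 4 / 9 * dist X Y" if "X \<in> near (hd w)" "Y \<in> near (hd w)" for X Y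
      using mu_word[OF w(1,2) aw[OF that(1)], of Y] aw[OF that(2)] by (simp add: dist_norm)
  qed simp_all
  then obtain E where "E \<in> near (hd w)" "mu_word w E = E" by blast
  then show ?thesis using that mu_word[OF w(1,2) aw] by metis
qed

text \<open>A form of signature (2, 2): it is positive on \<open>lag X\<close> exactly when X -
  \<open>cen l\<close> has operator norm below 1. Generators carry one such form to the negative of
  another (\<open>qf_gen\<close>).\<close>

definition qf :: "pants_gen \<times> bool \<Rightarrow> real^4 \<Rightarrow> real" where
  "qf l v = (let x = vector [v$1, v$2]; y = vector [v$3, v$4] in y \<bullet> y - (x - cen l *v y) \<bullet> (x - cen l *v y))"

lemma qf_vpair: "qf l (vpair x y) = y \<bullet> y - (x - cen l *v y) \<bullet> (x - cen l *v y)"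
proof -
  have "vector [u$1, u$2] = (u :: real^2)" for u by (simp add: vec2_eq_iff)
  then show ?thesis by (simp add: qf_def)
qed

lemma qf_gen: "qf l (gen l *v v) = - qf (gbar l) v"
proof -
  obtain x y where v: "v = vpair x y" by (rule vpair_exhaust)
  define u where "u = x - cen (gbar l) *v y"
  have "gen l *v v = vpair (y - cen l *v u) (- u)"
    by (simp add: v u_def gen_def block_mult_vec matrix_ring_simps matrix_vector_mult_add_rdistrib
      matrix_vector_mult_diff_distrib matrix_vector_mul_assoc)
  then show ?thesis by (simp add: v qf_vpair matrix_ring_simps flip: u_def)
qed

text \<open>Unit balls around centres at distance 4 are disjoint: s + t >= 4 |y| gives s^2 + t^2 >=
  8 |y|^2, while the sum of the forms is 2 |y|^2 minus this.\<close>

lemma qf_negative: assumes "l \<noteq> l'" "v \<noteq> 0" shows "qf l v + qf l' v < 0"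
proof -
  obtain x y where v: "v = vpair x y" by (rule vpair_exhaust)
  define s t where "s = norm (x - cen l *v y)" and "t = norm (x - cen l' *v y)"
  have q: "qf l v + qf l' v = 2 * (norm y)\<^sup>2 - (s\<^sup>2 + t\<^sup>2)"
    by (simp add: v qf_vpair s_def t_def power2_norm_eq_inner)
  show ?thesis
  proof (cases "y = 0")
    case True
    then show ?thesis using assms(2) unfolding q by (simp add: v s_def t_def)
  next
    case False
    have "(cen l - cen l') *v y = (x - cen l' *v y) - (x - cen l *v y)"
      by (simp add: matrix_vector_mult_diff_rdistrib)
    then have "4 * norm y \<le> t + s"
      using cen_separated[OF assms(1), of y] norm_triangle_ineq4[of "x - cen l' *v y" "x - cen l *v y"]
      unfolding s_def t_def by simp
    then have "(4 * norm y)\<^sup>2 \<le> (t + s)\<^sup>2" by (intro power_mono) auto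
    also have "\<dots> \<le> 2 * (s\<^sup>2 + t\<^sup>2)" using zero_le_power2[of "s - t"] by (simp add: power2_eq_square algebra_simps)
    finally have "8 * (norm y)\<^sup>2 \<le> s\<^sup>2 + t\<^sup>2" by (simp add: power_mult_distrib)
    moreover have "(norm y)\<^sup>2 > 0" using False by simp
    ultimately show ?thesis unfolding q by linarith
  qed
qed

lemma Sp_mult_vec_nz: "M \<in> Sp \<Longrightarrow> v \<noteq> 0 \<Longrightarrow> M *v v \<noteq> 0"
  by (metis Sp_inverse_ex matrix_vector_mul_assoc matrix_vector_mul_lid matrix_vector_mult_0_right)

text \<open>Inside a reduced word the form of each letter dominates that of the next. Together with
  \<open>qf_negative\<close> for the first letter and the inverse of the last, this gives strict
  growth under a cyclically reduced word.\<close>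

lemma qf_word:
  assumes "reduced gbar w" "w \<noteq> []" "v \<noteq> 0"
  shows "- qf (gbar (last w)) v \<le> qf (hd w) (word_mat w *v v)"
  using assms(1,2)
proof (induction w)
  case (Cons l w)
  show ?case
  proof (cases "w = []")
    case True
    then show ?thesis by (simp add: qf_gen)
  next
    case False
    have red: "reduced gbar w" "hd w \<noteq> gbar l"
      using Cons.prems(1) False by (cases w; simp add: reduced_def)+
    have "word_mat w *v v \<noteq> 0" using Sp_mult_vec_nz word_mat_Sp assms(3) by blast
    then have "qf (hd w) (word_mat w *v v) < - qf (gbar l) (word_mat w *v v)"
      using qf_negative[OF red(2)] by fastforce
    also have "\<dots> = qf l (word_mat (l # w) *v v)" by (simp add: qf_gen flip: matrix_vector_mul_assoc)
    finally show ?thesis using Cons.IH[OF red(1) False] False by simp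
  qed
qed simp

lemma qf_near: assumes "E \<in> near l" "v \<in> lag E" "v \<noteq> 0" shows "qf l v > 0"
proof -
  obtain u where u: "v = vpair (E *v u) u" using assms(2) by (auto simp: lag_eq)
  then have "u \<noteq> 0" using assms(3) by auto
  have "norm ((E - cen l) *v u) \<le> 2 / 3 * norm u" using assms(1) by (simp add: near_def)
  then have "(norm ((E - cen l) *v u))\<^sup>2 \<le> (2 / 3 * norm u)\<^sup>2" by (intro power_mono) auto
  moreover have "(2 / 3 * norm u)\<^sup>2 = 4 / 9 * (norm u)\<^sup>2" by (simp add: power_mult_distrib power_divide)
  moreover have "0 < (norm u)\<^sup>2" using \<open>u \<noteq> 0\<close> by simp
  ultimately have "(norm ((E - cen l) *v u))\<^sup>2 < (norm u)\<^sup>2" by linarith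
  then show ?thesis
    by (simp add: u qf_vpair matrix_vector_mult_diff_rdistrib power2_norm_eq_inner)
qed

section \<open>Shilov hyperbolicity and the limit map\<close>

definition shilov_mat :: "real^4^4 \<Rightarrow> bool" where
  "shilov_mat M \<longleftrightarrow> (\<exists>S\<in>Sp. \<exists>A::real^2^2. invertible A \<and>
     S ** M ** matrix_inv S = block A 0 0 (transpose (matrix_inv A)) \<and>
     (\<forall>(c::complex) v. v \<noteq> 0 \<and> map_matrix of_real A *v v = c *s v \<longrightarrow> cmod c > 1))"

lemma shilov_mat_conj:
  assumes M: "shilov_mat M" and U: "U \<in> Sp" "V ** U = mat 1"
  shows "shilov_mat (U ** M ** V)"
proof -
  obtain S A where S: "S \<in> Sp" "S ** M ** matrix_inv S = block A 0 0 (transpose (matrix_inv A))" "invertible A"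
    "\<forall>(c::complex) v. v \<noteq> 0 \<and> map_matrix of_real A *v v = c *s v \<longrightarrow> cmod c > 1"
    using M by (auto simp: shilov_mat_def)
  obtain T where T: "T ** S = mat 1" "S ** T = mat 1" using Sp_inverse_ex[OF S(1)] by blast
  have UV: "U ** V = mat 1" using U(2) matrix_left_right_inverse by blast
  have SV: "S ** V \<in> Sp" using Sp_mult(1)[OF S(1) Sp_inverse(1)[OF U(2,1)]] .
  have "(S ** V) ** (U ** T) = mat 1"
    using T(2) U(2) by (metis matrix_mul_assoc matrix_mul_rid)
  then have "matrix_inv (S ** V) = U ** T" by (rule matrix_inv_unique)
  moreover have "matrix_inv S = T" using T(2) by (rule matrix_inv_unique)
  ultimately have "(S ** V) ** (U ** M ** V) ** matrix_inv (S ** V) = S ** ((V ** U) ** M ** (V ** U)) ** matrix_inv S"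
    by (simp add: matrix_mul_assoc)
  then show ?thesis
    unfolding shilov_mat_def using S SV U(2) by (intro bexI[of _ "S ** V"] exI[of _ A]) auto
qed

text \<open>A complex eigenvalue a + ib acts on the real and imaginary parts of an eigenvector as a
  scaled rotation, which multiplies the sum of the two values of the form by |a + ib|^2.\<close>

lemma qf_rotate: "qf l (a *\<^sub>R s - b *\<^sub>R t) + qf l (b *\<^sub>R s + a *\<^sub>R t) = (a\<^sup>2 + b\<^sup>2) * (qf l s + qf l t)"
proof -
  have rot: "(a *\<^sub>R x - b *\<^sub>R y) \<bullet> (a *\<^sub>R x - b *\<^sub>R y) + (b *\<^sub>R x + a *\<^sub>R y) \<bullet> (b *\<^sub>R x + a *\<^sub>R y)
     = (a\<^sup>2 + b\<^sup>2) * (x \<bullet> x + y \<bullet> y)" for x y :: "real^2"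
    by (simp add: inner_diff_left inner_diff_right inner_add_left inner_add_right power2_eq_square algebra_simps inner_commute)
  obtain x y x' y' where s: "s = vpair x y" and t: "t = vpair x' y'" by (metis vpair_exhaust)
  have e: "qf l (vpair u v) = v \<bullet> v - (u - cen l *v v) \<bullet> (u - cen l *v v)" for u v by (rule qf_vpair)
  have 1: "a *\<^sub>R s - b *\<^sub>R t = vpair (a *\<^sub>R x - b *\<^sub>R x') (a *\<^sub>R y - b *\<^sub>R y')"
    "b *\<^sub>R s + a *\<^sub>R t = vpair (b *\<^sub>R x + a *\<^sub>R x') (b *\<^sub>R y + a *\<^sub>R y')"
    by (simp_all add: s t vpair_scaleR vpair_add vpair_diff)
  have 2: "(a *\<^sub>R x - b *\<^sub>R x') - cen l *v (a *\<^sub>R y - b *\<^sub>R y') = a *\<^sub>R (x - cen l *v y) - b *\<^sub>R (x' - cen l *v y')"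
    "(b *\<^sub>R x + a *\<^sub>R x') - cen l *v (b *\<^sub>R y + a *\<^sub>R y') = b *\<^sub>R (x - cen l *v y) + a *\<^sub>R (x' - cen l *v y')"
    by (simp_all add: matrix_vector_mult_diff_distrib matrix_vector_right_distrib matrix_vector_mult_scaleR scaleR_diff_right)
  have alg: "X1 - Z1 + (X2 - Z2) = c * (p - r + (q - s))" if "X1 + X2 = c * (p + q)" "Z1 + Z2 = c * (r + s)"
    for X1 X2 Z1 Z2 c p q r s :: real
    using that by algebra
  have st: "qf l s = y \<bullet> y - (x - cen l *v y) \<bullet> (x - cen l *v y)" "qf l t = y' \<bullet> y' - (x' - cen l *v y') \<bullet> (x' - cen l *v y')"
    by (simp_all only: s t e)
  show ?thesis
    unfolding 1 e 2 st by (rule alg[OF rot rot])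
qed

lemma uminus_lag: "(*v) (- mat 1) ` lag X = lag X" for X :: "real^2^2"
proof -
  have "(*v) (- mat 1 :: real^4^4) = uminus" by (auto simp: matrix_uminus_vec)
  moreover have "uminus ` lag X = lag X" using subspace_lag[of X] subspace_neg by (force simp: image_iff)
  ultimately show ?thesis by simp
qed

text \<open>The word fixes E near its first letter and, through its inverse, F near the inverse of
  its last letter. Moving these to infinity and 0 makes it block diagonal, and on E the form
  \<open>qf (hd w)\<close> is positive and grows, so the eigenvalues there exceed 1 in
  modulus.\<close>

lemma shilov_cyclically_reduced:
  assumes w: "reduced gbar w" "w \<noteq> []" "hd w \<noteq> gbar (last w)"
  shows "shilov_mat (word_mat w)"
proof -
  define M where "M = word_mat w"
  have MS: "M \<in> Sp" by (simp add: M_def word_mat_Sp)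
  obtain E where E: "E \<in> near (hd w)" "(*v) M ` lag E = lag E"
    using word_fixed_lagrangian[OF w] by (auto simp: M_def)
  define w' where "w' = rev (map gbar w)"
  have "successively (\<lambda>x y. y \<noteq> gbar x) w'"
    using w(1) unfolding w'_def reduced_def successively_rev successively_map
    by (rule successively_mono) auto
  then have "reduced gbar w'" "w' \<noteq> []" "hd w' = gbar (last w)" "last w' = gbar (hd w)"
    using w(2) by (simp_all add: w'_def reduced_def hd_rev last_rev last_map list.map_sel)
  then obtain F where F: "F \<in> near (gbar (last w))" "(*v) (word_mat w') ` lag F = lag F"
    using word_fixed_lagrangian[of w'] w(3) by auto
  have "(*v) M ` lag F = (*v) M ` ((*v) (word_mat w') ` lag F)" using F by simp
  also have "\<dots> = (*v) (M ** word_mat w') ` lag F" by (simp add: image_image matrix_vector_mul_assoc)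
  also have "M ** word_mat w' = mat 1 \<or> M ** word_mat w' = - mat 1"
    using word_mat_inverse[of w] by (simp add: M_def w'_def)
  then have "(*v) (M ** word_mat w') ` lag F = lag F"
    by (elim disjE) (simp, simp only: uminus_lag)
  finally have MF: "(*v) M ` lag F = lag F" .
  define D where "D = E - F"
  have symE: "sym_mat E" "sym_mat F" using E F by (auto simp: near_def)
  have "invertible D"
  proof (rule invertible_ker, rule ccontr)
    fix u assume u: "D *v u = 0" "u \<noteq> 0"
    then have "vpair (E *v u) u = vpair (F *v u) u" by (simp add: D_def matrix_vector_mult_diff_rdistrib)
    moreover have "vpair (X *v u) u \<in> lag X" for X by (simp add: lag_eq)
    ultimately have "vpair (E *v u) u \<in> lag E" "vpair (E *v u) u \<in> lag F" by metis+
    then show False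
      using qf_near[OF E(1)] qf_near[OF F(1)] qf_negative[OF w(3), of "vpair (E *v u) u"] u(2) by force
  qed
  define Di where "Di = matrix_inv D"
  have Di: "D ** Di = mat 1" "Di ** D = mat 1" using matrix_inv_mult[OF \<open>invertible D\<close>] by (auto simp: Di_def)
  have symDi: "transpose Di = Di" using sym_mat_inv[OF \<open>invertible D\<close>] symE by (simp add: Di_def D_def sym_mat_def[symmetric])
  \<comment> \<open>Translation by -F followed by the shear taking (x, y) to (x, y - Di x): the
    first sends F to 0 and E to D, the second sends D to infinity and keeps 0.\<close>
  define S where "S = block (mat 1) (- F) (- Di) (mat 1 + Di ** F)"
  have "S \<in> Sp" using symDi symE
    by (simp add: S_def Sp_block_iff matrix_ring_simps matrix_transpose_mul sym_mat_def matrix_mul_assoc)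
  then obtain T where T: "T \<in> Sp" "T ** S = mat 1" "S ** T = mat 1" using Sp_inverse_ex by blast
  have SE: "(*v) S ` lag E = lag_inf"
  proof -
    have "(*v) S ` lag E = frame (E - F) (- (Di ** E) + (mat 1 + Di ** F))" by (simp add: S_def image_lag matrix_ring_simps)
    also have "- (Di ** E) + (mat 1 + Di ** F) = mat 1 - Di ** D" by (simp add: D_def matrix_ring_simps)
    also have "\<dots> = 0 ** D" by (simp add: Di matrix_zero_mult)
    also have "E - F = mat 1 ** D" by (simp add: D_def)
    finally show ?thesis using frame_mult[OF \<open>invertible D\<close>, of "mat 1" 0] by (simp only: lag_inf_frame)
  qed
  have SF: "(*v) S ` lag F = lag 0"
    unfolding S_def image_lag lag_frame[of 0] by (simp add: matrix_ring_simps)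
  define N where "N = S ** M ** T"
  have TE: "(*v) T ` lag_inf = lag E" and TF: "(*v) T ` lag 0 = lag F"
    unfolding SE[symmetric] SF[symmetric] by (simp_all add: image_image matrix_vector_mul_assoc T)
  have comp: "(*v) (X ** Y) ` L = (*v) X ` ((*v) Y ` L)" for X Y :: "real^4^4" and L
    by (simp add: image_image matrix_vector_mul_assoc)
  have N: "(*v) N ` lag_inf = lag_inf" "(*v) N ` lag 0 = lag 0"
    by (simp_all add: N_def comp TE TF E MF SE SF)
  obtain A B C G where blk: "N = block A B C G" by (rule block_exhaust)
  have "C = 0"
  proof -
    have "vpair (A *v u) (C *v u) \<in> lag_inf" for u
      using N(1) by (force simp: lag_inf_eq blk block_mult_vec)
    moreover have "vpair a c \<in> lag_inf \<longleftrightarrow> c = 0" for a c by (auto simp: lag_inf_eq)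
    ultimately show ?thesis by (simp add: matrix_eq)
  qed
  have "B = 0"
  proof -
    have "vpair (B *v u) (G *v u) \<in> lag 0" for u
      using N(2) by (force simp: lag_eq blk block_mult_vec)
    moreover have "vpair b g \<in> lag 0 \<longleftrightarrow> b = 0" for b g :: "real^2" by (auto simp: lag_eq)
    ultimately show ?thesis by (simp add: matrix_eq)
  qed
  have "N \<in> Sp" unfolding N_def using MS T(1) \<open>S \<in> Sp\<close> Sp_mult(1) by blast
  then have AG: "transpose A ** G = mat 1" by (simp add: blk \<open>B = 0\<close> \<open>C = 0\<close> Sp_block_iff matrix_ring_simps)
  then have "transpose G ** A = mat 1" by (metis matrix_transpose_mul transpose_mat transpose_transpose)
  then have AG': "A ** transpose G = mat 1" using matrix_left_right_inverse by blast
  then have invA: "invertible A" "matrix_inv A = transpose G"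
    using \<open>transpose G ** A = mat 1\<close> matrix_inv_unique by (auto simp: invertible_def)
  have eig: "cmod c > 1" if v: "v \<noteq> 0" "map_matrix of_real A *v v = c *s v" for c :: complex and v
  proof -
    define x y where "x = (\<chi> i. Re (v$i))" and "y = (\<chi> i. Im (v$i))"
    define a b where "a = Re c" and "b = Im c"
    have Axy: "A *v x = a *\<^sub>R x - b *\<^sub>R y" "A *v y = b *\<^sub>R x + a *\<^sub>R y"
      using v(2) by (simp_all add: vec_eq_iff matrix_vector_mult_def map_matrix_def x_def y_def a_def b_def complex_eq_iff)
    have nz: "x \<noteq> 0 \<or> y \<noteq> 0" using v(1) by (auto simp: x_def y_def vec_eq_iff complex_eq_iff)
    define s t where "s = T *v vpair x 0" and "t = T *v vpair y 0"
    have MT: "M *v (T *v z) = T *v (N *v z)" for z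
      by (simp add: N_def matrix_vector_mul_assoc matrix_mul_assoc T)
    have Ms: "M *v s = a *\<^sub>R s - b *\<^sub>R t" "M *v t = b *\<^sub>R s + a *\<^sub>R t"
    proof -
      have "N *v vpair x 0 = a *\<^sub>R vpair x 0 - b *\<^sub>R vpair y 0" "N *v vpair y 0 = b *\<^sub>R vpair x 0 + a *\<^sub>R vpair y 0"
        by (simp_all add: blk block_mult_vec \<open>C = 0\<close> Axy vpair_scaleR vpair_add vpair_diff)
      then show "M *v s = a *\<^sub>R s - b *\<^sub>R t" "M *v t = b *\<^sub>R s + a *\<^sub>R t"
        unfolding s_def t_def MT by (simp_all add: matrix_vector_mult_diff_distrib matrix_vector_right_distrib matrix_vector_mult_scaleR)
    qed
    have inE: "s \<in> lag E" "t \<in> lag E" unfolding s_def t_def TE[symmetric] by (auto simp: lag_inf_eq)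
    have s0: "s = 0 \<longleftrightarrow> x = 0" "t = 0 \<longleftrightarrow> y = 0"
      using Sp_mult_vec_nz[OF T(1), of "vpair x 0"] Sp_mult_vec_nz[OF T(1), of "vpair y 0"] by (auto simp: s_def t_def)
    have grow: "qf (hd w) z < qf (hd w) (M *v z)" if "z \<noteq> 0" for z
      using qf_word[OF w(1,2) that] qf_negative[OF w(3) that] by (simp add: M_def)
    have q0: "qf l 0 = 0" for l using qf_vpair[of l 0 0] by simp
    have pos: "z \<in> lag E \<Longrightarrow> 0 \<le> qf (hd w) z \<and> (z \<noteq> 0 \<longrightarrow> 0 < qf (hd w) z)" for z
      using qf_near[OF E(1), of z] q0 by (cases "z = 0") auto
    define Q where "Q = qf (hd w) s + qf (hd w) t"
    have "Q > 0" using pos[OF inE(1)] pos[OF inE(2)] nz s0 by (auto simp: Q_def add_pos_nonneg add_nonneg_pos)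
    have "Q < qf (hd w) (M *v s) + qf (hd w) (M *v t)"
      using grow[of s] grow[of t] nz s0 q0 by (cases "s = 0"; cases "t = 0") (auto simp: Q_def)
    also have "\<dots> = (a\<^sup>2 + b\<^sup>2) * Q" unfolding Ms Q_def by (rule qf_rotate)
    finally have "1 < a\<^sup>2 + b\<^sup>2" using \<open>Q > 0\<close> by simp
    then show ?thesis by (simp add: cmod_def a_def b_def)
  qed
  have "matrix_inv S = T" using T(3) by (rule matrix_inv_unique)
  then show ?thesis
    unfolding shilov_mat_def using \<open>S \<in> Sp\<close> invA eig
    by (intro bexI[of _ S] exI[of _ A]) (auto simp: M_def[symmetric] N_def[symmetric] blk \<open>B = 0\<close> \<open>C = 0\<close>)
qed

text \<open>A letter and its inverse at the two ends amount to a conjugation. Each such removal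
  changes the sign of the representing matrix, hence the alternative.\<close>

lemma shilov_word:
  assumes "reduced gbar w" "w \<noteq> []"
  shows "shilov_mat (word_mat w) \<or> shilov_mat (- word_mat w)"
  using assms
proof (induction w rule: length_induct)
  case (1 w)
  show ?case
  proof (cases "hd w = gbar (last w)")
    case False
    then show ?thesis using shilov_cyclically_reduced 1 by blast
  next
    case True
    define l where "l = hd w"
    have ll: "last w = gbar l" using True by (simp add: l_def)
    have "tl w \<noteq> []" using True 1(3) by (cases w) auto
    define u where "u = butlast (tl w)"
    have "last (tl w) = gbar l" using ll 1(3) \<open>tl w \<noteq> []\<close> by (cases w) auto
    then have "tl w = u @ [gbar l]" using append_butlast_last_id[OF \<open>tl w \<noteq> []\<close>] by (simp add: u_def)
    then have wu: "w = l # u @ [gbar l]" using 1(3) by (cases w) (auto simp: l_def)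
    have "u \<noteq> []" using 1(2) by (auto simp: wu reduced_def)
    moreover have "reduced gbar u" using 1(2) \<open>u \<noteq> []\<close>
      by (auto simp: wu reduced_def successively_Cons successively_append_iff)
    ultimately have IH: "shilov_mat (word_mat u) \<or> shilov_mat (- word_mat u)"
      using 1(1) by (simp add: wu)
    have inv: "(- gen (gbar l)) ** gen l = mat 1" using gen_gbar[of "gbar l"] by (simp add: matrix_ring_simps)
    have "word_mat w = - (gen l ** word_mat u ** (- gen (gbar l)))"
      by (simp add: wu word_mat_append matrix_mul_assoc matrix_ring_simps)
    moreover have "word_mat w = gen l ** (- word_mat u) ** (- gen (gbar l))"
      by (simp add: wu word_mat_append matrix_mul_assoc matrix_ring_simps)
    ultimately show ?thesis
      using IH shilov_mat_conj[OF _ gen_Sp inv] by (metis minus_minus)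
  qed
qed

section \<open>The limit map as a limit of approximations\<close>

context pants
begin

text \<open>The complement of the arcs consists of the intervals from \<open>rp l\<close> to
  \<open>nx l\<close>, each just behind its arc; \<open>fl\<close> names the arc in front.\<close>

definition nx :: "pants_gen \<times> bool \<Rightarrow> real" where
  "nx l = (if l = la then lp lA else if l = lA then lp lb else if l = lb then lp lB else 2)"

definition fl :: "complex \<Rightarrow> pants_gen \<times> bool" where
  "fl x = (if P x < lp lA then la else if P x < lp lb then lA else if P x < lp lB then lb else lB)"

text \<open>The points outside the four arcs represent the orbits of points with finite itinerary, so the limit
  map can be prescribed there, subject to monotonicity and right continuity.\<close>

definition filler :: "complex \<Rightarrow> real^2^2" where
  "filler x = cen (fl x) + mat (7 / 4 + P x / 8)"

lemma idx_order: "idx l < idx l' \<Longrightarrow> rp l \<le> lp l' \<and> nx l \<le> lp l'"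
  using letter_cases[of l] letter_cases[of l'] P_chain by (auto simp: nx_def)

lemma idx_eq: "idx l = idx l' \<Longrightarrow> l = l'"
  using letter_cases[of l] letter_cases[of l'] by auto

lemma fill_region: "rp l \<le> P x \<Longrightarrow> P x < nx l \<Longrightarrow> fl x = l \<and> x \<notin> arc l'"
  using letter_cases[of l] letter_cases[of l'] P_chain by (auto simp: fl_def nx_def arc_def)

lemma fl_region: "cmod x = 1 \<Longrightarrow> \<forall>l. x \<notin> arc l \<Longrightarrow> rp (fl x) \<le> P x \<and> P x < nx (fl x)"
  using pos_bounds[of k x] P_chain(1)
  by (auto simp: fl_def nx_def arc_def not_less dest: spec[of _ la] spec[of _ lA] spec[of _ lb] spec[of _ lB])

text \<open>The position of the limit value at x relative to all centres. The margin 3/2 is what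
  \<open>away\<close> demands for the arcs that do not contain x.\<close>

definition good :: "complex \<Rightarrow> (real^2^2) set" where
  "good x = {X. sym_mat X \<and> (\<forall>l. x \<in> arc l \<longrightarrow> X \<in> near l) \<and>
     (\<forall>l. rp l \<le> P x \<longrightarrow> (\<forall>v. v \<bullet> (cen l *v v) + 3 / 2 * (v \<bullet> v) \<le> v \<bullet> (X *v v))) \<and>
     (\<forall>l. P x < lp l \<longrightarrow> (\<forall>v. v \<bullet> (X *v v) + 3 / 2 * (v \<bullet> v) \<le> v \<bullet> (cen l *v v)))}"

lemma near_quad: assumes "X \<in> near l" shows "\<bar>v \<bullet> (X *v v) - v \<bullet> (cen l *v v)\<bar> \<le> 2 / 3 * (v \<bullet> v)"
proof -
  have "\<bar>v \<bullet> ((X - cen l) *v v)\<bar> \<le> norm v * norm ((X - cen l) *v v)" by (rule Cauchy_Schwarz_ineq2)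
  also have "\<dots> \<le> norm v * (2 / 3 * norm v)" using assms by (intro mult_left_mono) (auto simp: near_def)
  also have "\<dots> = 2 / 3 * (v \<bullet> v)" by (simp add: power2_norm_eq_inner[symmetric] power2_eq_square)
  finally show ?thesis by (simp add: matrix_vector_mult_diff_rdistrib inner_diff_right)
qed

lemma near_good: assumes "x \<in> arc l" "X \<in> near l" shows "X \<in> good x"
proof -
  have x: "lp l \<le> P x" "P x < rp l" using assms(1) by (auto simp: arc_def)
  have "v \<bullet> (cen l' *v v) + 3 / 2 * (v \<bullet> v) \<le> v \<bullet> (X *v v)" if "rp l' \<le> P x" for l' v
  proof -
    have "idx l' < idx l" using that x idx_order[of l l'] lp_less_rp[of l'] idx_eq[of l l'] by (cases "idx l" "idx l'" rule: linorder_cases) auto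
    then show ?thesis using cen_gap[of l' l v] near_quad[OF assms(2), of v] inner_ge_zero[of v] by linarith
  qed
  moreover have "v \<bullet> (X *v v) + 3 / 2 * (v \<bullet> v) \<le> v \<bullet> (cen l' *v v)" if "P x < lp l'" for l' v
  proof -
    have "idx l < idx l'" using that x idx_order[of l' l] lp_less_rp[of l'] idx_eq[of l l'] by (cases "idx l" "idx l'" rule: linorder_cases) auto
    then show ?thesis using cen_gap[of l l' v] near_quad[OF assms(2), of v] inner_ge_zero[of v] by linarith
  qed
  moreover have "X \<in> near l'" if "x \<in> arc l'" for l' using that assms arc_disjoint by metis
  ultimately show ?thesis using assms(2) by (simp add: good_def near_def)
qed

lemma filler_quad: "v \<bullet> (filler x *v v) = v \<bullet> (cen (fl x) *v v) + (7 / 4 + P x / 8) * (v \<bullet> v)"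
  by (simp add: filler_def matrix_vector_mult_add_rdistrib inner_add_right mat_vec)

lemma filler_good: assumes "cmod x = 1" "\<forall>l. x \<notin> arc l" shows "filler x \<in> good x"
proof -
  have r: "rp (fl x) \<le> P x" "P x < nx (fl x)" using fl_region[OF assms] by auto
  \<comment> \<open>As P x lies in [-2, 2), the shift of the filler is between 3/2 and 2: far enough
    above its own centre and, the centres being 4 apart, at least 2 below the next.\<close>
  have b: "3 / 2 * (v \<bullet> v) \<le> (7 / 4 + P x / 8) * (v \<bullet> v)" "(7 / 4 + P x / 8) * (v \<bullet> v) \<le> 2 * (v \<bullet> v)" for v
    using pos_bounds[of k x] by (intro mult_right_mono; simp)+
  have "v \<bullet> (cen l' *v v) + 3 / 2 * (v \<bullet> v) \<le> v \<bullet> (filler x *v v)" if "rp l' \<le> P x" for l' v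
  proof -
    have "\<not> idx (fl x) < idx l'" using that r idx_order[of "fl x" l'] lp_less_rp[of l'] by linarith
    then have "l' = fl x \<or> idx l' < idx (fl x)" using idx_eq[of l' "fl x"] by linarith
    then show ?thesis
    proof
      assume "l' = fl x" then show ?thesis using b(1)[of v] unfolding filler_quad by simp
    next
      assume "idx l' < idx (fl x)"
      then show ?thesis using b(1)[of v] cen_gap[of l' "fl x" v] inner_ge_zero[of v] unfolding filler_quad by linarith
    qed
  qed
  moreover have "v \<bullet> (filler x *v v) + 3 / 2 * (v \<bullet> v) \<le> v \<bullet> (cen l' *v v)" if "P x < lp l'" for l' v
  proof -
    have "idx (fl x) < idx l'" using that r idx_order[of l' "fl x"] lp_less_rp[of l'] lp_less_rp[of "fl x"] idx_eq[of "fl x" l']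
      by (cases "idx (fl x)" "idx l'" rule: linorder_cases) auto
    then show ?thesis using b(2)[of v] cen_gap[of "fl x" l' v] inner_ge_zero[of v] unfolding filler_quad by linarith
  qed
  ultimately show ?thesis using assms by (simp add: good_def filler_def)
qed

lemma good_away: assumes "X \<in> good x" "cmod x = 1" "x \<notin> arc l" shows "X \<in> away l"
proof -
  have "P x < lp l \<or> rp l \<le> P x" using assms by (auto simp: arc_def)
  moreover have "v \<bullet> (cen l *v v) + 3 / 2 * (v \<bullet> v) \<le> v \<bullet> (X *v v)" if "rp l \<le> P x" for v
    using assms(1) that unfolding good_def by blast
  moreover have "v \<bullet> (X *v v) + 3 / 2 * (v \<bullet> v) \<le> v \<bullet> (cen l *v v)" if "P x < lp l" for v
    using assms(1) that unfolding good_def by blast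
  ultimately have "3 / 2 * (v \<bullet> v) \<le> \<bar>v \<bullet> ((X - cen l) *v v)\<bar>" for v
    unfolding matrix_vector_mult_diff_rdistrib inner_diff_right by (smt (verit))
  then have "3 / 2 * norm v \<le> norm ((X - cen l) *v v)" for v by (rule quad_bound_norm) simp
  then show ?thesis using assms(1) by (simp add: away_def good_def)
qed

definition \<sigma> :: "complex \<Rightarrow> complex" where "\<sigma> x = H [gbar (letter x)] x"

text \<open>The itinerary is followed for i steps and then cut off at the centre of the current arc;
  a finite itinerary ends in a filler value, from which point on the approximation is exact.\<close>

primrec appr :: "nat \<Rightarrow> complex \<Rightarrow> real^2^2" where
  "appr 0 x = (if \<exists>l. x \<in> arc l then cen (letter x) else filler x)"
| "appr (Suc i) x = (if \<exists>l. x \<in> arc l then mu (letter x) (appr i (\<sigma> x)) else filler x)"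

lemma \<sigma>_arc: assumes "x \<in> arc l" shows "\<sigma> x = H [gbar l] x" "cmod (\<sigma> x) = 1" "\<sigma> x \<notin> arc (gbar l)"
proof -
  show 1: "\<sigma> x = H [gbar l] x" using letter_eq[OF assms] by (simp add: \<sigma>_def)
  show "cmod (\<sigma> x) = 1" using 1 arc_unit[OF assms] H_sphere by simp
  show "\<sigma> x \<notin> arc (gbar l)" using 1 H_mem_arc[OF arc_unit[OF assms], of "gbar l"] assms by simp
qed

lemma appr_good: "cmod x = 1 \<Longrightarrow> appr i x \<in> good x"
proof (induction i arbitrary: x)
  case 0
  have "cen l \<in> near l" for l by (simp add: near_def)
  then show ?case using 0 near_good filler_good letter_eq by auto
next
  case (Suc i)
  show ?case
  proof (cases "\<exists>l. x \<in> arc l")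
    case True
    then obtain l where l: "x \<in> arc l" by blast
    then have "appr i (\<sigma> x) \<in> away (gbar l)" using good_away[OF Suc.IH] \<sigma>_arc[OF l] by blast
    then show ?thesis using near_good[OF l mu_near] True letter_eq[OF l] by simp
  qed (use Suc filler_good in auto)
qed

text \<open>A bound for the Frobenius diameter of \<open>near l\<close>, with the norm of the
  identity left unevaluated.\<close>

abbreviation (input) "K \<equiv> 4 / 3 * norm (mat 1 :: real^2^2)"

lemma near_diff: assumes "X \<in> near l" "Y \<in> near l" shows "norm (X - Y) \<le> K"
proof -
  have "norm ((X - Y) ** mat 1) \<le> K"
  proof (rule norm_mult_left)
    fix v
    have "(X - Y) *v v = (X - cen l) *v v - (Y - cen l) *v v" by (simp add: matrix_vector_mult_diff_rdistrib)
    then have "norm ((X - Y) *v v) \<le> norm ((X - cen l) *v v) + norm ((Y - cen l) *v v)" by (metis norm_triangle_ineq4)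
    also have "\<dots> \<le> 4 / 3 * norm v" using assms by (simp add: near_def) (smt (verit))
    finally show "norm ((X - Y) *v v) \<le> 4 / 3 * norm v" .
  qed simp
  then show ?thesis by simp
qed

lemma appr_diff: "cmod x = 1 \<Longrightarrow> norm (appr (Suc i) x - appr i x) \<le> K * (4 / 9) ^ i"
proof (induction i arbitrary: x)
  case 0
  show ?case
  proof (cases "\<exists>l. x \<in> arc l")
    case True
    then obtain l where l: "x \<in> arc l" by blast
    then have "appr (Suc 0) x \<in> near l" "appr 0 x \<in> near l" using appr_good[OF 0, of "Suc 0"] appr_good[OF 0, of 0] unfolding good_def by blast+
    then show ?thesis using near_diff by simp
  qed simp
next
  case (Suc i)
  show ?case
  proof (cases "\<exists>l. x \<in> arc l")
    case True
    then obtain l where l: "x \<in> arc l" by blast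
    have "appr j (\<sigma> x) \<in> away (gbar l)" for j using good_away[OF appr_good] \<sigma>_arc[OF l] by blast
    then have "norm (mu l (appr (Suc i) (\<sigma> x)) - mu l (appr i (\<sigma> x))) \<le> 4 / 9 * norm (appr (Suc i) (\<sigma> x) - appr i (\<sigma> x))"
      using mu_contraction by blast
    also have "\<dots> \<le> 4 / 9 * (K * (4 / 9) ^ i)" using Suc.IH[of "\<sigma> x"] \<sigma>_arc[OF l] by simp
    finally show ?thesis using True letter_eq[OF l] by (simp only: appr.simps(2) if_True power_Suc mult.left_commute)
  qed simp
qed

definition \<xi> :: "complex \<Rightarrow> real^2^2" where "\<xi> x = lim (\<lambda>i. appr i x)"

lemma appr_tendsto: assumes "cmod x = 1" shows "(\<lambda>i. appr i x) \<longlonglongrightarrow> \<xi> x"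
proof -
  have "summable (\<lambda>i. appr (Suc i) x - appr i x)"
    by (rule summable_comparison_test'[of "\<lambda>i. K * (4 / 9) ^ i" 0]) (use appr_diff[OF assms] in \<open>auto intro!: summable_mult summable_geometric\<close>)
  then have "convergent (\<lambda>n. \<Sum>i<n. appr (Suc i) x - appr i x)" by (rule summable_iff_convergent[THEN iffD1])
  then have "convergent (\<lambda>n. appr n x - appr 0 x)" by (simp only: sum_lessThan_telescope[of "\<lambda>i. appr i x"])
  then have "convergent (\<lambda>n. (appr n x - appr 0 x) + appr 0 x)" by (intro convergent_add convergent_const)
  then show ?thesis unfolding \<xi>_def by (simp add: convergent_LIMSEQ_iff)
qed

lemma quad_tendsto: "(\<lambda>i. X i) \<longlonglongrightarrow> Y \<Longrightarrow> (\<lambda>i. v \<bullet> (X i *v v)) \<longlonglongrightarrow> v \<bullet> (Y *v v)" for v :: "real^2"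
  unfolding matrix_vector_mult_def by (intro tendsto_intros tendsto_vec_lambda) auto

lemma \<xi>_good: assumes x: "cmod x = 1" shows "\<xi> x \<in> good x"
proof -
  note lim = appr_tendsto[OF x] and g = appr_good[OF x]
  have "(\<lambda>i. transpose (appr i x)) \<longlonglongrightarrow> transpose (\<xi> x)"
    unfolding transpose_def by (intro tendsto_vec_lambda tendsto_vec_nth lim)
  moreover have "(\<lambda>i. transpose (appr i x)) = (\<lambda>i. appr i x)" using g by (auto simp: good_def sym_mat_def)
  ultimately have "sym_mat (\<xi> x)" using lim LIMSEQ_unique unfolding sym_mat_def by metis
  moreover have "\<xi> x \<in> near l" if "x \<in> arc l" for l
    using closed_sequentially[OF complete_imp_closed[OF complete_near], of "\<lambda>i. appr i x"] lim g that unfolding good_def by blast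
  moreover have "v \<bullet> (cen l *v v) + 3 / 2 * (v \<bullet> v) \<le> v \<bullet> (\<xi> x *v v)" if "rp l \<le> P x" for l v
    using quad_tendsto[OF lim, of v] by (rule LIMSEQ_le_const) (use g that in \<open>unfold good_def; blast\<close>)
  moreover have "v \<bullet> (\<xi> x *v v) + 3 / 2 * (v \<bullet> v) \<le> v \<bullet> (cen l *v v)" if "P x < lp l" for l v
  proof -
    have "v \<bullet> (\<xi> x *v v) \<le> v \<bullet> (cen l *v v) - 3 / 2 * (v \<bullet> v)"
      using quad_tendsto[OF lim, of v] by (rule LIMSEQ_le_const2) (use g that in \<open>unfold good_def le_diff_eq; blast\<close>)
    then show ?thesis by simp
  qed
  ultimately show ?thesis by (simp add: good_def)
qed

lemma \<xi>_away: "cmod x = 1 \<Longrightarrow> x \<notin> arc l \<Longrightarrow> \<xi> x \<in> away l"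
  using good_away \<xi>_good by blast

lemma \<xi>_arc: assumes l: "x \<in> arc l" shows "\<xi> x = mu l (\<xi> (H [gbar l] x))"
proof -
  note s = \<sigma>_arc[OF l]
  have "(\<lambda>i. appr (Suc i) x) \<longlonglongrightarrow> \<xi> x" using appr_tendsto[OF arc_unit[OF l]] by (rule LIMSEQ_Suc)
  moreover have "\<exists>l. x \<in> arc l" using l by blast
  then have "appr (Suc i) x = mu l (appr i (\<sigma> x))" for i by (simp only: appr.simps if_True letter_eq[OF l])
  ultimately have 1: "(\<lambda>i. mu l (appr i (\<sigma> x))) \<longlonglongrightarrow> \<xi> x" by simp
  \<comment> \<open>The contraction estimate supplies the continuity of \<open>mu l\<close> along
    this sequence.\<close>
  have "(\<lambda>i. mu l (appr i (\<sigma> x))) \<longlonglongrightarrow> mu l (\<xi> (\<sigma> x))"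
  proof (rule LIM_zero_cancel, rule Lim_null_comparison)
    show "\<forall>\<^sub>F i in sequentially. norm (mu l (appr i (\<sigma> x)) - mu l (\<xi> (\<sigma> x))) \<le> 4 / 9 * norm (appr i (\<sigma> x) - \<xi> (\<sigma> x))"
      using mu_contraction good_away[OF appr_good] \<xi>_away s by (intro always_eventually allI) blast
    have "(\<lambda>i. norm (appr i (\<sigma> x) - \<xi> (\<sigma> x))) \<longlonglongrightarrow> 0"
      using appr_tendsto[OF s(2)] by (intro tendsto_norm_zero LIM_zero)
    then show "(\<lambda>i. 4 / 9 * norm (appr i (\<sigma> x) - \<xi> (\<sigma> x))) \<longlonglongrightarrow> 0" using tendsto_mult_right_zero by blast
  qed
  then show ?thesis using 1 LIMSEQ_unique s(1) by metis
qed

lemma \<xi>_filler: assumes "\<forall>l. x \<notin> arc l" shows "\<xi> x = filler x"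
proof -
  have "\<not> (\<exists>l. x \<in> arc l)" using assms by blast
  then have "appr i x = filler x" for i by (cases i) (simp_all only: appr.simps if_False)
  then show ?thesis by (simp add: \<xi>_def)
qed

end

section \<open>Tools for monotonicity and one-sided continuity\<close>

lemma loewner_inverse_pos: "0 \<prec>\<^sub>L A \<Longrightarrow> sym_mat A \<Longrightarrow> 0 \<prec>\<^sub>L matrix_inv A"
proof -
  assume A: "0 \<prec>\<^sub>L A" "sym_mat A"
  have "A \<prec>\<^sub>L A + A" using A(1) by (subst loewner_diff) simp
  moreover have "sym_mat (A + A)" using A(2) by (simp only: sym_mat_def transpose_add)
  ultimately show ?thesis using loewner_inverse[OF A(1) _ A(2)] loewner_trans by blast
qed

lemma matrix_inv_uminus: "invertible A \<Longrightarrow> matrix_inv (- A) = - matrix_inv A" for A :: "real^'n^'n"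
  by (rule matrix_inv_unique) (simp add: matrix_ring_simps matrix_inv_mult)

text \<open>The orientation is 2 sin (t/2) times a factor tending to 1 - Re u, which is positive
  because u = z / x is not 1. Small positive angles thus stay before z.\<close>

lemma positively_oriented_cis:
  assumes "cmod x = 1" "cmod z = 1" "z \<noteq> x"
  shows "\<forall>\<^sub>F t in at_right 0. positively_oriented x (cis t * x) z"
proof -
  define u where "u = cnj x * z"
  have xx: "cnj x * x = 1" using complex_norm_square[of x] assms(1) by (simp add: mult.commute)
  have z: "z = x * u" using xx by (simp add: u_def mult.assoc[symmetric] mult.commute[of x])
  have "cmod u = 1" using assms by (simp add: u_def norm_mult)
  then have "(Re u)\<^sup>2 + (Im u)\<^sup>2 = 1" by (metis cmod_power2 one_power2)
  moreover have "u \<noteq> 1" using z assms(3) by auto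
  ultimately have "Re u < 1"
    by (smt (verit) complex_eq_iff one_complex.simps power2_eq_iff_nonneg power_one zero_le_power2 power2_less_imp_less zero_eq_power2)
  have "((\<lambda>t. cos (t / 2) * (1 - Re u) - sin (t / 2) * Im u) \<longlongrightarrow> cos (0 / 2) * (1 - Re u) - sin (0 / 2) * Im u) (at_right 0)"
    by (intro tendsto_intros) auto
  then have "\<forall>\<^sub>F t in at_right 0. 0 < cos (t / 2) * (1 - Re u) - sin (t / 2) * Im u"
    using \<open>Re u < 1\<close> by (intro order_tendstoD) auto
  moreover have "\<forall>\<^sub>F t in at_right (0::real). t \<in> {0<..<pi}" by (rule eventually_at_right_real) simp
  ultimately show ?thesis
  proof eventually_elim
    case (elim t)
    then have "0 < sin (t / 2)" by (intro sin_gt_zero) auto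
    have "cnj (cis t * x - x) * (z - x) = (cnj x * x) * (cnj (cis t - 1) * (u - 1))"
      by (simp add: z algebra_simps)
    also have "\<dots> = cnj (cis t - 1) * (u - 1)" by (simp only: xx mult_1)
    finally have "Im (cnj (cis t * x - x) * (z - x)) = Im (cnj (cis t - 1) * (u - 1))" by (rule arg_cong)
    also have "\<dots> = sin t * (1 - Re u) - (1 - cos t) * Im u"
      by (simp add: algebra_simps)
    also have "\<dots> = 2 * sin (t / 2) * (cos (t / 2) * (1 - Re u) - sin (t / 2) * Im u)"
    proof -
      have "sin t = 2 * sin (t / 2) * cos (t / 2)" "1 - cos t = 2 * (sin (t / 2))\<^sup>2"
        using sin_double[of "t / 2"] cos_double_sin[of "t / 2"] by simp_all
      then show ?thesis by (simp only:) (simp add: power2_eq_square algebra_simps)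
    qed
    also have "\<dots> > 0" using elim \<open>0 < sin (t / 2)\<close> by simp
    finally show ?case using assms by (simp add: positively_oriented_def norm_mult)
  qed
qed

text \<open>The normal equation of the orthogonal projection, (X^2 + 1) u = X a + b.\<close>

lemma closest_point_lag:
  assumes "sym_mat X"
  obtains u where "closest_point (lag X) (vpair a b) = vpair (X *v u) u" "X *v (X *v u) + u = X *v a + b"
proof -
  define p where "p = closest_point (lag X) (vpair a b)"
  have S: "convex (lag X)" "closed (lag X)" "lag X \<noteq> {}"
    using subspace_lag[of X] subspace_imp_convex closed_subspace subspace_0 by blast+
  then have pl: "p \<in> lag X" by (simp add: p_def closest_point_in_set)
  then obtain u where u: "p = vpair (X *v u) u" by (auto simp: lag_eq)
  have orth: "(vpair a b - p) \<bullet> s = 0" if s: "s \<in> lag X" for s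
  proof -
    have "p + s \<in> lag X" "p - s \<in> lag X" using pl s subspace_lag[of X] subspace_add subspace_diff by blast+
    from this[THEN closest_point_dot[OF S(1,2), of _ "vpair a b"]] show ?thesis by (simp add: p_def[symmetric])
  qed
  have "(X *v a + b - (X *v (X *v u) + u)) \<bullet> w = 0" for w
    using orth[of "vpair (X *v w) w"] sym_mat_inner[OF assms, of "a - X *v u" w]
    by (simp add: lag_eq u vpair_diff inner_vpair matrix_vector_mult_diff_distrib inner_diff_left inner_add_left)
  then have "X *v a + b - (X *v (X *v u) + u) = 0" by (metis inner_eq_zero_iff)
  then show ?thesis using that u p_def by simp
qed

lemma closest_point_lag_tendsto:
  fixes Y :: "real \<Rightarrow> real^2^2"
  assumes sym: "\<And>t. sym_mat (Y t)" "sym_mat X" and lim: "(Y \<longlongrightarrow> X) F"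
  shows "((\<lambda>t. closest_point (lag (Y t)) v) \<longlongrightarrow> closest_point (lag X) v) F"
proof -
  obtain a b where v: "v = vpair a b" by (rule vpair_exhaust)
  obtain u where u: "closest_point (lag X) v = vpair (X *v u) u" "X *v (X *v u) + u = X *v a + b"
    using closest_point_lag[OF sym(2)] v by metis
  have "\<exists>w. closest_point (lag (Y t)) v = vpair (Y t *v w) w \<and> Y t *v (Y t *v w) + w = Y t *v a + b" for t
    using closest_point_lag[OF sym(1)] v by metis
  then obtain w where w: "\<And>t. closest_point (lag (Y t)) v = vpair (Y t *v w t) (w t)"
    "\<And>t. Y t *v (Y t *v w t) + w t = Y t *v a + b" by metis
  have mv: "((\<lambda>t. Y t *v f t) \<longlongrightarrow> X *v g) F" if "(f \<longlongrightarrow> g) F" for f g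
    using that lim unfolding matrix_vector_mult_def by (intro tendsto_intros tendsto_vec_lambda)
  have 0: "norm (w t - u) \<le> norm (Y t *v a + b - (Y t *v (Y t *v u) + u))" for t
  proof -
    \<comment> \<open>The matrix of the normal equation is at least the identity, so the error is
      bounded by the residual of the limiting solution.\<close>
    have "1 * norm (w t - u) \<le> norm ((Y t ** Y t + mat 1) *v (w t - u))"
    proof (rule quad_bound_norm)
      show "1 * ((w t - u) \<bullet> (w t - u)) \<le> \<bar>(w t - u) \<bullet> ((Y t ** Y t + mat 1) *v (w t - u))\<bar>"
        using sym_mat_inner[OF sym(1)[of t], of "w t - u" "Y t *v (w t - u)"] inner_ge_zero[of "Y t *v (w t - u)"]
        by (simp add: matrix_vector_mult_add_rdistrib matrix_vector_mul_assoc[symmetric] inner_add_right)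
    qed simp
    also have "(Y t ** Y t + mat 1) *v (w t - u) = Y t *v a + b - (Y t *v (Y t *v u) + u)"
      unfolding w(2)[symmetric]
      by (simp add: matrix_vector_mult_add_rdistrib matrix_vector_mul_assoc[symmetric] matrix_vector_mult_diff_distrib)
    finally show ?thesis by simp
  qed
  have "((\<lambda>t. norm (Y t *v a + b - (Y t *v (Y t *v u) + u))) \<longlongrightarrow> norm (X *v a + b - (X *v (X *v u) + u))) F"
    by (intro tendsto_norm tendsto_diff tendsto_add mv tendsto_const)
  then have "((\<lambda>t. norm (Y t *v a + b - (Y t *v (Y t *v u) + u))) \<longlongrightarrow> 0) F" by (simp add: u(2))
  then have "((\<lambda>t. w t - u) \<longlongrightarrow> 0) F" by (rule Lim_null_comparison[rotated]) (simp add: 0)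
  then have wl: "(w \<longlongrightarrow> u) F" by (rule LIM_zero_cancel)
  have vp: "vpair x y = x$1 *\<^sub>R axis 1 1 + x$2 *\<^sub>R axis 2 1 + y$1 *\<^sub>R axis 3 1 + y$2 *\<^sub>R axis 4 1" for x y :: "real^2"
    by (simp add: vec4_eq_iff axis_def)
  show ?thesis
    unfolding u(1) w(1) vp by (intro tendsto_intros mv wl)
qed

section \<open>Monotonicity, equivariance and right continuity of the limit map\<close>

context pants
begin

lemma good_above: assumes "X \<in> good x" "rp l \<le> P x" shows "cen l \<prec>\<^sub>L X"
  unfolding loewner_def
proof (intro allI impI)
  fix v :: "real^2" assume "v \<noteq> 0"
  then have "0 < v \<bullet> v" by simp
  moreover have "v \<bullet> (cen l *v v) + 3 / 2 * (v \<bullet> v) \<le> v \<bullet> (X *v v)" using assms unfolding good_def by blast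
  ultimately show "v \<bullet> (cen l *v v) < v \<bullet> (X *v v)" by linarith
qed

lemma good_below: assumes "X \<in> good x" "P x < lp l" shows "X \<prec>\<^sub>L cen l"
  unfolding loewner_def
proof (intro allI impI)
  fix v :: "real^2" assume "v \<noteq> 0"
  then have "0 < v \<bullet> v" by simp
  moreover have "v \<bullet> (X *v v) + 3 / 2 * (v \<bullet> v) \<le> v \<bullet> (cen l *v v)" using assms unfolding good_def by blast
  ultimately show "v \<bullet> (X *v v) < v \<bullet> (cen l *v v)" by linarith
qed

lemma good_sym: "X \<in> good x \<Longrightarrow> sym_mat X"
  unfolding good_def by blast

lemma good_near: "X \<in> good x \<Longrightarrow> x \<in> arc l \<Longrightarrow> X \<in> near l"
  unfolding good_def by blast

text \<open>On either side of its pole \<open>cen (gbar l)\<close> the map is increasing, since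
  inversion reverses the order. Across the pole, X above it goes below \<open>cen l\<close> and Y
  below it goes above.\<close>

lemma mu_strict_mono:
  assumes "sym_mat X" "sym_mat Y" "cen (gbar l) \<prec>\<^sub>L X \<and> X \<prec>\<^sub>L Y \<or> X \<prec>\<^sub>L Y \<and> Y \<prec>\<^sub>L cen (gbar l) \<or> Y \<prec>\<^sub>L cen (gbar l) \<and> cen (gbar l) \<prec>\<^sub>L X"
  shows "mu l X \<prec>\<^sub>L mu l Y"
proof -
  define A B where "A = X - cen (gbar l)" and "B = Y - cen (gbar l)"
  have sym: "sym_mat A" "sym_mat B" "sym_mat (- A)" "sym_mat (- B)"
    using assms(1,2) by (simp_all add: A_def B_def sym_mat_def matrix_ring_simps)
  have AB: "0 \<prec>\<^sub>L A \<longleftrightarrow> cen (gbar l) \<prec>\<^sub>L X" "0 \<prec>\<^sub>L - B \<longleftrightarrow> Y \<prec>\<^sub>L cen (gbar l)" "A \<prec>\<^sub>L B \<longleftrightarrow> X \<prec>\<^sub>L Y"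
    "- B \<prec>\<^sub>L - A \<longleftrightarrow> X \<prec>\<^sub>L Y"
    by (simp_all add: A_def B_def loewner_def matrix_vector_mult_diff_rdistrib inner_diff_right)
  have "matrix_inv B \<prec>\<^sub>L matrix_inv A"
    using assms(3)
  proof (elim disjE conjE)
    assume "cen (gbar l) \<prec>\<^sub>L X" "X \<prec>\<^sub>L Y"
    then show ?thesis using loewner_inverse(2)[of A B] AB sym by blast
  next
    assume *: "X \<prec>\<^sub>L Y" "Y \<prec>\<^sub>L cen (gbar l)"
    then have "invertible (- A)" "invertible (- B)" using AB pos_invertible loewner_trans by blast+
    then have "matrix_inv (- A) = - matrix_inv A" "matrix_inv (- B) = - matrix_inv B"
      using matrix_inv_uminus invertible_uminus[of "- A"] invertible_uminus[of "- B"] by auto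
    then show ?thesis using loewner_inverse(2)[of "- B" "- A"] AB sym * loewner_uminus by metis
  next
    assume *: "Y \<prec>\<^sub>L cen (gbar l)" "cen (gbar l) \<prec>\<^sub>L X"
    then have "invertible (- B)" using AB pos_invertible by blast
    then have "matrix_inv (- B) = - matrix_inv B"
      using matrix_inv_uminus invertible_uminus[of "- B"] by auto
    moreover have "0 \<prec>\<^sub>L matrix_inv (- B)" "0 \<prec>\<^sub>L matrix_inv A" using * AB sym loewner_inverse_pos by blast+
    moreover have "- 0 = (0 :: real^2^2)" by simp
    ultimately have "matrix_inv B \<prec>\<^sub>L 0" using loewner_uminus[of 0 "matrix_inv B"] by metis
    then show ?thesis using \<open>0 \<prec>\<^sub>L matrix_inv A\<close> loewner_trans by blast
  qed
  then show ?thesis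
    unfolding mu_def A_def[symmetric] B_def[symmetric]
    by (simp add: loewner_def matrix_vector_mult_diff_rdistrib inner_diff_right)
qed

text \<open>If no arc contains both points, a centre with its margin separates the two values, or
  both are filler values behind the same arc, and these increase with P.\<close>

lemma \<xi>_strict_mono_piece:
  assumes xy: "cmod x = 1" "cmod y = 1" "P x < P y" and n: "\<nexists>l. x \<in> arc l \<and> y \<in> arc l"
  shows "\<xi> x \<prec>\<^sub>L \<xi> y"
proof (cases "\<exists>l. x \<in> arc l")
  case True
  then obtain l where l: "x \<in> arc l" by blast
  then have "y \<notin> arc l" using n by blast
  then have rl: "rp l \<le> P y" using l xy unfolding arc_def by (simp; linarith)
  show ?thesis
    unfolding loewner_def
  proof (intro allI impI)
    fix v :: "real^2" assume "v \<noteq> 0"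
    then have "0 < v \<bullet> v" by simp
    moreover have "v \<bullet> (cen l *v v) + 3 / 2 * (v \<bullet> v) \<le> v \<bullet> (\<xi> y *v v)"
      using \<xi>_good[OF xy(2)] rl unfolding good_def by blast
    ultimately show "v \<bullet> (\<xi> x *v v) < v \<bullet> (\<xi> y *v v)"
      using near_quad[OF good_near[OF \<xi>_good[OF xy(1)] l], of v] by linarith
  qed
next
  case no_arc: False
  show ?thesis
  proof (cases "\<exists>l. y \<in> arc l")
    case True
    then obtain l where l: "y \<in> arc l" by blast
    have "x \<notin> arc l" using no_arc by blast
    then have rl: "P x < lp l" using l xy unfolding arc_def by (simp; linarith)
    show ?thesis
      unfolding loewner_def
    proof (intro allI impI)
      fix v :: "real^2" assume "v \<noteq> 0"
      then have "0 < v \<bullet> v" by simp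
      moreover have "v \<bullet> (\<xi> x *v v) + 3 / 2 * (v \<bullet> v) \<le> v \<bullet> (cen l *v v)"
        using \<xi>_good[OF xy(1)] rl unfolding good_def by blast
      ultimately show "v \<bullet> (\<xi> x *v v) < v \<bullet> (\<xi> y *v v)"
        using near_quad[OF good_near[OF \<xi>_good[OF xy(2)] l], of v] by linarith
    qed
  next
    case False
    have fx: "\<forall>l. x \<notin> arc l" "\<forall>l. y \<notin> arc l" using False no_arc by blast+
    note r = fl_region[OF xy(1) fx(1)] fl_region[OF xy(2) fx(2)]
    show ?thesis
    proof (cases "fl x = fl y")
      case True
      show ?thesis
        unfolding \<xi>_filler[OF fx(1)] \<xi>_filler[OF fx(2)] loewner_def filler_quad True
        using xy(3) by (auto intro!: mult_strict_right_mono)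
    next
      case False
      then have "idx (fl x) \<noteq> idx (fl y)" using idx_eq by blast
      moreover have "\<not> idx (fl y) < idx (fl x)"
        using idx_order[of "fl y" "fl x"] r xy(3) lp_less_rp[of "fl x"] by linarith
      ultimately have "idx (fl x) < idx (fl y)" by linarith
      then have "P x < lp (fl y)" using idx_order[of "fl x" "fl y"] r by linarith
      then show ?thesis
        using good_below[OF \<xi>_good[OF xy(1)]] good_above[OF \<xi>_good[OF xy(2)]] r loewner_trans by blast
    qed
  qed
qed

text \<open>Induction on the place where the itineraries part. The comparison of the shifted points
  is needed only when they are in the original order; otherwise the pole separates their
  values.\<close>

lemma \<xi>_strict_mono_agree:
  "cmod x = 1 \<Longrightarrow> cmod y = 1 \<Longrightarrow> P x < P y \<Longrightarrow> \<not> agree i x y \<Longrightarrow> \<xi> x \<prec>\<^sub>L \<xi> y"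
proof (induction i arbitrary: x y)
  case (Suc i)
  show ?case
  proof (cases "\<exists>l. x \<in> arc l \<and> y \<in> arc l")
    case False
    then show ?thesis using \<xi>_strict_mono_piece Suc.prems by blast
  next
    case True
    then obtain l where l: "x \<in> arc l" "y \<in> arc l" by blast
    define x' y' where "x' = H [gbar l] x" and "y' = H [gbar l] y"
    have u: "cmod x' = 1" "cmod y' = 1" using Suc.prems H_sphere by (simp_all add: x'_def y'_def)
    have "\<not> agree i x' y'" using Suc.prems(4) l unfolding agree.simps x'_def y'_def by blast
    then have IH: "P x' < P y' \<Longrightarrow> \<xi> x' \<prec>\<^sub>L \<xi> y'" using Suc.IH u by blast
    note g = \<xi>_good[OF u(1)] \<xi>_good[OF u(2)]
    have "cen (gbar l) \<prec>\<^sub>L \<xi> x' \<and> \<xi> x' \<prec>\<^sub>L \<xi> y' \<or> \<xi> x' \<prec>\<^sub>L \<xi> y' \<and> \<xi> y' \<prec>\<^sub>L cen (gbar l) \<or>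
      \<xi> y' \<prec>\<^sub>L cen (gbar l) \<and> cen (gbar l) \<prec>\<^sub>L \<xi> x'"
      using arc_order[OF l Suc.prems(3)] IH good_above[OF g(1)] good_below[OF g(2)] unfolding x'_def y'_def by blast
    then show ?thesis
      unfolding \<xi>_arc[OF l(1)] \<xi>_arc[OF l(2)] x'_def[symmetric] y'_def[symmetric]
      using mu_strict_mono good_sym[OF g(1)] good_sym[OF g(2)] by blast
  qed
qed simp

lemma \<xi>_strict_mono: assumes "cmod x = 1" "cmod y = 1" "P x < P y" shows "\<xi> x \<prec>\<^sub>L \<xi> y"
  using \<xi>_strict_mono_agree assms codes_differ[of x y] by force

lemma \<xi>_maximal_triple: assumes "positively_oriented x y z" shows "maximal_triple (lag (\<xi> x)) (lag (\<xi> y)) (lag (\<xi> z))"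
proof -
  have 1: "maximal_triple (lag (\<xi> x)) (lag (\<xi> y)) (lag (\<xi> z))"
    if "cmod x = 1" "cmod y = 1" "cmod z = 1" "P x < P y" "P y < P z" for x y z
    using that by (intro maximal_triple_lag \<xi>_strict_mono good_sym[OF \<xi>_good])
  have u: "cmod x = 1" "cmod y = 1" "cmod z = 1" using positively_orientedD[OF assms] by auto
  then show ?thesis
    using oriented_P[OF u] assms 1[of x y z] 1[of y z x] 1[of z x y] maximal_triple_rotate unfolding cyc3_def by blast
qed

text \<open>If x lies in the arc of the inverse letter, the image lies outside the arc of l, and the
  relation is obtained from the inverse letter; the resulting sign acts trivially on
  subspaces.\<close>

lemma \<xi>_letter: assumes x: "cmod x = 1" shows "lag (\<xi> (H [l] x)) = (*v) (gen l) ` lag (\<xi> x)"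
proof (cases "x \<in> arc (gbar l)")
  case False
  then have "H [l] x \<in> arc l" using H_mem_arc[OF x] by blast
  then show ?thesis using \<xi>_arc[of "H [l] x" l] H_letter_inv'[of x l] x gen_image[OF \<xi>_away[OF x False]] by simp
next
  case True
  then have n: "H [l] x \<notin> arc l" using H_mem_arc[OF x] by blast
  have "\<xi> (H [l] x) \<in> away (gbar (gbar l))" using \<xi>_away[OF _ n] H_sphere[of "[l]" x] x by simp
  from gen_image[OF this] have "lag (\<xi> x) = (*v) (gen (gbar l)) ` lag (\<xi> (H [l] x))" using \<xi>_arc[OF True] by simp
  then have "(*v) (gen l) ` lag (\<xi> x) = (*v) (gen l ** gen (gbar l)) ` lag (\<xi> (H [l] x))"
    by (simp add: image_image matrix_vector_mul_assoc)
  then show ?thesis by (simp only: gen_gbar uminus_lag)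
qed

lemma \<xi>_word: "reduced gbar w \<Longrightarrow> cmod x = 1 \<Longrightarrow> lag (\<xi> (H w x)) = (*v) (word_mat w) ` lag (\<xi> x)"
proof (induction w)
  case Nil
  then show ?case by (simp add: H_one[of x, unfolded one_\<Gamma>03])
next
  case (Cons l w)
  have w: "reduced gbar w" using reduced_ConsD[OF Cons.prems(1)] .
  have "w \<in> carrier \<Gamma>03" using w by (simp add: carrier_\<Gamma>03)
  then have "cmod (H w x) = 1" using H_sphere Cons.prems(2) by blast
  then show ?case
    using Cons.IH[OF w Cons.prems(2)] Cons.prems H_Cons[OF Cons.prems(1), of x] \<xi>_letter[of "H w x" l]
    by (simp add: image_image matrix_vector_mul_assoc)
qed

lemma rgt_not_mem_arc: "rgt l \<notin> arc l"
  using lft_neq_rgt[of l] positively_orientedD(5)[of "lft l" "rgt l" "rgt l"] by (auto simp: mem_arc)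

lemma arc_right: assumes "x \<in> arc l" "positively_oriented x y (rgt l)" shows "y \<in> arc l"
proof (cases "x = lft l")
  case True
  then show ?thesis using assms mem_arc by blast
next
  case False
  then have "positively_oriented (lft l) x (rgt l)" using assms mem_arc by blast
  then have "positively_oriented (rgt l) (lft l) x" "positively_oriented (rgt l) x y"
    using assms(2) positively_oriented_rotate by blast+
  then have "positively_oriented (rgt l) (lft l) y" by (rule positively_oriented_trans)
  then show ?thesis using positively_oriented_rotate mem_arc by blast
qed

lemma filler_right:
  assumes x: "cmod x = 1" "\<forall>l. x \<notin> arc l" and "e > 0"
  shows "\<exists>z. cmod z = 1 \<and> z \<noteq> x \<and> (\<forall>y. positively_oriented x y z \<longrightarrow> norm (\<xi> y - \<xi> x) \<le> K * e)"
proof -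
  note r = fl_region[OF x]
  have "x \<noteq> k" using x(2) mem_arc[of k la] by auto
  then have Px: "P x = arctan (chart k x)" by (simp add: pos_def)
  then have "P x < pi / 2" "- (pi / 2) < P x" using arctan_bounded by simp_all
  moreover obtain p where p: "P x < p" "p < Min {nx (fl x), pi / 2, P x + e}"
    using dense[of "P x" "Min {nx (fl x), pi / 2, P x + e}"] r \<open>P x < pi / 2\<close> \<open>e > 0\<close> by auto
  ultimately have p': "P x < p" "p < nx (fl x)" "p < P x + e" "- (pi / 2) < p" "p < pi / 2" by auto
  define z where "z = unchart k (tan p)"
  have z: "cmod z = 1" "P z = p"
    using unchart[OF unit(1), of "tan p"] arctan_tan[of p] p' by (simp_all add: z_def pos_def)
  have "norm (\<xi> y - \<xi> x) \<le> K * e" if o: "positively_oriented x y z" for y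
  proof -
    have u: "cmod y = 1" using positively_orientedD[OF o] by simp
    have P: "P x < P y" "P y < p"
      using o oriented_P[OF x(1) u z(1)] p' by (auto simp: z(2) cyc3_def)
    have "rp (fl x) \<le> P y" "P y < nx (fl x)" using P r p' by linarith+
    then have "fl y = fl x" "\<forall>l. y \<notin> arc l" using fill_region by blast+
    then have "\<xi> y - \<xi> x = filler y - filler x" using \<xi>_filler[OF x(2)] \<xi>_filler[of y] by simp
    also have "\<dots> = ((P y - P x) / 8) *\<^sub>R mat 1"
      using \<open>fl y = fl x\<close> by (simp add: filler_def vec_eq_iff mat_def)
    finally have "norm (\<xi> y - \<xi> x) = (P y - P x) / 8 * norm (mat 1 :: real^2^2)" using P by simp
    also have "\<dots> \<le> 4 / 3 * e * norm (mat 1 :: real^2^2)" using P p' by (intro mult_right_mono) auto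
    finally show ?thesis by (simp add: mult.commute mult.left_commute)
  qed
  then show ?thesis using z p' by (intro exI[of _ z]) auto
qed

text \<open>Arcs contain their left ends, so points slightly counterclockwise of x share its letter.
  Each shared letter contributes a factor 4/9, and a filler value varies continuously on its
  interval.\<close>

lemma \<xi>_right:
  "cmod x = 1 \<Longrightarrow> \<exists>z. cmod z = 1 \<and> z \<noteq> x \<and> (\<forall>y. positively_oriented x y z \<longrightarrow> norm (\<xi> y - \<xi> x) \<le> K * (4 / 9) ^ i)"
proof (induction i arbitrary: x)
  case (0 x)
  show ?case
  proof (cases "\<exists>l. x \<in> arc l")
    case True
    then obtain l where l: "x \<in> arc l" by blast
    have "norm (\<xi> y - \<xi> x) \<le> K" if "positively_oriented x y (rgt l)" for y
      using near_diff good_near[OF \<xi>_good] l arc_right[OF l that] arc_unit by blast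
    moreover have "rgt l \<noteq> x" using l rgt_not_mem_arc by blast
    ultimately show ?thesis by (intro exI[of _ "rgt l"]) simp
  next
    case False
    then show ?thesis using filler_right[OF 0, of "(4 / 9) ^ 0"] by simp
  qed
next
  case (Suc i)
  show ?case
  proof (cases "\<exists>l. x \<in> arc l")
    case True
    then obtain l where l: "x \<in> arc l" by blast
    define x' where "x' = H [gbar l] x"
    have x': "cmod x' = 1" "x' \<notin> arc (gbar l)" using \<sigma>_arc[OF l] by (simp_all add: x'_def)
    obtain z' where z': "cmod z' = 1" "z' \<noteq> x'"
      "\<And>y. positively_oriented x' y z' \<Longrightarrow> norm (\<xi> y - \<xi> x') \<le> K * (4 / 9) ^ i"
      using Suc.IH[OF x'(1)] by blast
    define z2 where "z2 = H [l] z'"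
    have Hz2: "H [gbar l] z2 = z'" using H_letter_inv'[of z' l] z' by (simp add: z2_def)
    have z2: "cmod z2 = 1" "z2 \<noteq> x" using H_sphere[of "[l]" z'] z' Hz2 by (auto simp: z2_def x'_def)
    have rx: "rgt l \<noteq> x" using l rgt_not_mem_arc by blast
    \<comment> \<open>The first of \<open>rgt l\<close> and the pulled-back bound that is met
      counterclockwise from x, so that both restrictions hold before it.\<close>
    define z where "z = (if z2 = rgt l \<or> positively_oriented x (rgt l) z2 then rgt l else z2)"
    have z: "positively_oriented x y (rgt l) \<and> positively_oriented x y z2" if "positively_oriented x y z" for y
    proof (cases "z2 = rgt l \<or> positively_oriented x (rgt l) z2")
      case True
      then have "positively_oriented x y (rgt l)" using that by (simp add: z_def)
      then show ?thesis using True positively_oriented_trans by blast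
    next
      case False
      then have o: "positively_oriented x y z2" using that by (simp add: z_def)
      have "positively_oriented x z2 (rgt l)"
        using False positively_oriented_total[of x z2 "rgt l"] z2 rx Suc.prems by auto
      then show ?thesis using o positively_oriented_trans by blast
    qed
    have "norm (\<xi> y - \<xi> x) \<le> K * (4 / 9) ^ Suc i" if o: "positively_oriented x y z" for y
    proof -
      have y: "y \<in> arc l" using arc_right[OF l] z[OF o] by blast
      define y' where "y' = H [gbar l] y"
      have y': "cmod y' = 1" "y' \<notin> arc (gbar l)" using \<sigma>_arc[OF y] by (simp_all add: y'_def)
      have "positively_oriented x' y' z'"
        using H_positively_oriented[of "[gbar l]" x y z2] z[OF o] Hz2 by (simp add: x'_def y'_def)
      then have "norm (\<xi> y' - \<xi> x') \<le> K * (4 / 9) ^ i" by (rule z'(3))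
      then have "4 / 9 * norm (\<xi> y' - \<xi> x') \<le> 4 / 9 * (K * (4 / 9) ^ i)" by simp
      moreover have "norm (mu l (\<xi> y') - mu l (\<xi> x')) \<le> 4 / 9 * norm (\<xi> y' - \<xi> x')"
        by (intro mu_contraction \<xi>_away x' y')
      ultimately show ?thesis
        unfolding \<xi>_arc[OF l] \<xi>_arc[OF y] x'_def[symmetric] y'_def[symmetric] by simp
    qed
    moreover have "cmod z = 1" "z \<noteq> x" using z2 rx by (auto simp: z_def)
    ultimately show ?thesis by blast
  next
    case False
    then show ?thesis using filler_right[OF Suc.prems, of "(4 / 9) ^ Suc i"] by simp
  qed
qed

lemma \<xi>_right_tendsto: assumes x: "cmod x = 1" shows "((\<lambda>t. \<xi> (cis t * x)) \<longlongrightarrow> \<xi> x) (at_right 0)"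
proof (rule tendstoI)
  fix e :: real assume "e > 0"
  have "(\<lambda>i. K * (4 / 9) ^ i) \<longlonglongrightarrow> 0" by (intro tendsto_mult_right_zero LIMSEQ_realpow_zero) auto
  then have "\<forall>\<^sub>F i in sequentially. K * (4 / 9) ^ i < e" using \<open>e > 0\<close> order_tendstoD(2) by blast
  then obtain i where i: "K * (4 / 9) ^ i < e" by (auto simp: eventually_sequentially)
  obtain z where z: "cmod z = 1" "z \<noteq> x" "\<And>y. positively_oriented x y z \<Longrightarrow> norm (\<xi> y - \<xi> x) \<le> K * (4 / 9) ^ i"
    using \<xi>_right[OF x, of i] by blast
  have "\<forall>\<^sub>F t in at_right 0. positively_oriented x (cis t * x) z"
    by (rule positively_oriented_cis[OF x z(1,2)])
  then show "\<forall>\<^sub>F t in at_right 0. dist (\<xi> (cis t * x)) (\<xi> x) < e"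
    by eventually_elim (use z(3) i in \<open>force simp: dist_norm\<close>)
qed

lemma right_continuous_\<xi>: "right_continuous (\<lambda>x. lag (\<xi> x))"
  unfolding right_continuous_def
proof (intro ballI allI)
  fix x :: complex and v assume "x \<in> sphere 0 1"
  then have x: "cmod x = 1" by simp
  have "sym_mat (\<xi> (cis t * x))" for t using x by (intro good_sym[OF \<xi>_good]) (simp add: norm_mult)
  moreover have "sym_mat (\<xi> x)" by (intro good_sym[OF \<xi>_good] x)
  ultimately show "((\<lambda>t. closest_point (lag (\<xi> (cis t * x))) v) \<longlongrightarrow> closest_point (lag (\<xi> x)) v) (at_right 0)"
    using \<xi>_right_tendsto[OF x] by (intro closest_point_lag_tendsto)
qed

end

section \<open>Failure of surjectivity\<close>

lemma conj_rel_PSp_refl: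
  assumes "\<rho> \<in> hom D PSp"
  shows "(\<rho>, \<rho>) \<in> conj_rel D PSp (carrier PSp)"
proof -
  interpret G: group PSp by (rule group_PSp)
  have "\<rho> x = \<one>\<^bsub>PSp\<^esub> \<otimes>\<^bsub>PSp\<^esub> \<rho> x \<otimes>\<^bsub>PSp\<^esub> inv\<^bsub>PSp\<^esub> \<one>\<^bsub>PSp\<^esub>" if "x \<in> carrier D" for x
    using hom_in_carrier[OF assms that] by simp
  then show ?thesis using assms unfolding conj_rel_def by (auto intro!: bexI[of _ "\<one>\<^bsub>PSp\<^esub>"])
qed

lemma (in pants) schottky_representation:
  "\<exists>\<rho>. maximal_\<Gamma>03 H \<rho> \<and> shilov_hyperbolic \<rho> \<and> (\<forall>l. \<rho> [l] = pm (gen l))"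
proof -
  interpret G: group PSp by (rule group_PSp)
  obtain \<rho> where \<rho>: "\<rho> \<in> hom \<Gamma>03 PSp" "\<And>l. \<rho> [l] = pm (gen l)"
    unfolding \<Gamma>03_gbar
    using word_group_hom[OF group_PSp, of "\<lambda>l. pm (gen l)" gbar] gen_Sp
    by (auto simp: mult_PSp one_PSp carrier_PSp gen_gbar)
  have word: "\<rho> w = pm (word_mat w)" if "reduced gbar w" for w
    using that
  proof (induction w)
    case Nil
    then show ?case using hom_one[OF \<rho>(1) group_\<Gamma>03 group_PSp] by (simp add: one_\<Gamma>03 one_PSp)
  next
    case (Cons l w)
    have w: "reduced gbar w" using reduced_ConsD[OF Cons.prems] .
    then have "\<rho> (l # w) = \<rho> [l] \<otimes>\<^bsub>PSp\<^esub> \<rho> w"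
      using reduced_Cons_mult[OF Cons.prems] hom_mult[OF \<rho>(1) letter_\<Gamma>03, of w l] by (simp add: carrier_\<Gamma>03)
    then show ?case using Cons.IH[OF w] \<rho>(2) gen_Sp word_mat_Sp by (simp add: mult_PSp)
  qed
  have "maximal_\<Gamma>03 H \<rho>"
    unfolding maximal_\<Gamma>03_def
  proof (intro conjI exI[of _ "\<lambda>x. lag (\<xi> x)"] \<rho>(1) right_continuous_\<xi> ballI allI impI \<xi>_maximal_triple)
    show "(\<lambda>x. lag (\<xi> x)) \<in> sphere 0 1 \<rightarrow> lagrangians"
      using lag_lagrangian[OF good_sym[OF \<xi>_good]] by auto
    fix \<gamma> x assume "\<gamma> \<in> carrier \<Gamma>03" "x \<in> sphere (0::complex) 1"
    then show "lag (\<xi> (H \<gamma> x)) = act (\<rho> \<gamma>) (lag (\<xi> x))"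
      using \<xi>_word[of \<gamma> x] by (simp add: word carrier_\<Gamma>03 act_pm[OF subspace_lag])
  qed
  moreover have "shilov_hyperbolic \<rho>"
    unfolding shilov_hyperbolic_def
  proof (intro ballI impI)
    fix \<gamma> assume "\<gamma> \<in> carrier \<Gamma>03" "\<gamma> \<noteq> \<one>\<^bsub>\<Gamma>03\<^esub>"
    then have "reduced gbar \<gamma>" "\<gamma> \<noteq> []" by (simp_all add: carrier_\<Gamma>03 one_\<Gamma>03)
    then have "\<exists>M\<in>\<rho> \<gamma>. shilov_mat M" using shilov_word word mem_pm by metis
    then show "\<exists>M\<in>\<rho> \<gamma>. \<exists>S\<in>Sp. \<exists>A::real^2^2. invertible A \<and>
        S ** M ** matrix_inv S = block A 0 0 (transpose (matrix_inv A)) \<and>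
        (\<forall>(c::complex) v. v \<noteq> 0 \<and> map_matrix of_real A *v v = c *s v \<longrightarrow> cmod c > 1)"
      unfolding shilov_mat_def .
  qed
  ultimately show ?thesis using \<rho>(2) by blast
qed

section \<open>The trace obstruction\<close>

lemma mat2_ring_simps:
  "mat2 a b c d ** mat2 a' b' c' d' = mat2 (a * a' + b * c') (a * b' + b * d') (c * a' + d * c') (c * b' + d * d')"
  "mat2 a b c d + mat2 a' b' c' d' = mat2 (a + a') (b + b') (c + c') (d + d')"
  "- mat2 a b c d = mat2 (- a) (- b) (- c) (- d)"
  "trace (mat2 a b c d) = a + d"
  "mat a = mat2 a 0 0 a" "0 = mat2 0 0 0 0" for a b c d :: real
  by (simp_all add: vec2_eq_iff matrix_matrix_mult_def sum_2 trace_def mat_def)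

text \<open>The two products spell the same word forwards and backwards. Their traces differ in
  absolute value, which no choice of signs of the generators can repair.\<close>

lemma trace_words:
  fixes A B :: "real^4^4"
  defines "A \<equiv> gen la" and "B \<equiv> gen lb"
  shows "trace (A ** (A ** (B ** (A ** (B ** B))))) = 330720" "trace (B ** (B ** (A ** (B ** (A ** A))))) = 330744"
proof -
  have A: "A = block (mat2 0 0 0 0) (mat2 1 0 0 1) (mat2 (- 1) 0 0 (- 1)) (mat2 5 0 0 4)"
    and B: "B = block (mat2 (- 9) 0 0 (- 10)) (mat2 127 9 10 161) (mat2 (- 1) 0 0 (- 1)) (mat2 14 1 1 16)"
    unfolding A_def B_def gen_def by (simp_all add: mat2_ring_simps(1-3,5-6))
  show "trace (A ** (A ** (B ** (A ** (B ** B))))) = 330720" "trace (B ** (B ** (A ** (B ** (A ** A))))) = 330744"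
    unfolding A B by (simp_all only: block_mult mat2_ring_simps(1-3) trace_block mat2_ring_simps(4)) simp_all
qed

text \<open>Conjugation by the involution q turns p q into q p, its inverse, and likewise q p into p
  q. The second form is there so that one q, the image of \<open>s2\<close>, serves both
  generators.\<close>

lemma (in group) conj_involution:
  assumes "k \<in> carrier G" "p \<in> carrier G" "q \<in> carrier G" "p \<otimes> p = \<one>" "q \<otimes> q = \<one>"
  defines "y \<equiv> k \<otimes> q \<otimes> inv k"
  shows "y \<otimes> inv (k \<otimes> (p \<otimes> q) \<otimes> inv k) \<otimes> inv y = k \<otimes> (p \<otimes> q) \<otimes> inv k"
    "y \<otimes> inv (k \<otimes> (q \<otimes> p) \<otimes> inv k) \<otimes> inv y = k \<otimes> (q \<otimes> p) \<otimes> inv k"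
proof -
  have i: "inv p = p" "inv q = q" using assms inv_equality by auto
  have c: "inv k \<otimes> (k \<otimes> x) = x" "q \<otimes> (q \<otimes> x) = x" if "x \<in> carrier G" for x
    using that assms by (simp_all add: m_assoc[symmetric])
  show "y \<otimes> inv (k \<otimes> (p \<otimes> q) \<otimes> inv k) \<otimes> inv y = k \<otimes> (p \<otimes> q) \<otimes> inv k"
    "y \<otimes> inv (k \<otimes> (q \<otimes> p) \<otimes> inv k) \<otimes> inv y = k \<otimes> (q \<otimes> p) \<otimes> inv k"
    using assms(1-3) by (simp_all add: y_def m_assoc inv_mult_group i c)
qed

text \<open>A homomorphism that extends to \<open>W\<^sub>3\<close> is inverted by the image of \<open>s\<^sub>2\<close> on both generators, so it
  sends a word and its reversal to elements of the same trace up to sign.\<close>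

lemma (in group) reversed_word_conj:
  assumes "a \<in> carrier G" "b \<in> carrier G" "y \<in> carrier G"
    "y \<otimes> inv a \<otimes> inv y = a" "y \<otimes> inv b \<otimes> inv y = b"
  shows "a \<otimes> (a \<otimes> (b \<otimes> (a \<otimes> (b \<otimes> b)))) = y \<otimes> inv (b \<otimes> (b \<otimes> (a \<otimes> (b \<otimes> (a \<otimes> a))))) \<otimes> inv y"
proof -
  have c: "inv y \<otimes> (y \<otimes> x) = x" if "x \<in> carrier G" for x
    using that assms by (simp add: m_assoc[symmetric])
  have "y \<otimes> inv x = z \<otimes> y" if "y \<otimes> inv x \<otimes> inv y = z" "x \<in> carrier G" for x z
    using that assms by (auto simp: m_assoc)
  from this[OF assms(4,1)] this[OF assms(5,2)]
  have m: "y \<otimes> inv a = a \<otimes> y" "y \<otimes> inv b = b \<otimes> y" by auto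
  then have m': "y \<otimes> (inv a \<otimes> x) = a \<otimes> (y \<otimes> x)" "y \<otimes> (inv b \<otimes> x) = b \<otimes> (y \<otimes> x)" if "x \<in> carrier G" for x
    using that assms(1-3) by (metis inv_closed m_assoc)+
  show ?thesis using assms(1-3) by (simp add: m_assoc inv_mult_group m')
qed

text \<open>Any invertible conjugator preserves the trace, antisymplectic ones included, and a
  symplectic inverse keeps it; the quotient leaves the sign open.\<close>

lemma trace_PSp_pm_conj_inverse:
  assumes "U \<in> Sp" "V \<in> Sp" "y \<in> carrier PSp_pm"
    "pm U = y \<otimes>\<^bsub>PSp_pm\<^esub> inv\<^bsub>PSp_pm\<^esub> (pm V) \<otimes>\<^bsub>PSp_pm\<^esub> inv\<^bsub>PSp_pm\<^esub> y"
  shows "\<bar>trace U\<bar> = \<bar>trace V\<bar>"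
proof -
  obtain Y where Y: "Y \<in> Sp \<union> Sp_minus" "y = pm Y" using assms(3) by (auto simp: carrier_PSp_pm)
  obtain N where N: "N \<in> Sp \<union> Sp_minus" "N ** Y = mat 1"
    using Y(1) Sp_inverse_ex Sp_minus_inverse_ex by blast
  obtain W where W: "W \<in> Sp" "W ** V = mat 1" using Sp_inverse_ex[OF assms(2)] by blast
  have "pm U = pm (Y ** W ** N)"
    using assms Y N W inv_PSp_pm[of V W] inv_PSp_pm[OF Y(1) N(2)] by (simp add: mult_PSp_pm)
  then have "trace U = trace (Y ** W ** N) \<or> trace U = - trace (Y ** W ** N)"
    by (auto simp: pm_eq_iff trace_uminus)
  then show ?thesis
    using trace_conj[OF N(2), of W] Sp_trace_inverse[OF assms(2) W(2)] by auto
qed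

lemma restriction_not_surjective:
  assumes H: "hyperbolization H"
    and \<phi>: "\<phi> \<in> hom \<Gamma>03 W3" "\<phi> \<alpha> = s1 \<otimes>\<^bsub>W3\<^esub> s2" "\<phi> \<beta> = s2 \<otimes>\<^bsub>W3\<^esub> s3"
  shows "\<not> chi_max_shilov H \<subseteq> restriction_map \<phi> ` chi_max_W3"
proof
  assume sub: "chi_max_shilov H \<subseteq> restriction_map \<phi> ` chi_max_W3"
  interpret hyp H by unfold_locales (rule H)
  obtain k m n where "pants H k m n" using pants_exists by blast
  then interpret pants H k m n .
  interpret G: group PSp_pm by (rule group_PSp_pm)
  obtain \<rho> where \<rho>: "maximal_\<Gamma>03 H \<rho>" "shilov_hyperbolic \<rho>" "\<And>l. \<rho> [l] = pm (gen l)"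
    using schottky_representation by blast
  have "conj_rel \<Gamma>03 PSp (carrier PSp) `` {\<rho>} \<in> chi_max_shilov H"
    using \<rho> by (auto simp: chi_max_shilov_def intro: quotientI)
  moreover have "\<rho> \<in> conj_rel \<Gamma>03 PSp (carrier PSp) `` {\<rho>}"
    using conj_rel_PSp_refl \<rho>(1) by (auto simp: maximal_\<Gamma>03_def)
  ultimately obtain C where C: "C \<in> chi_max_W3" "\<rho> \<in> restriction_map \<phi> C" using sub by blast
  then obtain \<tau> where "\<tau> \<in> C" and t: "(\<tau> \<circ> \<phi>, \<rho>) \<in> conj_rel \<Gamma>03 PSp (carrier PSp)"
    by (auto simp: restriction_map_def)
  then have \<tau>: "\<tau> \<in> hom W3 PSp_pm"
    using C(1) by (auto simp: chi_max_W3_def quotient_def conj_rel_def)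
  have sc: "s1 \<in> carrier W3" "s2 \<in> carrier W3" "s3 \<in> carrier W3"
    and ss: "s1 \<otimes>\<^bsub>W3\<^esub> s1 = \<one>\<^bsub>W3\<^esub>" "s2 \<otimes>\<^bsub>W3\<^esub> s2 = \<one>\<^bsub>W3\<^esub>" "s3 \<otimes>\<^bsub>W3\<^esub> s3 = \<one>\<^bsub>W3\<^esub>"
    by (simp_all add: W3_def word_group_def s1_def s2_def s3_def reduced_def)
  define p q r where "p = \<tau> s1" and "q = \<tau> s2" and "r = \<tau> s3"
  have pqr: "p \<in> carrier PSp_pm" "q \<in> carrier PSp_pm" "r \<in> carrier PSp_pm"
    using hom_in_carrier[OF \<tau>] sc by (simp_all add: p_def q_def r_def)
  have \<tau>1: "\<tau> \<one>\<^bsub>W3\<^esub> = \<one>\<^bsub>PSp_pm\<^esub>" by (rule hom_one[OF \<tau> group_W3 group_PSp_pm])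
  have inv: "p \<otimes>\<^bsub>PSp_pm\<^esub> p = \<one>\<^bsub>PSp_pm\<^esub>" "q \<otimes>\<^bsub>PSp_pm\<^esub> q = \<one>\<^bsub>PSp_pm\<^esub>" "r \<otimes>\<^bsub>PSp_pm\<^esub> r = \<one>\<^bsub>PSp_pm\<^esub>"
    using sc ss \<tau>1 hom_mult[OF \<tau>, symmetric] by (simp_all add: p_def q_def r_def)
  obtain g where g: "g \<in> carrier PSp" "\<And>x. x \<in> carrier \<Gamma>03 \<Longrightarrow> \<rho> x = g \<otimes>\<^bsub>PSp\<^esub> \<tau> (\<phi> x) \<otimes>\<^bsub>PSp\<^esub> inv\<^bsub>PSp\<^esub> g"
    using t by (auto simp: conj_rel_def)
  have gc: "g \<in> carrier PSp_pm" using g(1) PSp_subset by blast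
  have ab: "pm (gen la) = g \<otimes>\<^bsub>PSp_pm\<^esub> (p \<otimes>\<^bsub>PSp_pm\<^esub> q) \<otimes>\<^bsub>PSp_pm\<^esub> inv\<^bsub>PSp_pm\<^esub> g"
    "pm (gen lb) = g \<otimes>\<^bsub>PSp_pm\<^esub> (q \<otimes>\<^bsub>PSp_pm\<^esub> r) \<otimes>\<^bsub>PSp_pm\<^esub> inv\<^bsub>PSp_pm\<^esub> g"
    using g(2)[of \<alpha>] g(2)[of \<beta>] \<rho>(3)[of la] \<rho>(3)[of lb] \<phi> sc g(1)
    by (simp_all add: \<alpha>_def \<beta>_def mult_PSp_eq inv_PSp_eq hom_mult[OF \<tau>] p_def q_def r_def)
  \<comment> \<open>The image of \<open>s2\<close> moved by the conjugator g; it inverts the images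
    of both generators because \<open>s2\<close> is a factor of both.\<close>
  define y where "y = g \<otimes>\<^bsub>PSp_pm\<^esub> q \<otimes>\<^bsub>PSp_pm\<^esub> inv\<^bsub>PSp_pm\<^esub> g"
  have y: "y \<in> carrier PSp_pm" using gc pqr by (simp add: y_def)
  have mem: "pm (gen l) \<in> carrier PSp_pm" for l using gen_Sp by (auto simp: carrier_PSp_pm)
  have "y \<otimes>\<^bsub>PSp_pm\<^esub> inv\<^bsub>PSp_pm\<^esub> (pm (gen la)) \<otimes>\<^bsub>PSp_pm\<^esub> inv\<^bsub>PSp_pm\<^esub> y = pm (gen la)"
    "y \<otimes>\<^bsub>PSp_pm\<^esub> inv\<^bsub>PSp_pm\<^esub> (pm (gen lb)) \<otimes>\<^bsub>PSp_pm\<^esub> inv\<^bsub>PSp_pm\<^esub> y = pm (gen lb)"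
    using G.conj_involution(1)[OF gc pqr(1,2) inv(1,2)] G.conj_involution(2)[OF gc pqr(3,2) inv(3,2)]
    unfolding ab y_def .
  from G.reversed_word_conj[OF mem mem y this]
  have "\<bar>trace (gen la ** (gen la ** (gen lb ** (gen la ** (gen lb ** gen lb)))))\<bar>
      = \<bar>trace (gen lb ** (gen lb ** (gen la ** (gen lb ** (gen la ** gen la)))))\<bar>"
    using gen_Sp Sp_mult(1) by (intro trace_PSp_pm_conj_inverse[OF _ _ y]) (simp_all add: mult_PSp_pm)
  then show False unfolding trace_words by simp
qed

theorem corollary7p19:
  fixes H :: "(pants_gen \<times> bool) list \<Rightarrow> complex \<Rightarrow> complex"
    and \<phi> :: "(pants_gen \<times> bool) list \<Rightarrow> W3_gen list"
  assumes "hyperbolization H"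
    and "\<phi> \<in> hom \<Gamma>03 W3"
    and "\<phi> \<alpha> = s1 \<otimes>\<^bsub>W3\<^esub> s2"
    and "\<phi> \<beta> = s2 \<otimes>\<^bsub>W3\<^esub> s3"
  shows "\<not> inj_on (restriction_map \<phi>) chi_max_W3 \<and>
         \<not> chi_max_shilov H \<subseteq> restriction_map \<phi> ` chi_max_W3"
  using restriction_not_injective restriction_not_surjective assms by blast

end
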